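(* Let $\lambda,\alpha\in\mathbb{C}$ and $x\in\mathbb{C}\setminus((-\infty,-1]\cup[1,\infty))$, with parameters such that the integral below converges. Then $$[\mathsf{C}_\lambda^{\alpha}(x)]^2+[\mathsf{D}_\lambda^{\alpha}(x)]^2=\frac{e^{-i\pi\alpha}\Gamma(\lambda+2\alpha)}{2^{2\alpha-3}\Gamma(\alpha)^2\Gamma(\lambda+1)(1-x^2)^{2\alpha-1}}\int_1^\infty D_\lambda^{\alpha}(w)(w-1)^{\alpha-1}(1-2x^2+w)^{\alpha-1}\,dw .$$
   Context: Let $\mathbf{F}(a,b;c;z)=\sum_{n\ge0}\frac{(a)_n(b)_n}{\Gamma(c+n)}\frac{z^n}{n!}$ (continued analytically to $\mathbb{C}\setminus[1,\infty)$) be the regularized Gauss hypergeometric function. Gegenbauer function of the second kind on $\mathbb{C}\setminus(-\infty,1]$: $D_\lambda^\alpha(z)=\frac{e^{i\pi\alpha}\Gamma(\lambda+2\alpha)}{\Gamma(\alpha)(2z)^{\lambda+2\alpha}}\mathbf{F}\big(\frac{\lambda}{2}+\alpha,\frac{\lambda}{2}+\alpha+\frac12;\lambda+\alpha+1;\frac1{z^2}\big)$ for $|z|>1$, continued analytically. Gegenbauer functions in the trigonometric context, for $x\in(-1,1)$: $\mathsf{C}_\lambda^\alpha(x)=\frac{\sqrt\pi\,\Gamma(2\alpha+\lambda)}{2^{2\alpha-1}\Gamma(\alpha)\Gamma(\lambda+1)}\mathbf{F}\big(-\lambda,2\alpha+\lambda;\alpha+\frac12;\frac{1-x}{2}\big)$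 and $\mathsf{D}_\lambda^\alpha(x)=e^{-\frac{i\pi}{2}}D_\lambda^\alpha(x+i0)+e^{-2i\pi(\alpha-\frac14)}D_\lambda^\alpha(x-i0)$; both are extended analytically to $\mathbb{C}\setminus((-\infty,-1]\cup[1,\infty))$. Convention: the basic range is $x\in(-1,1)$ real (powers of positive numbers positive for real exponents); for complex $x$ both sides are understood by analytic continuation. Parameters are assumed such that all Gamma factors and functions are defined. *)

theory Defs
  imports "HOL-Complex_Analysis.Complex_Analysis"
begin

text \<open>
  Every use below has \<open>S\<close> open and connected and \<open>U \<subseteq> S\<close> with a limit point in \<open>S\<close>, so that the
  extension is unique on \<open>S\<close> (lemma \<open>analytic_extension_eqI\<close>). Values outside \<open>S\<close> are unspecified.
\<close>
definition analytic_extension ::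
    "(complex \<Rightarrow> complex) \<Rightarrow> complex set \<Rightarrow> complex set \<Rightarrow> complex \<Rightarrow> complex" where
  "analytic_extension f U S = (SOME g. g holomorphic_on S \<and> (\<forall>z\<in>U. g z = f z))"

lemma analytic_extension_eqI:
  assumes "open S" "connected S" "U \<subseteq> S" "\<xi> \<in> S" "\<xi> islimpt U"
    and "g holomorphic_on S" "\<And>z. z \<in> U \<Longrightarrow> g z = f z" "z \<in> S"
  shows "analytic_extension f U S z = g z"
proof -
  let ?h = "analytic_extension f U S"
  have h: "?h holomorphic_on S \<and> (\<forall>z\<in>U. ?h z = f z)"
    unfolding analytic_extension_def
    by (rule someI[where x = g]) (use assms in auto)
  have "?h z - g z = 0"
    by (rule analytic_continuation[where f = "\<lambda>z. ?h z - g z" and S = S and U = U and \<xi> = \<xi>])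
       (use assms h in \<open>auto intro!: holomorphic_intros\<close>)
  then show ?thesis by simp
qed

definition cut_plane_F :: "complex set" where
  "cut_plane_F = - (complex_of_real ` {1..})"

definition cut_plane_D :: "complex set" where
  "cut_plane_D = - (complex_of_real ` {..1})"

definition cut_plane_trig :: "complex set" where
  "cut_plane_trig = - (complex_of_real ` ({..-1} \<union> {1..}))"

text \<open>The entire function \<open>rGamma\<close> is \<open>1 / \<Gamma>\<close>, so no restriction on \<open>c\<close> is needed.\<close>
definition reg_hypergeo_series :: "complex \<Rightarrow> complex \<Rightarrow> complex \<Rightarrow> complex \<Rightarrow> complex" where
  "reg_hypergeo_series a b c z =
     (\<Sum>n. pochhammer a n * pochhammer b n * rGamma (c + of_nat n) * (z ^ n / fact n))"

definition reg_hypergeo :: "complex \<Rightarrow> complex \<Rightarrow> complex \<Rightarrow> complex \<Rightarrow> complex" where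
  "reg_hypergeo a b c = analytic_extension (reg_hypergeo_series a b c) (ball 0 1) cut_plane_F"

definition gegenbauer_D :: "complex \<Rightarrow> complex \<Rightarrow> complex \<Rightarrow> complex" where
  "gegenbauer_D l \<alpha> = analytic_extension
     (\<lambda>z. exp (\<i> * pi * \<alpha>) * Gamma (l + 2 * \<alpha>) / (Gamma \<alpha> * (2 * z) powr (l + 2 * \<alpha>))
           * reg_hypergeo (l / 2 + \<alpha>) (l / 2 + \<alpha> + 1 / 2) (l + \<alpha> + 1) (1 / z\<^sup>2))
     {z \<in> cut_plane_D. norm z > 1} cut_plane_D"

text \<open>
  The trigonometric functions are first given on the real interval \<open>(-1, 1)\<close>, where the second one
  involves the boundary values \<open>D(x + i0)\<close> and \<open>D(x - i0)\<close> on the two sides of the cut.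
\<close>
definition gegenbauer_C_trig_real :: "complex \<Rightarrow> complex \<Rightarrow> real \<Rightarrow> complex" where
  "gegenbauer_C_trig_real l \<alpha> x =
     of_real (sqrt pi) * Gamma (2 * \<alpha> + l) / (2 powr (2 * \<alpha> - 1) * Gamma \<alpha> * Gamma (l + 1))
       * reg_hypergeo (- l) (2 * \<alpha> + l) (\<alpha> + 1 / 2) (of_real ((1 - x) / 2))"

definition gegenbauer_D_trig_real :: "complex \<Rightarrow> complex \<Rightarrow> real \<Rightarrow> complex" where
  "gegenbauer_D_trig_real l \<alpha> x =
     exp (- (\<i> * pi / 2)) * Lim (at_right 0) (\<lambda>\<epsilon>. gegenbauer_D l \<alpha> (Complex x \<epsilon>))
     + exp (- 2 * \<i> * pi * (\<alpha> - 1 / 4)) * Lim (at_right 0) (\<lambda>\<epsilon>. gegenbauer_D l \<alpha> (Complex x (- \<epsilon>)))"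

definition gegenbauer_C_trig :: "complex \<Rightarrow> complex \<Rightarrow> complex \<Rightarrow> complex" where
  "gegenbauer_C_trig l \<alpha> = analytic_extension
     (\<lambda>z. gegenbauer_C_trig_real l \<alpha> (Re z)) (complex_of_real ` {-1<..<1}) cut_plane_trig"

definition gegenbauer_D_trig :: "complex \<Rightarrow> complex \<Rightarrow> complex \<Rightarrow> complex" where
  "gegenbauer_D_trig l \<alpha> = analytic_extension
     (\<lambda>z. gegenbauer_D_trig_real l \<alpha> (Re z)) (complex_of_real ` {-1<..<1}) cut_plane_trig"

text \<open>
  Principal powers in the integrand are the analytic continuations in \<open>x\<close> from \<open>(-1, 1)\<close>: for
  \<open>w \<ge> 1\<close> the number \<open>1 - 2 * x\<^sup>2 + w\<close> is a nonpositive real only if \<open>x\<^sup>2\<close> is real and \<open>x\<^sup>2 \<ge> 1\<close>, which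
  does not happen on \<open>cut_plane_trig\<close>. The same holds for \<open>1 - x\<^sup>2\<close>.
\<close>
definition nicholson_integrand :: "complex \<Rightarrow> complex \<Rightarrow> complex \<Rightarrow> real \<Rightarrow> complex" where
  "nicholson_integrand l \<alpha> x w =
     gegenbauer_D l \<alpha> (of_real w) * of_real (w - 1) powr (\<alpha> - 1)
       * (1 - 2 * x\<^sup>2 + of_real w) powr (\<alpha> - 1)"

end

theory Submission
  imports Defs "HOL-Real_Asymp.Real_Asymp"
begin

text \<open>
  Put \<open>\<mu> = l + 2\<alpha>\<close>. Laplace's integral \<open>I b = \<integral> (cosh b + t sinh b) powr -\<mu> (t\<^sup>2 - 1) powr (\<alpha> - 1) dt\<close> over \<open>t > 1\<close> is
  proportional to \<open>D (cosh b)\<close>, because both solve the Gegenbauer equation and are recessive at infinity. It extends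
  to \<open>b = \<plusminus>\<i>\<theta>\<close>, so that \<open>D (cos \<theta> \<plusminus> i0)\<close> are multiples of \<open>I (\<plusminus>\<i>\<theta>)\<close>, and a comparison of Wronskians expresses
  \<open>C (cos \<theta>)\<close> by the same two numbers. Hence \<open>C\<^sup>2 + D\<^sup>2\<close> is a multiple of \<open>I (\<i>\<theta>) I (-\<i>\<theta>)\<close>. On the other hand
  \<open>\<integral> D (cosh a cosh b + t sinh a sinh b) (t\<^sup>2 - 1) powr (\<alpha> - 1) dt\<close> is a multiple of \<open>I a I b\<close>, again by uniqueness of
  the recessive solution; for \<open>a = \<i>\<theta>\<close>, \<open>b = -\<i>\<theta>\<close> an affine substitution turns it into the integral over \<open>w\<close>.

  This needs \<open>Re \<alpha> > 0\<close> and \<open>Re l > -1\<close>. Both follow from the behaviour of a convergent integral at its endpoints,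
  except when \<open>l + \<alpha>\<close> is a negative integer; then \<open>l\<close> and \<open>-l - 2\<alpha>\<close> give the same functions, and the second
  parameter is in the good range.
\<close>

subsection \<open>Integrals depending holomorphically on a parameter\<close>

text \<open>Two features of the statement shape the proof. The functions are chosen extensions, so a
  holomorphic witness has to be exhibited for each; Euler's integral and contiguous relations supply
  it for \<open>reg_hypergeo\<close>. Convergence means only Henstock-Kurzweil integrability, so
  oscillating behaviour at an endpoint has to be excluded by integrals over windows
  [c + p, c + \<rho> p] instead of absolute values. The substitution is w = cos^2 \<theta> + t sin^2
  \<theta>, with x = cos \<theta>: it fixes the endpoint 1 and turns (w - 1) (1 - 2 x^2 + w) into
  sin^4 \<theta> (t^2 - 1). In the product formula b = -i\<theta> is fixed and a moves along r +
  i\<theta>, since there the argument of D has real part above 1 for all t >= 1 and r > 0; the point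
  a = i\<theta> is reached as r tends to 0. This is done for 0 < \<theta> < pi/2, and continuation
  in x gives the rest. The sum of squares collapses to one product because the phases in the
  definition of D give C = \<delta> (P + Q) and D = -i \<delta> (P - Q), where P and Q are multiples
  of I (i\<theta>) and I (-i\<theta>).\<close>

lemma param_integral_derivative:
  fixes f f' :: "complex \<Rightarrow> 'b \<Rightarrow> complex"
  assumes "open S" "x \<in> S"
    and der: "\<And>y t. y \<in> S \<Longrightarrow> t \<in> space M \<Longrightarrow> ((\<lambda>y. f y t) has_field_derivative f' y t) (at y)"
    and meas: "\<And>y. y \<in> S \<Longrightarrow> f y \<in> borel_measurable M"
    and g: "integrable M g"
    and bd: "\<And>y t. y \<in> S \<Longrightarrow> t \<in> space M \<Longrightarrow> norm (f y t) \<le> g t"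
  shows "integrable M (f' x)"
    and "((\<lambda>y. \<integral>t. f y t \<partial>M) has_field_derivative (\<integral>t. f' x t \<partial>M)) (at x)"
    and "\<exists>r>0. ball x r \<subseteq> S \<and> (\<forall>y\<in>ball x r. \<forall>t\<in>space M. norm (f' y t) \<le> g t / r)"
    and "f' x \<in> borel_measurable M"
proof -
  obtain r0 where r0: "r0 > 0" "cball x r0 \<subseteq> S"
    using assms(1,2) open_contains_cball by blast
  \<comment> \<open>With half the radius, the closed disc of radius r about any y in
    \<open>ball x r\<close> still lies in S, so Cauchy's inequality bounds the derivative there by g
    / r. Only f itself has to be dominated by hypothesis.\<close>
  define r where "r = r0 / 2"
  have r: "r > 0" "\<And>y. y \<in> ball x r \<Longrightarrow> cball y r \<subseteq> S"
  proof -
    show "r > 0" using r0 by (simp add: r_def)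
    fix y assume "y \<in> ball x r"
    then have "dist x y < r" by simp
    then have "cball y r \<subseteq> cball x r0"
      using dist_triangle[of x _ y] by (auto simp: r_def subset_eq) (smt (verit) dist_triangle)
    then show "cball y r \<subseteq> S" using r0 by blast
  qed
  have f'bd: "norm (f' y t) \<le> g t / r" if y: "y \<in> ball x r" and t: "t \<in> space M" for y t
  proof -
    have sub: "cball y r \<subseteq> S" using r(2)[OF y] .
    have hol: "(\<lambda>y. f y t) holomorphic_on cball y r"
      using der t sub by (meson holomorphic_onI field_differentiable_at_within field_differentiable_def subsetD)
    have "norm ((deriv ^^ 1) (\<lambda>y. f y t) y) \<le> fact 1 * g t / r ^ 1"
    proof (rule Cauchy_inequality)
      show "(\<lambda>y. f y t) holomorphic_on ball y r" using hol ball_subset_cball holomorphic_on_subset by blast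
      show "continuous_on (cball y r) (\<lambda>y. f y t)" using hol holomorphic_on_imp_continuous_on by blast
      show "0 < r" by fact
      show "norm (f z t) \<le> g t" if "norm (y - z) = r" for z
        using that sub bd t by (auto simp: dist_norm subset_eq)
    qed
    moreover have "deriv (\<lambda>y. f y t) y = f' y t"
      using der sub t r by (intro DERIV_imp_deriv) (auto simp: subset_eq)
    ultimately show ?thesis by simp
  qed
  have sub: "ball x r \<subseteq> S" using r0 by (auto simp: r_def subset_eq)
  show "\<exists>r>0. ball x r \<subseteq> S \<and> (\<forall>y\<in>ball x r. \<forall>t\<in>space M. norm (f' y t) \<le> g t / r)"
    by (intro exI[of _ r] conjI ballI r(1) sub f'bd)
  have int: "integrable M (f y)" if "y \<in> S" for y
  proof (rule Bochner_Integration.integrable_bound[OF g])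
    show "f y \<in> borel_measurable M" using meas that .
    show "AE t in M. norm (f y t) \<le> norm (g t)"
      using bd[OF that] by (intro AE_I2) (smt (verit) real_norm_def)
  qed
  \<comment> \<open>The mean value inequality on the ball passes the bound g / r on to the
    difference quotients; this is the majorant for the limit.\<close>
  have quot: "norm ((f y t - f x t) / (y - x)) \<le> g t / r" if "y \<in> ball x r" "y \<noteq> x" "t \<in> space M" for y t
  proof -
    have "norm (f y t - f x t) \<le> g t / r * norm (y - x)"
    proof (rule field_differentiable_bound[of "ball x r" "\<lambda>y. f y t" "\<lambda>y. f' y t"])
      show "((\<lambda>y. f y t) has_field_derivative f' z t) (at z within ball x r)" if "z \<in> ball x r" for z
        by (rule has_field_derivative_at_within, rule der) (use sub that \<open>t \<in> space M\<close> in blast)+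
      show "norm (f' z t) \<le> g t / r" if "z \<in> ball x r" for z
        by (rule f'bd) (use that \<open>t \<in> space M\<close> in blast)+
    qed (use that r(1) in simp_all)
    then show ?thesis using that r(1) by (simp add: norm_divide divide_simps)
  qed
  have key: "integrable M (f' x) \<and> f' x \<in> borel_measurable M \<and> (\<lambda>n. ((\<integral>t. f (X n) t \<partial>M) - (\<integral>t. f x t \<partial>M)) / (X n - x)) \<longlonglongrightarrow> (\<integral>t. f' x t \<partial>M)"
    if X: "\<And>n. X n \<in> ball x r" "\<And>n. X n \<noteq> x" "X \<longlonglongrightarrow> x" for X :: "nat \<Rightarrow> complex"
  proof -
    let ?q = "\<lambda>n t. (f (X n) t - f x t) / (X n - x)"
    have Xs: "X n \<in> S" for n using X(1)[of n] sub by blast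
    have qm: "?q n \<in> borel_measurable M" for n
      using meas[OF Xs] meas[OF \<open>x \<in> S\<close>] by measurable
    have lim: "(\<lambda>n. ?q n t) \<longlonglongrightarrow> f' x t" if "t \<in> space M" for t
    proof -
      have "((\<lambda>y. (f y t - f x t) / (y - x)) \<longlongrightarrow> f' x t) (at x)"
        using der[OF \<open>x \<in> S\<close> that] by (simp add: has_field_derivative_iff)
      then show ?thesis
        using X unfolding tendsto_at_iff_sequentially by (auto simp: o_def)
    qed
    have f'm: "f' x \<in> borel_measurable M"
      by (rule borel_measurable_LIMSEQ_metric[OF qm lim])
    have gi: "integrable M (\<lambda>t. g t / r)" using g by simp
    have "integrable M (f' x)"
      by (rule integrable_dominated_convergence[OF f'm qm gi])
         (rule AE_I2, erule lim, rule AE_I2, rule quot[OF X(1,2)], assumption)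
    moreover have "(\<lambda>n. \<integral>t. ?q n t \<partial>M) \<longlonglongrightarrow> (\<integral>t. f' x t \<partial>M)"
      by (rule integral_dominated_convergence[OF f'm qm gi])
         (rule AE_I2, erule lim, rule AE_I2, rule quot[OF X(1,2)], assumption)
    moreover have "(\<integral>t. ?q n t \<partial>M) = ((\<integral>t. f (X n) t \<partial>M) - (\<integral>t. f x t \<partial>M)) / (X n - x)" for n
      using int[OF Xs] int[OF \<open>x \<in> S\<close>] by (simp add: Bochner_Integration.integral_diff)
    ultimately show ?thesis using f'm by (simp only: simp_thms)
  qed
  \<comment> \<open>One concrete sequence tending to x inside the ball and avoiding x: integrability
    and measurability of \<open>f' x\<close> do not mention the sequence, so a single one yields
    them.\<close>
  let ?X = "\<lambda>n. x + of_real (r / 2 * inverse (real (Suc n)))"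
  have "?X \<longlonglongrightarrow> x + of_real (r / 2 * 0)"
    by (intro tendsto_intros LIMSEQ_inverse_real_of_nat)
  then have XX: "?X \<longlonglongrightarrow> x" by simp
  have X1: "?X n \<in> ball x r" for n
  proof -
    have "inverse (real (Suc n)) \<le> 1" by (simp add: divide_simps)
    then have "r / 2 * inverse (real (Suc n)) \<le> r / 2 * 1"
      by (intro mult_left_mono) (use r(1) in auto)
    then have "\<bar>r / 2 * inverse (real (Suc n))\<bar> < r" using r(1) by (simp add: abs_mult)
    then show ?thesis by (subst mem_ball, subst dist_commute) (simp only: dist_norm norm_of_real add_diff_cancel_left')
  qed
  have X2: "?X n \<noteq> x" for n
  proof -
    have "r / 2 * inverse (real (Suc n)) \<noteq> 0" using r(1) by simp
    then show ?thesis by (simp only: add_cancel_left_right of_real_eq_0_iff not_False_eq_True)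
  qed
  note K = key[OF X1 X2 XX]
  show "integrable M (f' x)" by (rule K[THEN conjunct1])
  show "f' x \<in> borel_measurable M" by (rule K[THEN conjunct2, THEN conjunct1])
  show "((\<lambda>y. \<integral>t. f y t \<partial>M) has_field_derivative (\<integral>t. f' x t \<partial>M)) (at x)"
    unfolding has_field_derivative_iff tendsto_at_iff_sequentially o_def
  proof (intro allI impI)
    fix X assume X: "\<forall>i. X i \<in> UNIV - {x}" "X \<longlonglongrightarrow> x"
    have "eventually (\<lambda>n. X n \<in> ball x r) sequentially"
      using topological_tendstoD[OF X(2) open_ball, of x r] r(1) by simp
    then obtain N where N: "\<And>n. n \<ge> N \<Longrightarrow> X n \<in> ball x r"
      unfolding eventually_sequentially by blast
    show "(\<lambda>n. ((\<integral>t. f (X n) t \<partial>M) - (\<integral>t. f x t \<partial>M)) / (X n - x)) \<longlonglongrightarrow> (\<integral>t. f' x t \<partial>M)"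
      by (rule LIMSEQ_offset[of _ N], rule key[THEN conjunct2, THEN conjunct2])
         (use N X LIMSEQ_ignore_initial_segment[of X x N] in simp_all)
  qed
qed

text \<open>Cauchy's bound g / r on the first derivative is itself an integrable majorant, so the
  previous lemma applies a second time, on a smaller ball.\<close>

lemma param_integral_derivative2:
  fixes f f' f'' :: "complex \<Rightarrow> 'b \<Rightarrow> complex"
  assumes "open S" "x \<in> S"
    and der: "\<And>y t. y \<in> S \<Longrightarrow> t \<in> space M \<Longrightarrow> ((\<lambda>y. f y t) has_field_derivative f' y t) (at y)"
    and der': "\<And>y t. y \<in> S \<Longrightarrow> t \<in> space M \<Longrightarrow> ((\<lambda>y. f' y t) has_field_derivative f'' y t) (at y)"
    and meas: "\<And>y. y \<in> S \<Longrightarrow> f y \<in> borel_measurable M"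
    and g: "integrable M g"
    and bd: "\<And>y t. y \<in> S \<Longrightarrow> t \<in> space M \<Longrightarrow> norm (f y t) \<le> g t"
  shows "integrable M (f'' x)"
    and "((\<lambda>y. \<integral>t. f' y t \<partial>M) has_field_derivative (\<integral>t. f'' x t \<partial>M)) (at x)"
proof -
  note P = param_integral_derivative[OF \<open>open S\<close> _ der meas g bd]
  obtain r where r: "r > 0" "ball x r \<subseteq> S" "\<forall>y\<in>ball x r. \<forall>t\<in>space M. norm (f' y t) \<le> g t / r"
    using P(3)[OF \<open>x \<in> S\<close>] by metis
  have gi: "integrable M (\<lambda>t. g t / r)" using g by simp
  have sub: "y \<in> S" if "y \<in> ball x r" for y using r(2) that by blast
  have x: "x \<in> ball x r" using r(1) by simp
  note Q = param_integral_derivative[OF open_ball x der'[OF sub] P(4)[OF sub] gi r(3)[rule_format]]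
  show "integrable M (f'' x)" by (rule Q(1))
  show "((\<lambda>y. \<integral>t. f' y t \<partial>M) has_field_derivative (\<integral>t. f'' x t \<partial>M)) (at x)"
    by (rule Q(2))
qed

text \<open>Holomorphy is local, so a majorant near each point is enough. The Beta integral, Euler's
  integral and the Nicholson integral are all treated in this form.\<close>

lemma param_integral_holomorphic:
  fixes f :: "complex \<Rightarrow> 'b \<Rightarrow> complex"
  assumes "open S"
    and hol: "\<And>t. t \<in> space M \<Longrightarrow> (\<lambda>y. f y t) holomorphic_on S"
    and meas: "\<And>y. y \<in> S \<Longrightarrow> f y \<in> borel_measurable M"
    and bd: "\<And>x. x \<in> S \<Longrightarrow> \<exists>U g. open U \<and> x \<in> U \<and> U \<subseteq> S \<and> integrable M g \<and>
               (\<forall>y\<in>U. \<forall>t\<in>space M. norm (f y t) \<le> g t)"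
  shows "(\<lambda>y. \<integral>t. f y t \<partial>M) holomorphic_on S"
proof (rule holomorphic_onI)
  fix x assume "x \<in> S"
  then obtain U g where U: "open U" "x \<in> U" "U \<subseteq> S" "integrable M g"
      "\<forall>y\<in>U. \<forall>t\<in>space M. norm (f y t) \<le> g t"
    using bd[OF \<open>x \<in> S\<close>] by (elim exE conjE) (rule that)
  have "((\<lambda>y. \<integral>t. f y t \<partial>M) has_field_derivative (\<integral>t. deriv (\<lambda>y. f y t) x \<partial>M)) (at x)"
  proof (rule param_integral_derivative(2)[OF U(1,2) _ _ U(4) U(5)[rule_format]])
    show "((\<lambda>y. f y t) has_field_derivative deriv (\<lambda>y. f y t) y) (at y)" if "y \<in> U" "t \<in> space M" for y t
      by (rule holomorphic_derivI[OF hol[OF that(2)] \<open>open S\<close> subsetD[OF U(3) that(1)]])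
    show "f y \<in> borel_measurable M" if "y \<in> U" for y
      by (rule meas[OF subsetD[OF U(3) that]])
  qed
  then show "(\<lambda>y. \<integral>t. f y t \<partial>M) field_differentiable at x within S"
    using field_differentiable_at_within field_differentiable_def by blast
qed

subsection \<open>Beta integrals on half lines\<close>

text \<open>The half line is made a measure space of its own, so that conditions on points of
  \<open>space M\<close> automatically mean t > a and no indicator functions enter the
  integrands.\<close>

definition lborel_gt :: "real \<Rightarrow> real measure" where
  "lborel_gt a = restrict_space lborel {a<..}"

lemma space_lborel_gt [simp]: "space (lborel_gt a) = {a<..}"
  by (simp add: lborel_gt_def space_restrict_space)

lemma integrable_lborel_gt:
  fixes f :: "real \<Rightarrow> 'a :: {banach, second_countable_topology}"
  shows "integrable (lborel_gt a) f \<longleftrightarrow> set_integrable lborel {a<..} f"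
  unfolding lborel_gt_def set_integrable_def by (rule integrable_restrict_space) simp

lemma integral_lborel_gt:
  fixes f :: "real \<Rightarrow> 'a :: {banach, second_countable_topology}"
  shows "(\<integral>t. f t \<partial>lborel_gt a) = (LBINT t:{a<..}. f t)"
  unfolding lborel_gt_def set_lebesgue_integral_def by (rule integral_restrict_space) simp

lemma measurable_lborel_gt_continuous:
  fixes f :: "real \<Rightarrow> 'a :: topological_space"
  assumes "continuous_on {a<..} f"
  shows "f \<in> borel_measurable (lborel_gt a)"
proof -
  have "f \<in> borel_measurable (restrict_space borel {a<..})"
    by (rule borel_measurable_continuous_on_restrict[OF assms])
  then show ?thesis
    by (simp add: lborel_gt_def cong: measurable_cong_sets sets_restrict_space_cong)
qed

lemma norm_of_real_powr: "t > 0 \<Longrightarrow> norm (complex_of_real t powr z) = t powr Re z"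
  by (subst norm_powr_real_powr) auto

lemma powr_of_real_mult:
  "A > 0 \<Longrightarrow> B > 0 \<Longrightarrow> complex_of_real (A * B) powr p = of_real A powr p * of_real B powr p"
  unfolding of_real_mult by (subst powr_times_real) simp_all

text \<open>The substitution t = x / (1 - x) maps (0, 1) onto the half line and turns the integrand
  into that of Euler's Beta integral.\<close>

lemma Beta_second_kind_real:
  fixes p q :: real
  assumes "p > 0" "q > 0"
  shows "integrable (lborel_gt 0) (\<lambda>t. t powr (p - 1) * (1 + t) powr (- (p + q)))"
    and "(\<integral>t. t powr (p - 1) * (1 + t) powr (- (p + q)) \<partial>lborel_gt 0) = Beta p q"
proof -
  let ?f = "\<lambda>t::real. t powr (p - 1) * (1 + t) powr (- (p + q))"
  let ?g = "\<lambda>x::real. x / (1 - x)"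
  let ?g' = "\<lambda>x::real. 1 / (1 - x)\<^sup>2"
  have eq: "?f (?g x) * ?g' x = x powr (p - 1) * (1 - x) powr (q - 1)" if "0 < x" "x < 1" for x
  proof -
    have 1: "1 + ?g x = 1 / (1 - x)" using that by (simp add: field_simps)
    have 2: "?g' x = (1 - x) powr (- 2)" using that by (simp add: powr_minus divide_simps powr_numeral)
    have 3: "(1 / (1 - x)) powr (- (p + q)) = (1 - x) powr (p + q)"
      using that by (subst powr_divide) (simp_all add: powr_minus divide_simps flip: powr_add)
    have 4: "?g x powr (p - 1) = x powr (p - 1) * (1 - x) powr (1 - p)"
      using that by (subst powr_divide) (simp_all add: powr_diff field_simps)
    have "?f (?g x) * ?g' x = x powr (p - 1) * ((1 - x) powr (1 - p) * (1 - x) powr (p + q) * (1 - x) powr (- 2))"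
      by (simp only: 1 2 3 4 mult.assoc)
    also have "(1 - x) powr (1 - p) * (1 - x) powr (p + q) * (1 - x) powr (- 2) = (1 - x) powr (q - 1)"
      by (simp only: powr_add [symmetric]) (simp add: algebra_simps)
    finally show ?thesis .
  qed
  have int01: "set_integrable lborel {0<..<1} (\<lambda>x. x powr (p - 1) * (1 - x) powr (q - 1))"
    by (rule set_integrable_subset[OF integrable_Beta[OF assms]]) auto
  have einv: "einterval 0 1 = {0<..<(1::real)}" "einterval 0 \<infinity> = {0<..}"
    by (simp_all add: zero_ereal_def one_ereal_def)
  have int: "set_integrable lborel (einterval 0 1) (\<lambda>x. ?f (?g x) * ?g' x)"
  proof -
    have "set_integrable lborel {0<..<1} (\<lambda>x. ?f (?g x) * ?g' x) \<longleftrightarrow>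
        set_integrable lborel {0<..<1} (\<lambda>x. x powr (p - 1) * (1 - x) powr (q - 1))"
      by (rule set_integrable_cong[OF refl refl], rule eq) simp_all
    then show ?thesis unfolding einv using int01 by (simp only:)
  qed
  have der: "DERIV ?g x :> ?g' x" if "0 < ereal x" "ereal x < 1" for x
  proof -
    have "x < 1" using that by (simp add: one_ereal_def)
    then show ?thesis
      by (auto intro!: derivative_eq_intros simp: power2_eq_square field_simps)
  qed
  have contf: "isCont ?f (?g x)" if "0 < ereal x" "ereal x < 1" for x
  proof -
    have "0 < x" "x < 1" using that by (simp_all add: one_ereal_def)
    then have "?g x > 0" by simp
    then show ?thesis by (intro continuous_intros) auto
  qed
  have contg: "isCont ?g' x" if "0 < ereal x" "ereal x < 1" for x
    using that by (intro continuous_intros) (auto simp: one_ereal_def)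
  have A: "((ereal \<circ> ?g \<circ> real_of_ereal) \<longlongrightarrow> 0) (at_right 0)"
  proof -
    have "(?g \<longlongrightarrow> 0) (at_right 0)" by real_asymp
    then show ?thesis unfolding zero_ereal_def by (simp add: ereal_tendsto_simps)
  qed
  have B: "((ereal \<circ> ?g \<circ> real_of_ereal) \<longlongrightarrow> \<infinity>) (at_left 1)"
  proof -
    have "filterlim ?g at_top (at_left 1)" by real_asymp
    then show ?thesis unfolding one_ereal_def by (simp add: ereal_tendsto_simps)
  qed
  note S = interval_integral_substitution_nonneg[where f = ?f and g = ?g and g' = ?g' and a = 0 and b = 1,
      OF _ der contf contg _ _ A B int]
  have "set_integrable lborel (einterval 0 \<infinity>) ?f"
    by (rule S(1)) auto
  then show "integrable (lborel_gt 0) ?f" by (simp add: integrable_lborel_gt einv)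
  have "(LBINT x=0..\<infinity>. ?f x) = (LBINT x=0..1. ?f (?g x) * ?g' x)"
    by (rule S(2)) auto
  also have "\<dots> = (LBINT x:{0<..<1}. x powr (p - 1) * (1 - x) powr (q - 1))"
  proof -
    have "(LBINT x:{0<..<1}. ?f (?g x) * ?g' x) = (LBINT x:{0<..<1}. x powr (p - 1) * (1 - x) powr (q - 1))"
      by (rule set_lebesgue_integral_cong, simp, intro allI impI, rule eq) simp_all
    then show ?thesis by (simp only: interval_lebesgue_integral_def einv) simp
  qed
  also have "\<dots> = integral {0<..<1} (\<lambda>x. x powr (p - 1) * (1 - x) powr (q - 1))"
    by (rule set_borel_integral_eq_integral(2)[OF int01])
  also have "\<dots> = integral {0..1} (\<lambda>x. x powr (p - 1) * (1 - x) powr (q - 1))"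
    by (rule integral_open_interval_real [symmetric])
  also have "\<dots> = Beta p q"
    using has_integral_Beta_real[OF assms] by (rule integral_unique)
  finally show "(\<integral>t. ?f t \<partial>lborel_gt 0) = Beta p q"
    by (simp add: integral_lborel_gt interval_lebesgue_integral_def einv)
qed

lemma analytic_continuation_of_reals:
  fixes f g :: "complex \<Rightarrow> complex"
  assumes "f holomorphic_on {z. Re z > a}" "g holomorphic_on {z. Re z > a}"
    and "\<And>x::real. x > a \<Longrightarrow> f (of_real x) = g (of_real x)" and "Re z > a"
  shows "f z = g z"
proof -
  let ?S = "{z. Re z > a}" and ?c = "complex_of_real (a + 1)"
  have "?c islimpt complex_of_real ` {a<..}"
    unfolding islimpt_approachable
  proof (intro allI impI)
    fix e :: real assume "e > 0"
    then show "\<exists>x'\<in>complex_of_real ` {a<..}. x' \<noteq> ?c \<and> dist x' ?c < e"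
      by (intro bexI[of _ "complex_of_real (a + 1 + e / 2)"])
         (auto simp: dist_norm simp flip: of_real_add of_real_diff)
  qed
  then have "f z - g z = 0"
    using assms
    by (intro analytic_continuation[of "\<lambda>z. f z - g z" ?S "complex_of_real ` {a<..}" ?c z])
       (auto intro!: holomorphic_intros open_halfspace_Re_gt convex_connected convex_halfspace_Re_gt)
  then show ?thesis by simp
qed

lemma Re_pos_imp_not_nonpos_Int: "Re z > 0 \<Longrightarrow> z \<notin> \<int>\<^sub>\<le>\<^sub>0"
  by (auto elim!: nonpos_Ints_cases)

context
  fixes G :: "complex \<Rightarrow> complex \<Rightarrow> real \<Rightarrow> complex"
  defines "G \<equiv> \<lambda>p q t. of_real t powr (p - 1) * of_real (1 + t) powr (- (p + q))"
begin

lemma norm_Beta_integrand: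
  "t > 0 \<Longrightarrow> norm (G p q t) = t powr (Re p - 1) * (1 + t) powr (- (Re p + Re q))"
  unfolding G_def norm_mult by (subst (1 2) norm_of_real_powr) simp_all

lemma measurable_Beta_integrand: "G p q \<in> borel_measurable (lborel_gt 0)"
  unfolding G_def
  by (intro measurable_lborel_gt_continuous continuous_intros) (auto simp: complex_eq_iff)

lemma integrable_Beta_second_kind:
  assumes "Re p > 0" "Re q > 0"
  shows "integrable (lborel_gt 0) (G p q)"
proof (rule Bochner_Integration.integrable_bound[OF Beta_second_kind_real(1)[OF assms] measurable_Beta_integrand])
  show "AE t in lborel_gt 0. norm (G p q t) \<le> norm (t powr (Re p - 1) * (1 + t) powr (- (Re p + Re q)))"
    by (intro AE_I2) (simp add: norm_Beta_integrand abs_mult)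
qed

text \<open>Written as (t / (1 + t))^p (1 + t)^(-q) / t, the integrand decreases in both Re p and Re
  q, because t / (1 + t) <= 1 <= 1 + t. A smaller pair of exponents therefore dominates a whole half
  plane of parameters.\<close>

lemma Beta_integrand_mono:
  assumes "t > 0" "a \<le> Re p" "b \<le> Re q"
  shows "norm (G p q t) \<le> t powr (a - 1) * (1 + t) powr (- (a + b))"
proof -
  have eq: "t powr (x - 1) * (1 + t) powr (- (x + y)) = (t / (1 + t)) powr x * (1 + t) powr (- y) / t" for x y
    using assms(1) by (simp add: powr_divide powr_diff powr_add powr_minus field_simps)
  have "(t / (1 + t)) powr Re p \<le> (t / (1 + t)) powr a"
    by (rule powr_mono') (use assms in auto)
  moreover have "(1 + t) powr (- Re q) \<le> (1 + t) powr (- b)"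
    by (rule powr_mono) (use assms in auto)
  ultimately show ?thesis
    unfolding norm_Beta_integrand[OF assms(1)] eq
    by (intro divide_right_mono mult_mono) (use assms(1) in auto)
qed

lemma holomorphic_Beta_second_kind:
  "Re q > 0 \<Longrightarrow> (\<lambda>p. \<integral>t. G p q t \<partial>lborel_gt 0) holomorphic_on {p. Re p > 0}"
  "Re p > 0 \<Longrightarrow> (\<lambda>q. \<integral>t. G p q t \<partial>lborel_gt 0) holomorphic_on {q. Re q > 0}"
proof -
  assume q: "Re q > 0"
  show "(\<lambda>p. \<integral>t. G p q t \<partial>lborel_gt 0) holomorphic_on {p. Re p > 0}"
  proof (rule param_integral_holomorphic)
    show "(\<lambda>p. G p q t) holomorphic_on {p. Re p > 0}" if "t \<in> space (lborel_gt 0)" for t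
      using that unfolding G_def by (intro holomorphic_intros) (auto simp: complex_nonpos_Reals_iff)
    fix p :: complex assume p: "p \<in> {p. Re p > 0}"
    \<comment> \<open>The half plane to the right of Re p / 2 is a neighbourhood of p, and the real
      integrand at Re p / 2 dominates on all of it.\<close>
    show "\<exists>U g. open U \<and> p \<in> U \<and> U \<subseteq> {p. Re p > 0} \<and> integrable (lborel_gt 0) g \<and>
               (\<forall>y\<in>U. \<forall>t\<in>space (lborel_gt 0). norm (G y q t) \<le> g t)"
      using p Beta_second_kind_real(1)[of "Re p / 2" "Re q"] q
      by (intro exI[of _ "{y. Re y > Re p / 2}"]
          exI[of _ "\<lambda>t. t powr (Re p / 2 - 1) * (1 + t) powr (- (Re p / 2 + Re q))"] conjI ballI Beta_integrand_mono)
        (auto simp: open_halfspace_Re_gt simp del: less_divide_eq_numeral1 divide_less_eq_numeral1)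
  qed (auto simp: open_halfspace_Re_gt measurable_Beta_integrand)
next
  assume p: "Re p > 0"
  show "(\<lambda>q. \<integral>t. G p q t \<partial>lborel_gt 0) holomorphic_on {q. Re q > 0}"
  proof (rule param_integral_holomorphic)
    show "(\<lambda>q. G p q t) holomorphic_on {q. Re q > 0}" if "t \<in> space (lborel_gt 0)" for t
      using that unfolding G_def by (intro holomorphic_intros) (auto simp: complex_nonpos_Reals_iff)
    fix q :: complex assume q: "q \<in> {q. Re q > 0}"
    show "\<exists>U g. open U \<and> q \<in> U \<and> U \<subseteq> {q. Re q > 0} \<and> integrable (lborel_gt 0) g \<and>
               (\<forall>y\<in>U. \<forall>t\<in>space (lborel_gt 0). norm (G p y t) \<le> g t)"
      using q Beta_second_kind_real(1)[of "Re p" "Re q / 2"] p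
      by (intro exI[of _ "{y. Re y > Re q / 2}"]
          exI[of _ "\<lambda>t. t powr (Re p - 1) * (1 + t) powr (- (Re p + Re q / 2))"] conjI ballI Beta_integrand_mono)
        (auto simp: open_halfspace_Re_gt simp del: less_divide_eq_numeral1 divide_less_eq_numeral1)
  qed (auto simp: open_halfspace_Re_gt measurable_Beta_integrand)
qed

text \<open>Both sides are holomorphic in each parameter separately, so the real case is continued
  first in q with p real (\<open>rc\<close>) and then in p.\<close>

lemma Beta_second_kind:
  assumes "Re p > 0" "Re q > 0"
  shows "(\<integral>t. G p q t \<partial>lborel_gt 0) = Beta p q"
proof -
  have hol: "(\<lambda>x. Beta x y) holomorphic_on {x. Re x > 0}" "(\<lambda>x. Beta y x) holomorphic_on {x. Re x > 0}"
    if "Re y > 0" for y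
    unfolding Beta_altdef using that
    by (intro holomorphic_intros; simp add: Re_pos_imp_not_nonpos_Int)+
  have rr: "(\<integral>t. G (of_real p) (of_real q) t \<partial>lborel_gt 0) = Beta (of_real p) (of_real q)"
    if "p > 0" "q > 0" for p q
  proof -
    have "(\<integral>t. G (of_real p) (of_real q) t \<partial>lborel_gt 0) =
        (\<integral>t. of_real (t powr (p - 1) * (1 + t) powr (- (p + q))) \<partial>lborel_gt 0)"
    proof (intro Bochner_Integration.integral_cong refl)
      fix t assume t: "t \<in> space (lborel_gt 0)"
      have "G (of_real p) (of_real q) t = of_real t powr of_real (p - 1) * of_real (1 + t) powr of_real (- (p + q))"
        by (simp add: G_def)
      also have "\<dots> = of_real (t powr (p - 1) * (1 + t) powr (- (p + q)))"
        using t by (subst (1 2) powr_of_real) simp_all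
      finally show "G (of_real p) (of_real q) t = of_real (t powr (p - 1) * (1 + t) powr (- (p + q)))" .
    qed
    also have "\<dots> = of_real (Beta p q)"
      by (simp only: integral_complex_of_real Beta_second_kind_real(2)[OF that])
    finally show ?thesis by (simp add: Beta_complex_of_real)
  qed
  have rc: "(\<integral>t. G (of_real p) q t \<partial>lborel_gt 0) = Beta (of_real p) q" if "p > 0" "Re q > 0" for p q
    using analytic_continuation_of_reals[OF holomorphic_Beta_second_kind(2) hol(2), of "of_real p" "of_real p" q] rr that
    by simp
  show ?thesis
    using analytic_continuation_of_reals[OF holomorphic_Beta_second_kind(1) hol(1), of q q p] rc assms by simp
qed

end

subsection \<open>The regularized hypergeometric function\<close>

lemma mem_cut_plane_F: "z \<in> cut_plane_F \<longleftrightarrow> \<not> (Im z = 0 \<and> Re z \<ge> 1)"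
  by (auto simp: cut_plane_F_def complex_eq_iff intro!: image_eqI[of _ _ "Re z"])

lemma mem_cut_plane_D: "z \<in> cut_plane_D \<longleftrightarrow> \<not> (Im z = 0 \<and> Re z \<le> 1)"
  by (auto simp: cut_plane_D_def complex_eq_iff intro!: image_eqI[of _ _ "Re z"])

lemma mem_cut_plane_trig: "z \<in> cut_plane_trig \<longleftrightarrow> \<not> (Im z = 0 \<and> (Re z \<le> -1 \<or> Re z \<ge> 1))"
  by (auto simp: cut_plane_trig_def complex_eq_iff intro!: image_eqI[of _ _ "Re z"])

lemma open_cut_planes: "open cut_plane_F" "open cut_plane_D" "open cut_plane_trig"
proof -
  have eqs: "- cut_plane_F = {z. Im z = 0} \<inter> {z. Re z \<ge> 1}"
            "- cut_plane_D = {z. Im z = 0} \<inter> {z. Re z \<le> 1}"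
            "- cut_plane_trig = {z. Im z = 0} \<inter> ({z. Re z \<le> -1} \<union> {z. Re z \<ge> 1})"
    by (auto simp: mem_cut_plane_F mem_cut_plane_D mem_cut_plane_trig)
  have cl: "closed {z. Im z = 0}" "closed {z. Re z \<ge> a}" "closed {z. Re z \<le> a}" for a
    by (intro closed_Collect_eq closed_Collect_le continuous_intros)+
  show "open cut_plane_F" "open cut_plane_D" "open cut_plane_trig"
    unfolding open_closed eqs by (intro closed_Int closed_Un cl)+
qed

text \<open>Each set is starlike, with centre 0, 2 and 0 respectively; for
  \<open>cut_plane_D\<close> the point 0 lies on the cut, so a centre to the right of 1 is
  taken.\<close>

lemma connected_cut_planes: "connected cut_plane_F" "connected cut_plane_D" "connected cut_plane_trig"
proof -
  have "starlike cut_plane_F"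
    unfolding starlike_def
  proof (intro bexI[of _ 0] ballI subsetI)
    fix z w assume z: "z \<in> cut_plane_F" and "w \<in> closed_segment 0 z"
    then obtain u where u: "0 \<le> u" "u \<le> 1" "w = of_real u * z"
      by (auto simp: in_segment scaleR_conv_of_real)
    have "u * Re z < 1" if "Re z < 1"
      using u that mult_left_le_one_le[of "Re z" u] mult_nonneg_nonpos[of u "Re z"] by (cases "Re z \<ge> 0") auto
    then show "w \<in> cut_plane_F" using z u by (auto simp: mem_cut_plane_F not_le)
  qed (simp add: mem_cut_plane_F)
  then show "connected cut_plane_F" by (rule starlike_imp_connected)
  have "starlike cut_plane_D"
    unfolding starlike_def
  proof (intro bexI[of _ 2] ballI subsetI)
    fix z w assume z: "z \<in> cut_plane_D" and "w \<in> closed_segment 2 z"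
    then obtain u where u: "0 \<le> u" "u \<le> 1" "w = of_real (1 - u) * 2 + of_real u * z"
      by (auto simp: in_segment scaleR_conv_of_real)
    have "(1 - u) * 2 + u * Re z > 1" if "Re z > 1"
    proof (cases "u = 1")
      case False
      then have "u * Re z \<ge> u * 1" using u that by (intro mult_left_mono) auto
      with False u show ?thesis by (simp add: algebra_simps)
    qed (use that in simp)
    then show "w \<in> cut_plane_D" using z u by (auto simp: mem_cut_plane_D not_le)
  qed (simp add: mem_cut_plane_D)
  then show "connected cut_plane_D" by (rule starlike_imp_connected)
  have "starlike cut_plane_trig"
    unfolding starlike_def
  proof (intro bexI[of _ 0] ballI subsetI)
    fix z w assume z: "z \<in> cut_plane_trig" and "w \<in> closed_segment 0 z"
    then obtain u where u: "0 \<le> u" "u \<le> 1" "w = of_real u * z"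
      by (auto simp: in_segment scaleR_conv_of_real)
    have "\<bar>u * Re z\<bar> < 1" if "\<bar>Re z\<bar> < 1"
      using u that mult_left_le_one_le[of "\<bar>Re z\<bar>" u] by (auto simp: abs_mult)
    then show "w \<in> cut_plane_trig" using z u by (auto simp: mem_cut_plane_trig not_le abs_less_iff)
  qed (simp add: mem_cut_plane_trig)
  then show "connected cut_plane_trig" by (rule starlike_imp_connected)
qed

section \<open>The hypergeometric series and its continuation\<close>

definition hyp_fps :: "complex \<Rightarrow> complex \<Rightarrow> complex \<Rightarrow> complex fps" where
  "hyp_fps a b c = Abs_fps (\<lambda>n. pochhammer a n * pochhammer b n * rGamma (c + of_nat n) / fact n)"

lemma hyp_fps_nth [simp]:
  "fps_nth (hyp_fps a b c) n = pochhammer a n * pochhammer b n * rGamma (c + of_nat n) / fact n"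
  by (simp add: hyp_fps_def)

lemma reg_hypergeo_series_eq: "reg_hypergeo_series a b c z = eval_fps (hyp_fps a b c) z"
  by (simp add: reg_hypergeo_series_def eval_fps_def)

text \<open>The recurrence is multiplied out because c + n may vanish; with \<open>rGamma\<close> in
  place of a quotient by Gamma it then holds for every c.\<close>

lemma hyp_fps_rec:
  "of_nat (Suc n) * (c + of_nat n) * fps_nth (hyp_fps a b c) (Suc n) =
     (a + of_nat n) * (b + of_nat n) * fps_nth (hyp_fps a b c) n"
proof -
  have "(c + of_nat n) * rGamma (c + of_nat (Suc n)) = rGamma (c + of_nat n)"
    using rGamma_plus1[of "c + of_nat n"] by (simp add: add_ac)
  then have r: "rGamma (c + of_nat n) = (c + of_nat n) * rGamma (c + of_nat (Suc n))" by simp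
  have f: "fact (Suc n) = of_nat (Suc n) * (fact n :: complex)" by simp
  show ?thesis
    unfolding hyp_fps_nth pochhammer_Suc r f
    by (simp del: of_nat_Suc fact_Suc add: field_simps)
qed

text \<open>Ratio test with a bound q strictly between |z| and 1. Beyond n > |c| the factor c + n in
  the recurrence is nonzero, with modulus at least n - |c|, so it can be divided out.\<close>

lemma summable_hyp_fps:
  assumes "norm z < 1"
  shows "summable (\<lambda>n. fps_nth (hyp_fps a b c) n * z ^ n)"
proof -
  define q where "q = (1 + norm z) / 2"
  have q: "norm z < q" "q < 1" "q \<ge> 0" using assms by (auto simp: q_def)
  define A B C where "A = norm a" and "B = norm b" and "C = norm c"
  have "((\<lambda>n. (real n + A) * (real n + B) * norm z / ((real n + 1) * (real n - C))) \<longlongrightarrow> norm z) sequentially"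
    by real_asymp
  then have "eventually (\<lambda>n. (real n + A) * (real n + B) * norm z / ((real n + 1) * (real n - C)) < q) sequentially"
    using q(1) by (rule order_tendstoD)
  moreover have "eventually (\<lambda>n. real n > C) sequentially"
    using filterlim_real_sequentially by (simp add: filterlim_at_top_dense)
  ultimately have "eventually (\<lambda>n. real n > C \<and> (real n + A) * (real n + B) * norm z \<le> q * ((real n + 1) * (real n - C))) sequentially"
  proof eventually_elim
    case (elim n)
    then have "(real n + 1) * (real n - C) > 0" by simp
    then show ?case using elim by (simp add: pos_divide_less_eq less_imp_le)
  qed
  then obtain N where N: "\<And>n. n \<ge> N \<Longrightarrow> real n > C"
      "\<And>n. n \<ge> N \<Longrightarrow> (real n + A) * (real n + B) * norm z \<le> q * ((real n + 1) * (real n - C))"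
    unfolding eventually_sequentially by blast
  let ?f = "\<lambda>n. fps_nth (hyp_fps a b c) n * z ^ n"
  have "norm (?f (Suc n)) \<le> q * norm (?f n)" if n: "n \<ge> N" for n
  proof -
    define X where "X = norm (?f n)"
    have cn: "real n - C \<le> norm (c + of_nat n)"
      using norm_triangle_ineq2[of "of_nat n" "- c"] by (simp add: C_def add.commute)
    have an: "norm (a + of_nat n) \<le> real n + A" "norm (b + of_nat n) \<le> real n + B"
      using norm_triangle_ineq[of a "of_nat n"] norm_triangle_ineq[of b "of_nat n"] by (simp_all add: A_def B_def)
    have "of_nat (Suc n) * (c + of_nat n) * ?f (Suc n) = (a + of_nat n) * (b + of_nat n) * z * ?f n"
      using hyp_fps_rec[of n c a b] by (simp only: power_Suc) (simp only: mult_ac)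
    then have "norm (of_nat (Suc n) * (c + of_nat n) * ?f (Suc n)) = norm ((a + of_nat n) * (b + of_nat n) * z * ?f n)"
      by (simp only:)
    then have "(real n + 1) * norm (c + of_nat n) * norm (?f (Suc n)) =
        norm (a + of_nat n) * norm (b + of_nat n) * norm z * X"
      unfolding norm_mult X_def norm_of_nat by (simp only: of_nat_Suc add.commute)
    also have "\<dots> \<le> (real n + A) * (real n + B) * norm z * X"
      by (intro mult_right_mono mult_mono an) (auto simp: X_def A_def B_def)
    also have "\<dots> \<le> q * ((real n + 1) * (real n - C)) * X"
      by (intro mult_right_mono N(2) n) (auto simp: X_def)
    also have "\<dots> \<le> q * ((real n + 1) * norm (c + of_nat n)) * X"
      using q(3) by (intro mult_right_mono mult_left_mono cn) (auto simp: X_def)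
    finally have "((real n + 1) * norm (c + of_nat n)) * norm (?f (Suc n)) \<le> ((real n + 1) * norm (c + of_nat n)) * (q * X)"
      by (simp only: mult_ac)
    moreover have "(real n + 1) * norm (c + of_nat n) > 0"
      using cn N(1)[OF n] by (intro mult_pos_pos) linarith+
    ultimately show ?thesis unfolding X_def by (simp only: mult_le_cancel_left_pos)
  qed
  then show ?thesis by (rule summable_ratio_test[OF q(2)])
qed

lemma hyp_fps_conv_radius: "fps_conv_radius (hyp_fps a b c) \<ge> 1"
  unfolding fps_conv_radius_def
proof (rule conv_radius_geI_ex')
  fix r assume r: "0 < r" "ereal r < 1"
  then have "norm (complex_of_real r) < 1" by (simp add: one_ereal_def)
  then show "summable (\<lambda>n. fps_nth (hyp_fps a b c) n * complex_of_real r ^ n)"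
    by (rule summable_hyp_fps)
qed

text \<open>Packages what a witness for the choice behind \<open>reg_hypergeo\<close> must provide,
  with the expansion at 0 as a formal series so that contiguous relations can be checked on
  coefficients.\<close>

definition hyp_extension :: "complex \<Rightarrow> complex \<Rightarrow> complex \<Rightarrow> (complex \<Rightarrow> complex) \<Rightarrow> bool" where
  "hyp_extension a b c F \<longleftrightarrow> F holomorphic_on cut_plane_F \<and> F has_fps_expansion hyp_fps a b c"

text \<open>The operator z d/dz + c multiplies the n-th coefficient by n + c, and (c + n) /
  \<Gamma>(c + 1 + n) = 1 / \<Gamma>(c + n).\<close>

lemma hyp_extension_lower_c:
  assumes "hyp_extension a b (c + 1) F"
  shows "hyp_extension a b c (\<lambda>z. z * deriv F z + c * F z)"
  unfolding hyp_extension_def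
proof
  show "(\<lambda>z. z * deriv F z + c * F z) holomorphic_on cut_plane_F"
    using assms unfolding hyp_extension_def
    by (intro holomorphic_intros holomorphic_deriv open_cut_planes) auto
  have "(\<lambda>z. z * deriv F z + c * F z) has_fps_expansion
      fps_X * fps_deriv (hyp_fps a b (c + 1)) + fps_const c * hyp_fps a b (c + 1)"
    using assms unfolding hyp_extension_def by (intro fps_expansion_intros) auto
  also have "fps_X * fps_deriv (hyp_fps a b (c + 1)) + fps_const c * hyp_fps a b (c + 1) = hyp_fps a b c"
  proof (rule fps_ext)
    fix n
    have "rGamma (c + of_nat n) = (c + of_nat n) * rGamma (c + 1 + of_nat n)"
      using rGamma_plus1[of "c + of_nat n"] by (simp add: add_ac)
    moreover have "fps_nth (fps_X * fps_deriv (hyp_fps a b (c + 1))) n = of_nat n * fps_nth (hyp_fps a b (c + 1)) n"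
      by (cases n) (simp_all del: hyp_fps_nth)
    ultimately show "fps_nth (fps_X * fps_deriv (hyp_fps a b (c + 1)) + fps_const c * hyp_fps a b (c + 1)) n =
        fps_nth (hyp_fps a b c) n"
      by (simp add: algebra_simps add_divide_distrib)
  qed
  finally show "(\<lambda>z. z * deriv F z + c * F z) has_fps_expansion hyp_fps a b c" .
qed

text \<open>Since (b + 1)_n - (b)_n = n (b + 1)_(n - 1), the series for b + 1 and for b differ by a
  z times the series with all three parameters raised by 1.\<close>

lemma hyp_extension_lower_b:
  assumes "hyp_extension a (b + 1) c F" "hyp_extension (a + 1) (b + 1) (c + 1) G"
  shows "hyp_extension a b c (\<lambda>z. F z - a * (z * G z))"
  unfolding hyp_extension_def
proof
  show "(\<lambda>z. F z - a * (z * G z)) holomorphic_on cut_plane_F"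
    using assms unfolding hyp_extension_def by (intro holomorphic_intros) auto
  have "(\<lambda>z. F z - a * (z * G z)) has_fps_expansion
      hyp_fps a (b + 1) c - fps_const a * (fps_X * hyp_fps (a + 1) (b + 1) (c + 1))"
    using assms unfolding hyp_extension_def by (intro fps_expansion_intros) auto
  also have "hyp_fps a (b + 1) c - fps_const a * (fps_X * hyp_fps (a + 1) (b + 1) (c + 1)) = hyp_fps a b c"
  proof (rule fps_ext)
    fix n
    show "fps_nth (hyp_fps a (b + 1) c - fps_const a * (fps_X * hyp_fps (a + 1) (b + 1) (c + 1))) n =
        fps_nth (hyp_fps a b c) n"
    proof (cases n)
      case (Suc m)
      define R where "R = rGamma (c + of_nat (Suc m))"
      have R': "rGamma (c + 1 + of_nat m) = R" by (simp add: R_def add_ac)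
      have a1: "pochhammer a (Suc m) = a * pochhammer (a + 1) m" by (rule pochhammer_rec)
      have b1: "pochhammer b (Suc m) = b * pochhammer (b + 1) m" by (rule pochhammer_rec)
      have b2: "pochhammer (b + 1) (Suc m) = pochhammer (b + 1) m * (b + 1 + of_nat m)" by (rule pochhammer_Suc)
      have f: "fact (Suc m) = (of_nat m + 1) * (fact m :: complex)" by simp
      have nz: "(of_nat m + 1 :: complex) \<noteq> 0" using of_nat_neq_0[of m, where 'a = complex] by (simp add: add.commute)
      have "fps_nth (hyp_fps a (b + 1) c) (Suc m) - a * fps_nth (hyp_fps (a + 1) (b + 1) (c + 1)) m =
          fps_nth (hyp_fps a b c) (Suc m)"
        unfolding hyp_fps_nth a1 b1 b2 f R' R_def [symmetric] using nz
        by (simp add: divide_simps) (simp add: algebra_simps)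
      then show ?thesis by (simp add: Suc del: hyp_fps_nth)
    qed simp
  qed
  finally show "(\<lambda>z. F z - a * (z * G z)) has_fps_expansion hyp_fps a b c" .
qed

text \<open>Euler's integral over s in (0, 1), rewritten with s = t / (1 + t). It is holomorphic in
  z wherever 1 - z s avoids the negative axis, which is exactly the cut plane; near 0 the binomial
  series is integrated term by term and the coefficients are Beta values.\<close>

lemma hyp_extension_Euler:
  assumes b: "Re b > 0" and cb: "Re (c - b) > 0"
  shows "hyp_extension a b c (\<lambda>z. rGamma b * rGamma (c - b) *
           (\<integral>t. (of_real t powr (b - 1) * of_real (1 + t) powr (- c)) *
              (1 - z * of_real (t / (1 + t))) powr (- a) \<partial>lborel_gt 0))"
proof -
  define k where "k = (\<lambda>t. complex_of_real t powr (b - 1) * of_real (1 + t) powr (- c))"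
  define p where "p = (\<lambda>z t. (1 - z * complex_of_real (t / (1 + t))) powr (- a))"
  define F where "F = (\<lambda>z. rGamma b * rGamma (c - b) * (\<integral>t. k t * p z t \<partial>lborel_gt 0))"
  note B = integrable_Beta_second_kind[of b "c - b", OF b cb] Beta_second_kind[of b "c - b", OF b cb]
  have kint: "integrable (lborel_gt 0) k" using B(1) by (simp add: k_def)
  have nonneg: "1 - z * complex_of_real s \<notin> \<real>\<^sub>\<le>\<^sub>0" if "z \<in> cut_plane_F" "0 \<le> s" "s \<le> 1" for z s
  proof
    assume "1 - z * complex_of_real s \<in> \<real>\<^sub>\<le>\<^sub>0"
    then have *: "Re z * s \<ge> 1" "Im z * s = 0" by (auto simp: complex_nonpos_Reals_iff)
    then have "s > 0" using that by (cases "s = 0") auto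
    moreover have "Re z \<ge> 1"
    proof (rule ccontr)
      assume "\<not> Re z \<ge> 1"
      then have "Re z * s < 1 * s" using \<open>s > 0\<close> by (intro mult_strict_right_mono) auto
      then show False using * that by simp
    qed
    ultimately show False using * that by (auto simp: mem_cut_plane_F)
  qed
  have s01: "0 \<le> t / (1 + t)" "t / (1 + t) \<le> 1" "t / (1 + t) < 1" if "t > 0" for t :: real
    using that by (auto simp: divide_simps)
  have pmeas: "(\<lambda>t. k t * p z t) \<in> borel_measurable (lborel_gt 0)" if "z \<in> cut_plane_F" for z
  proof (rule measurable_lborel_gt_continuous)
    have "continuous_on {0<..} (p z)"
      unfolding p_def
    proof (intro continuous_on_powr_complex continuous_intros subsetI CollectI)
      fix t :: real assume "t \<in> {0<..}"
      then have "1 - z * complex_of_real (t / (1 + t)) \<notin> \<real>\<^sub>\<le>\<^sub>0" using s01[of t] by (intro nonneg that) auto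
      then show "0 \<le> Re (1 - z * complex_of_real (t / (1 + t))) \<or> Im (1 - z * complex_of_real (t / (1 + t))) \<noteq> 0"
        "1 - z * complex_of_real (t / (1 + t)) = 0 \<Longrightarrow> 0 < Re (- a)"
        by (auto simp: complex_nonpos_Reals_iff)
    qed (auto simp: add_pos_pos)
    moreover have "continuous_on {0<..} k"
      unfolding k_def by (intro continuous_intros) (auto simp: complex_eq_iff)
    ultimately show "continuous_on {0<..} (\<lambda>t. k t * p z t)" by (intro continuous_intros)
  qed
  have "(\<lambda>z. \<integral>t. k t * p z t \<partial>lborel_gt 0) holomorphic_on cut_plane_F"
  proof (rule param_integral_holomorphic[OF open_cut_planes(1)])
    show "(\<lambda>z. k t * p z t) holomorphic_on cut_plane_F" if "t \<in> space (lborel_gt 0)" for t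
      unfolding p_def using that s01[of t] by (intro holomorphic_intros nonneg) auto
    show "(\<lambda>t. k t * p z t) \<in> borel_measurable (lborel_gt 0)" if "z \<in> cut_plane_F" for z
      by (rule pmeas[OF that])
    fix z0 assume z0: "z0 \<in> cut_plane_F"
    then obtain r where r: "r > 0" "cball z0 r \<subseteq> cut_plane_F"
      using open_cut_planes(1) open_contains_cball by blast
    \<comment> \<open>The closed interval contains s = 1, the limit of t / (1 + t) at infinity, so
      compactness bounds the factor uniformly in t.\<close>
    have "continuous_on (cball z0 r \<times> {0..1}) (\<lambda>x. (1 - fst x * complex_of_real (snd x)) powr (- a))"
    proof (intro continuous_on_powr_complex continuous_intros subsetI CollectI)
      fix x assume "x \<in> cball z0 r \<times> {0..1::real}"
      then have "1 - fst x * complex_of_real (snd x) \<notin> \<real>\<^sub>\<le>\<^sub>0"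
        using r by (intro nonneg) (auto simp: subset_eq)
      then show "0 \<le> Re (1 - fst x * complex_of_real (snd x)) \<or> Im (1 - fst x * complex_of_real (snd x)) \<noteq> 0"
        "1 - fst x * complex_of_real (snd x) = 0 \<Longrightarrow> 0 < Re (- a)"
        by (auto simp: complex_nonpos_Reals_iff)
    qed
    then have "compact ((\<lambda>x. (1 - fst x * complex_of_real (snd x)) powr (- a)) ` (cball z0 r \<times> {0..1}))"
      by (intro compact_continuous_image compact_Times) auto
    then have "bounded ((\<lambda>x. (1 - fst x * complex_of_real (snd x)) powr (- a)) ` (cball z0 r \<times> {0..1}))"
      by (rule compact_imp_bounded)
    then obtain C where "\<forall>y\<in>(\<lambda>x. (1 - fst x * complex_of_real (snd x)) powr (- a)) ` (cball z0 r \<times> {0..1}). norm y \<le> C"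
      unfolding bounded_iff by (elim exE)
    then have C: "norm ((1 - fst x * complex_of_real (snd x)) powr (- a)) \<le> C" if "x \<in> cball z0 r \<times> {0..1}" for x
      using that by (rule bspec[OF _ imageI])
    have "norm (k t * p z t) \<le> C * norm (k t)" if "z \<in> ball z0 r" "t > 0" for z t
      unfolding p_def norm_mult using C[of "(z, t / (1 + t))"] s01[OF that(2)] that(1)
      by (subst mult.commute) (intro mult_right_mono, auto)
    then show "\<exists>U g. open U \<and> z0 \<in> U \<and> U \<subseteq> cut_plane_F \<and> integrable (lborel_gt 0) g \<and>
               (\<forall>z\<in>U. \<forall>t\<in>space (lborel_gt 0). norm (k t * p z t) \<le> g t)"
    proof (intro exI[of _ "ball z0 r"] exI[of _ "\<lambda>t. C * norm (k t)"] conjI ballI)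
      show "ball z0 r \<subseteq> cut_plane_F" using r(2) ball_subset_cball by blast
      show "integrable (lborel_gt 0) (\<lambda>t. C * norm (k t))" using kint by simp
    qed (use r(1) in simp_all)
  qed
  then have hol: "F holomorphic_on cut_plane_F" unfolding F_def by (intro holomorphic_intros)
  have sums: "(\<lambda>n. fps_nth (hyp_fps a b c) n * z ^ n) sums F z" if z: "norm z < 1" for z
  proof -
    define f where "f = (\<lambda>n t. (pochhammer a n / fact n * z ^ n) *
        (complex_of_real t powr (b + of_nat n - 1) * of_real (1 + t) powr (- (b + of_nat n + (c - b)))))"
    have bn: "Re (b + of_nat n) > 0" for n using b by simp
    note Bn = integrable_Beta_second_kind[OF bn cb] Beta_second_kind[OF bn cb]
    have f_eq: "f n t = pochhammer a n / fact n * (z * of_real (t / (1 + t))) ^ n * k t" if "t > 0" for n t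
    proof -
      have "complex_of_real t powr (b + of_nat n - 1) = complex_of_real t powr ((b - 1) + of_nat n)"
        by (simp add: algebra_simps)
      also have "\<dots> = of_real t powr (b - 1) * of_real t ^ n"
        using that by (subst powr_add) (simp add: powr_nat')
      finally have 1: "complex_of_real t powr (b + of_nat n - 1) = of_real t powr (b - 1) * of_real t ^ n" .
      have nz: "complex_of_real (1 + t) \<noteq> 0" using that by (simp add: complex_eq_iff)
      have "complex_of_real (1 + t) powr (- (b + of_nat n + (c - b))) = of_real (1 + t) powr (- c - of_nat n)"
        by (simp add: algebra_simps)
      also have "\<dots> = of_real (1 + t) powr (- c) / of_real (1 + t) ^ n"
        using nz by (subst powr_diff) (simp add: powr_nat')
      finally have 2: "complex_of_real (1 + t) powr (- (b + of_nat n + (c - b))) = of_real (1 + t) powr (- c) / of_real (1 + t) ^ n" .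
      show ?thesis
        unfolding f_def 1 2 k_def by (simp add: power_mult_distrib power_divide)
    qed
    \<comment> \<open>The binomial series is \<open>hyp_fps a 1 1\<close> in disguise, since
      \<open>pochhammer 1 n\<close> cancels 1 / \<Gamma>(1 + n); its absolute convergence in the
      unit disc is therefore already known.\<close>
    have Q: "summable (\<lambda>n. norm (pochhammer a n / fact n * w ^ n))" if "norm w < 1" for w
    proof -
      have "fps_nth (hyp_fps a 1 1) n = pochhammer a n / fact n" for n
      proof -
        have "rGamma (1 + of_nat n :: complex) = 1 / fact n"
          using Gamma_fact[of n, where 'a = complex] by (simp add: rGamma_inverse_Gamma divide_inverse)
        then show ?thesis by (simp add: pochhammer_fact [symmetric])
      qed
      then have "summable (\<lambda>n. norm (fps_nth (hyp_fps a 1 1) n * w ^ n))"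
      proof (intro abs_summable_in_conv_radius)
        have "ereal (norm w) < 1" using that by (simp add: one_ereal_def)
        also have "1 \<le> fps_conv_radius (hyp_fps a 1 1)" by (rule hyp_fps_conv_radius)
        finally show "ereal (norm w) < conv_radius (fps_nth (hyp_fps a 1 1))" by (simp only: fps_conv_radius_def)
      qed
      then show ?thesis
        using \<open>\<And>n. fps_nth (hyp_fps a 1 1) n = pochhammer a n / fact n\<close> by (simp only:)
    qed
    have fint: "integrable (lborel_gt 0) (f n)" for n
      unfolding f_def by (intro Bochner_Integration.integrable_mult_right Bn)
    have zs: "norm (z * of_real (t / (1 + t))) < 1" if "t > 0" for t
    proof -
      have "norm (z * complex_of_real (t / (1 + t))) = norm z * (t / (1 + t))"
        using s01(1)[OF that] by (simp only: norm_mult norm_of_real abs_of_nonneg)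
      also have "\<dots> \<le> norm z * 1" using s01(2)[OF that] by (intro mult_left_mono) auto
      finally show ?thesis using z by simp
    qed
    have fs: "(\<lambda>n. f n t) sums (k t * p z t)" if "t > 0" for t
    proof -
      let ?w = "- (z * complex_of_real (t / (1 + t)))"
      have "(\<lambda>n. (- a gchoose n) * ?w ^ n) sums (1 + ?w) powr (- a)"
        by (rule gen_binomial_complex) (use zs[OF that] in \<open>simp only: norm_minus_cancel\<close>)
      then have "(\<lambda>n. (- a gchoose n) * ?w ^ n * k t) sums ((1 + ?w) powr (- a) * k t)"
        by (rule sums_mult2)
      moreover have "(- a gchoose n) * ?w ^ n * k t = f n t" for n
        unfolding f_eq[OF that] gbinomial_pochhammer power_minus[of "z * complex_of_real (t / (1 + t))"]
        by (simp add: power_mult_distrib [symmetric])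
      ultimately show ?thesis by (simp add: p_def mult.commute)
    qed
    have S: "(\<lambda>n. \<integral>t. f n t \<partial>lborel_gt 0) sums (\<integral>t. (\<Sum>n. f n t) \<partial>lborel_gt 0)"
    proof (rule sums_integral[OF fint])
      show "AE t in lborel_gt 0. summable (\<lambda>n. norm (f n t))"
      proof (intro AE_I2)
        fix t assume "t \<in> space (lborel_gt 0)"
        then have t: "t > 0" by simp
        show "summable (\<lambda>n. norm (f n t))"
          unfolding f_eq[OF t] norm_mult[of _ "k t"] by (intro summable_mult2 Q zs t)
      qed
      have bd: "norm (f n t) \<le> norm (pochhammer a n / fact n * z ^ n) * norm (k t)" if "t > 0" for n t
      proof -
        have "norm (z * complex_of_real (t / (1 + t))) \<le> norm z"
          using s01[OF that] by (simp only: norm_mult norm_of_real abs_of_nonneg mult_right_le_one_le norm_ge_zero)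
        then have "norm (z * complex_of_real (t / (1 + t))) ^ n \<le> norm z ^ n" by (intro power_mono) auto
        then show ?thesis unfolding f_eq[OF that] norm_mult norm_power
          by (intro mult_right_mono mult_left_mono) (simp_all only: norm_ge_zero)
      qed
      show "summable (\<lambda>n. \<integral>t. norm (f n t) \<partial>lborel_gt 0)"
      proof (rule summable_comparison_test')
        show "summable (\<lambda>n. norm (pochhammer a n / fact n * z ^ n) * (\<integral>t. norm (k t) \<partial>lborel_gt 0))"
          by (intro summable_mult2 Q z)
        fix n :: nat
        have "(\<integral>t. norm (f n t) \<partial>lborel_gt 0) \<le> (\<integral>t. norm (pochhammer a n / fact n * z ^ n) * norm (k t) \<partial>lborel_gt 0)"
          by (intro integral_mono integrable_norm fint Bochner_Integration.integrable_mult_right kint bd) auto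
        also have "\<dots> = norm (pochhammer a n / fact n * z ^ n) * (\<integral>t. norm (k t) \<partial>lborel_gt 0)"
          by (rule Bochner_Integration.integral_mult_right_zero)
        finally show "norm (\<integral>t. norm (f n t) \<partial>lborel_gt 0) \<le> norm (pochhammer a n / fact n * z ^ n) * (\<integral>t. norm (k t) \<partial>lborel_gt 0)"
          by (simp add: integral_nonneg_AE)
      qed
    qed
    have "(\<integral>t. (\<Sum>n. f n t) \<partial>lborel_gt 0) = (\<integral>t. k t * p z t \<partial>lborel_gt 0)"
      by (intro Bochner_Integration.integral_cong refl) (use fs sums_unique in force)
    with S have "(\<lambda>n. rGamma b * rGamma (c - b) * (\<integral>t. f n t \<partial>lborel_gt 0)) sums F z"
      unfolding F_def by (intro sums_mult) simp
    moreover have "rGamma b * rGamma (c - b) * (\<integral>t. f n t \<partial>lborel_gt 0) = fps_nth (hyp_fps a b c) n * z ^ n" for n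
    proof -
      have "(\<integral>t. f n t \<partial>lborel_gt 0) = (pochhammer a n / fact n * z ^ n) * Beta (b + of_nat n) (c - b)"
        unfolding f_def by (simp only: Bochner_Integration.integral_mult_right_zero Bn(2))
      also have "Beta (b + of_nat n) (c - b) = Gamma (b + of_nat n) * Gamma (c - b) * rGamma (c + of_nat n)"
        by (simp add: Beta_altdef algebra_simps)
      also have "Gamma (b + of_nat n) = pochhammer b n * Gamma b"
        by (subst pochhammer_Gamma) (use b in \<open>auto simp: Re_pos_imp_not_nonpos_Int Gamma_eq_zero_iff\<close>)
      finally show ?thesis
        using b cb by (simp add: rGamma_inverse_Gamma Gamma_eq_zero_iff Re_pos_imp_not_nonpos_Int field_simps)
    qed
    ultimately show ?thesis by (simp only:)
  qed
  have "eventually (\<lambda>z. (\<lambda>n. fps_nth (hyp_fps a b c) n * z ^ n) sums F z) (nhds 0)"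
    using eventually_nhds_in_open[of "ball 0 1" "0 :: complex"] by (auto elim!: eventually_mono intro: sums simp del: hyp_fps_nth)
  then have "F has_fps_expansion hyp_fps a b c" by (rule has_fps_expansionI)
  with hol show ?thesis unfolding hyp_extension_def F_def k_def p_def by blast
qed

text \<open>Euler's integral needs Re b > 0 and Re (c - b) > 0. An induction that lowers c removes
  the second condition; an induction that lowers b, with a and c free because the relation raises
  them, then removes the first.\<close>

lemma hyp_extension_exists: "\<exists>F. hyp_extension a b c F"
proof -
  have base: "\<exists>F. hyp_extension a b c F" if "Re b > 0" "Re (c - b) > - real m" for a b c m
    using that(2)
  proof (induction m arbitrary: c)
    case 0
    then show ?case using hyp_extension_Euler[OF that(1), of c a] by auto
  next
    case (Suc m)
    then have "Re (c + 1 - b) > - real m" by simp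
    from Suc.IH[OF this] show ?case using hyp_extension_lower_c by blast
  qed
  have step: "\<exists>F. hyp_extension a b c F" if "Re b > - real m" for m a b c
    using that
  proof (induction m arbitrary: a b c)
    case 0
    obtain n where "- Re (c - b) < real n" using reals_Archimedean2 by blast
    with 0 base[of b n c a] show ?case by simp
  next
    case (Suc m)
    then have b: "Re (b + 1) > - real m" by simp
    show ?case using Suc.IH[OF b, of a c] Suc.IH[OF b, of "a + 1" "c + 1"] hyp_extension_lower_b by blast
  qed
  obtain n where "- Re b < real n" using reals_Archimedean2 by blast
  with step[of n b a c] show ?thesis by simp
qed

lemma reg_hypergeo_extension:
  shows holomorphic_reg_hypergeo: "reg_hypergeo a b c holomorphic_on cut_plane_F"
    and has_fps_expansion_reg_hypergeo: "reg_hypergeo a b c has_fps_expansion hyp_fps a b c"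
    and reg_hypergeo_eq_series: "norm z < 1 \<Longrightarrow> reg_hypergeo a b c z = eval_fps (hyp_fps a b c) z"
proof -
  have sub: "ball 0 1 \<subseteq> cut_plane_F"
  proof
    fix z :: complex assume "z \<in> ball 0 1"
    then have "Re z < 1" using complex_Re_le_cmod[of z] by simp
    then show "z \<in> cut_plane_F" by (simp add: mem_cut_plane_F)
  qed
  obtain F where F: "F holomorphic_on cut_plane_F" "F has_fps_expansion hyp_fps a b c"
    using hyp_extension_exists unfolding hyp_extension_def by blast
  have holE: "eval_fps (hyp_fps a b c) holomorphic_on ball 0 1"
  proof (intro holomorphic_on_eval_fps subsetI)
    fix z :: complex assume "z \<in> ball 0 1"
    then have "ereal (norm z) < 1" by (simp add: one_ereal_def)
    also have "1 \<le> fps_conv_radius (hyp_fps a b c)" by (rule hyp_fps_conv_radius)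
    finally show "z \<in> eball 0 (fps_conv_radius (hyp_fps a b c))" by (simp add: in_eball_iff)
  qed
  have FE: "F z = eval_fps (hyp_fps a b c) z" if z: "z \<in> ball 0 1" for z
  proof -
    obtain s where s: "open s" "0 \<in> s" "\<And>z. z \<in> s \<Longrightarrow> eval_fps (hyp_fps a b c) z = F z"
      using F(2) unfolding has_fps_expansion_def eventually_nhds by blast
    show ?thesis
      by (rule analytic_continuation_open[of "s \<inter> ball 0 1" "ball 0 1"])
         (use s z F(1) sub holE in \<open>auto intro: holomorphic_on_subset\<close>)
  qed
  have "\<exists>g. g holomorphic_on cut_plane_F \<and> (\<forall>z\<in>ball 0 1. g z = reg_hypergeo_series a b c z)"
    using F(1) FE by (auto simp: reg_hypergeo_series_eq)
  from someI_ex[OF this] have R: "reg_hypergeo a b c holomorphic_on cut_plane_F"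
      "\<And>z. z \<in> ball 0 1 \<Longrightarrow> reg_hypergeo a b c z = eval_fps (hyp_fps a b c) z"
    unfolding reg_hypergeo_def analytic_extension_def by (auto simp: reg_hypergeo_series_eq)
  show "reg_hypergeo a b c holomorphic_on cut_plane_F" by (fact R(1))
  show "norm z < 1 \<Longrightarrow> reg_hypergeo a b c z = eval_fps (hyp_fps a b c) z" using R(2)[of z] by simp
  show "reg_hypergeo a b c has_fps_expansion hyp_fps a b c"
    unfolding has_fps_expansion_def
  proof
    show "0 < fps_conv_radius (hyp_fps a b c)"
      using hyp_fps_conv_radius[of a b c] by (simp add: less_le_trans[of 0 1])
    show "eventually (\<lambda>z. eval_fps (hyp_fps a b c) z = reg_hypergeo a b c z) (nhds 0)"
      using eventually_nhds_in_open[of "ball 0 1" "0 :: complex"] by (auto elim!: eventually_mono simp: R(2))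
  qed
qed

lemma reg_hypergeo_0: "reg_hypergeo a b c 0 = rGamma c"
  by (simp add: reg_hypergeo_eq_series eval_fps_at_0)

text \<open>Coefficient by coefficient the equation is the recurrence \<open>hyp_fps_rec\<close>, so
  it holds near 0, and the identity theorem carries it to the whole cut plane.\<close>

lemma hypergeometric_ODE:
  fixes a b c z :: complex
  assumes z: "z \<in> cut_plane_F"
  defines "F \<equiv> reg_hypergeo a b c"
  shows "z * (1 - z) * deriv (deriv F) z + (c - (a + b + 1) * z) * deriv F z - a * b * F z = 0"
proof -
  let ?f = "hyp_fps a b c"
  let ?L = "\<lambda>z. z * deriv (deriv F) z - z * (z * deriv (deriv F) z) + c * deriv F z - (a + b + 1) * (z * deriv F z) - a * b * F z"
  have "F has_fps_expansion ?f" unfolding F_def by (rule has_fps_expansion_reg_hypergeo)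
  then have "?L has_fps_expansion
      fps_X * fps_deriv (fps_deriv ?f) - fps_X * (fps_X * fps_deriv (fps_deriv ?f)) + fps_const c * fps_deriv ?f
      - fps_const (a + b + 1) * (fps_X * fps_deriv ?f) - fps_const (a * b) * ?f"
    by (intro fps_expansion_intros)
  also have "fps_X * fps_deriv (fps_deriv ?f) - fps_X * (fps_X * fps_deriv (fps_deriv ?f)) + fps_const c * fps_deriv ?f
      - fps_const (a + b + 1) * (fps_X * fps_deriv ?f) - fps_const (a * b) * ?f = 0"
  proof (rule fps_ext)
    fix n
    have 1: "fps_nth (fps_X * fps_deriv (fps_deriv ?f)) n = of_nat n * (of_nat n + 1) * fps_nth ?f (Suc n)"
      by (cases n) (simp_all del: hyp_fps_nth add: algebra_simps)
    have 2: "fps_nth (fps_X * (fps_X * fps_deriv (fps_deriv ?f))) n = of_nat n * (of_nat n - 1) * fps_nth ?f n"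
    proof (cases n)
      case (Suc m)
      then show ?thesis by (cases m) (simp_all del: hyp_fps_nth add: algebra_simps)
    qed simp
    have 3: "fps_nth (fps_X * fps_deriv ?f) n = of_nat n * fps_nth ?f n"
      by (cases n) (simp_all del: hyp_fps_nth)
    have 4: "fps_nth (fps_deriv ?f) n = (of_nat n + 1) * fps_nth ?f (Suc n)"
      by (simp del: hyp_fps_nth add: algebra_simps)
    show "fps_nth (fps_X * fps_deriv (fps_deriv ?f) - fps_X * (fps_X * fps_deriv (fps_deriv ?f)) + fps_const c * fps_deriv ?f
      - fps_const (a + b + 1) * (fps_X * fps_deriv ?f) - fps_const (a * b) * ?f) n = fps_nth 0 n"
    proof -
      let ?N = "of_nat n :: complex" and ?u = "fps_nth ?f n" and ?v = "fps_nth ?f (Suc n)"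
      have id: "N * (N + 1) * f1 - N * (N - 1) * f0 + c * ((N + 1) * f1) - (a + b + 1) * (N * f0) - a * b * f0 =
          (1 + N) * (c + N) * f1 - (a + N) * (b + N) * f0" for N f0 f1
        by (simp add: algebra_simps)
      have "fps_nth (fps_X * fps_deriv (fps_deriv ?f) - fps_X * (fps_X * fps_deriv (fps_deriv ?f)) + fps_const c * fps_deriv ?f
          - fps_const (a + b + 1) * (fps_X * fps_deriv ?f) - fps_const (a * b) * ?f) n =
          ?N * (?N + 1) * ?v - ?N * (?N - 1) * ?u + c * ((?N + 1) * ?v) - (a + b + 1) * (?N * ?u) - a * b * ?u"
        unfolding fps_sub_nth fps_add_nth fps_mult_left_const_nth 1 2 3 4 ..
      also have "\<dots> = (1 + ?N) * (c + ?N) * ?v - (a + ?N) * (b + ?N) * ?u" by (rule id)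
      also have "(1 + ?N) * (c + ?N) * ?v = (a + ?N) * (b + ?N) * ?u"
        using hyp_fps_rec[of n c a b] unfolding of_nat_Suc .
      finally show ?thesis unfolding diff_self fps_zero_nth .
    qed
  qed
  finally have "?L has_fps_expansion 0" .
  then have "eventually (\<lambda>z. ?L z = 0) (nhds 0)"
    unfolding has_fps_expansion_def eval_fps_0 by (elim conjE, elim eventually_mono) (rule sym)
  then obtain s where s: "open s" "0 \<in> s" "\<And>z. z \<in> s \<Longrightarrow> ?L z = 0"
    unfolding eventually_nhds by blast
  have F: "F holomorphic_on cut_plane_F" unfolding F_def by (rule holomorphic_reg_hypergeo)
  have "?L z = 0"
  proof (rule analytic_continuation_open[of "s \<inter> cut_plane_F" cut_plane_F ?L "\<lambda>_. 0"])
    show "?L holomorphic_on cut_plane_F"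
      by (intro holomorphic_intros holomorphic_deriv open_cut_planes F)
    show "s \<inter> cut_plane_F \<noteq> {}" using s(2) by (auto simp: mem_cut_plane_F)
  qed (use s z open_cut_planes connected_cut_planes in auto)
  then show ?thesis by (simp add: algebra_simps)
qed

subsection \<open>Weighted integrals and recessive solutions\<close>

lemma integral_lborel_gt_affine:
  fixes f :: "real \<Rightarrow> 'a :: {banach, second_countable_topology}"
  assumes "c > 0"
  shows "integrable (lborel_gt (d + c * a)) f \<longleftrightarrow> integrable (lborel_gt a) (\<lambda>s. f (d + c * s))"
    and "(\<integral>t. f t \<partial>lborel_gt (d + c * a)) = c *\<^sub>R (\<integral>s. f (d + c * s) \<partial>lborel_gt a)"
proof -
  have ind: "indicator {d + c * a<..} (d + c * s) = (indicator {a<..} s :: real)" for s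
    using assms by (auto simp: indicator_def)
  show "integrable (lborel_gt (d + c * a)) f \<longleftrightarrow> integrable (lborel_gt a) (\<lambda>s. f (d + c * s))"
    unfolding integrable_lborel_gt set_integrable_def
    using lborel_integrable_real_affine_iff[of c "\<lambda>t. indicator {d + c * a<..} t *\<^sub>R f t" d] assms
    by (simp add: ind)
  show "(\<integral>t. f t \<partial>lborel_gt (d + c * a)) = c *\<^sub>R (\<integral>s. f (d + c * s) \<partial>lborel_gt a)"
    unfolding integral_lborel_gt set_lebesgue_integral_def
    using lborel_integral_real_affine[of c "\<lambda>t. indicator {d + c * a<..} t *\<^sub>R f t" d] assms
    by (simp add: ind)
qed

text \<open>This disposes of the boundary terms when a differential operator under an integral
  produces a total derivative in the integration variable.\<close>

lemma integral_total_derivative_eq_0: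
  fixes H h :: "real \<Rightarrow> complex"
  assumes der: "\<And>t. t > a \<Longrightarrow> (H has_vector_derivative h t) (at t)"
    and cont: "continuous_on {a<..} h" and int: "integrable (lborel_gt a) h"
    and "(H \<longlongrightarrow> 0) (at_right a)" "(H \<longlongrightarrow> 0) at_top"
  shows "(\<integral>t. h t \<partial>lborel_gt a) = 0"
proof -
  have ei: "einterval (ereal a) \<infinity> = {a<..}" by simp
  have "(LBINT t=ereal a..\<infinity>. h t) = 0 - 0"
  proof (rule interval_integral_FTC_integrable)
    show "isCont h t" if "ereal a < ereal t" for t
      using cont that by (simp add: continuous_on_eq_continuous_at)
    show "((H \<circ> real_of_ereal) \<longlongrightarrow> 0) (at_right (ereal a))" "((H \<circ> real_of_ereal) \<longlongrightarrow> 0) (at_left \<infinity>)"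
      using assms by (simp_all add: ereal_tendsto_simps)
  qed (use der int in \<open>simp_all add: integrable_lborel_gt\<close>)
  then show ?thesis by (simp add: integral_lborel_gt interval_lebesgue_integral_def)
qed

lemma dominated_convergence_within:
  fixes f :: "real \<Rightarrow> 'b \<Rightarrow> complex"
  assumes meas: "\<And>x. x \<in> S \<Longrightarrow> x \<noteq> a \<Longrightarrow> f x \<in> borel_measurable M" "g \<in> borel_measurable M" and w: "integrable M w"
    and lim: "\<And>t. t \<in> space M \<Longrightarrow> ((\<lambda>x. f x t) \<longlongrightarrow> g t) (at a within S)"
    and bd: "\<And>x t. x \<in> S \<Longrightarrow> x \<noteq> a \<Longrightarrow> t \<in> space M \<Longrightarrow> norm (f x t) \<le> w t"
  shows "((\<lambda>x. \<integral>t. f x t \<partial>M) \<longlongrightarrow> (\<integral>t. g t \<partial>M)) (at a within S)"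
  unfolding tendsto_at_iff_sequentially o_def
proof (intro allI impI)
  fix X assume X: "\<forall>i. X i \<in> S - {a}" "X \<longlonglongrightarrow> a"
  have X1: "X n \<in> S" "X n \<noteq> a" for n using X(1) by auto
  show "(\<lambda>n. \<integral>t. f (X n) t \<partial>M) \<longlonglongrightarrow> (\<integral>t. g t \<partial>M)"
  proof (rule integral_dominated_convergence[OF meas(2) meas(1)[OF X1] w])
    show "AE t in M. (\<lambda>n. f (X n) t) \<longlonglongrightarrow> g t"
    proof (rule AE_I2)
      fix t assume "t \<in> space M"
      from lim[OF this] X show "(\<lambda>n. f (X n) t) \<longlonglongrightarrow> g t"
        unfolding tendsto_at_iff_sequentially o_def by (elim allE[of _ X] impE) simp_all
    qed
    show "AE t in M. norm (f (X n) t) \<le> w t" for n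
      by (rule AE_I2) (rule bd[OF X1])
  qed
qed

text \<open>The modulus of z^w is |z|^(Re w) exp (- Im w Arg z), and |Arg z| <= pi; the constant is
  thus independent of z.\<close>

lemma norm_powr_le:
  assumes "z \<noteq> 0"
  shows "norm (z powr w) \<le> exp (pi * \<bar>Im w\<bar>) * norm z powr Re w"
proof -
  have "\<bar>Im w * Arg z\<bar> \<le> \<bar>Im w\<bar> * pi"
    unfolding abs_mult using Arg_le_pi[of z] mpi_less_Arg[of z] by (intro mult_left_mono) linarith+
  then have "- Im w * Arg z \<le> pi * \<bar>Im w\<bar>" by (simp add: mult.commute)
  then show ?thesis
    unfolding norm_powr_complex by (subst mult.commute) (intro mult_right_mono, auto)
qed

text \<open>For y >= 0 the upper bound on x decides and for y < 0 the lower one; adding both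
  constants gives one estimate for either sign.\<close>

lemma powr_between:
  fixes x t y :: real
  assumes "0 < c" "0 < t" "c * t \<le> x" "x \<le> d * t"
  shows "x powr y \<le> (c powr y + d powr y) * t powr y"
proof -
  have ct: "0 < c * t" using assms by simp
  have d: "0 < d"
  proof (rule ccontr)
    assume "\<not> 0 < d"
    then have "d * t \<le> 0" using assms(2) by (simp add: mult_nonpos_nonneg)
    then show False using ct assms by linarith
  qed
  show ?thesis
  proof (cases "y \<ge> 0")
    case True
    have "x powr y \<le> (d * t) powr y" using assms ct True by (intro powr_mono2) linarith+
    also have "\<dots> = d powr y * t powr y" using assms d by (simp add: powr_mult)
    also have "\<dots> \<le> (c powr y + d powr y) * t powr y" by (intro mult_right_mono) auto
    finally show ?thesis .
  next
    case False
    have "x powr y \<le> (c * t) powr y" using assms ct False by (intro powr_mono2') auto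
    also have "\<dots> = c powr y * t powr y" using assms d by (simp add: powr_mult)
    also have "\<dots> \<le> (c powr y + d powr y) * t powr y" by (intro mult_right_mono) auto
    finally show ?thesis .
  qed
qed

text \<open>Separates the singularity at 1 from the growth at infinity, using t^2 - 1 = (t - 1) (t +
  1) and t <= t + 1 <= 2 t.\<close>

lemma square_minus_1_powr_le:
  fixes t x :: real
  assumes "t > 1"
  shows "(t\<^sup>2 - 1) powr x \<le> (1 + 2 powr x) * ((t - 1) powr x * t powr x)"
proof -
  have "t\<^sup>2 - 1 = (t - 1) * (t + 1)" by (simp add: power2_eq_square algebra_simps)
  then have "(t\<^sup>2 - 1) powr x = (t - 1) powr x * (t + 1) powr x" using assms by (simp add: powr_mult)
  moreover have "(t + 1) powr x \<le> (1 powr x + 2 powr x) * t powr x"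
    using assms by (intro powr_between) auto
  ultimately show ?thesis using assms by (simp add: mult_ac mult_left_mono)
qed

lemma square_minus_1_pos: "t > 1 \<Longrightarrow> t\<^sup>2 - 1 > (0::real)"
  by (simp add: power2_eq_square) (metis less_1_mult)

lemma integrable_weight_split:
  fixes x y :: real
  assumes "x > -1" "y > x + 1"
  shows "integrable (lborel_gt 1) (\<lambda>t. (t - 1) powr x * t powr (- y))"
proof -
  have "integrable (lborel_gt 0) (\<lambda>s. s powr x * (1 + s) powr (- y))"
    using Beta_second_kind_real(1)[of "x + 1" "y - x - 1"] assms by simp
  then show ?thesis
    using integral_lborel_gt_affine(1)[of 1 1 0 "\<lambda>t. (t - 1) powr x * t powr (- y)"] by simp
qed

section \<open>The weight of Laplace's integral and its Beta integrals\<close>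

definition gweight :: "complex \<Rightarrow> real \<Rightarrow> complex" where
  "gweight \<alpha> t = of_real (t\<^sup>2 - 1) powr (\<alpha> - 1)"

lemma norm_gweight: "t > 1 \<Longrightarrow> norm (gweight \<alpha> t) = (t\<^sup>2 - 1) powr (Re \<alpha> - 1)"
  unfolding gweight_def by (subst norm_of_real_powr) (simp_all add: square_minus_1_pos)

lemma continuous_on_gweight: "continuous_on {1<..} (gweight \<alpha>)"
  unfolding gweight_def
  by (intro continuous_intros) (auto dest: square_minus_1_pos simp: complex_eq_iff)

text \<open>The condition \<rho> > 0 is convergence at t = 1; e > 2 \<rho> - 1 is convergence at
  infinity, where the weight grows like t^(2 \<rho> - 2).\<close>

lemma integrable_gweight:
  fixes e \<rho> :: real
  assumes "\<rho> > 0" "e > 2 * \<rho> - 1"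
  shows "integrable (lborel_gt 1) (\<lambda>t. t powr (- e) * (t\<^sup>2 - 1) powr (\<rho> - 1))"
proof (rule Bochner_Integration.integrable_bound)
  show "integrable (lborel_gt 1) (\<lambda>t. (1 + 2 powr (\<rho> - 1)) * ((t - 1) powr (\<rho> - 1) * t powr (- (e - (\<rho> - 1)))))"
    by (intro Bochner_Integration.integrable_mult_right integrable_weight_split) (use assms in auto)
  show "(\<lambda>t. t powr (- e) * (t\<^sup>2 - 1) powr (\<rho> - 1)) \<in> borel_measurable (lborel_gt 1)"
    by (intro measurable_lborel_gt_continuous continuous_intros) (auto dest: square_minus_1_pos)
  show "AE t in lborel_gt 1. norm (t powr (- e) * (t\<^sup>2 - 1) powr (\<rho> - 1)) \<le>
      norm ((1 + 2 powr (\<rho> - 1)) * ((t - 1) powr (\<rho> - 1) * t powr (- (e - (\<rho> - 1)))))"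
  proof (intro AE_I2)
    fix t assume "t \<in> space (lborel_gt 1)"
    then have t: "t > 1" by simp
    have "t powr (- e) * (t\<^sup>2 - 1) powr (\<rho> - 1) \<le>
        t powr (- e) * ((1 + 2 powr (\<rho> - 1)) * ((t - 1) powr (\<rho> - 1) * t powr (\<rho> - 1)))"
      by (intro mult_left_mono square_minus_1_powr_le t) auto
    also have "\<dots> = (1 + 2 powr (\<rho> - 1)) * ((t - 1) powr (\<rho> - 1) * (t powr (- e) * t powr (\<rho> - 1)))"
      by (simp only: mult_ac)
    also have "t powr (- e) * t powr (\<rho> - 1) = t powr (- (e - (\<rho> - 1)))"
      by (simp only: powr_add [symmetric]) (simp add: algebra_simps)
    finally show "norm (t powr (- e) * (t\<^sup>2 - 1) powr (\<rho> - 1)) \<le>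
      norm ((1 + 2 powr (\<rho> - 1)) * ((t - 1) powr (\<rho> - 1) * t powr (- (e - (\<rho> - 1)))))"
      by (simp add: abs_mult)
  qed
qed

text \<open>This is the leading coefficient of Laplace's integral: (1 + t) / 2 is the limit of
  e^(-r) (cosh r + t sinh r). The substitution t = 1 + 2 s reduces it to a Beta integral.\<close>

lemma integral_gweight_shifted:
  assumes "Re \<alpha> > 0" "Re l > -1"
  shows "(\<integral>t. of_real ((1 + t) / 2) powr (- (l + 2 * \<alpha>)) * gweight \<alpha> t \<partial>lborel_gt 1) =
    2 powr (2 * \<alpha> - 1) * Beta \<alpha> (l + 1)"
proof -
  let ?f = "\<lambda>t. of_real ((1 + t) / 2) powr (- (l + 2 * \<alpha>)) * gweight \<alpha> t"
  have "(\<integral>t. ?f t \<partial>lborel_gt 1) = 2 *\<^sub>R (\<integral>s. ?f (1 + 2 * s) \<partial>lborel_gt 0)"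
    using integral_lborel_gt_affine(2)[of 2 1 0 ?f] by simp
  also have "(\<integral>s. ?f (1 + 2 * s) \<partial>lborel_gt 0) =
      (\<integral>s. 4 powr (\<alpha> - 1) * (of_real s powr (\<alpha> - 1) * of_real (1 + s) powr (- (\<alpha> + (l + 1)))) \<partial>lborel_gt 0)"
  proof (intro Bochner_Integration.integral_cong refl)
    fix s assume "s \<in> space (lborel_gt 0)"
    then have s: "s > 0" by simp
    have 1: "(1 + (1 + 2 * s)) / 2 = 1 + s" by simp
    have 2: "(1 + 2 * s)\<^sup>2 - 1 = 4 * s * (1 + s)" by (simp add: power2_eq_square algebra_simps)
    have "gweight \<alpha> (1 + 2 * s) = (of_real 4 * of_real s * of_real (1 + s)) powr (\<alpha> - 1)"
      unfolding gweight_def 2 by (simp only: of_real_mult)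
    also have "\<dots> = 4 powr (\<alpha> - 1) * of_real s powr (\<alpha> - 1) * of_real (1 + s) powr (\<alpha> - 1)"
      using s by (subst powr_times_real; simp add: powr_times_real)+
    finally have 3: "gweight \<alpha> (1 + 2 * s) = 4 powr (\<alpha> - 1) * of_real s powr (\<alpha> - 1) * of_real (1 + s) powr (\<alpha> - 1)" .
    have "complex_of_real (1 + s) powr (- (l + 2 * \<alpha>)) * of_real (1 + s) powr (\<alpha> - 1) =
        of_real (1 + s) powr (- (\<alpha> + (l + 1)))"
      by (simp only: powr_add [symmetric]) (simp add: algebra_simps)
    then show "?f (1 + 2 * s) = 4 powr (\<alpha> - 1) * (of_real s powr (\<alpha> - 1) * of_real (1 + s) powr (- (\<alpha> + (l + 1))))"
      unfolding 1 3 by (simp only: mult_ac) 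
  qed
  also have "\<dots> = 4 powr (\<alpha> - 1) * Beta \<alpha> (l + 1)"
    using assms by (simp only: Bochner_Integration.integral_mult_right_zero) (subst Beta_second_kind; simp)
  also have "2 *\<^sub>R (4 powr (\<alpha> - 1) * Beta \<alpha> (l + 1)) = 2 powr (2 * \<alpha> - 1) * Beta \<alpha> (l + 1)"
  proof -
    have "(4 :: complex) powr (\<alpha> - 1) = (2 * 2) powr (\<alpha> - 1)" by simp
    also have "\<dots> = 2 powr (\<alpha> - 1) * 2 powr (\<alpha> - 1)" by (subst powr_times_real) simp_all
    also have "\<dots> = 2 powr ((\<alpha> - 1) + (\<alpha> - 1))" by (simp only: powr_add)
    finally have "2 * (4 :: complex) powr (\<alpha> - 1) = 2 powr 1 * 2 powr ((\<alpha> - 1) + (\<alpha> - 1))" by simp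
    also have "\<dots> = 2 powr (2 * \<alpha> - 1)" by (simp only: powr_add [symmetric]) (simp add: algebra_simps)
    finally show ?thesis by (simp add: scaleR_conv_of_real)
  qed
  finally show ?thesis .
qed

text \<open>The substitution v = t^2 - 1 gives a Beta integral. These values occur at b =
  \<plusminus> i pi / 2, where cosh b = 0 and the base of the Laplace integrand is a pure multiple
  of t.\<close>

lemma integral_gweight_powr:
  assumes "Re \<alpha> > 0" "Re s > 2 * Re \<alpha> - 1"
  shows "(\<integral>t. of_real t powr (- s) * gweight \<alpha> t \<partial>lborel_gt 1) = Beta \<alpha> ((s + 1) / 2 - \<alpha>) / 2"
proof -
  define q where "q = (s + 1) / 2 - \<alpha>"
  have q: "Re q > 0" using assms by (simp add: q_def)
  let ?f = "\<lambda>v. complex_of_real v powr (\<alpha> - 1) * of_real (1 + v) powr (- (\<alpha> + q))"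
  let ?g = "\<lambda>t::real. t\<^sup>2 - 1" and ?g' = "\<lambda>t::real. 2 * t"
  have eq: "?g' t *\<^sub>R ?f (?g t) = 2 * (of_real t powr (- s) * gweight \<alpha> t)" if t: "t > 1" for t
  proof -
    have "of_real (1 + (t\<^sup>2 - 1)) = complex_of_real t * of_real t" by (simp add: power2_eq_square)
    then have "of_real (1 + (t\<^sup>2 - 1)) powr (- (\<alpha> + q)) = complex_of_real t powr (- (\<alpha> + q)) * of_real t powr (- (\<alpha> + q))"
      using t by (simp only:) (subst powr_times_real; simp)
    also have "\<dots> = of_real t powr (- (\<alpha> + q) + - (\<alpha> + q))" by (simp only: powr_add)
    also have "- (\<alpha> + q) + - (\<alpha> + q) = - s - 1" by (simp add: q_def field_simps)
    also have "complex_of_real t powr (- s - 1) = of_real t powr (- s) / of_real t"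
      using t by (simp add: powr_diff)
    finally show ?thesis using t by (simp add: gweight_def scaleR_conv_of_real)
  qed
  have int: "integrable (lborel_gt 1) (\<lambda>t. of_real t powr (- s) * gweight \<alpha> t)"
  proof (rule Bochner_Integration.integrable_bound)
    show "integrable (lborel_gt 1) (\<lambda>t. t powr (- Re s) * (t\<^sup>2 - 1) powr (Re \<alpha> - 1))"
      by (rule integrable_gweight) (use assms in auto)
    show "(\<lambda>t. of_real t powr (- s) * gweight \<alpha> t) \<in> borel_measurable (lborel_gt 1)"
      by (intro measurable_lborel_gt_continuous continuous_intros continuous_on_gweight) (auto simp: complex_eq_iff)
    show "AE t in lborel_gt 1. norm (of_real t powr (- s) * gweight \<alpha> t) \<le> norm (t powr (- Re s) * (t\<^sup>2 - 1) powr (Re \<alpha> - 1))"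
      by (intro AE_I2) (simp add: norm_mult norm_gweight norm_of_real_powr)
  qed
  have ei: "einterval 0 \<infinity> = {0<..}" "einterval 1 \<infinity> = {1<..}"
    by (simp_all add: zero_ereal_def one_ereal_def)
  have "(LBINT v=0..\<infinity>. ?f v) = (LBINT t=1..\<infinity>. ?g' t *\<^sub>R ?f (?g t))"
  proof (rule interval_integral_substitution_integrable)
    show "DERIV ?g t :> ?g' t" if "1 < ereal t" for t
      using that by (auto intro!: derivative_eq_intros simp: one_ereal_def)
    show "isCont ?f (?g t)" if "1 < ereal t" for t
    proof -
      have "isCont ?f v" if "v > 0" for v
        using that by (intro continuous_intros) (auto simp: complex_nonpos_Reals_iff complex_eq_iff)
      then show ?thesis using that square_minus_1_pos[of t] by (simp add: one_ereal_def)
    qed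
    show "isCont ?g' t" if "1 < ereal t" for t
      by (intro continuous_intros)
    show "((ereal \<circ> ?g \<circ> real_of_ereal) \<longlongrightarrow> 0) (at_right 1)"
    proof -
      have "(?g \<longlongrightarrow> 0) (at_right 1)" by real_asymp
      then show ?thesis unfolding zero_ereal_def one_ereal_def by (simp add: ereal_tendsto_simps)
    qed
    show "((ereal \<circ> ?g \<circ> real_of_ereal) \<longlongrightarrow> \<infinity>) (at_left \<infinity>)"
    proof -
      have "filterlim ?g at_top at_top" by real_asymp
      then show ?thesis by (simp add: ereal_tendsto_simps)
    qed
    have "set_integrable lborel {1<..} (\<lambda>t. ?g' t *\<^sub>R ?f (?g t)) \<longleftrightarrow> set_integrable lborel {1<..} (\<lambda>t. 2 * (of_real t powr (- s) * gweight \<alpha> t))"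
      by (rule set_integrable_cong[OF refl refl], rule eq) simp
    then show "set_integrable lborel (einterval 1 \<infinity>) (\<lambda>t. ?g' t *\<^sub>R ?f (?g t))"
      using int by (simp add: ei integrable_lborel_gt)
    show "set_integrable lborel (einterval 0 \<infinity>) ?f"
      unfolding ei integrable_lborel_gt [symmetric] by (rule integrable_Beta_second_kind) (use assms q in auto)
  qed simp_all
  also have "(LBINT t=1..\<infinity>. ?g' t *\<^sub>R ?f (?g t)) = (LBINT t:{1<..}. ?g' t *\<^sub>R ?f (?g t))"
    by (simp only: interval_lebesgue_integral_def ei) simp
  also have "\<dots> = (LBINT t:{1<..}. 2 * (of_real t powr (- s) * gweight \<alpha> t))"
    by (rule set_lebesgue_integral_cong, simp, intro allI impI, rule eq) simp
  also have "\<dots> = 2 * (\<integral>t. of_real t powr (- s) * gweight \<alpha> t \<partial>lborel_gt 1)"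
    by (simp add: integral_lborel_gt)
  also have "(LBINT v=0..\<infinity>. ?f v) = (\<integral>v. ?f v \<partial>lborel_gt 0)"
    by (simp only: integral_lborel_gt interval_lebesgue_integral_def ei) simp
  also have "\<dots> = Beta \<alpha> q" by (rule Beta_second_kind) (use assms q in auto)
  finally show ?thesis by (simp add: q_def)
qed

section \<open>Uniqueness of recessive solutions\<close>

lemma constant_on_ray:
  fixes V :: "complex \<Rightarrow> complex"
  assumes "\<And>r::real. r > R \<Longrightarrow> (V has_field_derivative 0) (at (of_real r + \<i> * of_real th))"
  shows "\<exists>c. \<forall>r::real. r > R \<longrightarrow> V (of_real r + \<i> * of_real th) = c"
proof -
  let ?b = "\<lambda>r::real. of_real r + \<i> * of_real th"
  have der: "((V \<circ> ?b) has_vector_derivative 0) (at r within {R<..})" if "r \<in> {R<..}" for r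
  proof -
    have "((V \<circ> ?b) has_vector_derivative (1 * 0)) (at r)"
      using that by (intro field_vector_diff_chain_at assms) (auto intro!: derivative_eq_intros)
    then show ?thesis by (simp add: has_vector_derivative_at_within)
  qed
  obtain c where "\<And>r. r \<in> {R<..} \<Longrightarrow> (V \<circ> ?b) r = c"
    using has_vector_derivative_zero_constant[OF _ der] by auto
  then show ?thesis by auto
qed

lemma Im_sinh: "Im (sinh z) = cosh (Re z) * sin (Im z)"
  and Re_sinh: "Re (sinh z) = sinh (Re z) * cos (Im z)"
  and Im_cosh: "Im (cosh z) = sinh (Re z) * sin (Im z)"
  and Re_cosh: "Re (cosh z) = cosh (Re z) * cos (Im z)"
  by (simp_all add: sinh_def cosh_def Re_exp Im_exp algebra_simps)

lemma sinh_cosh_of_real: "sinh (complex_of_real r) = of_real (sinh r)" "cosh (complex_of_real r) = of_real (cosh r)"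
  by (simp_all add: complex_eq_iff Re_sinh Im_sinh Re_cosh Im_cosh)

lemma norm_sinh_le: "norm (sinh z) \<le> exp \<bar>Re z\<bar>"
proof -
  have "norm (sinh z) \<le> (norm (exp z) + norm (exp (- z))) / 2"
    using norm_triangle_ineq4[of "exp z" "exp (- z)"] by (simp add: sinh_field_def norm_divide)
  also have "\<dots> = (exp (Re z) + exp (- Re z)) / 2" by simp
  also have "\<dots> \<le> exp \<bar>Re z\<bar>" by (simp add: abs_if)
  finally show ?thesis .
qed

text \<open>A solution with the recessive behaviour \<open>e\<^bsup>-\<mu>r\<^esup>(1 + O(e\<^bsup>-2r\<^esup>))\<close>, where \<open>\<mu> = l + 2\<alpha>\<close>, is unique up to a
  factor: the relative error \<open>O(e\<^bsup>-2r\<^esup>)\<close> forces the Wronskian times \<open>sinh\<^bsup>2\<alpha>\<^esup>\<close>, which is constant, to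
  tend to \<open>0\<close> even where the solution is not the smaller one at infinity.\<close>
lemma recessive_solutions_proportional:
  fixes f f' g g' :: "complex \<Rightarrow> complex" and l \<alpha> F G :: complex and th :: real
  defines "b \<equiv> (\<lambda>r::real. of_real r + \<i> * of_real th)" and "\<mu> \<equiv> l + 2 * \<alpha>"
  assumes par: "Re \<alpha> > 0" "Re l > -1" "0 \<le> th" "th < pi" "R \<ge> 0"
    and df: "\<And>r. r > R \<Longrightarrow> (f has_field_derivative f' (b r)) (at (b r))"
    and df': "\<And>r. r > R \<Longrightarrow> (f' has_field_derivative
                (l * \<mu> * f (b r) - 2 * \<alpha> * cosh (b r) / sinh (b r) * f' (b r))) (at (b r))"
    and dg: "\<And>r. r > R \<Longrightarrow> (g has_field_derivative g' (b r)) (at (b r))"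
    and dg': "\<And>r. r > R \<Longrightarrow> (g' has_field_derivative
                (l * \<mu> * g (b r) - 2 * \<alpha> * cosh (b r) / sinh (b r) * g' (b r))) (at (b r))"
    and bf: "\<And>r. r > R \<Longrightarrow> norm (f (b r)) \<le> C * exp (- Re \<mu> * r)"
            "\<And>r. r > R \<Longrightarrow> norm (f' (b r) + \<mu> * f (b r)) \<le> C * exp (- (Re \<mu> + 2) * r)"
    and bg: "\<And>r. r > R \<Longrightarrow> norm (g (b r)) \<le> D * exp (- Re \<mu> * r)"
            "\<And>r. r > R \<Longrightarrow> norm (g' (b r) + \<mu> * g (b r)) \<le> D * exp (- (Re \<mu> + 2) * r)"
    and lf: "((\<lambda>r. exp (\<mu> * b r) * f (b r)) \<longlongrightarrow> F) at_top"
    and lg: "((\<lambda>r. exp (\<mu> * b r) * g (b r)) \<longlongrightarrow> G) at_top" and G: "G \<noteq> 0"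
  obtains R' where "R' \<ge> R" "\<And>r. r > R' \<Longrightarrow> f (b r) * G = F * g (b r)"
proof -
  define W where "W = (\<lambda>z. f' z * g z - f z * g' z)"
  define V where "V = (\<lambda>z. W z * sinh z powr (2 * \<alpha>))"
  have Reb [simp]: "Re (b r) = r" "Im (b r) = th" for r by (simp_all add: b_def)
  have sinh_nonneg: "sinh (b r) \<notin> \<real>\<^sub>\<le>\<^sub>0" if "r > R" for r
  proof (cases "th = 0")
    case True
    then show ?thesis using that par by (simp add: complex_nonpos_Reals_iff Re_sinh)
  next
    case False
    then have "sin th > 0" using par by (intro sin_gt_zero) auto
    then show ?thesis by (simp add: complex_nonpos_Reals_iff Im_sinh)
  qed
  have "(V has_field_derivative 0) (at (b r))" if r: "r > R" for r
  proof -
    have nz: "sinh (b r) \<noteq> 0" using sinh_nonneg[OF r] by auto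
    have dW: "(W has_field_derivative (- 2 * \<alpha> * cosh (b r) / sinh (b r) * W (b r))) (at (b r))"
      unfolding W_def
      by (rule derivative_eq_intros df[OF r] df'[OF r] dg[OF r] dg'[OF r] refl)+ (simp add: algebra_simps)
    have dS: "((\<lambda>z. sinh z powr (2 * \<alpha>)) has_field_derivative (2 * \<alpha> * sinh (b r) powr (2 * \<alpha> - 1) * cosh (b r))) (at (b r))"
      by (rule derivative_eq_intros refl sinh_nonneg[OF r])+ simp
    have "sinh (b r) powr (2 * \<alpha> - 1) = sinh (b r) powr (2 * \<alpha>) / sinh (b r)"
      using nz by (simp add: powr_diff)
    then have "- 2 * \<alpha> * cosh (b r) / sinh (b r) * W (b r) * sinh (b r) powr (2 * \<alpha>) +
        2 * \<alpha> * sinh (b r) powr (2 * \<alpha> - 1) * cosh (b r) * W (b r) = 0"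
      by simp
    from DERIV_cong[OF DERIV_mult[OF dW dS] this] show ?thesis unfolding V_def .
  qed
  then obtain c where c: "\<And>r. r > R \<Longrightarrow> V (b r) = c"
    using constant_on_ray[of R V th] unfolding b_def by auto
  define E where "E = 2 * (C * D) * exp (pi * \<bar>Im (2 * \<alpha>)\<bar>)"
  have Vbound: "norm (V (b r)) \<le> E * exp (- 2 * (Re l + Re \<alpha> + 1) * r)" if r: "r > R" for r
  proof -
    let ?m = "Re \<mu>"
    have e1: "exp (- (?m + 2) * r) * exp (- ?m * r) = exp (- (2 * ?m + 2) * r)"
      by (simp add: exp_add [symmetric] algebra_simps)
    have CD: "C \<ge> 0" "D \<ge> 0"
      using order_trans[OF norm_ge_zero bf(1)[OF r]] order_trans[OF norm_ge_zero bg(1)[OF r]]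
      by (simp_all add: zero_le_mult_iff)
    have "W (b r) = (f' (b r) + \<mu> * f (b r)) * g (b r) - f (b r) * (g' (b r) + \<mu> * g (b r))"
      by (simp add: W_def algebra_simps)
    also have "norm \<dots> \<le> norm (f' (b r) + \<mu> * f (b r)) * norm (g (b r)) + norm (f (b r)) * norm (g' (b r) + \<mu> * g (b r))"
      by (rule order_trans[OF norm_triangle_ineq4]) (simp only: norm_mult order_refl)
    also have "\<dots> \<le> (C * exp (- (?m + 2) * r)) * (D * exp (- ?m * r)) + (C * exp (- ?m * r)) * (D * exp (- (?m + 2) * r))"
      using CD by (intro add_mono mult_mono bf bg r) auto
    also have "\<dots> = 2 * (C * D) * (exp (- (?m + 2) * r) * exp (- ?m * r))" by (simp only: mult_ac mult_2 distrib_left distrib_right)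
    finally have W: "norm (W (b r)) \<le> 2 * (C * D) * exp (- (2 * ?m + 2) * r)" unfolding e1 .
    have nz: "sinh (b r) \<noteq> 0" using sinh_nonneg[OF r] by auto
    have "norm (sinh (b r) powr (2 * \<alpha>)) \<le> exp (pi * \<bar>Im (2 * \<alpha>)\<bar>) * norm (sinh (b r)) powr Re (2 * \<alpha>)"
      by (rule norm_powr_le[OF nz])
    also have "\<dots> \<le> exp (pi * \<bar>Im (2 * \<alpha>)\<bar>) * exp \<bar>r\<bar> powr Re (2 * \<alpha>)"
      using norm_sinh_le[of "b r"] par by (intro mult_left_mono powr_mono2) auto
    also have "exp \<bar>r\<bar> powr Re (2 * \<alpha>) = exp (2 * Re \<alpha> * r)" using r par by (simp add: exp_powr_real mult.commute)
    finally have S: "norm (sinh (b r) powr (2 * \<alpha>)) \<le> exp (pi * \<bar>Im (2 * \<alpha>)\<bar>) * exp (2 * Re \<alpha> * r)" .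
    have "norm (V (b r)) \<le> (2 * (C * D) * exp (- (2 * ?m + 2) * r)) * (exp (pi * \<bar>Im (2 * \<alpha>)\<bar>) * exp (2 * Re \<alpha> * r))"
      unfolding V_def norm_mult using CD by (intro mult_mono W S) auto
    also have "\<dots> = E * (exp (- (2 * ?m + 2) * r) * exp (2 * Re \<alpha> * r))" by (simp only: E_def mult_ac)
    also have "exp (- (2 * ?m + 2) * r) * exp (2 * Re \<alpha> * r) = exp (- 2 * (Re l + Re \<alpha> + 1) * r)"
      by (simp add: exp_add [symmetric] \<mu>_def algebra_simps)
    finally show ?thesis .
  qed
  have "c = 0"
  proof -
    have k: "0 < 2 * (Re l + Re \<alpha> + 1)" using par by simp
    have "((\<lambda>r. exp (- (2 * (Re l + Re \<alpha> + 1)) * r)) \<longlongrightarrow> 0) at_top"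
      using k by (intro filterlim_compose[OF exp_at_bot] filterlim_tendsto_neg_mult_at_bot[OF tendsto_const] filterlim_ident) auto
    then have "((\<lambda>r. E * exp (- 2 * (Re l + Re \<alpha> + 1) * r)) \<longlongrightarrow> E * 0) at_top"
      by (intro tendsto_mult tendsto_const) (simp only: minus_mult_left mult.assoc)
    then have "((\<lambda>r. V (b r)) \<longlongrightarrow> 0) at_top"
      by (rule Lim_null_comparison[rotated, OF tendsto_eq_rhs])
         (simp, rule eventually_mono[OF eventually_gt_at_top[of R]], erule Vbound)
    moreover have "((\<lambda>r. V (b r)) \<longlongrightarrow> c) at_top"
      by (rule tendsto_eventually) (auto intro: eventually_mono[OF eventually_gt_at_top[of R]] c)
    ultimately show "c = 0" using tendsto_unique trivial_limit_at_top_linorder by blast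
  qed
  then have W0: "W (b r) = 0" if "r > R" for r
    using c[OF that] sinh_nonneg[OF that] by (auto simp: V_def)
  have "eventually (\<lambda>r. exp (\<mu> * b r) * g (b r) \<noteq> 0) at_top"
    by (rule tendsto_imp_eventually_ne[OF lg G])
  then obtain R1 where R1: "\<And>r. r \<ge> R1 \<Longrightarrow> g (b r) \<noteq> 0"
    unfolding eventually_at_top_linorder by auto
  define R' where "R' = max R R1"
  have gnz: "g (b r) \<noteq> 0" "r > R" if "r > R'" for r using R1[of r] that by (auto simp: R'_def)
  have "((\<lambda>z. f z / g z) has_field_derivative 0) (at (b r))" if "r > R'" for r
    using DERIV_divide[OF df[OF gnz(2)[OF that]] dg[OF gnz(2)[OF that]] gnz(1)[OF that]] W0[OF gnz(2)[OF that]]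
    by (simp add: W_def)
  then obtain k where k: "\<And>r. r > R' \<Longrightarrow> f (b r) / g (b r) = k"
    using constant_on_ray[of R' "\<lambda>z. f z / g z" th] unfolding b_def by auto
  have "((\<lambda>r. (exp (\<mu> * b r) * f (b r)) / (exp (\<mu> * b r) * g (b r))) \<longlongrightarrow> F / G) at_top"
    by (rule tendsto_divide[OF lf lg G])
  moreover have "((\<lambda>r. (exp (\<mu> * b r) * f (b r)) / (exp (\<mu> * b r) * g (b r))) \<longlongrightarrow> k) at_top"
    by (rule tendsto_eventually) (auto intro: eventually_mono[OF eventually_gt_at_top[of R']] k)
  ultimately have "k = F / G" using tendsto_unique trivial_limit_at_top_linorder by blast
  then have "f (b r) * G = F * g (b r)" if "r > R'" for r
    using k[OF that] gnz(1)[OF that] G by (simp add: field_simps)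
  then show ?thesis using that[of R'] by (auto simp: R'_def)
qed

subsection \<open>Laplace integrals\<close>

text \<open>On this set neither sinh b nor cosh b + t sinh b, for t >= 1, meets the negative axis or
  0, so all principal powers are holomorphic. It contains i\<theta> and -i\<theta> for 0 < \<theta>
  < pi, which is what lets the integral cross Re b = 0.\<close>

definition laplace_domain :: "complex set" where
  "laplace_domain = {b. \<bar>Im b\<bar> < pi} - \<real>\<^sub>\<le>\<^sub>0"

lemma mem_laplace_domain: "b \<in> laplace_domain \<longleftrightarrow> \<bar>Im b\<bar> < pi \<and> (Im b = 0 \<longrightarrow> Re b > 0)"
  by (auto simp: laplace_domain_def complex_nonpos_Reals_iff)

lemma open_laplace_domain: "open laplace_domain"
  unfolding laplace_domain_def
  by (intro open_Diff closed_nonpos_Reals_complex open_Collect_less continuous_intros)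

lemma sin_nonzero_strip: "\<bar>x\<bar> < pi \<Longrightarrow> x \<noteq> 0 \<Longrightarrow> sin x \<noteq> 0"
  using sin_gt_zero[of x] sin_gt_zero[of "- x"] by (cases "x > 0") auto

lemma sinh_not_nonpos: "b \<in> laplace_domain \<Longrightarrow> sinh b \<notin> \<real>\<^sub>\<le>\<^sub>0"
  using sin_nonzero_strip[of "Im b"]
  by (cases "Im b = 0") (auto simp: mem_laplace_domain complex_nonpos_Reals_iff Im_sinh Re_sinh)

lemma sinh_nonzero: "b \<in> laplace_domain \<Longrightarrow> sinh b \<noteq> 0"
  using sinh_not_nonpos by fastforce

text \<open>The imaginary part is (sinh (Re b) + t cosh (Re b)) sin (Im b), and for t >= 1 the first
  factor is at least exp (Re b).\<close>

lemma cosh_plus_sinh_not_nonpos: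
  assumes b: "b \<in> laplace_domain" and t: "t \<ge> 1"
  shows "cosh b + of_real t * sinh b \<notin> \<real>\<^sub>\<le>\<^sub>0"
proof (cases "Im b = 0")
  case True
  then have "Re b > 0" using b by (simp add: mem_laplace_domain)
  then have "cosh (Re b) + t * sinh (Re b) > 0" using t cosh_real_pos[of "Re b"] by (intro add_pos_nonneg) auto
  then show ?thesis using True by (simp add: complex_nonpos_Reals_iff Re_cosh Re_sinh)
next
  case False
  have "1 * cosh (Re b) \<le> t * cosh (Re b)" using t cosh_real_pos[of "Re b"] by (intro mult_right_mono) auto
  then have "sinh (Re b) + t * cosh (Re b) > 0"
    using sinh_plus_cosh[of "Re b"] exp_gt_zero[of "Re b"] by linarith
  moreover have "Im (cosh b + of_real t * sinh b) = (sinh (Re b) + t * cosh (Re b)) * sin (Im b)"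
    by (simp add: Im_cosh Im_sinh algebra_simps)
  ultimately show ?thesis using False b sin_nonzero_strip[of "Im b"]
    by (auto simp: complex_nonpos_Reals_iff mem_laplace_domain)
qed

text \<open>Dividing by t and putting s = 1 / t gives s cosh b + sinh b on the compact set K x
  [0, 1]; the added value s = 0 is harmless because sinh b does not vanish on
  \<open>laplace_domain\<close>.\<close>

lemma cosh_plus_sinh_bounds:
  assumes K: "compact K" "K \<noteq> {}" "K \<subseteq> laplace_domain"
  obtains c d where "c > 0" "\<And>b t. b \<in> K \<Longrightarrow> t \<ge> 1 \<Longrightarrow> c * t \<le> norm (cosh b + of_real t * sinh b)"
    "\<And>b t. b \<in> K \<Longrightarrow> t \<ge> 1 \<Longrightarrow> norm (cosh b + of_real t * sinh b) \<le> d * t"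
proof -
  let ?p = "\<lambda>x. norm (of_real (snd x) * cosh (fst x) + sinh (fst x :: complex))"
  have cont: "continuous_on (K \<times> {0..1::real}) ?p" by (intro continuous_intros)
  have cpt: "compact (K \<times> {0..1::real})" "K \<times> {0..1::real} \<noteq> {}" using K by (auto intro: compact_Times)
  obtain x where x: "x \<in> K \<times> {0..1}" "\<And>y. y \<in> K \<times> {0..1} \<Longrightarrow> ?p x \<le> ?p y"
    using continuous_attains_inf[OF cpt cont] by blast
  obtain y where y: "\<And>z. z \<in> K \<times> {0..1} \<Longrightarrow> ?p z \<le> ?p y"
    using continuous_attains_sup[OF cpt cont] by blast
  have eq: "norm (cosh b + of_real t * sinh b) = ?p (b, 1 / t) * t" if "t \<ge> 1" for b t
  proof -
    have "cosh b + of_real t * sinh b = (of_real (1 / t) * cosh b + sinh b) * of_real t"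
      using that by (simp add: field_simps)
    then show ?thesis using that by (simp add: norm_mult)
  qed
  have "?p x > 0"
  proof (cases "snd x = 0")
    case True
    then show ?thesis using x(1) K(3) sinh_nonzero[of "fst x"] by auto
  next
    case False
    then have s: "snd x > 0" "snd x \<le> 1" using x(1) by auto
    have "cosh (fst x) + of_real (1 / snd x) * sinh (fst x) \<notin> \<real>\<^sub>\<le>\<^sub>0"
      using s x(1) K(3) by (intro cosh_plus_sinh_not_nonpos) auto
    then have "norm (cosh (fst x) + of_real (1 / snd x) * sinh (fst x)) > 0" by auto
    also have "norm (cosh (fst x) + of_real (1 / snd x) * sinh (fst x)) = ?p x * (1 / snd x)"
      using eq[of "1 / snd x" "fst x"] s by simp
    finally show ?thesis using s by (simp add: zero_less_divide_iff)
  qed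
  moreover have mem: "(b, 1 / t) \<in> K \<times> {0..1}" if "b \<in> K" "t \<ge> 1" for b and t :: real
  proof -
    have "t > 0" using that by simp
    then show ?thesis using that by (simp add: divide_le_eq)
  qed
  ultimately show ?thesis
    using that[of "?p x" "?p y"] x(2)[OF mem] y[OF mem] eq by (simp add: mult_right_mono)
qed

lemma cosh_plus_sinh_powr_bound:
  assumes K: "compact K" "K \<noteq> {}" "K \<subseteq> laplace_domain"
  obtains C where "\<And>b t. b \<in> K \<Longrightarrow> t \<ge> 1 \<Longrightarrow> norm ((cosh b + of_real t * sinh b) powr w) \<le> C * t powr Re w"
proof -
  obtain c d where cd: "c > 0" "\<And>b t. b \<in> K \<Longrightarrow> t \<ge> 1 \<Longrightarrow> c * t \<le> norm (cosh b + of_real t * sinh b)"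
    "\<And>b t. b \<in> K \<Longrightarrow> t \<ge> 1 \<Longrightarrow> norm (cosh b + of_real t * sinh b) \<le> d * t"
    using cosh_plus_sinh_bounds[OF K] by metis
  have "norm ((cosh b + of_real t * sinh b) powr w) \<le> (exp (pi * \<bar>Im w\<bar>) * (c powr Re w + d powr Re w)) * t powr Re w"
    if "b \<in> K" "t \<ge> 1" for b and t :: real
  proof -
    have "cosh b + of_real t * sinh b \<noteq> 0" using cosh_plus_sinh_not_nonpos[of b t] that K(3) by auto
    then have "norm ((cosh b + of_real t * sinh b) powr w) \<le> exp (pi * \<bar>Im w\<bar>) * norm (cosh b + of_real t * sinh b) powr Re w"
      by (rule norm_powr_le)
    also have "\<dots> \<le> exp (pi * \<bar>Im w\<bar>) * ((c powr Re w + d powr Re w) * t powr Re w)"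
      by (intro mult_left_mono powr_between cd that) (use that in auto)
    finally show ?thesis by (simp only: mult.assoc)
  qed
  then show ?thesis using that by blast
qed

lemma continuous_on_cosh_plus_sinh_powr:
  assumes "b \<in> laplace_domain"
  shows "continuous_on {1<..} (\<lambda>t. (cosh b + of_real t * sinh b) powr w)"
proof (intro continuous_on_powr_complex continuous_intros subsetI CollectI)
  fix t :: real assume "t \<in> {1<..}"
  then have np: "cosh b + of_real t * sinh b \<notin> \<real>\<^sub>\<le>\<^sub>0" using cosh_plus_sinh_not_nonpos[OF assms, of t] by simp
  then show "0 \<le> Re (cosh b + of_real t * sinh b) \<or> Im (cosh b + of_real t * sinh b) \<noteq> 0"
    unfolding complex_nonpos_Reals_iff by linarith
  show "0 < Re w" if "cosh b + of_real t * sinh b = 0" using np unfolding that by simp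
qed

text \<open>Exactly the convergence conditions of Laplace's integral: the weight at t = 1 needs Re
  \<alpha> > 0, and at infinity the integrand has size t^(- Re l - 2).\<close>

locale gegenbauer_params =
  fixes l \<alpha> :: complex
  assumes Re_alpha: "Re \<alpha> > 0" and Re_l: "Re l > -1"
begin

definition mu :: complex where "mu = l + 2 * \<alpha>"

lemma Re_mu: "Re mu > 2 * Re \<alpha> - 1" "Re mu > -1"
  using Re_alpha Re_l by (simp_all add: mu_def)

abbreviation (input) base :: "complex \<Rightarrow> real \<Rightarrow> complex" where
  "base b t \<equiv> cosh b + of_real t * sinh b"

definition laplaceI :: "complex \<Rightarrow> complex" where
  "laplaceI b = (\<integral>t. base b t powr (- mu) * gweight \<alpha> t \<partial>lborel_gt 1)"

definition laplaceI' :: "complex \<Rightarrow> complex" where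
  "laplaceI' b = (\<integral>t. - mu * base b t powr (- mu - 1) * (sinh b + of_real t * cosh b) * gweight \<alpha> t \<partial>lborel_gt 1)"

text \<open>The equation is y'' + 2 \<alpha> coth b y' = l \<mu> y. Applied to the integrand, the
  operator gives - \<mu> / sinh b times the t-derivative of (t^2 - 1)^\<alpha> (cosh b + t sinh
  b)^(-\<mu> - 1), whose boundary values vanish.\<close>

lemma laplaceI_derivatives:
  assumes b: "b \<in> laplace_domain"
  shows integrable_laplaceI: "integrable (lborel_gt 1) (\<lambda>t. base b t powr (- mu) * gweight \<alpha> t)"
    and integrable_laplaceI': "integrable (lborel_gt 1)
          (\<lambda>t. - mu * base b t powr (- mu - 1) * (sinh b + of_real t * cosh b) * gweight \<alpha> t)"
    and has_derivative_laplaceI: "(laplaceI has_field_derivative laplaceI' b) (at b)"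
    and has_derivative_laplaceI': "(laplaceI' has_field_derivative
          (l * mu * laplaceI b - 2 * \<alpha> * cosh b / sinh b * laplaceI' b)) (at b)"
proof -
  define f where "f = (\<lambda>b t. base b t powr (- mu) * gweight \<alpha> t)"
  define q where "q = (\<lambda>b t. sinh b + complex_of_real t * cosh b)"
  define f' where "f' = (\<lambda>b t. - mu * base b t powr (- mu - 1) * q b t * gweight \<alpha> t)"
  define f'' where "f'' = (\<lambda>b t. (mu * (mu + 1) * base b t powr (- mu - 2) * (q b t)\<^sup>2
      - mu * base b t powr (- mu - 1) * base b t) * gweight \<alpha> t)"
  obtain r where r: "r > 0" "cball b r \<subseteq> laplace_domain"
    using b open_laplace_domain open_contains_cball by blast
  have sub: "y \<in> laplace_domain" if "y \<in> ball b r" for y using r(2) that by auto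
  have nonpos: "base y t \<notin> \<real>\<^sub>\<le>\<^sub>0" if "y \<in> laplace_domain" "t \<in> space (lborel_gt 1)" for y t
    using cosh_plus_sinh_not_nonpos[of y t] that by simp
  have der: "((\<lambda>y. f y t) has_field_derivative f' y t) (at y)" if "y \<in> laplace_domain" "t \<in> space (lborel_gt 1)" for y t
    unfolding f_def f'_def q_def
    by (rule derivative_eq_intros refl nonpos[OF that])+ simp
  have der': "((\<lambda>y. f' y t) has_field_derivative f'' y t) (at y)" if "y \<in> laplace_domain" "t \<in> space (lborel_gt 1)" for y t
    unfolding f'_def f''_def q_def
    by (rule derivative_eq_intros refl nonpos[OF that])+ (simp add: algebra_simps power2_eq_square)
  have meas: "f y \<in> borel_measurable (lborel_gt 1)" if "y \<in> laplace_domain" for y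
    unfolding f_def by (intro measurable_lborel_gt_continuous continuous_on_mult continuous_on_gweight
        continuous_on_cosh_plus_sinh_powr that)
  obtain C where C: "\<And>y t. y \<in> cball b r \<Longrightarrow> t \<ge> 1 \<Longrightarrow> norm (base y t powr (- mu)) \<le> C * t powr Re (- mu)"
    using cosh_plus_sinh_powr_bound[OF compact_cball _ r(2)] r(1) by (metis cball_eq_empty not_less_iff_gr_or_eq)
  define g where "g = (\<lambda>t. C * (t powr (- Re mu) * (t\<^sup>2 - 1) powr (Re \<alpha> - 1)))"
  have g: "integrable (lborel_gt 1) g"
    unfolding g_def by (intro Bochner_Integration.integrable_mult_right integrable_gweight Re_alpha Re_mu)
  have bd: "norm (f y t) \<le> g t" if "y \<in> ball b r" "t \<in> space (lborel_gt 1)" for y t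
  proof -
    have "norm (f y t) = norm (base y t powr (- mu)) * (t\<^sup>2 - 1) powr (Re \<alpha> - 1)"
      using that by (simp add: f_def norm_mult norm_gweight)
    also have "\<dots> \<le> (C * t powr Re (- mu)) * (t\<^sup>2 - 1) powr (Re \<alpha> - 1)"
      using that by (intro mult_right_mono C) auto
    finally show ?thesis by (simp add: g_def mult.assoc)
  qed
  have bball: "b \<in> ball b r" using r by simp
  note P = param_integral_derivative[OF open_ball bball der[OF sub] meas[OF sub] g bd]
  note P2 = param_integral_derivative2[OF open_ball bball der[OF sub] der'[OF sub] meas[OF sub] g bd]
  have if0: "integrable (lborel_gt 1) (f b)"
    by (rule Bochner_Integration.integrable_bound[OF g meas[OF b]], rule AE_I2)
       (use bd[OF bball] in \<open>auto intro: order_trans[OF _ abs_ge_self]\<close>)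
  then show "integrable (lborel_gt 1) (\<lambda>t. base b t powr (- mu) * gweight \<alpha> t)" unfolding f_def .
  have if1: "integrable (lborel_gt 1) (f' b)" by (rule P(1))
  then show "integrable (lborel_gt 1) (\<lambda>t. - mu * base b t powr (- mu - 1) * (sinh b + of_real t * cosh b) * gweight \<alpha> t)"
    unfolding f'_def q_def .
  have if2: "integrable (lborel_gt 1) (f'' b)" by (rule P2(1))
  have L0: "laplaceI y = (\<integral>t. f y t \<partial>lborel_gt 1)" for y by (simp add: laplaceI_def f_def)
  have L1: "laplaceI' y = (\<integral>t. f' y t \<partial>lborel_gt 1)" for y by (simp add: laplaceI'_def f'_def q_def)
  show "(laplaceI has_field_derivative laplaceI' b) (at b)"
    using P(2) unfolding L0 [abs_def] L1 .
  have D2: "(laplaceI' has_field_derivative (\<integral>t. f'' b t \<partial>lborel_gt 1)) (at b)"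
    using P2(2) unfolding L1 [abs_def] .
  define h where "h = (\<lambda>t. (2 * \<alpha> * of_real t * base b t powr (- mu - 1)
      - (mu + 1) * of_real (t\<^sup>2 - 1) * base b t powr (- mu - 2) * sinh b) * gweight \<alpha> t)"
  define H where "H = (\<lambda>z. (z\<^sup>2 - 1) powr \<alpha> * (cosh b + z * sinh b) powr (- mu - 1))"
  have sb: "sinh b \<noteq> 0" by (rule sinh_nonzero[OF b])
  have id: "f'' b t + 2 * \<alpha> * cosh b / sinh b * f' b t - l * mu * f b t = - (mu / sinh b) * h t"
    if t: "t \<in> space (lborel_gt 1)" for t
  proof -
    let ?p = "base b t" and ?s = "sinh b" and ?c = "cosh b" and ?T = "complex_of_real t"
    have pnz: "?p \<noteq> 0" using nonpos[OF b t] by auto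
    define A where "A = ?p powr (- mu - 2)"
    have A1: "?p powr (- mu - 1) = A * ?p"
    proof -
      have "?p powr ((- mu - 2) + 1) = A * ?p" using pnz by (subst powr_add) (simp add: A_def)
      moreover have "(- mu - 2) + 1 = - mu - 1" by simp
      ultimately show ?thesis by (simp only:)
    qed
    have A0: "?p powr (- mu) = A * ?p\<^sup>2"
      using pnz powr_add[of ?p "- mu - 1" 1] A1 by (simp add: power2_eq_square)
    have cs: "?c\<^sup>2 = 1 + ?s\<^sup>2" using hyperbolic_pythagoras[of b] by (simp add: algebra_simps)
    have tt: "complex_of_real (t\<^sup>2 - 1) = ?T\<^sup>2 - 1" by simp
    \<comment> \<open>With the common power A taken out, the identity is polynomial; what remains
      are two multiples of cosh^2 b - sinh^2 b - 1.\<close>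
    have poly: "mu * (mu + 1) * (q b t)\<^sup>2 * ?s - mu * ?p\<^sup>2 * ?s - 2 * \<alpha> * ?c * mu * ?p * q b t - l * mu * ?p\<^sup>2 * ?s
        + mu * (2 * \<alpha> * ?T * ?p - (mu + 1) * (?T\<^sup>2 - 1) * ?s) = 0"
    proof -
      have "mu * (mu + 1) * (q b t)\<^sup>2 * ?s - mu * ?p\<^sup>2 * ?s - 2 * \<alpha> * ?c * mu * ?p * q b t - l * mu * ?p\<^sup>2 * ?s
        + mu * (2 * \<alpha> * ?T * ?p - (mu + 1) * (?T\<^sup>2 - 1) * ?s) =
        mu * ((mu + 1) * ?s * ((q b t)\<^sup>2 - ?p\<^sup>2 - (?T\<^sup>2 - 1)) + 2 * \<alpha> * ?p * (?T - ?c * q b t + ?p * ?s))"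
        unfolding mu_def by (simp add: algebra_simps power2_eq_square)
      also have "(q b t)\<^sup>2 - ?p\<^sup>2 - (?T\<^sup>2 - 1) = (?c\<^sup>2 - ?s\<^sup>2 - 1) * (?T\<^sup>2 - 1)"
        by (simp add: q_def algebra_simps power2_eq_square)
      also have "?T - ?c * q b t + ?p * ?s = ?T * (1 + ?s\<^sup>2 - ?c\<^sup>2)"
        by (simp add: q_def algebra_simps power2_eq_square)
      finally show ?thesis unfolding cs by simp
    qed
    have "(f'' b t + 2 * \<alpha> * ?c / ?s * f' b t - l * mu * f b t + (mu / ?s) * h t) * ?s =
        A * gweight \<alpha> t * (mu * (mu + 1) * (q b t)\<^sup>2 * ?s - mu * ?p\<^sup>2 * ?s - 2 * \<alpha> * ?c * mu * ?p * q b t - l * mu * ?p\<^sup>2 * ?s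
        + mu * (2 * \<alpha> * ?T * ?p - (mu + 1) * (?T\<^sup>2 - 1) * ?s))"
      unfolding f_def f'_def f''_def h_def A_def [symmetric] A1 A0 tt using sb
      by (simp add: divide_simps) (simp add: algebra_simps power2_eq_square)
    also have "\<dots> = 0" unfolding poly by simp
    finally show ?thesis using sb by (simp add: eq_neg_iff_add_eq_0)
  qed
  have hint: "integrable (lborel_gt 1) (\<lambda>t. - (mu / sinh b) * h t)"
    by (subst Bochner_Integration.integrable_cong[OF refl id [symmetric]])
       (auto intro!: Bochner_Integration.integrable_add Bochner_Integration.integrable_diff Bochner_Integration.integrable_mult_right if0 if1 if2)
  have "(\<integral>t. - (mu / sinh b) * h t \<partial>lborel_gt 1) = 0"
  \<comment> \<open>Integrability of h is read off from that of its multiple by dividing by \<mu>;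
    for \<mu> = 0 the integrand on the left is zero anyway.\<close>
  proof (cases "mu = 0")
    case False
    have "integrable (lborel_gt 1) (\<lambda>t. (- sinh b / mu) * (- (mu / sinh b) * h t))"
      by (rule Bochner_Integration.integrable_mult_right) (rule hint)
    moreover have "(\<lambda>t. (- sinh b / mu) * (- (mu / sinh b) * h t)) = h"
      using False sb by (intro ext) simp
    ultimately have "integrable (lborel_gt 1) h" by (simp only:)
    have "(\<integral>t. h t \<partial>lborel_gt 1) = 0"
    proof (rule integral_total_derivative_eq_0[where H = "\<lambda>t. H (of_real t)"])
      show "integrable (lborel_gt 1) h" by fact
      show "continuous_on {1<..} h"
        unfolding h_def
        by (intro continuous_on_mult continuous_on_diff continuous_on_const continuous_on_of_real continuous_on_id
            continuous_on_power continuous_on_gweight continuous_on_cosh_plus_sinh_powr[OF b])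
      show "((\<lambda>t. H (of_real t)) has_vector_derivative h t) (at t)" if t: "t > 1" for t
      proof (rule has_vector_derivative_real_field)
        have np: "(complex_of_real t)\<^sup>2 - 1 \<notin> \<real>\<^sub>\<le>\<^sub>0"
          using square_minus_1_pos[OF t] by (simp add: complex_nonpos_Reals_iff power2_eq_square)
        have np': "cosh b + complex_of_real t * sinh b \<notin> \<real>\<^sub>\<le>\<^sub>0" using nonpos[OF b, of t] t by simp
        have pa: "((complex_of_real t)\<^sup>2 - 1) powr \<alpha> = of_real (t\<^sup>2 - 1) * gweight \<alpha> t"
          using square_minus_1_pos[OF t] powr_add[of "complex_of_real (t\<^sup>2 - 1)" "\<alpha> - 1" 1]
          by (simp add: gweight_def mult.commute)
        have pb: "((complex_of_real t)\<^sup>2 - 1) powr (\<alpha> - 1) = gweight \<alpha> t" by (simp add: gweight_def)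
        have e: "- mu - 1 - 1 = - mu - 2" by simp
        show "(H has_field_derivative h t) (at (complex_of_real t))"
          unfolding H_def
          by (rule derivative_eq_intros refl np np')+ (simp add: pa pb e h_def algebra_simps)
      qed
      obtain C where C: "\<And>y t. y \<in> {b} \<Longrightarrow> t \<ge> 1 \<Longrightarrow> norm (base y t powr (- mu - 1)) \<le> C * t powr Re (- mu - 1)"
        using cosh_plus_sinh_powr_bound[of "{b}" "- mu - 1"] b by auto
      have C0: "C \<ge> 0" using order_trans[OF norm_ge_zero C[of b 1]] by simp
      have Hb: "norm (H (of_real t)) \<le> C * ((t\<^sup>2 - 1) powr Re \<alpha> * t powr (- Re mu - 1))" if "t > 1" for t
      proof -
        have "norm (H (of_real t)) = (t\<^sup>2 - 1) powr Re \<alpha> * norm (base b t powr (- mu - 1))"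
          unfolding H_def norm_mult using norm_of_real_powr[OF square_minus_1_pos[OF that], of \<alpha>] by simp
        also have "\<dots> \<le> (t\<^sup>2 - 1) powr Re \<alpha> * (C * t powr Re (- mu - 1))"
          using that by (intro mult_left_mono C) auto
        finally show ?thesis by (simp add: mult_ac)
      qed
      show "((\<lambda>t. H (of_real t)) \<longlongrightarrow> 0) (at_right 1)"
      proof (rule Lim_null_comparison)
        show "eventually (\<lambda>t. norm (H (of_real t)) \<le> C * ((t\<^sup>2 - 1) powr Re \<alpha> * t powr (- Re mu - 1))) (at_right 1)"
          by (rule eventually_at_rightI[of 1 2]) (use Hb in auto)
        have "((\<lambda>t. C * ((t\<^sup>2 - 1) powr Re \<alpha> * t powr (- Re mu - 1))) \<longlongrightarrow> C * ((1\<^sup>2 - 1) powr Re \<alpha> * 1 powr (- Re mu - 1))) (at_right 1)"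
          using Re_alpha
          by (intro tendsto_intros tendsto_powr2) (auto intro!: eventually_at_rightI[of 1 2] simp: power2_eq_square less_1_mult less_imp_le)
        then show "((\<lambda>t. C * ((t\<^sup>2 - 1) powr Re \<alpha> * t powr (- Re mu - 1))) \<longlongrightarrow> 0) (at_right 1)" by simp
      qed
      show "((\<lambda>t. H (of_real t)) \<longlongrightarrow> 0) at_top"
      proof (rule Lim_null_comparison)
        \<comment> \<open>The growth t^(2 Re \<alpha>) against t^(- Re \<mu> - 1) leaves the
          exponent - Re l - 1, negative by the assumption on l. At t = 1 it was Re \<alpha> > 0 that
          made H vanish.\<close>
        have "norm (H (of_real t)) \<le> C * t powr (- Re l - 1)" if t: "t > 1" for t
        proof -
          have "(t\<^sup>2 - 1) powr Re \<alpha> \<le> (t\<^sup>2) powr Re \<alpha>" using square_minus_1_pos[OF t] Re_alpha by (intro powr_mono2) auto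
          also have "(t\<^sup>2) powr Re \<alpha> = t powr (2 * Re \<alpha>)"
          proof -
            have "t\<^sup>2 = t powr 2" using t by (simp add: powr_numeral)
            then show ?thesis by (simp only: powr_powr)
          qed
          finally have "(t\<^sup>2 - 1) powr Re \<alpha> * t powr (- Re mu - 1) \<le> t powr (2 * Re \<alpha>) * t powr (- Re mu - 1)"
            by (intro mult_right_mono) auto
          also have "\<dots> = t powr (2 * Re \<alpha> + (- Re mu - 1))" by (simp only: powr_add)
          also have "2 * Re \<alpha> + (- Re mu - 1) = - Re l - 1" by (simp add: mu_def)
          finally show ?thesis using Hb[OF t] C0 by (meson mult_left_mono order_trans)
        qed
        then show "eventually (\<lambda>t. norm (H (of_real t)) \<le> C * t powr (- Re l - 1)) at_top"
          by (intro eventually_mono[OF eventually_gt_at_top[of 1]]) auto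
        have "((\<lambda>t::real. t powr (- Re l - 1)) \<longlongrightarrow> 0) at_top"
          using Re_l by (intro tendsto_neg_powr filterlim_ident) auto
        then show "((\<lambda>t. C * t powr (- Re l - 1)) \<longlongrightarrow> 0) at_top" using tendsto_mult_right_zero by blast
      qed
    qed
    then show ?thesis by simp
  qed simp
  then have "0 = (\<integral>t. - (mu / sinh b) * h t \<partial>lborel_gt 1)" by (rule sym)
  also have "(\<integral>t. - (mu / sinh b) * h t \<partial>lborel_gt 1) = (\<integral>t. f'' b t + 2 * \<alpha> * cosh b / sinh b * f' b t - l * mu * f b t \<partial>lborel_gt 1)"
    by (rule Bochner_Integration.integral_cong[OF refl id [symmetric]])
  also have "(\<integral>t. f'' b t + 2 * \<alpha> * cosh b / sinh b * f' b t - l * mu * f b t \<partial>lborel_gt 1) =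
      (\<integral>t. f'' b t \<partial>lborel_gt 1) + 2 * \<alpha> * cosh b / sinh b * laplaceI' b - l * mu * laplaceI b"
    unfolding L0 L1 using if0 if1 if2 by simp
  finally have "(\<integral>t. f'' b t \<partial>lborel_gt 1) = l * mu * laplaceI b - 2 * \<alpha> * cosh b / sinh b * laplaceI' b"
  proof -
    have "0 = Z + a - c \<Longrightarrow> Z = c - a" for Z a c :: complex by (simp add: algebra_simps)
    then show "0 = (\<integral>t. f'' b t \<partial>lborel_gt 1) + 2 * \<alpha> * cosh b / sinh b * laplaceI' b - l * mu * laplaceI b \<Longrightarrow> ?thesis" .
  qed
  with D2 show "(laplaceI' has_field_derivative (l * mu * laplaceI b - 2 * \<alpha> * cosh b / sinh b * laplaceI' b)) (at b)"
    by simp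
qed

end

text \<open>For Re w > 0 the logarithm of w has imaginary part in (-pi/2, pi/2); subtracting b with
  0 <= Im b < pi/2 keeps it in (-pi, pi), so the principal branch does not jump.\<close>

lemma powr_shift_exp:
  assumes "Re w > 0" "0 \<le> Im b" "Im b < pi / 2"
  shows "w powr s = exp (s * b) * (w * exp (- b)) powr s"
proof -
  have w: "w \<noteq> 0" using assms by auto
  have "\<bar>Im (Ln w)\<bar> < pi / 2" using Re_Ln_pos_lt[OF w] assms(1) by blast
  then have "Ln (w * exp (- b)) = Ln w - b"
    using assms w by (intro Ln_unique) (auto simp: exp_diff exp_minus field_simps)
  then have "(w * exp (- b)) powr s = exp (s * (Ln w - b))" using w by (simp add: powr_def)
  then show ?thesis using w by (simp add: powr_def exp_add [symmetric] algebra_simps)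
qed

lemma cosh_bounds:
  assumes "Re b \<ge> 1"
  shows "exp (Re b) / 4 \<le> norm (cosh b)" "norm (cosh b) \<le> exp (Re b)"
    "norm (cosh b - sinh b) = exp (- Re b)"
proof -
  have e: "exp (- Re b) \<le> exp (Re b) / 2"
  proof -
    have "2 \<le> exp (Re b)" using exp_ge_add_one_self[of "Re b"] assms by linarith
    then have "2 \<le> exp (Re b) * exp (Re b)" using mult_mono[of 1 "exp (Re b)" 2 "exp (Re b)"] assms by simp
    then show ?thesis by (simp add: exp_minus field_simps)
  qed
  have c: "cosh b = (exp b + exp (- b)) / 2" by (simp add: cosh_field_def)
  have "norm (exp b) - norm (exp (- b)) \<le> norm (exp b + exp (- b))"
    using norm_triangle_ineq2[of "exp b" "- exp (- b)"] by simp
  then show "exp (Re b) / 4 \<le> norm (cosh b)" using e by (simp add: c norm_divide)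
  have "norm (exp b + exp (- b)) \<le> exp (Re b) + exp (- Re b)"
    using norm_triangle_ineq[of "exp b" "exp (- b)"] by simp
  then have "norm (exp b + exp (- b)) \<le> 2 * exp (Re b)"
    using e exp_gt_zero[of "Re b"] by linarith
  then show "norm (cosh b) \<le> exp (Re b)" by (simp add: c norm_divide)
  have "cosh b - sinh b = exp (- b)" by (simp add: cosh_minus_sinh)
  then show "norm (cosh b - sinh b) = exp (- Re b)" by simp
qed

lemma cosh_in_cut_plane_D:
  assumes "Re b > 0" "\<bar>Im b\<bar> < pi"
  shows "cosh b \<in> cut_plane_D"
proof (cases "Im b = 0")
  case True
  then show ?thesis using assms cosh_real_strict_mono[of 0 "Re b"] by (simp add: mem_cut_plane_D Re_cosh)
next
  case False
  then show ?thesis using assms sin_nonzero_strip[of "Im b"] by (simp add: mem_cut_plane_D Im_cosh)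
qed

text \<open>If 1 / z^2 is real and at least 1, then z lies in [-1, 1], which belongs to the cut.
  Hence the formula defining D for |z| > 1, read with the continued hypergeometric function, is
  valid on all of \<open>cut_plane_D\<close>.\<close>

lemma inverse_square_in_cut_plane_F:
  assumes z: "z \<in> cut_plane_D"
  shows "1 / z\<^sup>2 \<in> cut_plane_F"
proof (rule ccontr)
  assume "1 / z\<^sup>2 \<notin> cut_plane_F"
  then obtain s where s: "1 / z\<^sup>2 = complex_of_real s" "s \<ge> 1" unfolding cut_plane_F_def by auto
  have "z \<noteq> 0" using s by auto
  then have "z\<^sup>2 = 1 / (1 / z\<^sup>2)" by simp
  then have "z\<^sup>2 = of_real (1 / s)" unfolding s(1) by simp
  also have "\<dots> = (of_real (sqrt (1 / s)))\<^sup>2" using s(2) by (simp add: of_real_power [symmetric] del: of_real_power)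
  finally have "z = of_real (sqrt (1 / s)) \<or> z = - of_real (sqrt (1 / s))" by (simp add: power2_eq_iff)
  moreover obtain q where q: "sqrt (1 / s) = q" "0 \<le> q" "q \<le> 1" using s(2) by (auto simp: real_sqrt_divide)
  ultimately show False using z unfolding q(1) by (auto simp: mem_cut_plane_D)
qed

lemma norm_integral_le:
  fixes f :: "'b \<Rightarrow> complex"
  assumes "integrable M f" "integrable M g" "\<And>x. x \<in> space M \<Longrightarrow> norm (f x) \<le> g x"
  shows "norm (\<integral>x. f x \<partial>M) \<le> (\<integral>x. g x \<partial>M)"
proof -
  have "norm (\<integral>x. f x \<partial>M) \<le> (\<integral>x. norm (f x) \<partial>M)" by (rule integral_norm_bound)
  also have "\<dots> \<le> (\<integral>x. g x \<partial>M)"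
    by (intro integral_mono integrable_norm assms)
  finally show ?thesis .
qed

context gegenbauer_params
begin

lemma base_of_real_bounds:
  assumes r: "r \<ge> 1" and t: "t \<ge> 1"
  shows "base (of_real r) t = of_real (cosh r + t * sinh r)"
    "1 / 4 * (exp r * t) \<le> cosh r + t * sinh r" "cosh r + t * sinh r \<le> 1 * (exp r * t)"
proof -
  show "base (of_real r) t = of_real (cosh r + t * sinh r)"
    by (simp add: cosh_def sinh_def exp_of_real scaleR_conv_of_real flip: of_real_minus)
  have e: "exp (- r) \<le> exp r / 2"
  proof -
    have "2 \<le> exp r" using exp_ge_add_one_self[of r] r by linarith
    then have "2 \<le> exp r * exp r" using mult_mono[of 1 "exp r" 2 "exp r"] r by simp
    then show ?thesis by (simp add: exp_minus field_simps)
  qed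
  have "exp r / 4 \<le> sinh r" using e by (simp add: sinh_field_def)
  then have "t * (exp r / 4) \<le> t * sinh r" using t by (intro mult_left_mono) auto
  moreover have "t * (exp r / 4) = 1 / 4 * (exp r * t)" by simp
  ultimately show "1 / 4 * (exp r * t) \<le> cosh r + t * sinh r" using cosh_real_pos[of r] by linarith
  have "1 * cosh r \<le> t * cosh r" using t cosh_real_pos[of r] by (intro mult_right_mono) auto
  then have "cosh r + t * sinh r \<le> t * (sinh r + cosh r)" by (simp add: algebra_simps)
  then show "cosh r + t * sinh r \<le> 1 * (exp r * t)" by (simp add: sinh_plus_cosh mult.commute)
qed

lemma base_of_real_powr_bound:
  "\<exists>C\<ge>0. \<forall>r t. r \<ge> 1 \<longrightarrow> t \<ge> 1 \<longrightarrow> norm (base (of_real r) t powr w) \<le> C * (exp (Re w * r) * t powr Re w)"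
proof (intro exI conjI allI impI)
  let ?C = "exp (pi * \<bar>Im w\<bar>) * ((1 / 4) powr Re w + 1 powr Re w)"
  show "?C \<ge> 0" by simp
  fix r t :: real assume rt: "r \<ge> 1" "t \<ge> 1"
  note b = base_of_real_bounds[OF rt]
  have pos: "0 < exp r * t" using rt by simp
  have p: "cosh r + t * sinh r > 0" using b(2) pos by linarith
  have "norm (base (of_real r) t powr w) \<le> exp (pi * \<bar>Im w\<bar>) * norm (base (of_real r) t) powr Re w"
    unfolding b(1) by (rule norm_powr_le) (use p in \<open>simp only: of_real_eq_0_iff\<close>)
  also have "norm (base (of_real r) t) = cosh r + t * sinh r" unfolding b(1) norm_of_real using p by simp
  also have "(cosh r + t * sinh r) powr Re w \<le> ((1 / 4) powr Re w + 1 powr Re w) * (exp r * t) powr Re w"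
    by (rule powr_between[OF _ pos b(2,3)]) simp
  also have "(exp r * t) powr Re w = exp (Re w * r) * t powr Re w"
    using rt by (simp add: powr_mult exp_powr_real mult.commute)
  finally show "norm (base (of_real r) t powr w) \<le> ?C * (exp (Re w * r) * t powr Re w)"
    by (simp add: mult.assoc mult_left_mono)
qed

lemma of_real_laplace_domain: "r > 0 \<Longrightarrow> complex_of_real r \<in> laplace_domain"
  by (simp add: mem_laplace_domain)

text \<open>With p = cosh r + t sinh r and q its r-derivative, the integrand of I' + \<mu> I is
  \<mu> p^(-\<mu> - 1) (p - q) times the weight, and p - q = e^(-r) (1 - t). One factor e^(-r) comes
  from the extra power of p and one from p - q, which gives the relative error e^(-2r) that the
  uniqueness lemma requires.\<close>

lemma laplaceI_asymptotic_bounds: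
  obtains C where
    "\<And>r. r > 1 \<Longrightarrow> norm (laplaceI (of_real r)) \<le> C * exp (- Re mu * r)"
    "\<And>r. r > 1 \<Longrightarrow> norm (laplaceI' (of_real r) + mu * laplaceI (of_real r)) \<le> C * exp (- (Re mu + 2) * r)"
proof -
  define k where "k = (\<lambda>t. t powr (- Re mu) * (t\<^sup>2 - 1) powr (Re \<alpha> - 1))"
  have k: "integrable (lborel_gt 1) k" unfolding k_def by (rule integrable_gweight[OF Re_alpha Re_mu(1)])
  define N where "N = (\<integral>t. k t \<partial>lborel_gt 1)"
  have kpos: "k t \<ge> 0" for t by (simp add: k_def)
  have N: "N \<ge> 0" unfolding N_def by (intro integral_nonneg_AE AE_I2 kpos)
  obtain C0 where C0: "C0 \<ge> 0" "\<And>r t. r \<ge> 1 \<Longrightarrow> t \<ge> 1 \<Longrightarrow> norm (base (of_real r) t powr (- mu)) \<le> C0 * (exp (Re (- mu) * r) * t powr Re (- mu))"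
    using base_of_real_powr_bound[of "- mu"] by blast
  obtain C1 where C1: "C1 \<ge> 0" "\<And>r t. r \<ge> 1 \<Longrightarrow> t \<ge> 1 \<Longrightarrow> norm (base (of_real r) t powr (- mu - 1)) \<le> C1 * (exp (Re (- mu - 1) * r) * t powr Re (- mu - 1))"
    using base_of_real_powr_bound[of "- mu - 1"] by blast
  have 1: "norm (laplaceI (of_real r)) \<le> (C0 * N) * exp (- Re mu * r)" if r: "r > 1" for r
  proof -
    have dom: "complex_of_real r \<in> laplace_domain" using r by (intro of_real_laplace_domain) simp
    have "norm (laplaceI (of_real r)) \<le> (\<integral>t. (C0 * exp (- Re mu * r)) * k t \<partial>lborel_gt 1)"
      unfolding laplaceI_def
    proof (rule norm_integral_le)
      show "integrable (lborel_gt 1) (\<lambda>t. base (of_real r) t powr (- mu) * gweight \<alpha> t)" by (rule integrable_laplaceI[OF dom])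
      show "integrable (lborel_gt 1) (\<lambda>t. (C0 * exp (- Re mu * r)) * k t)" by (intro Bochner_Integration.integrable_mult_right k)
      fix t assume "t \<in> space (lborel_gt 1)"
      then have t: "t > 1" by simp
      have "norm (base (of_real r) t powr (- mu) * gweight \<alpha> t) \<le> (C0 * (exp (Re (- mu) * r) * t powr Re (- mu))) * (t\<^sup>2 - 1) powr (Re \<alpha> - 1)"
        unfolding norm_mult norm_gweight[OF t] using r t by (intro mult_right_mono C0) auto
      then show "norm (base (of_real r) t powr (- mu) * gweight \<alpha> t) \<le> (C0 * exp (- Re mu * r)) * k t"
        by (simp add: k_def mult_ac)
    qed
    then show ?thesis by (simp add: N_def mult_ac)
  qed
  have 2: "norm (laplaceI' (of_real r) + mu * laplaceI (of_real r)) \<le> (norm mu * C1 * N) * exp (- (Re mu + 2) * r)" if r: "r > 1" for r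
  proof -
    have dom: "complex_of_real r \<in> laplace_domain" using r by (intro of_real_laplace_domain) simp
    define f where "f = (\<lambda>t. base (of_real r) t powr (- mu) * gweight \<alpha> t)"
    define f' where "f' = (\<lambda>t. - mu * base (of_real r) t powr (- mu - 1) * (sinh (of_real r) + of_real t * cosh (of_real r)) * gweight \<alpha> t)"
    have int: "integrable (lborel_gt 1) f" "integrable (lborel_gt 1) f'"
      unfolding f_def f'_def by (rule integrable_laplaceI[OF dom], rule integrable_laplaceI'[OF dom])
    have eq: "f' t + mu * f t = mu * base (of_real r) t powr (- mu - 1) * (of_real (exp (- r)) * (1 - of_real t)) * gweight \<alpha> t"
      if t: "t > 1" for t
    proof -
      let ?p = "base (of_real r) t"
      have "?p \<notin> \<real>\<^sub>\<le>\<^sub>0" using cosh_plus_sinh_not_nonpos[OF dom, of t] t by simp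
      then have nz: "?p \<noteq> 0" by auto
      have "?p powr ((- mu - 1) + 1) = ?p powr (- mu - 1) * ?p" using nz by (subst powr_add) simp
      then have P: "?p powr (- mu) = ?p powr (- mu - 1) * ?p" by simp
      have "?p - (sinh (of_real r) + of_real t * cosh (of_real r)) = (cosh (of_real r) - sinh (of_real r)) * (1 - of_real t)"
        by (simp add: algebra_simps)
      also have "cosh (of_real r) - sinh (of_real r) = complex_of_real (exp (- r))"
        by (simp only: cosh_minus_sinh of_real_minus [symmetric] exp_of_real)
      finally have "?p - (sinh (of_real r) + of_real t * cosh (of_real r)) = of_real (exp (- r)) * (1 - of_real t)" .
      moreover have "f' t + mu * f t = mu * ?p powr (- mu - 1) * (?p - (sinh (of_real r) + of_real t * cosh (of_real r))) * gweight \<alpha> t"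
        unfolding f_def f'_def P by (simp add: algebra_simps)
      ultimately show ?thesis by (simp only:)
    qed
    have "laplaceI' (of_real r) + mu * laplaceI (of_real r) = (\<integral>t. f' t + mu * f t \<partial>lborel_gt 1)"
    proof -
      have "laplaceI (of_real r) = (\<integral>t. f t \<partial>lborel_gt 1)" "laplaceI' (of_real r) = (\<integral>t. f' t \<partial>lborel_gt 1)"
        by (simp_all only: laplaceI_def laplaceI'_def f_def f'_def)
      then show ?thesis using int by simp
    qed
    also have "norm \<dots> \<le> (\<integral>t. (norm mu * C1 * exp (- (Re mu + 2) * r)) * k t \<partial>lborel_gt 1)"
    proof (rule norm_integral_le)
      show "integrable (lborel_gt 1) (\<lambda>t. f' t + mu * f t)" using int by simp
      show "integrable (lborel_gt 1) (\<lambda>t. (norm mu * C1 * exp (- (Re mu + 2) * r)) * k t)"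
        by (intro Bochner_Integration.integrable_mult_right k)
      fix t assume "t \<in> space (lborel_gt 1)"
      then have t: "t > 1" by simp
      have n1: "norm (1 - complex_of_real t) = t - 1"
      proof -
        have "1 - complex_of_real t = of_real (1 - t)" by simp
        then show ?thesis using t by (simp only: norm_of_real)
      qed
      have "norm (f' t + mu * f t) =
          norm mu * norm (base (of_real r) t powr (- mu - 1)) * (exp (- r) * (t - 1)) * (t\<^sup>2 - 1) powr (Re \<alpha> - 1)"
        unfolding eq[OF t] norm_mult norm_gweight[OF t] n1 by simp
      also have "\<dots> \<le> norm mu * (C1 * (exp (Re (- mu - 1) * r) * t powr Re (- mu - 1))) * (exp (- r) * t) * (t\<^sup>2 - 1) powr (Re \<alpha> - 1)"
        using r t C1(1) by (intro mult_right_mono mult_mono mult_left_mono C1 mult_nonneg_nonneg) auto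
      also have "\<dots> = norm mu * C1 * (exp (Re (- mu - 1) * r) * exp (- r)) * ((t powr Re (- mu - 1) * t) * (t\<^sup>2 - 1) powr (Re \<alpha> - 1))"
        by (simp only: mult_ac)
      also have "exp (Re (- mu - 1) * r) * exp (- r) = exp (- (Re mu + 2) * r)"
        by (simp add: exp_add [symmetric] algebra_simps)
      also have "t powr Re (- mu - 1) * t = t powr (- Re mu)" using t by (simp add: powr_diff)
      finally show "norm (f' t + mu * f t) \<le> (norm mu * C1 * exp (- (Re mu + 2) * r)) * k t"
        by (simp only: k_def mult.assoc)
    qed
    finally show ?thesis by (simp add: N_def mult_ac)
  qed
  define C where "C = C0 * N + norm mu * C1 * N"
  have "C0 * N \<le> C" "norm mu * C1 * N \<le> C" using N C0(1) C1(1) by (simp_all add: C_def)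
  then have le: "(C0 * N) * exp (- Re mu * r) \<le> C * exp (- Re mu * r)"
      "(norm mu * C1 * N) * exp (- (Re mu + 2) * r) \<le> C * exp (- (Re mu + 2) * r)" for r
    by (auto intro!: mult_right_mono)

  show ?thesis
  proof (rule that[of C])
    show "norm (laplaceI (of_real r)) \<le> C * exp (- Re mu * r)" if "r > 1" for r
      by (rule order_trans[OF 1[OF that] le(1)])
    show "norm (laplaceI' (of_real r) + mu * laplaceI (of_real r)) \<le> C * exp (- (Re mu + 2) * r)" if "r > 1" for r
      by (rule order_trans[OF 2[OF that] le(2)])
  qed
qed

text \<open>Moving e^(\<mu> r) inside the power replaces the base by (1 + t) / 2 + (1 - t) / 2
  e^(-2r), and the limit may be taken under the integral.\<close>

lemma laplaceI_limit:
  "((\<lambda>r. exp (mu * of_real r) * laplaceI (of_real r)) \<longlongrightarrow> 2 powr (2 * \<alpha> - 1) * Beta \<alpha> (l + 1)) at_top"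
proof -
  define s0 where "s0 = (\<lambda>r t. exp (mu * of_real r) * (base (of_real r) t powr (- mu) * gweight \<alpha> t))"
  \<comment> \<open>The bounds are available for r >= 1 only; clamping r makes the integrands
    measurable and dominated for every r without changing the limit.\<close>
  define s where "s = (\<lambda>r. s0 (max r 1))"
  define f where "f = (\<lambda>t. of_real ((1 + t) / 2) powr (- mu) * gweight \<alpha> t)"
  obtain C where C: "C \<ge> 0" "\<And>r t. r \<ge> 1 \<Longrightarrow> t \<ge> 1 \<Longrightarrow> norm (base (of_real r) t powr (- mu)) \<le> C * (exp (Re (- mu) * r) * t powr Re (- mu))"
    using base_of_real_powr_bound[of "- mu"] by blast
  have main: "((\<lambda>r. \<integral>t. s r t \<partial>lborel_gt 1) \<longlongrightarrow> (\<integral>t. f t \<partial>lborel_gt 1)) at_top"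
  proof (rule integral_dominated_convergence_at_top[where w = "\<lambda>t. C * (t powr (- Re mu) * (t\<^sup>2 - 1) powr (Re \<alpha> - 1))"])
    show "f \<in> borel_measurable (lborel_gt 1)"
      unfolding f_def by (intro measurable_lborel_gt_continuous continuous_on_mult continuous_on_gweight continuous_intros) (auto simp: complex_eq_iff)
    show "s r \<in> borel_measurable (lborel_gt 1)" for r
      unfolding s_def s0_def
      by (intro borel_measurable_times borel_measurable_const borel_measurable_integrable[OF integrable_laplaceI]
          of_real_laplace_domain) simp
    show "integrable (lborel_gt 1) (\<lambda>t. C * (t powr (- Re mu) * (t\<^sup>2 - 1) powr (Re \<alpha> - 1)))"
      by (intro Bochner_Integration.integrable_mult_right integrable_gweight Re_alpha Re_mu)
    have "norm (s0 r t) \<le> C * (t powr (- Re mu) * (t\<^sup>2 - 1) powr (Re \<alpha> - 1))" if r: "r \<ge> 1" and t: "t > 1" for r t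
    proof -
      have "norm (s0 r t) = exp (Re mu * r) * (norm (base (of_real r) t powr (- mu)) * (t\<^sup>2 - 1) powr (Re \<alpha> - 1))"
        unfolding s0_def norm_mult norm_gweight[OF t] by simp
      also have "\<dots> \<le> exp (Re mu * r) * ((C * (exp (Re (- mu) * r) * t powr Re (- mu))) * (t\<^sup>2 - 1) powr (Re \<alpha> - 1))"
        using r t by (intro mult_left_mono mult_right_mono C) auto
      also have "\<dots> = (exp (Re mu * r) * exp (Re (- mu) * r)) * (C * (t powr (- Re mu) * (t\<^sup>2 - 1) powr (Re \<alpha> - 1)))"
        by (simp add: mult_ac)
      also have "exp (Re mu * r) * exp (Re (- mu) * r) = 1" by (simp add: exp_add [symmetric])
      finally show ?thesis by simp
    qed
    then show "eventually (\<lambda>r. AE t in lborel_gt 1. norm (s r t) \<le> C * (t powr (- Re mu) * (t\<^sup>2 - 1) powr (Re \<alpha> - 1))) at_top"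
      unfolding s_def by (intro always_eventually allI AE_I2) auto
    show "AE t in lborel_gt 1. ((\<lambda>r. s r t) \<longlongrightarrow> f t) at_top"
    proof (rule AE_I2)
      fix t assume "t \<in> space (lborel_gt 1)"
      then have t: "t > 1" by simp
      have "((\<lambda>r. (1 + t) / 2 + (1 - t) / 2 * exp (- 2 * r)) \<longlongrightarrow> (1 + t) / 2 + (1 - t) / 2 * 0) at_top"
        by (intro tendsto_intros) real_asymp
      then have "((\<lambda>r. complex_of_real ((1 + t) / 2 + (1 - t) / 2 * exp (- 2 * r))) \<longlongrightarrow> of_real ((1 + t) / 2)) at_top"
        by (intro tendsto_of_real) simp
      moreover have "complex_of_real ((1 + t) / 2) \<notin> \<real>\<^sub>\<le>\<^sub>0" using t by (simp add: complex_nonpos_Reals_iff)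
      ultimately have T: "((\<lambda>r. complex_of_real ((1 + t) / 2 + (1 - t) / 2 * exp (- 2 * r)) powr (- mu) * gweight \<alpha> t) \<longlongrightarrow>
          of_real ((1 + t) / 2) powr (- mu) * gweight \<alpha> t) at_top"
        by (intro tendsto_mult tendsto_powr_complex tendsto_const)
      have E: "complex_of_real ((1 + t) / 2 + (1 - t) / 2 * exp (- 2 * r)) powr (- mu) * gweight \<alpha> t = s0 r t" if r: "r \<ge> 1" for r
      proof -
        have rt: "r \<ge> 1" "t \<ge> 1" using r t by auto
        note b = base_of_real_bounds[OF rt]
        have "0 < exp r * t" using rt by simp
        then have pos: "cosh r + t * sinh r > 0" using b(2) by linarith
        have "complex_of_real (cosh r + t * sinh r) powr (- mu) =
            exp (- mu * of_real r) * (of_real (cosh r + t * sinh r) * exp (- of_real r)) powr (- mu)"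
          by (rule powr_shift_exp) (use pos in simp_all)
        also have "complex_of_real (cosh r + t * sinh r) * exp (- of_real r) = of_real ((cosh r + t * sinh r) * exp (- r))"
          by (simp only: of_real_mult of_real_minus [symmetric] exp_of_real)
        also have "(cosh r + t * sinh r) * exp (- r) = (1 + t) / 2 + (1 - t) / 2 * exp (- 2 * r)"
        proof -
          have "exp (- r) * exp (- r) = exp (- 2 * r)" "exp r * exp (- r) = 1" by (simp_all add: exp_add [symmetric])
          then show ?thesis by (simp add: cosh_field_def sinh_field_def algebra_simps add_divide_distrib diff_divide_distrib)
        qed
        finally show ?thesis unfolding s0_def b(1) by (simp add: exp_add [symmetric] mult.assoc [symmetric])
      qed
      have "complex_of_real ((1 + t) / 2 + (1 - t) / 2 * exp (- 2 * r)) powr (- mu) * gweight \<alpha> t = s r t" if "r \<ge> 1" for r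
        using E[OF that] that by (simp only: s_def max_absorb1)
      then show "((\<lambda>r. s r t) \<longlongrightarrow> f t) at_top"
        unfolding f_def
        by (intro Lim_transform_eventually[OF T] eventually_mono[OF eventually_ge_at_top[of 1]])
    qed
  qed
  have val: "(\<integral>t. f t \<partial>lborel_gt 1) = 2 powr (2 * \<alpha> - 1) * Beta \<alpha> (l + 1)"
    unfolding f_def mu_def by (rule integral_gweight_shifted[OF Re_alpha Re_l])
  have conv: "(\<integral>t. s r t \<partial>lborel_gt 1) = exp (mu * of_real r) * laplaceI (of_real r)" if "r \<ge> 1" for r
    using that by (simp add: s_def s0_def laplaceI_def)
  show ?thesis
    by (rule Lim_transform_eventually[OF main[unfolded val]], rule eventually_mono[OF eventually_ge_at_top[of 1]], erule conv)
qed

end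

subsection \<open>The function of the second kind as a Laplace integral\<close>

lemma analytic_continuation_ray:
  fixes f g :: "complex \<Rightarrow> complex"
  assumes hol: "f holomorphic_on S" "g holomorphic_on S" and S: "open S" "connected S"
    and sub: "\<And>r::real. r > R \<Longrightarrow> of_real r + \<i> * of_real th \<in> S"
    and eq: "\<And>r::real. r > R \<Longrightarrow> f (of_real r + \<i> * of_real th) = g (of_real r + \<i> * of_real th)"
    and z: "z \<in> S"
  shows "f z = g z"
proof -
  let ?b = "\<lambda>r::real. complex_of_real r + \<i> * of_real th"
  have "?b (R + 1) islimpt ?b ` {R<..}"
    unfolding islimpt_approachable
  proof (intro allI impI)
    fix e :: real assume e: "e > 0"
    have "?b (R + 1 + e / 2) - ?b (R + 1) = of_real (e / 2)" by simp
    then have "dist (?b (R + 1 + e / 2)) (?b (R + 1)) = e / 2" using e by (simp only: dist_norm norm_of_real)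
    then have "dist (?b (R + 1 + e / 2)) (?b (R + 1)) < e" "?b (R + 1 + e / 2) \<noteq> ?b (R + 1)"
      using e by auto
    moreover have "?b (R + 1 + e / 2) \<in> ?b ` {R<..}" using e by (intro imageI) simp
    ultimately show "\<exists>x'\<in>?b ` {R<..}. x' \<noteq> ?b (R + 1) \<and> dist x' (?b (R + 1)) < e" by blast
  qed
  moreover have "?b (R + 1) \<in> S" by (rule sub) simp
  ultimately have "f z - g z = 0"
    using assms
    by (intro analytic_continuation[of "\<lambda>z. f z - g z" S "?b ` {R<..}" "?b (R + 1)" z] holomorphic_intros) auto
  then show ?thesis by simp
qed

text \<open>The part of \<open>laplace_domain\<close> to the right of the imaginary axis; cosh maps
  it onto \<open>cut_plane_D\<close>.\<close>

definition half_strip :: "complex set" where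
  "half_strip = {b. Re b > 0} \<inter> ({b. Im b < pi} \<inter> {b. Im b > - pi})"

lemma mem_half_strip: "b \<in> half_strip \<longleftrightarrow> Re b > 0 \<and> \<bar>Im b\<bar> < pi"
  by (auto simp: half_strip_def)

lemma open_half_strip: "open half_strip" and connected_half_strip: "connected half_strip"
  unfolding half_strip_def
  by (intro open_Int open_halfspace_Re_gt open_halfspace_Im_lt open_halfspace_Im_gt)
     (intro convex_connected convex_Int convex_halfspace_Re_gt convex_halfspace_Im_lt convex_halfspace_Im_gt)

lemma half_strip_subset: "half_strip \<subseteq> laplace_domain"
  by (auto simp: mem_half_strip mem_laplace_domain)

context gegenbauer_params
begin

definition hypF :: "complex \<Rightarrow> complex" where
  "hypF = reg_hypergeo (mu / 2) (mu / 2 + 1 / 2) (l + \<alpha> + 1)"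

lemma hypF_derivatives:
  assumes "z \<in> cut_plane_F"
  shows "(hypF has_field_derivative deriv hypF z) (at z)"
    and "(deriv hypF has_field_derivative deriv (deriv hypF) z) (at z)"
  using assms holomorphic_reg_hypergeo open_cut_planes(1) unfolding hypF_def
  by (auto intro!: holomorphic_derivI holomorphic_deriv)

text \<open>D stripped of its exponential and Gamma factors, which leaves a function with leading
  coefficient 1 / \<Gamma>(l + \<alpha> + 1) in terms of e^(-\<mu> b), z = cosh b.\<close>

definition gegJ :: "complex \<Rightarrow> complex" where
  "gegJ z = (2 * z) powr (- mu) * hypF (1 / z\<^sup>2)"

definition gegJ' :: "complex \<Rightarrow> complex" where
  "gegJ' z = (2 * z) powr (- mu) * (- mu / z * hypF (1 / z\<^sup>2) - 2 / z ^ 3 * deriv hypF (1 / z\<^sup>2))"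

lemma cut_plane_D_facts:
  assumes "z \<in> cut_plane_D"
  shows "z \<noteq> 0" "2 * z \<notin> \<real>\<^sub>\<le>\<^sub>0" "z\<^sup>2 - 1 \<noteq> 0"
proof -
  show "z \<noteq> 0" using assms by (auto simp: mem_cut_plane_D)
  show "2 * z \<notin> \<real>\<^sub>\<le>\<^sub>0" using assms by (auto simp: mem_cut_plane_D complex_nonpos_Reals_iff)
  show "z\<^sup>2 - 1 \<noteq> 0"
  proof
    assume "z\<^sup>2 - 1 = 0"
    then have "z = 1 \<or> z = - 1" by (simp add: power2_eq_1_iff)
    then show False using assms by (auto simp: mem_cut_plane_D)
  qed
qed

text \<open>Gegenbauer's equation (z^2 - 1) J'' + (2 \<alpha> + 1) z J' = l \<mu> J, obtained from
  the hypergeometric equation at x = 1 / z^2.\<close>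

lemma gegJ_derivatives:
  assumes z: "z \<in> cut_plane_D"
  shows has_derivative_gegJ: "(gegJ has_field_derivative gegJ' z) (at z)"
    and has_derivative_gegJ': "(gegJ' has_field_derivative (l * mu * gegJ z - (2 * \<alpha> + 1) * z * gegJ' z) / (z\<^sup>2 - 1)) (at z)"
proof -
  note zf = cut_plane_D_facts[OF z]
  let ?x = "1 / z\<^sup>2"
  have xF: "?x \<in> cut_plane_F" by (rule inverse_square_in_cut_plane_F[OF z])
  note dF = hypF_derivatives[OF xF]
  define P where "P = (\<lambda>z::complex. (2 * z) powr (- mu))"
  have dP: "(P has_field_derivative (- mu / z * P z)) (at z)"
  proof -
    have "(2 * z) powr (- mu - 1) * (2 * z) = P z"
      using zf(1) powr_add[of "2 * z" "- mu - 1" 1] by (simp add: P_def)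
    then have "- mu * (2 * z) powr (- mu - 1) * 2 = - mu / z * P z" using zf(1) by (simp add: field_simps)
    then show ?thesis
      unfolding P_def using zf(2) by (auto intro!: derivative_eq_intros)
  qed
  have dx: "((\<lambda>z. 1 / z\<^sup>2) has_field_derivative (- 2 / z ^ 3)) (at z)"
    using zf(1) by (auto intro!: derivative_eq_intros simp: field_simps power2_eq_square power3_eq_cube)
  note dF0 = DERIV_chain2[OF dF(1) dx]
  note dF1 = DERIV_chain2[OF dF(2) dx]
  have J: "gegJ = (\<lambda>z. P z * hypF (1 / z\<^sup>2))" by (simp add: gegJ_def P_def fun_eq_iff)
  have J': "gegJ' = (\<lambda>z. P z * (- mu / z * hypF (1 / z\<^sup>2) - 2 / z ^ 3 * deriv hypF (1 / z\<^sup>2)))"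
    by (simp add: gegJ'_def P_def fun_eq_iff)
  show "(gegJ has_field_derivative gegJ' z) (at z)"
    unfolding J J' by (rule DERIV_cong[OF DERIV_mult[OF dP dF0]]) (simp add: algebra_simps)
  define F0 F1 F2 where "F0 = hypF ?x" and "F1 = deriv hypF ?x" and "F2 = deriv (deriv hypF) ?x"
  have d1: "((\<lambda>z. - mu / z) has_field_derivative (mu / z\<^sup>2)) (at z)"
    using zf(1) by (auto intro!: derivative_eq_intros simp: field_simps power2_eq_square)
  have d2: "((\<lambda>z. 2 / z ^ 3) has_field_derivative (- 6 / z ^ 4)) (at z)"
    using zf(1) by (auto intro!: derivative_eq_intros simp: field_simps power2_eq_square power3_eq_cube power4_eq_xxxx)
  have D: "(gegJ' has_field_derivative
      P z * ((mu / z\<^sup>2 * F0 + (F1 * (- 2 / z ^ 3)) * (- mu / z)) - ((- 6 / z ^ 4) * F1 + (F2 * (- 2 / z ^ 3)) * (2 / z ^ 3)))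
      + (- mu / z * P z) * (- mu / z * F0 - 2 / z ^ 3 * F1)) (at z)"
    unfolding J' F0_def F1_def F2_def
    by (rule DERIV_cong[OF DERIV_mult[OF dP DERIV_diff[OF DERIV_mult[OF d1 dF0] DERIV_mult[OF d2 dF1]]]])
       (simp only: mult.commute add.commute)
  have ode: "?x * (1 - ?x) * F2 + ((l + \<alpha> + 1) - (mu + 3 / 2) * ?x) * F1 - mu * (mu + 1) / 4 * F0 = 0"
    using hypergeometric_ODE[OF xF, of "mu / 2" "mu / 2 + 1 / 2" "l + \<alpha> + 1"]
    unfolding hypF_def [symmetric] F0_def F1_def F2_def by (simp add: algebra_simps add_divide_distrib)
  define x where "x = 1 / z\<^sup>2"
  have t: "mu / z\<^sup>2 = mu * x" "(2 / z ^ 3) * (mu / z) = 2 * mu * x\<^sup>2" "6 / z ^ 4 = 6 * x\<^sup>2"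
    "(2 / z ^ 3) * (2 / z ^ 3) = 4 * x ^ 3" "(mu / z) * (mu / z) = mu\<^sup>2 * x" "z * (mu / z) = mu" "z * (2 / z ^ 3) = 2 * x"
    "x * (z\<^sup>2 - 1) = 1 - x"
    unfolding x_def using zf(1)
    by (simp_all add: field_simps power2_eq_square power3_eq_cube power4_eq_xxxx)
  have "P z * ((mu / z\<^sup>2 * F0 + (F1 * (- 2 / z ^ 3)) * (- mu / z)) - ((- 6 / z ^ 4) * F1 + (F2 * (- 2 / z ^ 3)) * (2 / z ^ 3)))
      + (- mu / z * P z) * (- mu / z * F0 - 2 / z ^ 3 * F1) =
      P z * ((mu / z\<^sup>2) * F0 + F1 * ((2 / z ^ 3) * (mu / z)) + (6 / z ^ 4) * F1 + F2 * ((2 / z ^ 3) * (2 / z ^ 3)))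
      + P z * (((mu / z) * (mu / z)) * F0 + ((2 / z ^ 3) * (mu / z)) * F1)"
    by (simp add: algebra_simps)
  also have "\<dots> = P z * x * (mu * (mu + 1) * F0 + (4 * mu + 6) * x * F1 + 4 * x\<^sup>2 * F2)"
    unfolding t by (simp add: algebra_simps power2_eq_square power3_eq_cube)
  finally have D2: "P z * ((mu / z\<^sup>2 * F0 + (F1 * (- 2 / z ^ 3)) * (- mu / z)) - ((- 6 / z ^ 4) * F1 + (F2 * (- 2 / z ^ 3)) * (2 / z ^ 3)))
      + (- mu / z * P z) * (- mu / z * F0 - 2 / z ^ 3 * F1) =
      P z * x * (mu * (mu + 1) * F0 + (4 * mu + 6) * x * F1 + 4 * x\<^sup>2 * F2)" .
  have "z * gegJ' z = P z * (- (z * (mu / z)) * F0 - (z * (2 / z ^ 3)) * F1)"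
    unfolding J' F0_def F1_def by (simp add: algebra_simps)
  then have zJ: "z * gegJ' z = P z * (- mu * F0 - 2 * x * F1)" unfolding t .
  have J0: "gegJ z = P z * F0" unfolding J F0_def ..
  have "P z * x * (mu * (mu + 1) * F0 + (4 * mu + 6) * x * F1 + 4 * x\<^sup>2 * F2) * (z\<^sup>2 - 1) - (l * mu * gegJ z - (2 * \<alpha> + 1) * z * gegJ' z) =
      P z * (mu * (mu + 1) * F0 + (4 * mu + 6) * x * F1 + 4 * x\<^sup>2 * F2) * (x * (z\<^sup>2 - 1)) - (l * mu * gegJ z - (2 * \<alpha> + 1) * (z * gegJ' z))"
    by (simp only: mult_ac)
  \<comment> \<open>The difference of the two sides is 4 x P z times the hypergeometric equation,
    plus terms containing the factor \<mu> - l - 2 \<alpha>, which is zero.\<close>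
  also have "\<dots> = P z * (4 * x) * (x * (1 - x) * F2 + ((l + \<alpha> + 1) - (mu + 3 / 2) * x) * F1 - mu * (mu + 1) / 4 * F0)
      + P z * (2 * F1 * x * (2 * mu - 2 * l - 4 * \<alpha>) + mu * F0 * (mu - 2 * \<alpha> - l))"
    unfolding t zJ J0 by (simp add: algebra_simps power2_eq_square)
  also have "\<dots> = 0" unfolding ode[folded x_def] by (simp add: mu_def)
  finally have "P z * ((mu / z\<^sup>2 * F0 + (F1 * (- 2 / z ^ 3)) * (- mu / z)) - ((- 6 / z ^ 4) * F1 + (F2 * (- 2 / z ^ 3)) * (2 / z ^ 3)))
      + (- mu / z * P z) * (- mu / z * F0 - 2 / z ^ 3 * F1) = (l * mu * gegJ z - (2 * \<alpha> + 1) * z * gegJ' z) / (z\<^sup>2 - 1)"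
    unfolding D2 using zf(3) by (simp add: eq_divide_eq)
  then show "(gegJ' has_field_derivative (l * mu * gegJ z - (2 * \<alpha> + 1) * z * gegJ' z) / (z\<^sup>2 - 1)) (at z)"
    using D by (simp only:)
qed

text \<open>For |z| >= 2 the argument 1 / z^2 stays in the disc of radius 1/4, where the
  hypergeometric function and its derivative are bounded. In z J' + \<mu> J the derivative of the
  power cancels and only the term with F' survives, which carries the extra factor 1 / z^2.\<close>

lemma gegJ_bounds:
  obtains M where "M \<ge> 0"
    "\<And>z. z \<in> cut_plane_D \<Longrightarrow> norm z \<ge> 2 \<Longrightarrow> norm (gegJ z) \<le> M * norm z powr (- Re mu)"
    "\<And>z. z \<in> cut_plane_D \<Longrightarrow> norm z \<ge> 2 \<Longrightarrow> norm (z * gegJ' z + mu * gegJ z) \<le> M * norm z powr (- Re mu - 2)"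
    "\<And>z. z \<in> cut_plane_D \<Longrightarrow> norm z \<ge> 2 \<Longrightarrow> norm (gegJ' z) \<le> M * norm z powr (- Re mu - 1)"
proof -
  have sub: "cball 0 (1 / 4) \<subseteq> cut_plane_F"
  proof
    fix z :: complex assume "z \<in> cball 0 (1 / 4)"
    then have "Re z < 1" using complex_Re_le_cmod[of z] by simp
    then show "z \<in> cut_plane_F" by (simp add: mem_cut_plane_F)
  qed
  have hF: "hypF holomorphic_on cut_plane_F" unfolding hypF_def by (rule holomorphic_reg_hypergeo)
  have "continuous_on (cball 0 (1 / 4)) hypF" "continuous_on (cball 0 (1 / 4)) (deriv hypF)"
    using holomorphic_on_imp_continuous_on[OF hF] holomorphic_on_imp_continuous_on[OF holomorphic_deriv[OF hF open_cut_planes(1)]] sub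
    by (auto intro: continuous_on_subset)
  then have "bounded (hypF ` cball 0 (1 / 4))" "bounded (deriv hypF ` cball 0 (1 / 4))"
    by (auto intro!: compact_imp_bounded compact_continuous_image)
  then obtain B0 B1 where B: "\<forall>y\<in>hypF ` cball 0 (1 / 4). norm y \<le> B0" "\<forall>y\<in>deriv hypF ` cball 0 (1 / 4). norm y \<le> B1"
    unfolding bounded_iff by blast
  define E where "E = exp (pi * \<bar>Im mu\<bar>) * 2 powr (- Re mu)"
  have E0: "E \<ge> 0" by (simp add: E_def)
  have B0: "B0 \<ge> 0" "B1 \<ge> 0"
    using order_trans[OF norm_ge_zero B(1)[rule_format, OF imageI[of 0]]]
      order_trans[OF norm_ge_zero B(2)[rule_format, OF imageI[of 0]]] by simp_all
  define M where "M = E * (B0 + 2 * B1) * (1 + norm mu)"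
  have M0: "E * B0 \<le> M" "E * (2 * B1) \<le> M" "E * (norm mu * B0 + 2 * B1) \<le> M" "M \<ge> 0"
  proof -
    have "M = E * B0 + E * (2 * B1) + E * (norm mu * B0) + E * (norm mu * (2 * B1))" by (simp add: M_def algebra_simps)
    moreover have "E * B0 \<ge> 0" "E * (2 * B1) \<ge> 0" "E * (norm mu * B0) \<ge> 0" "E * (norm mu * (2 * B1)) \<ge> 0"
      using E0 B0 by auto
    ultimately show "E * B0 \<le> M" "E * (2 * B1) \<le> M" "E * (norm mu * B0 + 2 * B1) \<le> M" "M \<ge> 0"
      by (simp_all add: distrib_left)
  qed
  have est: "norm (gegJ z) \<le> M * norm z powr (- Re mu) \<and> norm (z * gegJ' z + mu * gegJ z) \<le> M * norm z powr (- Re mu - 2)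
      \<and> norm (gegJ' z) \<le> M * norm z powr (- Re mu - 1)"
    if z: "z \<in> cut_plane_D" and z2: "norm z \<ge> 2" for z
  proof -
    note zf = cut_plane_D_facts[OF z]
    let ?x = "1 / z\<^sup>2"
    have n: "norm z > 0" using z2 by linarith
    have "2 * 2 \<le> norm z * norm z" using z2 by (intro mult_mono) auto
    then have "norm ?x \<le> 1 / 4" by (simp add: norm_divide norm_mult power2_eq_square divide_simps)
    then have b: "norm (hypF ?x) \<le> B0" "norm (deriv hypF ?x) \<le> B1" using B by auto
    have "norm ((2 * z) powr (- mu)) \<le> exp (pi * \<bar>Im (- mu)\<bar>) * norm (2 * z) powr Re (- mu)"
      by (rule norm_powr_le) (use zf(1) in simp)
    also have "\<dots> = E * norm z powr (- Re mu)" by (simp add: E_def norm_mult powr_mult)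
    finally have P: "norm ((2 * z) powr (- mu)) \<le> E * norm z powr (- Re mu)" .
    have pz: "norm z powr (- Re mu - 1) = norm z powr (- Re mu) / norm z" "norm z powr (- Re mu - 2) = norm z powr (- Re mu) / (norm z)\<^sup>2"
      using n by (simp_all add: powr_diff)
    have EP: "E * norm z powr (- Re mu) \<ge> 0" using E0 by simp
    have 1: "norm (gegJ z) \<le> M * norm z powr (- Re mu)"
    proof -
      have "norm (gegJ z) \<le> (E * norm z powr (- Re mu)) * B0"
        unfolding gegJ_def norm_mult by (intro mult_mono P b EP) auto
      also have "\<dots> = (E * B0) * norm z powr (- Re mu)" by (simp only: mult_ac)
      also have "\<dots> \<le> M * norm z powr (- Re mu)" by (intro mult_right_mono M0) auto
      finally show ?thesis .
    qed
    have 2: "norm (z * gegJ' z + mu * gegJ z) \<le> M * norm z powr (- Re mu - 2)"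
    proof -
      have "z * gegJ' z + mu * gegJ z = (2 * z) powr (- mu) * (- 2 * ?x * deriv hypF ?x)"
        unfolding gegJ_def gegJ'_def using zf(1) by (simp add: field_simps power2_eq_square power3_eq_cube)
      also have "norm \<dots> = norm ((2 * z) powr (- mu)) * (2 * norm (deriv hypF ?x)) / (norm z)\<^sup>2"
        by (simp add: norm_mult norm_divide norm_power)
      also have "\<dots> \<le> (E * norm z powr (- Re mu)) * (2 * B1) / (norm z)\<^sup>2"
        by (intro divide_right_mono mult_mono P EP) (use b in auto)
      also have "\<dots> = (E * (2 * B1)) * norm z powr (- Re mu - 2)" unfolding pz by (simp add: mult_ac)
      also have "\<dots> \<le> M * norm z powr (- Re mu - 2)" by (intro mult_right_mono M0) auto
      finally show ?thesis .
    qed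
    have 3: "norm (gegJ' z) \<le> M * norm z powr (- Re mu - 1)"
    proof -
      have "gegJ' z = (2 * z) powr (- mu) * (- mu * hypF ?x - 2 * ?x * deriv hypF ?x) / z"
        unfolding gegJ'_def using zf(1) by (simp add: field_simps power2_eq_square power3_eq_cube)
      also have "norm \<dots> = norm ((2 * z) powr (- mu)) * norm (- mu * hypF ?x - 2 * ?x * deriv hypF ?x) / norm z"
        by (simp add: norm_mult norm_divide)
      also have "norm (- mu * hypF ?x - 2 * ?x * deriv hypF ?x) \<le> norm mu * B0 + 2 * B1"
      proof -
        have "norm (- mu * hypF ?x - 2 * ?x * deriv hypF ?x) \<le> norm (- mu * hypF ?x) + norm (2 * ?x * deriv hypF ?x)"
          by (rule norm_triangle_ineq4)
        also have "norm (- mu * hypF ?x) \<le> norm mu * B0"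
          using b by (simp add: norm_mult mult_left_mono)
        also have "norm (2 * ?x * deriv hypF ?x) \<le> 2 * 1 * B1"
          unfolding norm_mult using b \<open>norm ?x \<le> 1 / 4\<close> by (intro mult_mono) auto
        finally show ?thesis by simp
      qed
      also have "norm ((2 * z) powr (- mu)) * (norm mu * B0 + 2 * B1) / norm z \<le> (E * norm z powr (- Re mu)) * (norm mu * B0 + 2 * B1) / norm z"
        using B0 by (intro divide_right_mono mult_right_mono P) auto
      also have "\<dots> = (E * (norm mu * B0 + 2 * B1)) * norm z powr (- Re mu - 1)" unfolding pz by (simp add: mult_ac)
      also have "\<dots> \<le> M * norm z powr (- Re mu - 1)" by (intro mult_right_mono M0) auto
      finally show ?thesis by (simp add: divide_right_mono mult_left_mono)
    qed
    show ?thesis using 1 2 3 by blast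
  qed
  show ?thesis by (rule that[of M]) (use est M0(4) in auto)
qed

text \<open>With z = cosh b and z^2 - 1 = sinh^2 b, Gegenbauer's equation becomes the one satisfied
  by Laplace's integral.\<close>

lemma gegJ_cosh_derivatives:
  assumes b: "b \<in> half_strip"
  shows "((\<lambda>b. gegJ (cosh b)) has_field_derivative gegJ' (cosh b) * sinh b) (at b)"
    and "((\<lambda>b. gegJ' (cosh b) * sinh b) has_field_derivative
          (l * mu * gegJ (cosh b) - 2 * \<alpha> * cosh b / sinh b * (gegJ' (cosh b) * sinh b))) (at b)"
proof -
  have z: "cosh b \<in> cut_plane_D" using b by (intro cosh_in_cut_plane_D) (auto simp: mem_half_strip)
  have s: "sinh b \<noteq> 0" using b half_strip_subset sinh_nonzero by blast
  have dc: "(cosh has_field_derivative sinh b) (at b)" by (auto intro!: derivative_eq_intros)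
  show "((\<lambda>b. gegJ (cosh b)) has_field_derivative gegJ' (cosh b) * sinh b) (at b)"
    by (rule DERIV_chain2[OF has_derivative_gegJ[OF z] dc])
  have ds: "(sinh has_field_derivative cosh b) (at b)" by (auto intro!: derivative_eq_intros)
  have e: "(cosh b)\<^sup>2 - 1 = (sinh b)\<^sup>2" using hyperbolic_pythagoras[of b] by (simp add: algebra_simps)
  show "((\<lambda>b. gegJ' (cosh b) * sinh b) has_field_derivative
          (l * mu * gegJ (cosh b) - 2 * \<alpha> * cosh b / sinh b * (gegJ' (cosh b) * sinh b))) (at b)"
    by (rule DERIV_cong[OF DERIV_mult[OF DERIV_chain2[OF has_derivative_gegJ'[OF z] dc] ds]])
       (simp only: e, use s in \<open>simp add: field_simps power2_eq_square\<close>)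
qed

lemma gegJ_cosh_asymptotic_bounds:
  obtains C where
    "\<And>b. b \<in> half_strip \<Longrightarrow> Re b > 7 \<Longrightarrow> norm (gegJ (cosh b)) \<le> C * exp (- Re mu * Re b)"
    "\<And>b. b \<in> half_strip \<Longrightarrow> Re b > 7 \<Longrightarrow> norm (gegJ' (cosh b) * sinh b + mu * gegJ (cosh b)) \<le> C * exp (- (Re mu + 2) * Re b)"
proof -
  obtain M where M: "M \<ge> 0"
    "\<And>z. z \<in> cut_plane_D \<Longrightarrow> norm z \<ge> 2 \<Longrightarrow> norm (gegJ z) \<le> M * norm z powr (- Re mu)"
    "\<And>z. z \<in> cut_plane_D \<Longrightarrow> norm z \<ge> 2 \<Longrightarrow> norm (z * gegJ' z + mu * gegJ z) \<le> M * norm z powr (- Re mu - 2)"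
    "\<And>z. z \<in> cut_plane_D \<Longrightarrow> norm z \<ge> 2 \<Longrightarrow> norm (gegJ' z) \<le> M * norm z powr (- Re mu - 1)"
    using gegJ_bounds by metis
  define A where "A = (\<lambda>y::real. (1 / 4) powr y + 1 powr y)"
  have A0: "A y \<ge> 0" for y by (simp add: A_def)
  define C where "C = M * A (- Re mu) + M * A (- Re mu - 1) + M * A (- Re mu - 2)"
  have est: "norm (gegJ (cosh b)) \<le> C * exp (- Re mu * Re b) \<and>
      norm (gegJ' (cosh b) * sinh b + mu * gegJ (cosh b)) \<le> C * exp (- (Re mu + 2) * Re b)"
    if b: "b \<in> half_strip" and r: "Re b > 7" for b
  proof -
    have z: "cosh b \<in> cut_plane_D" using b by (intro cosh_in_cut_plane_D) (auto simp: mem_half_strip)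
    have r1: "Re b \<ge> 1" using r by simp
    note cb = cosh_bounds[OF r1]
    \<comment> \<open>Origin of the threshold 7: exp (Re b) >= 8 and |cosh b| >= exp (Re b) / 4 give
      |cosh b| >= 2, as the bounds on \<open>gegJ\<close> require.\<close>
    have "8 \<le> exp (Re b)" using exp_ge_add_one_self[of "Re b"] r by linarith
    then have z2: "norm (cosh b) \<ge> 2" using cb(1) by linarith
    have pw: "norm (cosh b) powr y \<le> A y * exp (y * Re b)" for y
    proof -
      have "norm (cosh b) powr y \<le> ((1 / 4) powr y + 1 powr y) * exp (Re b) powr y"
        by (rule powr_between) (use cb in auto)
      then show ?thesis by (simp add: A_def exp_powr_real mult.commute)
    qed
    have "norm (gegJ (cosh b)) \<le> M * norm (cosh b) powr (- Re mu)" by (rule M(2)[OF z z2])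
    also have "\<dots> \<le> M * (A (- Re mu) * exp (- Re mu * Re b))" by (intro mult_left_mono pw M)
    also have "\<dots> \<le> C * exp (- Re mu * Re b)"
      unfolding mult.assoc [symmetric] by (intro mult_right_mono) (use M(1) A0 in \<open>auto simp: C_def\<close>)
    finally have 1: "norm (gegJ (cosh b)) \<le> C * exp (- Re mu * Re b)" .
    \<comment> \<open>Replacing sinh b by cosh b - e^(-b) separates the combination that gains
      z^(-2) from a term in which J' and e^(-b) gain one order each.\<close>
    have "gegJ' (cosh b) * sinh b + mu * gegJ (cosh b) =
        (cosh b * gegJ' (cosh b) + mu * gegJ (cosh b)) - gegJ' (cosh b) * (cosh b - sinh b)"
      by (simp add: algebra_simps)
    also have "norm \<dots> \<le> norm (cosh b * gegJ' (cosh b) + mu * gegJ (cosh b)) + norm (gegJ' (cosh b)) * norm (cosh b - sinh b)"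
      by (rule order_trans[OF norm_triangle_ineq4]) (simp add: norm_mult)
    also have "\<dots> \<le> M * norm (cosh b) powr (- Re mu - 2) + (M * norm (cosh b) powr (- Re mu - 1)) * exp (- Re b)"
      unfolding cb(3) by (intro add_mono mult_right_mono M z z2) auto
    also have "\<dots> \<le> M * (A (- Re mu - 2) * exp ((- Re mu - 2) * Re b)) + (M * (A (- Re mu - 1) * exp ((- Re mu - 1) * Re b))) * exp (- Re b)"
      by (intro add_mono mult_right_mono mult_left_mono pw M) auto
    also have "\<dots> = (M * A (- Re mu - 2) + M * A (- Re mu - 1)) * exp (- (Re mu + 2) * Re b)"
    proof -
      have e: "exp ((- Re mu - 1) * Re b) * exp (- Re b) = exp (- (Re mu + 2) * Re b)"
        "exp ((- Re mu - 2) * Re b) = exp (- (Re mu + 2) * Re b)"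
        by (simp_all add: exp_add [symmetric] algebra_simps)
      show ?thesis unfolding distrib_right e(1) [symmetric] e(2) by (simp add: mult_ac e)
    qed
    also have "\<dots> \<le> C * exp (- (Re mu + 2) * Re b)"
      by (intro mult_right_mono) (use M(1) A0 in \<open>auto simp: C_def\<close>)
    finally show ?thesis using 1 by blast
  qed
  show ?thesis by (rule that[of C]) (use est in auto)
qed

text \<open>For 0 <= Im b < pi/2 the number cosh b has positive real part, so e^(\<mu> b) moves
  inside the power and gives (1 + e^(-2b))^(-\<mu>). The hypergeometric factor tends to its value at
  0.\<close>

lemma gegJ_cosh_limit:
  assumes th: "0 \<le> th" "th < pi / 2"
  defines "b \<equiv> (\<lambda>r::real. of_real r + \<i> * of_real th)"
  shows "((\<lambda>r. exp (mu * b r) * gegJ (cosh (b r))) \<longlongrightarrow> rGamma (l + \<alpha> + 1)) at_top"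
proof -
  have e0: "((\<lambda>r. exp (- 2 * b r)) \<longlongrightarrow> 0) at_top"
  proof (rule tendsto_norm_zero_cancel)
    have "((\<lambda>r::real. exp (- 2 * r)) \<longlongrightarrow> 0) at_top" by real_asymp
    then show "((\<lambda>r. norm (exp (- 2 * b r))) \<longlongrightarrow> 0) at_top" by (simp add: b_def)
  qed
  have e1: "((\<lambda>r. exp (- b r)) \<longlongrightarrow> 0) at_top"
  proof (rule tendsto_norm_zero_cancel)
    have "((\<lambda>r::real. exp (- r)) \<longlongrightarrow> 0) at_top" by real_asymp
    then show "((\<lambda>r. norm (exp (- b r))) \<longlongrightarrow> 0) at_top" by (simp add: b_def)
  qed
  have c: "2 * cosh z * exp (- z) = 1 + exp (- 2 * z)" for z :: complex
    by (simp add: cosh_field_def algebra_simps exp_add [symmetric])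
  have l1: "((\<lambda>r. (1 + exp (- 2 * b r)) powr (- mu)) \<longlongrightarrow> 1 powr (- mu)) at_top"
  proof -
    have "((\<lambda>r. 1 + exp (- 2 * b r)) \<longlongrightarrow> 1 + 0) at_top" by (intro tendsto_intros e0)
    then show ?thesis by (intro tendsto_powr_complex tendsto_const) simp_all
  qed
  have l2: "((\<lambda>r. hypF (1 / (cosh (b r))\<^sup>2)) \<longlongrightarrow> hypF 0) at_top"
  proof (rule isCont_tendsto_compose[of 0 hypF])
    have "0 \<in> cut_plane_F" by (simp add: mem_cut_plane_F)
    from hypF_derivatives(1)[OF this] show "isCont hypF 0" by (rule DERIV_isCont)
    have "1 / (cosh z)\<^sup>2 = (2 * exp (- z) / (1 + exp (- 2 * z)))\<^sup>2" if "cosh z \<noteq> 0" for z :: complex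
      using that unfolding c [symmetric] by (simp add: power2_eq_square)
    have "((\<lambda>r. (2 * exp (- b r) / (1 + exp (- 2 * b r)))\<^sup>2) \<longlongrightarrow> (2 * 0 / (1 + 0))\<^sup>2) at_top"
      by (intro tendsto_intros e0 e1) auto
    moreover have "eventually (\<lambda>r. (2 * exp (- b r) / (1 + exp (- 2 * b r)))\<^sup>2 = 1 / (cosh (b r))\<^sup>2) at_top"
      using eventually_gt_at_top[of 0]
    proof eventually_elim
      case (elim r)
      have "cosh (b r) \<noteq> 0" using elim th cosh_real_pos[of r] cos_gt_zero_pi[of th] by (auto simp: complex_eq_iff Re_cosh b_def)
      then show ?case unfolding c [symmetric] by (simp add: power2_eq_square)
    qed
    ultimately show "((\<lambda>r. 1 / (cosh (b r))\<^sup>2) \<longlongrightarrow> 0) at_top"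
      by (auto dest: Lim_transform_eventually)
  qed
  have "((\<lambda>r. (1 + exp (- 2 * b r)) powr (- mu) * hypF (1 / (cosh (b r))\<^sup>2)) \<longlongrightarrow> 1 powr (- mu) * hypF 0) at_top"
    by (intro tendsto_mult l1 l2)
  moreover have "eventually (\<lambda>r. (1 + exp (- 2 * b r)) powr (- mu) * hypF (1 / (cosh (b r))\<^sup>2) = exp (mu * b r) * gegJ (cosh (b r))) at_top"
    using eventually_gt_at_top[of 0]
  proof eventually_elim
    case (elim r)
    have "Re (2 * cosh (b r)) > 0" using th cosh_real_pos[of r] cos_gt_zero_pi[of th] by (simp add: Re_cosh b_def)
    then have "(2 * cosh (b r)) powr (- mu) = exp (- mu * b r) * (2 * cosh (b r) * exp (- b r)) powr (- mu)"
      using th by (intro powr_shift_exp) (simp_all add: b_def)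
    then show ?case unfolding gegJ_def c by (simp add: mult.assoc [symmetric] exp_add [symmetric])
  qed
  ultimately show ?thesis
    by (simp add: hypF_def reg_hypergeo_0) (erule Lim_transform_eventually)
qed

text \<open>The ratio of the leading coefficients of \<open>gegJ (cosh b)\<close> and
  \<open>laplaceI b\<close>, in which \<Gamma>(l + \<alpha> + 1) has cancelled.\<close>

definition kJ :: complex where "kJ = 1 / (2 powr (2 * \<alpha> - 1) * Gamma \<alpha> * Gamma (l + 1))"

text \<open>Both sides are recessive on the positive real axis, which gives proportionality for
  large r with the ratio of leading coefficients; the identity theorem extends it to the connected
  half strip.\<close>

lemma gegJ_eq_laplaceI:
  assumes b: "b \<in> half_strip"
  shows "gegJ (cosh b) = kJ * laplaceI b"
proof -
  obtain C where C:
    "\<And>b. b \<in> half_strip \<Longrightarrow> Re b > 7 \<Longrightarrow> norm (gegJ (cosh b)) \<le> C * exp (- Re mu * Re b)"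
    "\<And>b. b \<in> half_strip \<Longrightarrow> Re b > 7 \<Longrightarrow> norm (gegJ' (cosh b) * sinh b + mu * gegJ (cosh b)) \<le> C * exp (- (Re mu + 2) * Re b)"
    using gegJ_cosh_asymptotic_bounds by metis
  obtain D where D:
    "\<And>r. r > 1 \<Longrightarrow> norm (laplaceI (of_real r)) \<le> D * exp (- Re mu * r)"
    "\<And>r. r > 1 \<Longrightarrow> norm (laplaceI' (of_real r) + mu * laplaceI (of_real r)) \<le> D * exp (- (Re mu + 2) * r)"
    using laplaceI_asymptotic_bounds by metis
  define L where "L = 2 powr (2 * \<alpha> - 1) * Beta \<alpha> (l + 1)"
  have np: "\<alpha> \<notin> \<int>\<^sub>\<le>\<^sub>0" "l + 1 \<notin> \<int>\<^sub>\<le>\<^sub>0" "l + \<alpha> + 1 \<notin> \<int>\<^sub>\<le>\<^sub>0"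
    using Re_alpha Re_l by (auto intro!: Re_pos_imp_not_nonpos_Int)
  have g: "rGamma (l + \<alpha> + 1) \<noteq> 0" "Gamma \<alpha> \<noteq> 0" "Gamma (l + 1) \<noteq> 0"
    using np by (auto simp: rGamma_eq_zero_iff Gamma_eq_zero_iff)
  have L: "L = rGamma (l + \<alpha> + 1) / kJ"
    unfolding L_def kJ_def Beta_altdef by (simp add: add_ac)
  have L0: "L \<noteq> 0" unfolding L using g by (simp add: kJ_def)
  have mem: "complex_of_real r + \<i> * of_real 0 \<in> half_strip" if "r > 7" for r using that by (simp add: mem_half_strip)
  have mem': "complex_of_real r + \<i> * of_real 0 \<in> laplace_domain" if "r > 7" for r using mem[OF that] half_strip_subset by blast
  note dj = gegJ_cosh_derivatives[OF mem]
  note dI = has_derivative_laplaceI[OF mem'] has_derivative_laplaceI'[OF mem']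
  obtain R' where R': "R' \<ge> 7" "\<And>r::real. r > R' \<Longrightarrow> gegJ (cosh (of_real r + \<i> * of_real 0)) * L = rGamma (l + \<alpha> + 1) * laplaceI (of_real r + \<i> * of_real 0)"
  proof (rule recessive_solutions_proportional[of \<alpha> l 0 7 "\<lambda>b. gegJ (cosh b)" "\<lambda>b. gegJ' (cosh b) * sinh b" laplaceI laplaceI' C D
        "rGamma (l + \<alpha> + 1)" L, folded mu_def])
    show "((\<lambda>r. exp (mu * (of_real r + \<i> * of_real 0)) * gegJ (cosh (of_real r + \<i> * of_real 0))) \<longlongrightarrow> rGamma (l + \<alpha> + 1)) at_top"
      by (rule gegJ_cosh_limit) auto
    show "((\<lambda>r. exp (mu * (of_real r + \<i> * of_real 0)) * laplaceI (of_real r + \<i> * of_real 0)) \<longlongrightarrow> L) at_top"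
      using laplaceI_limit unfolding L_def by simp
    show "cmod (gegJ (cosh (of_real r + \<i> * of_real 0))) \<le> C * exp (- Re mu * r)" if "7 < r" for r
      using C(1)[OF mem[OF that]] that by simp
    show "cmod (gegJ' (cosh (of_real r + \<i> * of_real 0)) * sinh (of_real r + \<i> * of_real 0) + mu * gegJ (cosh (of_real r + \<i> * of_real 0))) \<le> C * exp (- (Re mu + 2) * r)"
      if "7 < r" for r
      using C(2)[OF mem[OF that]] that by simp
    show "cmod (laplaceI (of_real r + \<i> * of_real 0)) \<le> D * exp (- Re mu * r)" if "7 < r" for r
      using D(1)[of r] that by simp
    show "cmod (laplaceI' (of_real r + \<i> * of_real 0) + mu * laplaceI (of_real r + \<i> * of_real 0)) \<le> D * exp (- (Re mu + 2) * r)" if "7 < r" for r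
      using D(2)[of r] that by simp
  qed (use Re_alpha Re_l dj dI L0 in auto)
  have "gegJ (cosh b) * L = rGamma (l + \<alpha> + 1) * laplaceI b"
  proof (rule analytic_continuation_ray[where f = "\<lambda>b. gegJ (cosh b) * L" and g = "\<lambda>b. rGamma (l + \<alpha> + 1) * laplaceI b"
        and R = R' and th = 0 and S = half_strip])
    show "(\<lambda>b. gegJ (cosh b) * L) holomorphic_on half_strip"
      using gegJ_cosh_derivatives(1) open_half_strip
      by (intro holomorphic_intros) (auto simp: holomorphic_on_open)
    show "(\<lambda>b. rGamma (l + \<alpha> + 1) * laplaceI b) holomorphic_on half_strip"
      using has_derivative_laplaceI half_strip_subset open_half_strip
      by (intro holomorphic_intros) (auto simp: holomorphic_on_open)
    show "of_real r + \<i> * of_real 0 \<in> half_strip" if "R' < r" for r using that R'(1) mem by simp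
  qed (use open_half_strip connected_half_strip b R' in auto)
  then show ?thesis unfolding L using g by (simp add: kJ_def field_simps)
qed

end

subsection \<open>The product formula\<close>

text \<open>Take b = \<plusminus> i Arccos w with the sign that makes Re b >= 0. The excluded
  boundary cases Re b = 0 and |Im b| = pi would put w on the cut.\<close>

lemma cosh_surj_half_strip:
  assumes w: "w \<in> cut_plane_D"
  obtains b where "b \<in> half_strip" "cosh b = w"
proof -
  define z where "z = \<i> * Arccos w"
  have cz: "cosh z = w" unfolding z_def by (simp add: cosh_complex cosh_field_def flip: cos_exp_eq)
  define b where "b = (if Re z \<ge> 0 then z else - z)"
  have cb: "cosh b = w" using cz by (simp add: b_def)
  have r: "Re b \<ge> 0" by (simp add: b_def)
  have i: "\<bar>Im b\<bar> \<le> pi" using Re_Arccos_bound[of w] by (simp add: b_def z_def)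
  have "Re b \<noteq> 0"
  proof
    assume "Re b = 0"
    then have "Re w = cos (Im b)" "Im w = 0" using cb Re_cosh[of b] Im_cosh[of b] by auto
    then show False using w by (simp add: mem_cut_plane_D)
  qed
  moreover have "\<bar>Im b\<bar> \<noteq> pi"
  proof
    assume "\<bar>Im b\<bar> = pi"
    then have "Im b = pi \<or> Im b = - pi" by linarith
    then have "Re w = - cosh (Re b)" "Im w = 0" using cb Re_cosh[of b] Im_cosh[of b] by auto
    then show False using w cosh_real_pos[of "Re b"] by (simp add: mem_cut_plane_D)
  qed
  ultimately show ?thesis using that[of b] cb r i by (simp add: mem_half_strip)
qed

context gegenbauer_params
begin

text \<open>As w tends to 1 the argument 1 / w^2 reaches the branch point, so the bound is taken
  from Laplace's integral. With sinh^2 b = w^2 - 1 the base is at least |w| and at least t |sinh b|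
  in modulus, and for Re \<mu> > 0 the power -Re \<mu> is shared between the two. Since e/2 < Re
  \<alpha>, the resulting singularity at w = 1 is integrable against (w - 1)^(Re \<alpha> -
  1).\<close>

lemma gegJ_bound_right_half_plane:
  obtains e M where "0 \<le> e" "e < 2 * Re \<alpha>" "M \<ge> 0"
    "\<And>w. Re w > 1 \<Longrightarrow> norm (gegJ w) \<le> M * norm w powr (e - Re mu) * norm (w\<^sup>2 - 1) powr (- e / 2)"
proof -
  define m \<rho> where "m = Re mu" and "\<rho> = Re \<alpha>"
  have m: "m > 2 * \<rho> - 1" "\<rho> > 0" using Re_mu Re_alpha by (auto simp: m_def \<rho>_def)
  obtain e where e: "0 \<le> e" "e < 2 * \<rho>" "(m > 0 \<and> e > 2 * \<rho> - 1 \<and> e \<le> m) \<or> (m \<le> 0 \<and> e = 0)"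
  proof (cases "m > 0")
    case True
    have "max 0 (2 * \<rho> - 1) < min m (2 * \<rho>)" using True m by auto
    then obtain e where "max 0 (2 * \<rho> - 1) < e" "e < min m (2 * \<rho>)" using dense by blast
    then show ?thesis using that[of e] True by auto
  qed (use that[of 0] m in auto)
  define E where "E = exp (pi * \<bar>Im mu\<bar>)"
  define y where "y = (if m > 0 then e else m)"
  define N where "N = (\<integral>t. t powr (- y) * (t\<^sup>2 - 1) powr (\<rho> - 1) \<partial>lborel_gt 1)"
  have y: "y > 2 * \<rho> - 1" using e m by (auto simp: y_def)
  have yint: "integrable (lborel_gt 1) (\<lambda>t. t powr (- y) * (t\<^sup>2 - 1) powr (\<rho> - 1))"
    by (rule integrable_gweight[OF m(2) y])
  have N0: "N \<ge> 0" unfolding N_def by (intro integral_nonneg_AE AE_I2) simp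
  define M where "M = norm kJ * (E * 3 powr \<bar>m\<bar> * N)"
  have "norm (gegJ w) \<le> M * norm w powr (e - Re mu) * norm (w\<^sup>2 - 1) powr (- e / 2)" if w: "Re w > 1" for w
  proof -
    have wD: "w \<in> cut_plane_D" using w by (simp add: mem_cut_plane_D)
    obtain b where b: "b \<in> half_strip" "cosh b = w" using cosh_surj_half_strip[OF wD] .
    have dom: "b \<in> laplace_domain" using b half_strip_subset by blast
    have s2: "(sinh b)\<^sup>2 = w\<^sup>2 - 1" using hyperbolic_pythagoras[of b] b(2) by (simp add: algebra_simps)
    have sp: "norm (sinh b) > 0" using sinh_nonzero[OF dom] by simp
    have w1: "norm w > 1" using w complex_Re_le_cmod[of w] by linarith
    have s2n: "norm (sinh b) ^ 2 = norm (w\<^sup>2 - 1)" by (simp add: s2 flip: norm_power)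
    have sle: "norm (sinh b) \<le> 2 * norm w"
    proof -
      have "norm (w\<^sup>2 - 1) \<le> norm w ^ 2 + 1" using norm_triangle_ineq4[of "w\<^sup>2" 1] by (simp add: norm_power)
      also have "\<dots> \<le> 4 * norm w ^ 2" using w1 one_le_power[of "norm w" 2] by linarith
      finally have "norm (sinh b) ^ 2 \<le> (2 * norm w) ^ 2" by (simp add: s2n power_mult_distrib)
      then show ?thesis by (rule power2_le_imp_le) simp
    qed
    define p where "p = (\<lambda>t. norm (base b t))"
    \<comment> \<open>Expanding the square of the modulus, the cross term is 2 t cosh (Re b) sinh
      (Re b), which is nonnegative because Re b > 0.\<close>
    have sq: "(norm w)\<^sup>2 + (t * norm (sinh b))\<^sup>2 \<le> (p t)\<^sup>2" if "t \<ge> 1" for t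
    proof -
      have n2: "(norm z)\<^sup>2 = (Re z)\<^sup>2 + (Im z)\<^sup>2" for z by (simp add: norm_complex_def)
      have "(p t)\<^sup>2 = (norm (cosh b))\<^sup>2 + (t * norm (sinh b))\<^sup>2 + 2 * t * (Re (cosh b) * Re (sinh b) + Im (cosh b) * Im (sinh b))"
        unfolding p_def power_mult_distrib n2 by (simp add: power2_eq_square algebra_simps)
      also have "Re (cosh b) * Re (sinh b) + Im (cosh b) * Im (sinh b) = cosh (Re b) * sinh (Re b) * ((sin (Im b))\<^sup>2 + (cos (Im b))\<^sup>2)"
        unfolding Re_cosh Re_sinh Im_cosh Im_sinh by (simp only: power2_eq_square distrib_left mult_ac add_ac)
      also have "\<dots> = cosh (Re b) * sinh (Re b)" by simp
      finally have "(p t)\<^sup>2 = (norm w)\<^sup>2 + (t * norm (sinh b))\<^sup>2 + 2 * t * (cosh (Re b) * sinh (Re b))"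
        using b(2) by simp
      moreover have "0 \<le> 2 * t * (cosh (Re b) * sinh (Re b))"
        using b(1) that by (intro mult_nonneg_nonneg) (auto simp: mem_half_strip)
      ultimately show ?thesis by linarith
    qed
    have pl: "norm w \<le> p t" "t * norm (sinh b) \<le> p t" if "t \<ge> 1" for t
    proof -
      have "(norm w)\<^sup>2 \<le> (p t)\<^sup>2" "(t * norm (sinh b))\<^sup>2 \<le> (p t)\<^sup>2"
        using sq[OF that] zero_le_power2[of "norm w"] zero_le_power2[of "t * norm (sinh b)"] by linarith+
      then show "norm w \<le> p t" "t * norm (sinh b) \<le> p t"
        by (auto intro: power2_le_imp_le simp: p_def)
    qed
    have pu: "p t \<le> 3 * (t * norm w)" if "t \<ge> 1" for t
    proof -
      have "p t \<le> norm w + t * norm (sinh b)"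
        unfolding p_def using norm_triangle_ineq[of "cosh b" "of_real t * sinh b"] b(2) that by (simp add: norm_mult)
      moreover have "t * norm (sinh b) \<le> t * (2 * norm w)" using sle that by (intro mult_left_mono) auto
      moreover have "1 * norm w \<le> t * norm w" using that by (intro mult_right_mono) auto
      moreover have "t * (2 * norm w) = 2 * (t * norm w)" by simp
      ultimately show ?thesis by linarith
    qed
    have pb: "p t powr (- m) \<le> 3 powr \<bar>m\<bar> * (norm w powr (e - m) * norm (sinh b) powr (- e)) * t powr (- y)" if t: "t \<ge> 1" for t
    proof (cases "m > 0")
      case True
      then have e': "e \<le> m" and y': "y = e" using e by (auto simp: y_def)
      have "p t powr (- m) = p t powr (e - m) * p t powr (- e)" by (simp add: powr_add [symmetric])
      also have "\<dots> \<le> norm w powr (e - m) * (t * norm (sinh b)) powr (- e)"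
        by (intro mult_mono powr_mono2' pl t) (use e' e(1) w1 sp t in auto)
      also have "(t * norm (sinh b)) powr (- e) = t powr (- e) * norm (sinh b) powr (- e)" using t by (simp add: powr_mult)
      finally have "p t powr (- m) \<le> 1 * (norm w powr (e - m) * norm (sinh b) powr (- e)) * t powr (- y)" by (simp add: y' mult_ac)
      also have "\<dots> \<le> 3 powr \<bar>m\<bar> * (norm w powr (e - m) * norm (sinh b) powr (- e)) * t powr (- y)"
        by (intro mult_right_mono) (auto simp: ge_one_powr_ge_zero)
      finally show ?thesis .
    next
      case False
      then have e': "e = 0" "y = m" "\<bar>m\<bar> = - m" using e by (auto simp: y_def)
      have "p t powr (- m) \<le> (3 * (t * norm w)) powr (- m)" using False by (intro powr_mono2 pu t) (auto simp: p_def)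
      also have "\<dots> = 3 powr \<bar>m\<bar> * (t powr (- m) * norm w powr (- m))" using t by (simp add: powr_mult e')
      finally show ?thesis using sp by (simp add: e' mult_ac)
    qed
    have "norm (laplaceI b) \<le> (\<integral>t. (E * (3 powr \<bar>m\<bar> * (norm w powr (e - m) * norm (sinh b) powr (- e)))) * (t powr (- y) * (t\<^sup>2 - 1) powr (\<rho> - 1)) \<partial>lborel_gt 1)"
      unfolding laplaceI_def
    proof (rule norm_integral_le[OF integrable_laplaceI[OF dom] Bochner_Integration.integrable_mult_right[OF yint]])
      fix t assume "t \<in> space (lborel_gt 1)"
      then have t: "t > 1" by simp
      have "base b t \<noteq> 0" using cosh_plus_sinh_not_nonpos[OF dom, of t] t by auto
      then have "norm (base b t powr (- mu)) \<le> exp (pi * \<bar>Im (- mu)\<bar>) * norm (base b t) powr Re (- mu)"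
        by (rule norm_powr_le)
      also have "\<dots> = E * p t powr (- m)" by (simp add: E_def p_def m_def)
      also have "\<dots> \<le> E * (3 powr \<bar>m\<bar> * (norm w powr (e - m) * norm (sinh b) powr (- e)) * t powr (- y))"
        using t by (intro mult_left_mono pb) (auto simp: E_def)
      finally have "norm (base b t powr (- mu)) * (t\<^sup>2 - 1) powr (\<rho> - 1) \<le>
          E * (3 powr \<bar>m\<bar> * (norm w powr (e - m) * norm (sinh b) powr (- e)) * t powr (- y)) * (t\<^sup>2 - 1) powr (\<rho> - 1)"
        by (rule mult_right_mono) simp
      then show "norm (base b t powr (- mu) * gweight \<alpha> t) \<le>
          (E * (3 powr \<bar>m\<bar> * (norm w powr (e - m) * norm (sinh b) powr (- e)))) * (t powr (- y) * (t\<^sup>2 - 1) powr (\<rho> - 1))"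
        unfolding norm_mult norm_gweight[OF t] \<rho>_def by (simp only: mult_ac)
    qed
    also have "\<dots> = E * 3 powr \<bar>m\<bar> * N * (norm w powr (e - m) * norm (sinh b) powr (- e))"
      unfolding Bochner_Integration.integral_mult_right_zero N_def by (simp only: mult_ac)
    finally have I: "norm (laplaceI b) \<le> E * 3 powr \<bar>m\<bar> * N * (norm w powr (e - m) * norm (sinh b) powr (- e))" .
    have "norm (sinh b) powr (- e) = (norm (sinh b) powr 2) powr (- e / 2)" by (simp only: powr_powr) simp
    also have "norm (sinh b) powr 2 = norm (w\<^sup>2 - 1)" using sp s2n by (simp add: powr_numeral)
    finally have se: "norm (sinh b) powr (- e) = norm (w\<^sup>2 - 1) powr (- e / 2)" .
    have "norm (gegJ w) = norm kJ * norm (laplaceI b)" using gegJ_eq_laplaceI[OF b(1)] b(2) by (simp add: norm_mult)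
    also have "\<dots> \<le> norm kJ * (E * 3 powr \<bar>m\<bar> * N * (norm w powr (e - m) * norm (sinh b) powr (- e)))"
      by (intro mult_left_mono I) simp
    finally show ?thesis unfolding se by (simp add: M_def m_def mult_ac)
  qed
  moreover have "M \<ge> 0" using N0 by (simp add: M_def E_def)
  ultimately show ?thesis using that[of e M] e by (simp add: \<rho>_def)
qed

text \<open>Arguments that grow linearly in t share one majorant, since |w^2 - 1| >= \<delta>^2 (t -
  1) t. The condition at t = 1 is only that Re w - 1 is of order t - 1, so that the limit r = 0 of
  the product integral is covered too.\<close>

lemma gegJ_dominated:
  assumes "0 < \<delta>"
  obtains g where "integrable (lborel_gt 1) g"
    "\<And>w t. t > 1 \<Longrightarrow> Re w > 1 \<Longrightarrow> \<delta> * (t - 1) \<le> Re w - 1 \<Longrightarrow> \<delta> * t \<le> Re w \<Longrightarrow> norm w \<le> d * t \<Longrightarrow>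
       norm (gegJ w * gweight \<alpha> t) \<le> g t"
proof -
  obtain e M where eM: "0 \<le> e" "e < 2 * Re \<alpha>" "M \<ge> 0"
    "\<And>w. Re w > 1 \<Longrightarrow> norm (gegJ w) \<le> M * norm w powr (e - Re mu) * norm (w\<^sup>2 - 1) powr (- e / 2)"
    using gegJ_bound_right_half_plane by metis
  define \<rho> m where "\<rho> = Re \<alpha>" and "m = Re mu"
  have m: "m > 2 * \<rho> - 1" "\<rho> > 0" using Re_mu Re_alpha by (auto simp: m_def \<rho>_def)
  define A where "A = M * (\<delta> powr (e - m) + d powr (e - m)) * (\<delta>\<^sup>2) powr (- e / 2) * (1 + 2 powr (\<rho> - 1))"
  define g where "g = (\<lambda>t. A * ((t - 1) powr (\<rho> - 1 - e / 2) * t powr (- (m - e / 2 - \<rho> + 1))))"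
  show ?thesis
  proof (rule that[of g])
    show "integrable (lborel_gt 1) g"
      unfolding g_def by (intro Bochner_Integration.integrable_mult_right integrable_weight_split) (use eM m in \<open>auto simp: \<rho>_def\<close>)
    fix w t assume t: "t > 1" and w: "Re w > 1" "\<delta> * (t - 1) \<le> Re w - 1" "\<delta> * t \<le> Re w" "norm w \<le> d * t"
    have wl: "\<delta> * t \<le> norm w" using w(3) complex_Re_le_cmod[of w] by linarith
    have 1: "norm w powr (e - m) \<le> (\<delta> powr (e - m) + d powr (e - m)) * t powr (e - m)"
      by (rule powr_between) (use assms t wl w in auto)
    have "w\<^sup>2 - 1 = (w - 1) * (w + 1)" by (simp add: power2_eq_square algebra_simps)
    then have "norm (w\<^sup>2 - 1) = norm (w - 1) * norm (w + 1)" by (simp add: norm_mult)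
    moreover have "\<delta> * (t - 1) \<le> norm (w - 1)" using w(2) complex_Re_le_cmod[of "w - 1"] by simp
    moreover have "\<delta> * t \<le> norm (w + 1)" using w(3) complex_Re_le_cmod[of "w + 1"] by simp
    ultimately have "(\<delta> * (t - 1)) * (\<delta> * t) \<le> norm (w\<^sup>2 - 1)"
      using assms t by (simp only:) (intro mult_mono, auto)
    then have "norm (w\<^sup>2 - 1) powr (- e / 2) \<le> ((\<delta> * (t - 1)) * (\<delta> * t)) powr (- e / 2)"
      using assms t eM(1) by (intro powr_mono2') auto
    also have "(\<delta> * (t - 1)) * (\<delta> * t) = \<delta>\<^sup>2 * ((t - 1) * t)" by (simp add: power2_eq_square)
    also have "(\<delta>\<^sup>2 * ((t - 1) * t)) powr (- e / 2) = (\<delta>\<^sup>2) powr (- e / 2) * ((t - 1) powr (- e / 2) * t powr (- e / 2))"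
      using assms t by (simp add: powr_mult)
    finally have 2: "norm (w\<^sup>2 - 1) powr (- e / 2) \<le> (\<delta>\<^sup>2) powr (- e / 2) * ((t - 1) powr (- e / 2) * t powr (- e / 2))" .
    have "norm (gegJ w) \<le> M * norm w powr (e - m) * norm (w\<^sup>2 - 1) powr (- e / 2)"
      using eM(4)[OF w(1)] by (simp add: m_def)
    also have "\<dots> \<le> M * ((\<delta> powr (e - m) + d powr (e - m)) * t powr (e - m)) * ((\<delta>\<^sup>2) powr (- e / 2) * ((t - 1) powr (- e / 2) * t powr (- e / 2)))"
      by (intro mult_mono mult_left_mono 1 2 eM) (auto intro!: mult_nonneg_nonneg eM add_nonneg_nonneg)
    finally have J: "norm (gegJ w) \<le> M * ((\<delta> powr (e - m) + d powr (e - m)) * t powr (e - m)) * ((\<delta>\<^sup>2) powr (- e / 2) * ((t - 1) powr (- e / 2) * t powr (- e / 2)))" .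
    have "norm (gegJ w * gweight \<alpha> t) \<le> M * ((\<delta> powr (e - m) + d powr (e - m)) * t powr (e - m)) * ((\<delta>\<^sup>2) powr (- e / 2) * ((t - 1) powr (- e / 2) * t powr (- e / 2))) *
        ((1 + 2 powr (\<rho> - 1)) * ((t - 1) powr (\<rho> - 1) * t powr (\<rho> - 1)))"
      unfolding norm_mult norm_gweight[OF t] \<rho>_def [symmetric]
      by (intro mult_mono J square_minus_1_powr_le t) (auto intro!: mult_nonneg_nonneg eM add_nonneg_nonneg)
    also have "\<dots> = A * (((t - 1) powr (- e / 2) * (t - 1) powr (\<rho> - 1)) * ((t powr (e - m) * t powr (- e / 2)) * t powr (\<rho> - 1)))"
      unfolding A_def by (simp only: mult_ac)
    also have "(t - 1) powr (- e / 2) * (t - 1) powr (\<rho> - 1) = (t - 1) powr (\<rho> - 1 - e / 2)"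
      by (simp add: powr_add [symmetric])
    also have "(t powr (e - m) * t powr (- e / 2)) * t powr (\<rho> - 1) = t powr (- (m - e / 2 - \<rho> + 1))"
    proof -
      have "(e - m) + (- e / 2) + (\<rho> - 1) = - (m - e / 2 - \<rho> + 1)" by (simp add: field_simps)
      then show ?thesis by (simp only: powr_add [symmetric])
    qed
    finally show "norm (gegJ w * gweight \<alpha> t) \<le> g t" by (simp only: g_def)
  qed
qed

text \<open>Controls the boundary term at infinity in the differential equation for the product
  integral.\<close>

lemma gegJ'_bound_right_half_plane:
  assumes "0 < \<delta>"
  obtains M where "\<And>w t. t > 1 \<Longrightarrow> Re w > 1 \<Longrightarrow> norm w \<ge> 2 \<Longrightarrow> \<delta> * t \<le> norm w \<Longrightarrow> norm w \<le> d * t \<Longrightarrow> norm (gegJ' w) \<le> M * t powr (- Re mu - 1)"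
proof -
  obtain M where M: "M \<ge> 0"
    "\<And>z. z \<in> cut_plane_D \<Longrightarrow> norm z \<ge> 2 \<Longrightarrow> norm (gegJ' z) \<le> M * norm z powr (- Re mu - 1)"
    using gegJ_bounds by metis
  show ?thesis
  proof (rule that[of "M * (\<delta> powr (- Re mu - 1) + d powr (- Re mu - 1))"])
    fix w t assume t: "(t::real) > 1" and w: "Re w > 1" "norm w \<ge> 2" "\<delta> * t \<le> norm w" "norm w \<le> d * t"
    have "norm (gegJ' w) \<le> M * norm w powr (- Re mu - 1)" by (rule M(2)) (use w in \<open>auto simp: mem_cut_plane_D\<close>)
    also have "\<dots> \<le> M * ((\<delta> powr (- Re mu - 1) + d powr (- Re mu - 1)) * t powr (- Re mu - 1))"
      by (intro mult_left_mono powr_between M) (use assms t w in auto)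
    finally show "norm (gegJ' w) \<le> M * (\<delta> powr (- Re mu - 1) + d powr (- Re mu - 1)) * t powr (- Re mu - 1)"
      by (simp only: mult.assoc)
  qed
qed

section \<open>The product integral: domain, differential equation and asymptotics\<close>

text \<open>With \<open>a = r + \<i>\<theta>\<close> this is \<open>cosh a cosh b + t sinh a sinh b\<close> at \<open>b = -\<i>\<theta>\<close>; at \<open>a = \<i>\<theta>\<close> it is
  the real number \<open>cos\<^sup>2 \<theta> + t sin\<^sup>2 \<theta>\<close>.\<close>
definition prod_arg :: "real \<Rightarrow> complex \<Rightarrow> real \<Rightarrow> complex" where
  "prod_arg th a t = of_real (cos th) * cosh a - \<i> * of_real (sin th) * of_real t * sinh a"

definition prod_arg' :: "real \<Rightarrow> complex \<Rightarrow> real \<Rightarrow> complex" where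
  "prod_arg' th a t = of_real (cos th) * sinh a - \<i> * of_real (sin th) * of_real t * cosh a"

lemma Re_prod_arg: "Re (prod_arg th a t) = cosh (Re a) * (cos th * cos (Im a) + t * (sin th * sin (Im a)))"
  by (simp add: prod_arg_def Re_cosh Im_sinh algebra_simps)

text \<open>A convex set containing the ray r + i\<theta>, r > 0, narrow enough that
  \<open>prod_arg\<close> has real part above 1 for every t >= 1. The opening |Im a - \<theta>| < Re
  a / 2 serves the value at t = 1; the other bounds keep Im a inside (0, pi/2).\<close>

definition wedge :: "real \<Rightarrow> complex set" where
  "wedge th = {a. \<bar>Im a - th\<bar> < Re a / 2 \<and> \<bar>Im a - th\<bar> < min 1 (min th (pi / 2 - th))}"

definition prodG :: "real \<Rightarrow> complex \<Rightarrow> complex" where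
  "prodG th a = (\<integral>t. gegJ (prod_arg th a t) * gweight \<alpha> t \<partial>lborel_gt 1)"

definition prodG' :: "real \<Rightarrow> complex \<Rightarrow> complex" where
  "prodG' th a = (\<integral>t. gegJ' (prod_arg th a t) * prod_arg' th a t * gweight \<alpha> t \<partial>lborel_gt 1)"

end

lemma sinh_ge_self:
  assumes "x \<ge> 0"
  shows "sinh x \<ge> (x :: real)"
proof -
  have "sinh 0 - 0 \<le> sinh x - x"
    by (rule DERIV_nonneg_imp_nondecreasing[OF assms])
       (auto intro!: exI derivative_eq_intros simp: cosh_real_ge_1)
  then show ?thesis by simp
qed

context gegenbauer_params
begin

lemma open_wedge: "open (wedge th)" and convex_wedge: "convex (wedge th)"
proof -
  let ?e = "min 1 (min th (pi / 2 - th))"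
  show "open (wedge th)"
    unfolding wedge_def by (intro open_Collect_conj open_Collect_less continuous_intros) simp_all
  have "wedge th = {a. inner (Complex (-1 / 2) 1) a < th} \<inter> {a. inner (Complex (-1 / 2) (-1)) a < - th}
      \<inter> ({a. Im a < th + ?e} \<inter> {a. Im a > th - ?e})"
  proof (rule set_eqI)
    fix a
    have "inner (Complex (-1 / 2) 1) a = Im a - Re a / 2" "inner (Complex (-1 / 2) (-1)) a = - Im a - Re a / 2"
      by (simp_all add: inner_complex_def)
    then show "a \<in> wedge th \<longleftrightarrow> a \<in> {a. inner (Complex (-1 / 2) 1) a < th} \<inter> {a. inner (Complex (-1 / 2) (-1)) a < - th}
      \<inter> ({a. Im a < th + ?e} \<inter> {a. Im a > th - ?e})"
      unfolding wedge_def mem_Collect_eq Int_iff abs_less_iff by linarith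
  qed
  then show "convex (wedge th)"
    by (simp only:) (intro convex_Int convex_halfspace_lt convex_halfspace_Im_lt convex_halfspace_Im_gt)
qed

text \<open>The product cosh r cos y is (1 + 2 S^2) (1 - 2 s^2) with S = sinh (r/2) and s = sin
  (y/2). The opening gives s <= S / 2 and y < 1 gives s <= 1/2; together they make the product
  exceed 1.\<close>

lemma wedge_facts:
  assumes "a \<in> wedge th"
  shows "Re a > 0" "0 < Im a" "Im a < pi / 2" "cosh (Re a) * cos (Im a - th) > 1" "0 < th" "th < pi / 2"
proof -
  define r y where "r = Re a" and "y = \<bar>Im a - th\<bar>"
  have y: "0 \<le> y" "y < r / 2" "y < 1" using assms by (auto simp: wedge_def r_def y_def)
  show r0: "Re a > 0" using y by (simp add: r_def)
  show "0 < Im a" "Im a < pi / 2" "0 < th" "th < pi / 2" using assms by (auto simp: wedge_def)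
  define S s where "S = sinh (r / 2)" and "s = sin (y / 2)"
  have S: "r / 2 \<le> S" unfolding S_def by (rule sinh_ge_self) (use y in simp)
  have "0 \<le> y / 2" "y / 2 \<le> pi" using y pi_gt3 by linarith+
  then have s: "0 \<le> s" "s \<le> y / 2" unfolding s_def by (simp_all only: sin_ge_zero sin_x_le_x)
  have "s \<le> 1 / 2" "s \<le> S / 2" using s S y by linarith+
  then have "s\<^sup>2 \<le> (1 / 2)\<^sup>2" "s\<^sup>2 \<le> (S / 2)\<^sup>2" using s by (intro power_mono; simp)+
  then have s2: "s\<^sup>2 \<le> 1 / 4" "s\<^sup>2 \<le> S\<^sup>2 / 4" by (simp_all add: power2_eq_square)
  have S2: "S\<^sup>2 > 0" using S y by simp
  have "cosh r = 1 + 2 * S\<^sup>2" using cosh_double[of "r / 2"] hyperbolic_pythagoras[of "r / 2"] by (simp add: S_def)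
  moreover have "cos (Im a - th) = 1 - 2 * s\<^sup>2"
    using cos_double_sin[of "y / 2"] unfolding s_def y_def by simp
  moreover have "(1 + 2 * S\<^sup>2) * (1 - 2 * s\<^sup>2) > 1"
  proof -
    have "S\<^sup>2 * s\<^sup>2 \<le> S\<^sup>2 * (1 / 4)" using s2 by (intro mult_left_mono) auto
    moreover have "(1 + 2 * S\<^sup>2) * (1 - 2 * s\<^sup>2) = 1 + 2 * S\<^sup>2 - 2 * s\<^sup>2 - 4 * (S\<^sup>2 * s\<^sup>2)"
      by (simp add: algebra_simps)
    ultimately show ?thesis using s2 S2 by linarith
  qed
  ultimately show "cosh (Re a) * cos (Im a - th) > 1" by (simp add: r_def)
qed

lemma wedge_subset: "wedge th \<subseteq> half_strip"
proof
  fix a assume "a \<in> wedge th"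
  from wedge_facts(1-3)[OF this] pi_gt_zero show "a \<in> half_strip" unfolding mem_half_strip by linarith
qed

lemma ray_in_wedge:
  assumes "0 < th" "th < pi / 2" "r > 0"
  shows "of_real r + \<i> * of_real th \<in> wedge th"
  using assms by (simp add: wedge_def)

text \<open>The real part is affine in t, with value cosh (Re a) cos (Im a - \<theta>) at t = 1 and
  positive slope.\<close>

lemma Re_prod_arg_wedge:
  assumes a: "a \<in> wedge th" and t: "t \<ge> 1"
  shows "Re (prod_arg th a t) = cosh (Re a) * cos (Im a - th) + (t - 1) * (cosh (Re a) * (sin th * sin (Im a)))"
    "cosh (Re a) * (sin th * sin (Im a)) > 0" "Re (prod_arg th a t) > 1"
proof -
  show 1: "Re (prod_arg th a t) = cosh (Re a) * cos (Im a - th) + (t - 1) * (cosh (Re a) * (sin th * sin (Im a)))"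
    unfolding Re_prod_arg cos_diff by (simp add: algebra_simps)
  show 2: "cosh (Re a) * (sin th * sin (Im a)) > 0"
    using wedge_facts[OF a] pi_gt_zero by (intro mult_pos_pos sin_gt_zero cosh_real_pos) linarith+
  show "Re (prod_arg th a t) > 1" 
  proof -
    have "0 \<le> (t - 1) * (cosh (Re a) * (sin th * sin (Im a)))" by (rule mult_nonneg_nonneg) (use 2 t in linarith)+
    then show ?thesis unfolding 1 using wedge_facts(4)[OF a] by linarith
  qed
qed

lemma norm_prod_arg_le:
  assumes "t \<ge> 1"
  shows "norm (prod_arg th a t) \<le> (norm (cosh a) + norm (sinh a)) * t"
proof -
  have "norm (prod_arg th a t) \<le> \<bar>cos th\<bar> * norm (cosh a) + \<bar>sin th\<bar> * t * norm (sinh a)"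
    unfolding prod_arg_def using assms by (intro order_trans[OF norm_triangle_ineq4]) (simp add: norm_mult)
  also have "\<dots> \<le> (1 * norm (cosh a)) * t + 1 * t * norm (sinh a)"
  proof (intro add_mono mult_right_mono)
    have "\<bar>cos th\<bar> * norm (cosh a) \<le> 1 * norm (cosh a) * 1" by (simp add: mult_left_le_one_le)
    also have "\<dots> \<le> 1 * norm (cosh a) * t" using assms by (intro mult_left_mono) auto
    finally show "\<bar>cos th\<bar> * norm (cosh a) \<le> 1 * norm (cosh a) * t" .
  qed (use assms in auto)
  finally show ?thesis by (simp add: algebra_simps)
qed

text \<open>Writing the affine function of t from its value and slope at t = 1, the minimum of
  (value - 1) and slope over a compact disc serves as \<delta>.\<close>

lemma prod_arg_local_bounds:
  assumes a: "a \<in> wedge th"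
  obtains r \<delta> d where "r > 0" "cball a r \<subseteq> wedge th" "\<delta> > 0"
    "\<And>y t. y \<in> cball a r \<Longrightarrow> t > 1 \<Longrightarrow> \<delta> * t \<le> Re (prod_arg th y t) - 1"
    "\<And>y t. y \<in> cball a r \<Longrightarrow> t > 1 \<Longrightarrow> norm (prod_arg th y t) \<le> d * t"
proof -
  obtain r where r: "r > 0" "cball a r \<subseteq> wedge th"
    using a open_wedge open_contains_cball by blast
  let ?f = "\<lambda>y. min (cosh (Re y) * cos (Im y - th) - 1) (cosh (Re y) * (sin th * sin (Im y)))"
  let ?g = "\<lambda>y::complex. norm (cosh y) + norm (sinh y)"
  have ne: "cball a r \<noteq> {}" using r by simp
  have "continuous_on (cball a r) ?f" by (intro continuous_intros)
  from continuous_attains_inf[OF compact_cball ne this]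
  obtain y0 where y0: "y0 \<in> cball a r" "\<forall>y\<in>cball a r. ?f y0 \<le> ?f y" by (elim bexE)
  have "continuous_on (cball a r) ?g" by (intro continuous_intros)
  from continuous_attains_sup[OF compact_cball ne this]
  obtain y1 where y1: "\<forall>y\<in>cball a r. ?g y \<le> ?g y1" by (elim bexE)
  have yw0: "y0 \<in> wedge th" by (rule subsetD[OF r(2) y0(1)])
  have "?f y0 > 0"
    using wedge_facts(4)[OF yw0] Re_prod_arg_wedge(2)[OF yw0 order_refl] by (simp only: min_less_iff_conj diff_gt_0_iff_gt simp_thms)
  moreover have "?f y0 * t \<le> Re (prod_arg th y t) - 1" if y: "y \<in> cball a r" and t: "t > 1" for y t
  proof -
    have yw: "y \<in> wedge th" by (rule subsetD[OF r(2) y])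
    have 1: "?f y0 \<le> cosh (Re y) * cos (Im y - th) - 1" "?f y0 \<le> cosh (Re y) * (sin th * sin (Im y))"
      using y0(2)[rule_format, OF y] by (simp_all only: min.bounded_iff)
    have "?f y0 * t = ?f y0 + (t - 1) * ?f y0" by (simp add: algebra_simps)
    also have "\<dots> \<le> (cosh (Re y) * cos (Im y - th) - 1) + (t - 1) * (cosh (Re y) * (sin th * sin (Im y)))"
      using t by (intro add_mono mult_left_mono 1) auto
    finally show ?thesis using Re_prod_arg_wedge(1)[OF yw] t by simp
  qed
  moreover have "norm (prod_arg th y t) \<le> ?g y1 * t" if y: "y \<in> cball a r" and t: "t > 1" for y t
    by (rule order_trans[OF norm_prod_arg_le mult_right_mono[OF y1[rule_format, OF y]]]) (use t in auto)
  ultimately show ?thesis by (rule that[OF r])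
qed

lemma continuous_on_gegJ_prod_arg:
  assumes "\<And>t. t > 1 \<Longrightarrow> Re (prod_arg th a t) > 1"
  shows "continuous_on {1<..} (\<lambda>t. gegJ (prod_arg th a t))" "continuous_on {1<..} (\<lambda>t. gegJ' (prod_arg th a t))"
proof -
  have D: "prod_arg th a t \<in> cut_plane_D" if "t \<in> {1<..}" for t using assms[of t] that by (simp add: mem_cut_plane_D)
  have "continuous_on cut_plane_D gegJ" "continuous_on cut_plane_D gegJ'"
    by (intro continuous_at_imp_continuous_on ballI DERIV_isCont[OF has_derivative_gegJ] DERIV_isCont[OF has_derivative_gegJ'], assumption)+
  moreover have "continuous_on {1<..} (prod_arg th a)" unfolding prod_arg_def by (intro continuous_intros)
  ultimately show "continuous_on {1<..} (\<lambda>t. gegJ (prod_arg th a t))" "continuous_on {1<..} (\<lambda>t. gegJ' (prod_arg th a t))"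
    using D by (auto intro!: continuous_on_compose2[where f = "prod_arg th a" and s = "{1<..}"])
qed

text \<open>As a function of a, the integral satisfies the same equation as Laplace's integral. Here
  the operator applied to the integrand is \<open>sb / sinh a\<close> times the t-derivative of (t^2
  - 1)^\<alpha> J'(w), and the equation that makes this work is Gegenbauer's for J at w.\<close>

lemma prodG_derivatives:
  assumes a: "a \<in> wedge th"
  shows integrable_prodG: "integrable (lborel_gt 1) (\<lambda>t. gegJ (prod_arg th a t) * gweight \<alpha> t)"
    and integrable_prodG': "integrable (lborel_gt 1) (\<lambda>t. gegJ' (prod_arg th a t) * prod_arg' th a t * gweight \<alpha> t)"
    and has_derivative_prodG: "(prodG th has_field_derivative prodG' th a) (at a)"
    and has_derivative_prodG': "(prodG' th has_field_derivative
          (l * mu * prodG th a - 2 * \<alpha> * cosh a / sinh a * prodG' th a)) (at a)"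
proof -
  define J2 where "J2 = (\<lambda>z. (l * mu * gegJ z - (2 * \<alpha> + 1) * z * gegJ' z) / (z\<^sup>2 - 1))"
  define f where "f = (\<lambda>a t. gegJ (prod_arg th a t) * gweight \<alpha> t)"
  define f' where "f' = (\<lambda>a t. gegJ' (prod_arg th a t) * prod_arg' th a t * gweight \<alpha> t)"
  define f'' where "f'' = (\<lambda>a t. (J2 (prod_arg th a t) * (prod_arg' th a t)\<^sup>2 + gegJ' (prod_arg th a t) * prod_arg th a t) * gweight \<alpha> t)"
  obtain r \<delta> d where r: "r > 0" "cball a r \<subseteq> wedge th" "\<delta> > 0"
    and bds: "\<And>y t. y \<in> cball a r \<Longrightarrow> t > 1 \<Longrightarrow> \<delta> * t \<le> Re (prod_arg th y t) - 1"
    "\<And>y t. y \<in> cball a r \<Longrightarrow> t > 1 \<Longrightarrow> norm (prod_arg th y t) \<le> d * t"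
    using prod_arg_local_bounds[OF a] by metis
  have sub: "y \<in> wedge th" if "y \<in> ball a r" for y using r(2) that by auto
  have wD: "prod_arg th y t \<in> cut_plane_D" if "y \<in> wedge th" "t \<in> space (lborel_gt 1)" for y t
    using Re_prod_arg_wedge(3)[OF that(1), of t] that(2) by (simp add: mem_cut_plane_D)
  have dw: "((\<lambda>a. prod_arg th a t) has_field_derivative prod_arg' th y t) (at y)" for y t
    unfolding prod_arg_def prod_arg'_def by (auto intro!: derivative_eq_intros)
  have dw': "((\<lambda>a. prod_arg' th a t) has_field_derivative prod_arg th y t) (at y)" for y t
    unfolding prod_arg_def prod_arg'_def by (auto intro!: derivative_eq_intros)
  have der: "((\<lambda>y. f y t) has_field_derivative f' y t) (at y)" if "y \<in> wedge th" "t \<in> space (lborel_gt 1)" for y t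
    unfolding f_def f'_def
    by (rule DERIV_cmult_right, rule DERIV_chain2[OF has_derivative_gegJ[OF wD[OF that]] dw])
  have der': "((\<lambda>y. f' y t) has_field_derivative f'' y t) (at y)" if "y \<in> wedge th" "t \<in> space (lborel_gt 1)" for y t
    unfolding f'_def f''_def J2_def
    by (rule DERIV_cmult_right, rule DERIV_cong[OF DERIV_mult[OF DERIV_chain2[OF has_derivative_gegJ'[OF wD[OF that]] dw] dw']])
       (simp add: algebra_simps power2_eq_square)
  have meas: "f y \<in> borel_measurable (lborel_gt 1)" if "y \<in> wedge th" for y
    unfolding f_def
    by (intro measurable_lborel_gt_continuous continuous_on_mult continuous_on_gweight continuous_on_gegJ_prod_arg Re_prod_arg_wedge(3)[OF that]) simp
  obtain g where g: "integrable (lborel_gt 1) g"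
    "\<And>w t. t > 1 \<Longrightarrow> Re w > 1 \<Longrightarrow> \<delta> * (t - 1) \<le> Re w - 1 \<Longrightarrow> \<delta> * t \<le> Re w \<Longrightarrow> norm w \<le> d * t \<Longrightarrow>
       norm (gegJ w * gweight \<alpha> t) \<le> g t"
    using gegJ_dominated[OF r(3)] by metis
  have bd: "norm (f y t) \<le> g t" if "y \<in> ball a r" "t \<in> space (lborel_gt 1)" for y t
  proof -
    have y: "y \<in> cball a r" and t: "t > 1" using that by auto
    have "\<delta> * (t - 1) \<le> \<delta> * t" using r(3) by (intro mult_left_mono) auto
    then show ?thesis
      unfolding f_def using bds[OF y t] Re_prod_arg_wedge(3)[OF sub[OF that(1)], of t] t by (intro g(2)) linarith+
  qed
  have aball: "a \<in> ball a r" using r by simp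
  note P = param_integral_derivative[OF open_ball aball der[OF sub] meas[OF sub] g(1) bd]
  note P2 = param_integral_derivative2[OF open_ball aball der[OF sub] der'[OF sub] meas[OF sub] g(1) bd]
  have if0: "integrable (lborel_gt 1) (f a)"
    by (rule Bochner_Integration.integrable_bound[OF g(1) meas[OF a]], rule AE_I2)
       (use bd[OF aball] in \<open>auto intro: order_trans[OF _ abs_ge_self]\<close>)
  then show "integrable (lborel_gt 1) (\<lambda>t. gegJ (prod_arg th a t) * gweight \<alpha> t)" unfolding f_def .
  have if1: "integrable (lborel_gt 1) (f' a)" by (rule P(1))
  then show "integrable (lborel_gt 1) (\<lambda>t. gegJ' (prod_arg th a t) * prod_arg' th a t * gweight \<alpha> t)" unfolding f'_def .
  have if2: "integrable (lborel_gt 1) (f'' a)" by (rule P2(1))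
  have L0: "prodG th y = (\<integral>t. f y t \<partial>lborel_gt 1)" for y by (simp add: prodG_def f_def)
  have L1: "prodG' th y = (\<integral>t. f' y t \<partial>lborel_gt 1)" for y by (simp add: prodG'_def f'_def)
  show "(prodG th has_field_derivative prodG' th a) (at a)"
    using P(2) unfolding L0 [abs_def] L1 .
  have D2: "(prodG' th has_field_derivative (\<integral>t. f'' a t \<partial>lborel_gt 1)) (at a)"
    using P2(2) unfolding L1 [abs_def] .
  have sa: "sinh a \<noteq> 0" using a wedge_subset half_strip_subset sinh_nonzero by blast
  have sth: "sin th > 0" using wedge_facts[OF a] pi_gt_zero by (intro sin_gt_zero) linarith+
  \<comment> \<open>The value of sinh b at b = -i\<theta>; \<open>cb\<close> below is cosh b, and w
    = cb cosh a + t sb sinh a.\<close>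
  define sb where "sb = - \<i> * complex_of_real (sin th)"
  have sb: "sb \<noteq> 0" using sth by (simp add: sb_def)
  define h where "h = (\<lambda>t. (2 * \<alpha> * of_real t * gegJ' (prod_arg th a t) + of_real (t\<^sup>2 - 1) * J2 (prod_arg th a t) * (sinh a * sb)) * gweight \<alpha> t)"
  have id: "f'' a t + 2 * \<alpha> * cosh a / sinh a * f' a t - l * mu * f a t = (sb / sinh a) * h t"
    if t: "t \<in> space (lborel_gt 1)" for t
  proof -
    let ?w = "prod_arg th a t" and ?w' = "prod_arg' th a t" and ?s = "sinh a" and ?c = "cosh a" and ?T = "complex_of_real t" and ?g = "gweight \<alpha> t"
    define cb where "cb = complex_of_real (cos th)"
    define Ja Jb Jc where "Ja = gegJ ?w" and "Jb = gegJ' ?w" and "Jc = J2 ?w"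
    have cs: "?c\<^sup>2 = 1 + ?s\<^sup>2" using hyperbolic_pythagoras[of a] by (simp add: algebra_simps)
    have cbs: "cb\<^sup>2 = 1 + sb\<^sup>2"
    proof -
      have "sb\<^sup>2 = - (of_real (sin th))\<^sup>2" by (simp add: sb_def power_mult_distrib)
      then show ?thesis using sin_cos_squared_add[of "complex_of_real th"] by (simp add: cb_def sin_of_real cos_of_real eq_diff_eq add.commute)
    qed
    have w: "?w = cb * ?c + sb * ?T * ?s" "?w' = cb * ?s + sb * ?T * ?c" by (simp_all add: prod_arg_def prod_arg'_def cb_def sb_def)
    \<comment> \<open>With w' the a-derivative of w, this identity lets J''(w) occur only with the
      factor w^2 - 1, removed by Gegenbauer's equation, and with t^2 - 1, which belongs to the total
      derivative. The next one does the same for the first-order terms.\<close>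
    have w2: "?w'\<^sup>2 = ?w\<^sup>2 - 1 + sb\<^sup>2 * (?T\<^sup>2 - 1)"
    proof -
      have "?w'\<^sup>2 - ?w\<^sup>2 = (?c\<^sup>2 - ?s\<^sup>2) * (sb\<^sup>2 * ?T\<^sup>2 - cb\<^sup>2)" unfolding w by (simp add: algebra_simps power2_eq_square)
      also have "\<dots> = sb\<^sup>2 * ?T\<^sup>2 - 1 - sb\<^sup>2" unfolding cs cbs by simp
      finally show ?thesis by (simp add: algebra_simps)
    qed
    have cw: "?c * ?w' - ?s * ?w = sb * ?T"
    proof -
      have "?c * ?w' - ?s * ?w = sb * ?T * (?c\<^sup>2 - ?s\<^sup>2)" unfolding w by (simp add: algebra_simps power2_eq_square)
      then show ?thesis unfolding cs by simp
    qed
    have ode: "(?w\<^sup>2 - 1) * Jc = l * mu * Ja - (2 * \<alpha> + 1) * ?w * Jb"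
      unfolding Jc_def J2_def Ja_def Jb_def using cut_plane_D_facts(3)[OF wD[OF a t]] by simp
    have T: "of_real (t\<^sup>2 - 1) = ?T\<^sup>2 - 1" by simp
    have "(f'' a t + 2 * \<alpha> * ?c / ?s * f' a t - l * mu * f a t) * ?s =
        ?g * (((?w\<^sup>2 - 1) * Jc + sb\<^sup>2 * (?T\<^sup>2 - 1) * Jc + Jb * ?w) * ?s + 2 * \<alpha> * (?c * ?w') * Jb - l * mu * Ja * ?s)"
      unfolding f_def f'_def f''_def w2 Ja_def [symmetric] Jb_def [symmetric] Jc_def [symmetric] using sa
      by (simp add: field_simps)
    also have "?c * ?w' = sb * ?T + ?s * ?w" using cw by (simp add: algebra_simps)
    also have "?g * (((?w\<^sup>2 - 1) * Jc + sb\<^sup>2 * (?T\<^sup>2 - 1) * Jc + Jb * ?w) * ?s + 2 * \<alpha> * (sb * ?T + ?s * ?w) * Jb - l * mu * Ja * ?s) =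
        sb * h t"
      unfolding ode h_def T Jb_def [symmetric] Jc_def [symmetric] by (simp add: algebra_simps power2_eq_square)
    finally have "(f'' a t + 2 * \<alpha> * ?c / ?s * f' a t - l * mu * f a t) * ?s = sb * h t" .
    then show ?thesis unfolding times_divide_eq_left nonzero_eq_divide_eq[OF sa] .
  qed
  have "integrable (lborel_gt 1) (\<lambda>t. (sinh a / sb) * (f'' a t + 2 * \<alpha> * cosh a / sinh a * f' a t - l * mu * f a t))"
    by (intro Bochner_Integration.integrable_mult_right Bochner_Integration.integrable_add Bochner_Integration.integrable_diff if0 if1 if2)
  moreover have "(sinh a / sb) * (f'' a t + 2 * \<alpha> * cosh a / sinh a * f' a t - l * mu * f a t) = h t" if "t \<in> space (lborel_gt 1)" for t
    unfolding id[OF that] using sa sb by simp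
  ultimately have hint: "integrable (lborel_gt 1) h"
    using Bochner_Integration.integrable_cong[of "lborel_gt 1" "lborel_gt 1"
        "\<lambda>t. (sinh a / sb) * (f'' a t + 2 * \<alpha> * cosh a / sinh a * f' a t - l * mu * f a t)" h] by blast
  have Re1: "Re (prod_arg th a t) > 1" if "t \<ge> 1" for t using Re_prod_arg_wedge(3)[OF a that] .
  have J2c: "continuous_on {1<..} (\<lambda>t. J2 (prod_arg th a t))"
    unfolding J2_def
  proof (intro continuous_on_divide continuous_on_diff continuous_on_mult continuous_on_const continuous_on_gegJ_prod_arg continuous_on_power ballI)
    show "continuous_on {1<..} (prod_arg th a)" unfolding prod_arg_def by (intro continuous_intros)
    then show "continuous_on {1<..} (prod_arg th a)" .
    show "(prod_arg th a t)\<^sup>2 - 1 \<noteq> 0" if "t \<in> {1<..}" for t using cut_plane_D_facts(3)[OF wD[OF a]] that by simp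
  qed (use Re1 in auto)
  define H where "H = (\<lambda>t. of_real (t\<^sup>2 - 1) powr \<alpha> * gegJ' (prod_arg th a t))"
  have Hn: "norm (H t) = (t\<^sup>2 - 1) powr Re \<alpha> * norm (gegJ' (prod_arg th a t))" if "t > 1" for t
    unfolding H_def norm_mult norm_of_real_powr[OF square_minus_1_pos[OF that]] ..
  have "(\<integral>t. h t \<partial>lborel_gt 1) = 0"
  proof (rule integral_total_derivative_eq_0[where H = H])
    show "continuous_on {1<..} h"
      unfolding h_def
      by (intro continuous_on_mult continuous_on_add continuous_on_const continuous_on_of_real continuous_on_id continuous_on_diff
          continuous_on_power continuous_on_gweight continuous_on_gegJ_prod_arg J2c Re1) simp
    show "integrable (lborel_gt 1) h" by (rule hint)
    show "(H has_vector_derivative h t) (at t)" if t: "t > 1" for t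
    proof -
      let ?pa = "\<lambda>z. of_real (cos th) * cosh a - \<i> * of_real (sin th) * z * sinh a"
      let ?H = "\<lambda>z. (z\<^sup>2 - 1) powr \<alpha> * gegJ' (?pa z)"
      have np: "(complex_of_real t)\<^sup>2 - 1 \<notin> \<real>\<^sub>\<le>\<^sub>0"
        using square_minus_1_pos[OF t] by (simp add: complex_nonpos_Reals_iff power2_eq_square)
      have pa: "((complex_of_real t)\<^sup>2 - 1) powr \<alpha> = of_real (t\<^sup>2 - 1) * gweight \<alpha> t"
        using square_minus_1_pos[OF t] powr_add[of "complex_of_real (t\<^sup>2 - 1)" "\<alpha> - 1" 1]
        by (simp add: gweight_def mult.commute)
      have pb: "((complex_of_real t)\<^sup>2 - 1) powr (\<alpha> - 1) = gweight \<alpha> t" by (simp add: gweight_def)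
      have d1: "((\<lambda>z. (z\<^sup>2 - 1) powr \<alpha>) has_field_derivative (\<alpha> * gweight \<alpha> t * (2 * of_real t))) (at (complex_of_real t))"
        by (rule derivative_eq_intros refl np)+ (simp add: pb)
      have d2: "(?pa has_field_derivative (sinh a * sb)) (at (complex_of_real t))"
        by (rule derivative_eq_intros refl)+ (simp add: sb_def)
      have wt: "?pa (of_real t) \<in> cut_plane_D" using wD[OF a, of t] t by (simp add: prod_arg_def)
      have "(?H has_field_derivative (\<alpha> * gweight \<alpha> t * (2 * of_real t) * gegJ' (?pa (of_real t)) +
          (J2 (?pa (of_real t)) * (sinh a * sb)) * ((complex_of_real t)\<^sup>2 - 1) powr \<alpha>)) (at (of_real t))"
        unfolding J2_def by (rule DERIV_mult[OF d1 DERIV_chain2[OF has_derivative_gegJ'[OF wt] d2]])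
      moreover have "\<alpha> * gweight \<alpha> t * (2 * of_real t) * gegJ' (?pa (of_real t)) +
          (J2 (?pa (of_real t)) * (sinh a * sb)) * ((complex_of_real t)\<^sup>2 - 1) powr \<alpha> = h t"
        unfolding pa h_def prod_arg_def by (simp add: algebra_simps)
      ultimately have "(?H has_field_derivative h t) (at (of_real t))" by (simp only:)
      from has_vector_derivative_real_field[OF this] show ?thesis
        by (simp add: H_def prod_arg_def)
    qed
    show "(H \<longlongrightarrow> 0) (at_right 1)"
    proof (rule tendsto_norm_zero_cancel)
      have w1: "prod_arg th a 1 \<in> cut_plane_D" using Re1[of 1] by (simp add: mem_cut_plane_D)
      have "((\<lambda>t. prod_arg th a t) \<longlongrightarrow> prod_arg th a 1) (at_right 1)"
        unfolding prod_arg_def by (intro tendsto_intros)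
      then have T1: "((\<lambda>t. gegJ' (prod_arg th a t)) \<longlongrightarrow> gegJ' (prod_arg th a 1)) (at_right 1)"
        by (rule isCont_tendsto_compose[OF DERIV_isCont[OF has_derivative_gegJ'[OF w1]]])
      have T2: "((\<lambda>t::real. (t\<^sup>2 - 1) powr Re \<alpha>) \<longlongrightarrow> (1\<^sup>2 - 1) powr Re \<alpha>) (at_right 1)"
        using Re_alpha
        by (intro tendsto_intros tendsto_powr2) (auto intro!: eventually_at_rightI[of 1 2] simp: power2_eq_square less_1_mult less_imp_le)
      have "((\<lambda>t. (t\<^sup>2 - 1) powr Re \<alpha> * norm (gegJ' (prod_arg th a t))) \<longlongrightarrow> (1\<^sup>2 - 1) powr Re \<alpha> * norm (gegJ' (prod_arg th a 1))) (at_right 1)"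
        by (rule tendsto_mult[OF T2 tendsto_norm[OF T1]])
      then have "((\<lambda>t. (t\<^sup>2 - 1) powr Re \<alpha> * norm (gegJ' (prod_arg th a t))) \<longlongrightarrow> 0) (at_right 1)" by simp
      then show "((\<lambda>t. norm (H t)) \<longlongrightarrow> 0) (at_right 1)"
        by (rule Lim_transform_eventually) (rule eventually_at_rightI[of 1 2], use Hn in auto)
    qed
    show "(H \<longlongrightarrow> 0) at_top"
    proof -
      obtain M where M: "\<And>w t. t > 1 \<Longrightarrow> Re w > 1 \<Longrightarrow> norm w \<ge> 2 \<Longrightarrow> \<delta> * t \<le> norm w \<Longrightarrow> norm w \<le> d * t \<Longrightarrow> norm (gegJ' w) \<le> M * t powr (- Re mu - 1)"
        using gegJ'_bound_right_half_plane[OF r(3)] by metis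
      \<comment> \<open>The condition t >= 2 / \<delta> makes |w| >= 2, where the bound on J' holds;
        the exponents combine to - Re l - 1 as for Laplace's integral.\<close>
      have "norm (H t) \<le> M * t powr (- Re l - 1)" if t: "t > 1" "t \<ge> 2 / \<delta>" for t
      proof -
        have ac: "a \<in> cball a r" using r by simp
        have "\<delta> * t \<le> norm (prod_arg th a t)" using bds(1)[OF ac t(1)] complex_Re_le_cmod[of "prod_arg th a t"] by linarith
        moreover have "2 \<le> \<delta> * t" using t(2) r(3) by (simp add: divide_le_eq mult.commute)
        ultimately have J: "norm (gegJ' (prod_arg th a t)) \<le> M * t powr (- Re mu - 1)"
          using t(1) bds(2)[OF ac t(1)] Re1[of t] by (intro M) linarith+
        have "(t\<^sup>2 - 1) powr Re \<alpha> \<le> (t\<^sup>2) powr Re \<alpha>" using square_minus_1_pos[OF t(1)] Re_alpha by (intro powr_mono2) auto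
        also have "(t\<^sup>2) powr Re \<alpha> = t powr (2 * Re \<alpha>)"
        proof -
          have "t\<^sup>2 = t powr 2" using t by (simp add: powr_numeral)
          then show ?thesis by (simp only: powr_powr)
        qed
        finally have "norm (H t) \<le> t powr (2 * Re \<alpha>) * (M * t powr (- Re mu - 1))"
          unfolding Hn[OF t(1)] by (intro mult_mono J) auto
        also have "\<dots> = M * t powr (2 * Re \<alpha> + (- Re mu - 1))" by (simp add: powr_add)
        also have "2 * Re \<alpha> + (- Re mu - 1) = - Re l - 1" by (simp add: mu_def)
        finally show ?thesis .
      qed
      then have ev: "eventually (\<lambda>t. norm (H t) \<le> M * t powr (- Re l - 1)) at_top"
        by (intro eventually_mono[OF eventually_conj[OF eventually_gt_at_top[of 1] eventually_ge_at_top[of "2 / \<delta>"]]]) auto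
      have "((\<lambda>t::real. t powr (- Re l - 1)) \<longlongrightarrow> 0) at_top"
        using Re_l by (intro tendsto_neg_powr filterlim_ident) auto
      then have "((\<lambda>t. M * t powr (- Re l - 1)) \<longlongrightarrow> 0) at_top" by (rule tendsto_mult_right_zero)
      with ev show ?thesis by (rule Lim_null_comparison)
    qed
  qed
  then have "0 = (\<integral>t. (sb / sinh a) * h t \<partial>lborel_gt 1)" by simp
  also have "\<dots> = (\<integral>t. f'' a t + 2 * \<alpha> * cosh a / sinh a * f' a t - l * mu * f a t \<partial>lborel_gt 1)"
    by (rule Bochner_Integration.integral_cong[OF refl id [symmetric]])
  also have "\<dots> = (\<integral>t. f'' a t \<partial>lborel_gt 1) + 2 * \<alpha> * cosh a / sinh a * prodG' th a - l * mu * prodG th a"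
    unfolding L0 L1 using if0 if1 if2 by simp
  finally have "(\<integral>t. f'' a t \<partial>lborel_gt 1) = l * mu * prodG th a - 2 * \<alpha> * cosh a / sinh a * prodG' th a"
  proof -
    have "0 = Z + a - c \<Longrightarrow> Z = c - a" for Z a c :: complex by (simp add: algebra_simps)
    then show "0 = (\<integral>t. f'' a t \<partial>lborel_gt 1) + 2 * \<alpha> * cosh a / sinh a * prodG' th a - l * mu * prodG th a \<Longrightarrow> ?thesis" .
  qed
  with D2 show "(prodG' th has_field_derivative (l * mu * prodG th a - 2 * \<alpha> * cosh a / sinh a * prodG' th a)) (at a)"
    by simp
qed

text \<open>On the ray the real part is cosh r (1 - s + t s) with s = sin^2 \<theta>. Unlike the
  bounds in the wedge, these estimates include r = 0.\<close>

lemma norm_prod_arg_ray: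
  fixes th r t :: real
  assumes th: "0 < th" "th < pi / 2" and r: "r \<ge> 0" and t: "t \<ge> 1"
  defines "b \<equiv> complex_of_real r + \<i> * of_real th" and "s \<equiv> (sin th)\<^sup>2"
  shows "Re (prod_arg th b t) = cosh r * ((1 - s) + t * s)" "0 < s" "s < 1"
    "s * (t - 1) \<le> Re (prod_arg th b t) - 1" "s * t \<le> Re (prod_arg th b t)"
    "s / 2 * (exp r * t) \<le> norm (prod_arg th b t)" "norm (prod_arg th b t) \<le> 2 * (exp r * t)"
proof -
  have c: "(cos th)\<^sup>2 = 1 - s" by (simp add: s_def cos_squared_eq)
  have "0 < sin th" using th pi_gt_zero by (intro sin_gt_zero) linarith+
  then show s0: "0 < s" by (simp add: s_def)
  have "0 < cos th" using th by (intro cos_gt_zero_pi) linarith+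
  then have "0 < (cos th)\<^sup>2" by simp
  then show s1: "s < 1" using c by simp
  have "Re (prod_arg th b t) = cosh r * (cos th * cos th + t * (sin th * sin th))"
    by (simp add: Re_prod_arg b_def)
  then show 1: "Re (prod_arg th b t) = cosh r * ((1 - s) + t * s)"
    unfolding power2_eq_square [symmetric] c s_def [symmetric] .
  have pos: "(1 - s) + t * s \<ge> 1"
  proof -
    have "0 \<le> (t - 1) * s" using t s0 by simp
    then show ?thesis by (simp add: algebra_simps)
  qed
  have le: "(1 - s) + t * s \<le> Re (prod_arg th b t)"
    unfolding 1 using pos cosh_real_ge_1[of r] mult_right_mono[of 1 "cosh r" "(1 - s) + t * s"] by simp
  then show "s * (t - 1) \<le> Re (prod_arg th b t) - 1" "s * t \<le> Re (prod_arg th b t)"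
    using s1 by (simp_all add: algebra_simps)
  have "exp r / 2 \<le> cosh r" by (simp add: cosh_field_def)
  moreover have "s * t \<le> (1 - s) + t * s" using s1 by (simp add: mult.commute)
  ultimately have "exp r / 2 * (s * t) \<le> cosh r * ((1 - s) + t * s)"
    using s0 t by (intro mult_mono) auto
  then show "s / 2 * (exp r * t) \<le> norm (prod_arg th b t)"
  proof -
    have "s / 2 * (exp r * t) = exp r / 2 * (s * t)" by simp
    then show "exp r / 2 * (s * t) \<le> cosh r * ((1 - s) + t * s) \<Longrightarrow> ?thesis"
      using complex_Re_le_cmod[of "prod_arg th b t"] unfolding 1 by linarith
  qed
  have "norm (cosh b) \<le> exp r"
  proof -
    have "norm (exp b + exp (- b)) \<le> exp r + exp (- r)"
      using norm_triangle_ineq[of "exp b" "exp (- b)"] by (simp add: b_def)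
    moreover have "exp (- r) \<le> exp r" using r by simp
    ultimately have "norm (exp b + exp (- b)) \<le> 2 * exp r" by linarith
    then show ?thesis by (simp add: cosh_field_def norm_divide)
  qed
  moreover have "norm (sinh b) \<le> exp r" using norm_sinh_le[of b] r by (simp add: b_def)
  ultimately have "(norm (cosh b) + norm (sinh b)) * t \<le> (2 * exp r) * t" using t by (intro mult_right_mono) auto
  then show "norm (prod_arg th b t) \<le> 2 * (exp r * t)" using norm_prod_arg_le[OF t, of th b] by simp
qed

text \<open>With a = r + i\<theta>, 2 w e^(-a) tends to cosh b + t sinh b at b = -i\<theta>. So
  e^(\<mu> a) J(w) tends to 1 / \<Gamma>(l + \<alpha> + 1) times the Laplace integrand at
  -i\<theta>, which is where the second factor of the product formula comes from.\<close>

lemma prodG_asymptotics: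
  fixes th :: real
  assumes th: "0 < th" "th < pi / 2"
  defines "b \<equiv> \<lambda>r::real. of_real r + \<i> * of_real th"
  obtains R C where "R \<ge> 7"
    "\<And>r. r > R \<Longrightarrow> norm (prodG th (b r)) \<le> C * exp (- Re mu * r)"
    "\<And>r. r > R \<Longrightarrow> norm (prodG' th (b r) + mu * prodG th (b r)) \<le> C * exp (- (Re mu + 2) * r)"
    "((\<lambda>r. exp (mu * b r) * prodG th (b r)) \<longlongrightarrow> rGamma (l + \<alpha> + 1) * laplaceI (- \<i> * of_real th)) at_top"
proof -
  define s m where "s = (sin th)\<^sup>2" and "m = Re mu"
  note P = norm_prod_arg_ray[OF th, folded s_def]
  have s: "0 < s" "s < 1" using P(2,3)[of 1 1] by auto
  \<comment> \<open>The 7 is the threshold for the other solution in the comparison,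
    \<open>gegJ (cosh a)\<close>. From r >= 4 / s follows s e^r >= 4, hence |w| >= (s / 2) e^r t >=
    2.\<close>
  define R where "R = max 7 (4 / s)"
  have R: "R \<ge> 7" by (simp add: R_def)
  have big: "norm (prod_arg th (b r) t) \<ge> 2" if "r \<ge> R" "t \<ge> 1" for r t
  proof -
    have "4 / s \<le> r" using that by (simp add: R_def)
    also have "r \<le> exp r" using exp_ge_add_one_self[of r] by linarith
    finally have "4 \<le> s * exp r" using s by (simp add: divide_le_eq mult.commute)
    then have "4 * 1 \<le> (s * exp r) * t" using that s by (intro mult_mono) auto
    then have "2 \<le> s / 2 * (exp r * t)" by simp
    also have "\<dots> \<le> norm (prod_arg th (b r) t)" unfolding b_def using that R by (intro P) auto
    finally show ?thesis .
  qed
  obtain M where M: "M \<ge> 0"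
    "\<And>z. z \<in> cut_plane_D \<Longrightarrow> norm z \<ge> 2 \<Longrightarrow> norm (gegJ z) \<le> M * norm z powr (- Re mu)"
    "\<And>z. z \<in> cut_plane_D \<Longrightarrow> norm z \<ge> 2 \<Longrightarrow> norm (z * gegJ' z + mu * gegJ z) \<le> M * norm z powr (- Re mu - 2)"
    "\<And>z. z \<in> cut_plane_D \<Longrightarrow> norm z \<ge> 2 \<Longrightarrow> norm (gegJ' z) \<le> M * norm z powr (- Re mu - 1)"
    using gegJ_bounds by metis
  define A where "A = (\<lambda>y::real. (s / 2) powr y + 2 powr y)"
  have A0: "A y \<ge> 0" for y by (simp add: A_def)
  have pw: "norm (prod_arg th (b r) t) powr y \<le> A y * (exp (y * r) * t powr y)" if "r \<ge> R" "t \<ge> 1" for r t y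
  proof -
    have r0: "r \<ge> 0" using that R by simp
    have "norm (prod_arg th (b r) t) powr y \<le> A y * (exp r * t) powr y"
      unfolding A_def b_def by (rule powr_between) (use P(6,7)[OF r0 that(2)] s that in auto)
    also have "(exp r * t) powr y = exp (y * r) * t powr y" using that by (simp add: powr_mult exp_powr_real mult.commute)
    finally show ?thesis .
  qed
  have mem: "b r \<in> wedge th" if "r \<ge> R" for r unfolding b_def using that R by (intro ray_in_wedge th) simp
  have wD: "prod_arg th (b r) t \<in> cut_plane_D" if "r \<ge> R" "t \<ge> 1" for r t
    using Re_prod_arg_wedge(3)[OF mem[OF that(1)] that(2)] by (simp add: mem_cut_plane_D)
  define k where "k = (\<lambda>t. t powr (- m) * (t\<^sup>2 - 1) powr (Re \<alpha> - 1))"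
  have k: "integrable (lborel_gt 1) k" unfolding k_def m_def by (rule integrable_gweight[OF Re_alpha Re_mu(1)])
  define N where "N = (\<integral>t. k t \<partial>lborel_gt 1)"
  have kpos: "k t \<ge> 0" for t by (simp add: k_def)
  have N: "N \<ge> 0" unfolding N_def by (intro integral_nonneg_AE AE_I2 kpos)
  have bd0: "norm (gegJ (prod_arg th (b r) t) * gweight \<alpha> t) \<le> (M * A (- m) * exp (- m * r)) * k t" if r: "r \<ge> R" and t: "t > 1" for r t
  proof -
    have t1: "t \<ge> 1" using t by simp
    have "norm (gegJ (prod_arg th (b r) t)) \<le> M * norm (prod_arg th (b r) t) powr (- m)"
      unfolding m_def by (rule M(2)[OF wD[OF r t1] big[OF r t1]])
    also have "\<dots> \<le> M * (A (- m) * (exp (- m * r) * t powr (- m)))" by (intro mult_left_mono pw r t1 M)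
    finally have "norm (gegJ (prod_arg th (b r) t)) * (t\<^sup>2 - 1) powr (Re \<alpha> - 1) \<le> M * (A (- m) * (exp (- m * r) * t powr (- m))) * (t\<^sup>2 - 1) powr (Re \<alpha> - 1)"
      by (rule mult_right_mono) simp
    then show ?thesis unfolding norm_mult norm_gweight[OF t] k_def by (simp only: mult_ac)
  qed
  have 1: "norm (prodG th (b r)) \<le> (M * A (- m) * N) * exp (- m * r)" if r: "r \<ge> R" for r
  proof -
    have "norm (prodG th (b r)) \<le> (\<integral>t. (M * A (- m) * exp (- m * r)) * k t \<partial>lborel_gt 1)"
      unfolding prodG_def
      by (rule norm_integral_le[OF integrable_prodG[OF mem[OF r]] Bochner_Integration.integrable_mult_right[OF k] bd0[OF r]]) simp
    also have "\<dots> = (M * A (- m) * exp (- m * r)) * N" unfolding N_def by (rule Bochner_Integration.integral_mult_right_zero)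
    finally show ?thesis by (simp only: mult_ac)
  qed
  have 2: "norm (prodG' th (b r) + mu * prodG th (b r)) \<le> ((M * A (- m - 2) + 2 * M * A (- m - 1)) * N) * exp (- (m + 2) * r)" if r: "r \<ge> R" for r
  proof -
    define f f' where "f = (\<lambda>t. gegJ (prod_arg th (b r) t) * gweight \<alpha> t)"
      and "f' = (\<lambda>t. gegJ' (prod_arg th (b r) t) * prod_arg' th (b r) t * gweight \<alpha> t)"
    have int: "integrable (lborel_gt 1) f" "integrable (lborel_gt 1) f'"
      unfolding f_def f'_def by (rule integrable_prodG[OF mem[OF r]], rule integrable_prodG'[OF mem[OF r]])
    have L: "prodG' th (b r) + mu * prodG th (b r) = (\<integral>t. f' t + mu * f t \<partial>lborel_gt 1)"
    proof -
      have "prodG th (b r) = (\<integral>t. f t \<partial>lborel_gt 1)" "prodG' th (b r) = (\<integral>t. f' t \<partial>lborel_gt 1)"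
        by (simp_all only: prodG_def prodG'_def f_def f'_def)
      then show ?thesis using int by simp
    qed
    have "norm (\<integral>t. f' t + mu * f t \<partial>lborel_gt 1) \<le> (\<integral>t. ((M * A (- m - 2) + 2 * M * A (- m - 1)) * exp (- (m + 2) * r)) * k t \<partial>lborel_gt 1)"
    proof (rule norm_integral_le)
      show "integrable (lborel_gt 1) (\<lambda>t. f' t + mu * f t)" using int by simp
      show "integrable (lborel_gt 1) (\<lambda>t. ((M * A (- m - 2) + 2 * M * A (- m - 1)) * exp (- (m + 2) * r)) * k t)"
        by (intro Bochner_Integration.integrable_mult_right k)
      fix t assume "t \<in> space (lborel_gt 1)"
      then have t: "t > 1" and t1: "t \<ge> 1" by auto
      let ?w = "prod_arg th (b r) t" and ?w' = "prod_arg' th (b r) t"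
      have Rb: "Re (b r) \<ge> 1" using r R by (simp add: b_def)
      \<comment> \<open>The difference w' - w contains the factor cosh a - sinh a = e^(-a). Hence
        J'(w) w' + \<mu> J(w) splits into the combination bounded in \<open>gegJ_bounds\<close> and
        a term that is smaller by e^(-2r) as well.\<close>
      have dw: "norm (?w' - ?w) \<le> exp (- r) * (2 * t)"
      proof -
        have "?w' - ?w = (cosh (b r) - sinh (b r)) * - (of_real (cos th) + \<i> * of_real (sin th) * of_real t)"
          by (simp add: prod_arg_def prod_arg'_def algebra_simps)
        also have "norm \<dots> = exp (- Re (b r)) * norm (of_real (cos th) + \<i> * of_real (sin th) * of_real t)"
          by (simp only: norm_mult norm_minus_cancel cosh_bounds(3)[OF Rb])
        also have "norm (of_real (cos th) + \<i> * of_real (sin th) * of_real t) \<le> \<bar>cos th\<bar> + \<bar>sin th\<bar> * t"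
          using t by (intro order_trans[OF norm_triangle_ineq]) (simp add: norm_mult)
        also have "\<dots> \<le> 1 + 1 * t" using t by (intro add_mono mult_right_mono) auto
        also have "\<dots> \<le> 2 * t" using t by simp
        finally show ?thesis by (simp add: b_def)
      qed
      have "norm (gegJ' ?w * ?w' + mu * gegJ ?w) = norm ((?w * gegJ' ?w + mu * gegJ ?w) + gegJ' ?w * (?w' - ?w))"
        by (simp add: algebra_simps)
      also have "\<dots> \<le> norm (?w * gegJ' ?w + mu * gegJ ?w) + norm (gegJ' ?w) * norm (?w' - ?w)"
        by (rule order_trans[OF norm_triangle_ineq]) (simp add: norm_mult)
      also have "\<dots> \<le> M * norm ?w powr (- m - 2) + (M * norm ?w powr (- m - 1)) * (exp (- r) * (2 * t))"
        unfolding m_def using M(1) by (intro add_mono mult_mono M wD[OF r t1] big[OF r t1] dw) auto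
      also have "\<dots> \<le> M * (A (- m - 2) * (exp ((- m - 2) * r) * t powr (- m - 2))) + (M * (A (- m - 1) * (exp ((- m - 1) * r) * t powr (- m - 1)))) * (exp (- r) * (2 * t))"
        using t by (intro add_mono mult_right_mono mult_left_mono pw r t1 M) auto
      also have "\<dots> = M * A (- m - 2) * exp ((- m - 2) * r) * t powr (- m - 2) + 2 * M * A (- m - 1) * (exp ((- m - 1) * r) * exp (- r)) * (t powr (- m - 1) * t)"
        by (simp only: mult_ac)
      also have "exp ((- m - 1) * r) * exp (- r) = exp (- (m + 2) * r)" by (simp add: exp_add [symmetric] algebra_simps)
      also have "t powr (- m - 1) * t = t powr (- m)" using t by (simp add: powr_diff)
      also have "M * A (- m - 2) * exp ((- m - 2) * r) * t powr (- m - 2) \<le> M * A (- m - 2) * exp (- (m + 2) * r) * t powr (- m)"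
        using t M(1) A0 by (intro mult_mono powr_mono) (auto simp: algebra_simps)
      finally have "norm (gegJ' ?w * ?w' + mu * gegJ ?w) \<le> (M * A (- m - 2) + 2 * M * A (- m - 1)) * exp (- (m + 2) * r) * t powr (- m)"
        by (simp add: algebra_simps)
      then have "norm (gegJ' ?w * ?w' + mu * gegJ ?w) * (t\<^sup>2 - 1) powr (Re \<alpha> - 1) \<le> (M * A (- m - 2) + 2 * M * A (- m - 1)) * exp (- (m + 2) * r) * t powr (- m) * (t\<^sup>2 - 1) powr (Re \<alpha> - 1)"
        by (rule mult_right_mono) simp
      moreover have "f' t + mu * f t = (gegJ' ?w * ?w' + mu * gegJ ?w) * gweight \<alpha> t" by (simp add: f_def f'_def algebra_simps)
      ultimately show "norm (f' t + mu * f t) \<le> ((M * A (- m - 2) + 2 * M * A (- m - 1)) * exp (- (m + 2) * r)) * k t"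
        unfolding k_def by (simp only: norm_mult norm_gweight[OF t] mult.assoc)
    qed
    also have "\<dots> = ((M * A (- m - 2) + 2 * M * A (- m - 1)) * exp (- (m + 2) * r)) * N"
      unfolding N_def by (rule Bochner_Integration.integral_mult_right_zero)
    finally show ?thesis unfolding L by (simp only: mult_ac)
  qed
  define C where "C = M * A (- m) * N + (M * A (- m - 2) + 2 * M * A (- m - 1)) * N"
  have C: "M * A (- m) * N \<le> C" "(M * A (- m - 2) + 2 * M * A (- m - 1)) * N \<le> C"
    using M(1) N A0 by (simp_all add: C_def)
  define s0 where "s0 = (\<lambda>r t. exp (mu * b r) * (gegJ (prod_arg th (b r) t) * gweight \<alpha> t))"
  define sr where "sr = (\<lambda>r. s0 (max r R))"
  define f where "f = (\<lambda>t. rGamma (l + \<alpha> + 1) * (base (- \<i> * of_real th) t powr (- mu) * gweight \<alpha> t))"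
  have dom: "- \<i> * of_real th \<in> laplace_domain" using th pi_gt_zero by (simp add: mem_laplace_domain)
  have lim: "((\<lambda>r. \<integral>t. sr r t \<partial>lborel_gt 1) \<longlongrightarrow> (\<integral>t. f t \<partial>lborel_gt 1)) at_top"
  proof (rule integral_dominated_convergence_at_top[where w = "\<lambda>t. (M * A (- m) * exp (- Im mu * th)) * k t"])
    show "f \<in> borel_measurable (lborel_gt 1)"
      unfolding f_def by (intro borel_measurable_times borel_measurable_const borel_measurable_integrable[OF integrable_laplaceI[OF dom]])
    show "sr r \<in> borel_measurable (lborel_gt 1)" for r
      unfolding sr_def s0_def
      by (intro borel_measurable_times borel_measurable_const borel_measurable_integrable[OF integrable_prodG] mem) simp
    show "integrable (lborel_gt 1) (\<lambda>t. (M * A (- m) * exp (- Im mu * th)) * k t)"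
      by (intro Bochner_Integration.integrable_mult_right k)
    have "norm (s0 r t) \<le> (M * A (- m) * exp (- Im mu * th)) * k t" if r: "r \<ge> R" and t: "t > 1" for r t
    proof -
      have "norm (s0 r t) = exp (m * r - Im mu * th) * norm (gegJ (prod_arg th (b r) t) * gweight \<alpha> t)"
        unfolding s0_def norm_mult[of "exp (mu * b r)"] by (simp add: b_def m_def)
      also have "\<dots> \<le> exp (m * r - Im mu * th) * ((M * A (- m) * exp (- m * r)) * k t)"
        by (intro mult_left_mono bd0 r t) simp
      also have "\<dots> = (exp (m * r - Im mu * th) * exp (- m * r)) * (M * A (- m)) * k t" by (simp only: mult_ac)
      also have "exp (m * r - Im mu * th) * exp (- m * r) = exp (- Im mu * th)" by (simp add: exp_add [symmetric])
      finally show ?thesis by (simp only: mult_ac)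
    qed
    then show "eventually (\<lambda>r. AE t in lborel_gt 1. norm (sr r t) \<le> (M * A (- m) * exp (- Im mu * th)) * k t) at_top"
      unfolding sr_def by (intro always_eventually allI AE_I2) auto
    show "AE t in lborel_gt 1. ((\<lambda>r. sr r t) \<longlongrightarrow> f t) at_top"
    proof (rule AE_I2)
      fix t assume "t \<in> space (lborel_gt 1)"
      then have t: "t > 1" by simp
      let ?w = "\<lambda>r. prod_arg th (b r) t"
      let ?p = "\<lambda>z. of_real (cos th) * (1 + z) - \<i> * of_real (sin th) * of_real t * (1 - z)"
      have e0: "((\<lambda>r. exp (- 2 * b r)) \<longlongrightarrow> 0) at_top"
      proof (rule tendsto_norm_zero_cancel)
        have "((\<lambda>r::real. exp (- 2 * r)) \<longlongrightarrow> 0) at_top" by real_asymp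
        then show "((\<lambda>r. norm (exp (- 2 * b r))) \<longlongrightarrow> 0) at_top" by (simp add: b_def)
      qed
      have p0: "?p 0 = base (- \<i> * of_real th) t"
      proof -
        have "cosh (- \<i> * complex_of_real th) = of_real (cos th)" "sinh (- \<i> * complex_of_real th) = - \<i> * of_real (sin th)"
          by (simp_all add: complex_eq_iff Re_cosh Im_cosh Re_sinh Im_sinh)
        then show ?thesis by simp
      qed
      have pe: "2 * ?w r * exp (- b r) = ?p (exp (- 2 * b r))" for r
      proof -
        have "2 * cosh z * exp (- z) = 1 + exp (- 2 * z)" "2 * sinh z * exp (- z) = 1 - exp (- 2 * z)" for z :: complex
        proof -
          have e: "exp z * exp (- z) = 1" "exp (- z) * exp (- z) = exp (- 2 * z)" by (simp_all add: exp_add [symmetric])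
          have "2 * cosh z * exp (- z) = exp z * exp (- z) + exp (- z) * exp (- z)"
            "2 * sinh z * exp (- z) = exp z * exp (- z) - exp (- z) * exp (- z)"
            by (simp_all add: cosh_field_def sinh_field_def ring_distribs)
          then show "2 * cosh z * exp (- z) = 1 + exp (- 2 * z)" "2 * sinh z * exp (- z) = 1 - exp (- 2 * z)"
            unfolding e .
        qed
        note e = this[of "b r"]
        have "2 * ?w r * exp (- b r) = of_real (cos th) * (2 * cosh (b r) * exp (- b r)) - \<i> * of_real (sin th) * of_real t * (2 * sinh (b r) * exp (- b r))"
          by (simp add: prod_arg_def algebra_simps)
        then show ?thesis unfolding e .
      qed
      have np: "base (- \<i> * of_real th) t \<notin> \<real>\<^sub>\<le>\<^sub>0" using cosh_plus_sinh_not_nonpos[OF dom, of t] t by simp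
      have "((\<lambda>r. ?p (exp (- 2 * b r))) \<longlongrightarrow> ?p 0) at_top" by (intro tendsto_intros e0)
      then have l1: "((\<lambda>r. ?p (exp (- 2 * b r)) powr (- mu)) \<longlongrightarrow> base (- \<i> * of_real th) t powr (- mu)) at_top"
        unfolding p0 by (intro tendsto_powr_complex tendsto_const np)
      have winf: "filterlim (\<lambda>r. norm (?w r)) at_top at_top"
      proof (rule filterlim_at_top_mono)
        show "filterlim (\<lambda>r. s / 2 * (exp r * t)) at_top at_top" using s t by real_asymp
        show "eventually (\<lambda>r. s / 2 * (exp r * t) \<le> norm (?w r)) at_top"
          unfolding b_def by (intro eventually_mono[OF eventually_ge_at_top[of 0]] P(6)) (use t in auto)
      qed
      have l2: "((\<lambda>r. hypF (1 / (?w r)\<^sup>2)) \<longlongrightarrow> hypF 0) at_top"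
      proof (rule isCont_tendsto_compose[of 0 hypF])
        have "0 \<in> cut_plane_F" by (simp add: mem_cut_plane_F)
        from hypF_derivatives(1)[OF this] show "isCont hypF 0" by (rule DERIV_isCont)
        have "((\<lambda>r. 1 / (norm (?w r))\<^sup>2) \<longlongrightarrow> 0) at_top"
          by (intro tendsto_divide_0[OF tendsto_const] filterlim_at_top_imp_at_infinity filterlim_pow_at_top winf) simp
        then show "((\<lambda>r. 1 / (?w r)\<^sup>2) \<longlongrightarrow> 0) at_top"
          by (intro tendsto_norm_zero_cancel[of "\<lambda>r. 1 / (?w r)\<^sup>2"]) (simp add: norm_divide norm_power)
      qed
      have T: "((\<lambda>r. (?p (exp (- 2 * b r)) powr (- mu) * hypF (1 / (?w r)\<^sup>2)) * gweight \<alpha> t) \<longlongrightarrow> (base (- \<i> * of_real th) t powr (- mu) * hypF 0) * gweight \<alpha> t) at_top"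
        by (intro tendsto_mult l1 l2 tendsto_const)
      have E: "(?p (exp (- 2 * b r)) powr (- mu) * hypF (1 / (?w r)\<^sup>2)) * gweight \<alpha> t = sr r t" if r: "r \<ge> R" for r
      proof -
        have "Re (2 * ?w r) > 0" using Re_prod_arg_wedge(3)[OF mem[OF r], of t] t by simp
        then have "(2 * ?w r) powr (- mu) = exp (- mu * b r) * (2 * ?w r * exp (- b r)) powr (- mu)"
          using th by (intro powr_shift_exp) (simp_all add: b_def)
        then have "exp (mu * b r) * gegJ (?w r) = (exp (mu * b r) * exp (- mu * b r)) * (2 * ?w r * exp (- b r)) powr (- mu) * hypF (1 / (?w r)\<^sup>2)"
          unfolding gegJ_def by (simp only: mult.assoc)
        also have "exp (mu * b r) * exp (- mu * b r) = 1" by (simp add: exp_add [symmetric])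
        finally have "exp (mu * b r) * gegJ (?w r) = ?p (exp (- 2 * b r)) powr (- mu) * hypF (1 / (?w r)\<^sup>2)"
          unfolding pe by simp
        moreover have "sr r t = (exp (mu * b r) * gegJ (?w r)) * gweight \<alpha> t"
          using r by (simp only: sr_def s0_def max_absorb1 mult.assoc)
        ultimately show ?thesis by (simp only:)
      qed
      have F: "(base (- \<i> * of_real th) t powr (- mu) * hypF 0) * gweight \<alpha> t = f t"
        unfolding f_def hypF_def reg_hypergeo_0 by (simp only: mult_ac)
      show "((\<lambda>r. sr r t) \<longlongrightarrow> f t) at_top"
        by (rule Lim_transform_eventually[OF T[unfolded F]], rule eventually_mono[OF eventually_ge_at_top[of R]], erule E)
    qed
  qed
  have val: "(\<integral>t. f t \<partial>lborel_gt 1) = rGamma (l + \<alpha> + 1) * laplaceI (- \<i> * of_real th)"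
    unfolding f_def laplaceI_def by (rule Bochner_Integration.integral_mult_right_zero)
  have conv: "(\<integral>t. sr r t \<partial>lborel_gt 1) = exp (mu * b r) * prodG th (b r)" if "r \<ge> R" for r
    using that by (simp add: sr_def s0_def prodG_def)
  have lim': "((\<lambda>r. exp (mu * b r) * prodG th (b r)) \<longlongrightarrow> rGamma (l + \<alpha> + 1) * laplaceI (- \<i> * of_real th)) at_top"
    by (rule Lim_transform_eventually[OF lim[unfolded val]], rule eventually_mono[OF eventually_ge_at_top[of R]], erule conv)
  show ?thesis
  proof (rule that[of R C])
    show "norm (prodG th (b r)) \<le> C * exp (- Re mu * r)" if "r > R" for r
      by (rule order_trans[OF 1[unfolded m_def] mult_right_mono[OF C(1)[unfolded m_def]]]) (use that in auto)
    show "norm (prodG' th (b r) + mu * prodG th (b r)) \<le> C * exp (- (Re mu + 2) * r)" if "r > R" for r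
      by (rule order_trans[OF 2[unfolded m_def] mult_right_mono[OF C(2)[unfolded m_def]]]) (use that in auto)
  qed (use R lim' in auto)
qed

text \<open>On the ray the product integral and J (cosh a) are recessive solutions of one equation,
  with leading coefficients in the ratio \<open>laplaceI\<close> at -i\<theta>; uniqueness and the
  identity theorem on the wedge give proportionality for all r > 0. The point i\<theta> lies on the
  boundary of the wedge, so both sides are finally carried to it by r -> 0.\<close>

theorem laplaceI_product_formula:
  fixes th :: real
  assumes th: "0 < th" "th < pi / 2"
  shows "integrable (lborel_gt 1) (\<lambda>t. gegJ (of_real ((cos th)\<^sup>2 + t * (sin th)\<^sup>2)) * gweight \<alpha> t)"
    and "(\<integral>t. gegJ (of_real ((cos th)\<^sup>2 + t * (sin th)\<^sup>2)) * gweight \<alpha> t \<partial>lborel_gt 1) =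
      kJ * laplaceI (\<i> * of_real th) * laplaceI (- \<i> * of_real th)"
proof -
  define b where "b = (\<lambda>r::real. complex_of_real r + \<i> * of_real th)"
  define s where "s = (sin th)\<^sup>2"
  note P = norm_prod_arg_ray[OF th, folded s_def]
  have c: "(cos th)\<^sup>2 = 1 - s" by (simp add: s_def cos_squared_eq)
  define w where "w = (\<lambda>t. complex_of_real ((cos th)\<^sup>2 + t * (sin th)\<^sup>2))"
  have w0: "prod_arg th (b 0) t = w t" for t
  proof -
    have "cosh (b 0) = of_real (cos th)" "sinh (b 0) = \<i> * of_real (sin th)"
      by (simp_all add: complex_eq_iff Re_cosh Im_cosh Re_sinh Im_sinh b_def)
    then show ?thesis by (simp add: prod_arg_def w_def power2_eq_square algebra_simps)
  qed
  obtain R C where A: "R \<ge> 7"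
    "\<And>r. r > R \<Longrightarrow> norm (prodG th (of_real r + \<i> * of_real th)) \<le> C * exp (- Re mu * r)"
    "\<And>r. r > R \<Longrightarrow> norm (prodG' th (of_real r + \<i> * of_real th) + mu * prodG th (of_real r + \<i> * of_real th)) \<le> C * exp (- (Re mu + 2) * r)"
    "((\<lambda>r. exp (mu * (of_real r + \<i> * of_real th)) * prodG th (of_real r + \<i> * of_real th)) \<longlongrightarrow> rGamma (l + \<alpha> + 1) * laplaceI (- \<i> * of_real th)) at_top"
    by (rule prodG_asymptotics[OF th]) (rule that)
  obtain D where D:
    "\<And>b. b \<in> half_strip \<Longrightarrow> Re b > 7 \<Longrightarrow> norm (gegJ (cosh b)) \<le> D * exp (- Re mu * Re b)"
    "\<And>b. b \<in> half_strip \<Longrightarrow> Re b > 7 \<Longrightarrow> norm (gegJ' (cosh b) * sinh b + mu * gegJ (cosh b)) \<le> D * exp (- (Re mu + 2) * Re b)"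
    using gegJ_cosh_asymptotic_bounds by metis
  have memw: "b r \<in> wedge th" if "r > 0" for r unfolding b_def by (rule ray_in_wedge[OF th that])
  have mem: "b r \<in> half_strip" if "r > 0" for r using memw[OF that] wedge_subset by blast
  have pos: "r > 0" "r > 7" if "r > R" for r using that A(1) by auto
  have "l + \<alpha> + 1 \<notin> \<int>\<^sub>\<le>\<^sub>0" using Re_alpha Re_l by (intro Re_pos_imp_not_nonpos_Int) simp
  then have g0: "rGamma (l + \<alpha> + 1) \<noteq> 0" by (simp add: rGamma_eq_zero_iff)
  obtain R' where R': "R' \<ge> R" "\<And>r. r > R' \<Longrightarrow> prodG th (b r) * rGamma (l + \<alpha> + 1) =
      (rGamma (l + \<alpha> + 1) * laplaceI (- \<i> * of_real th)) * gegJ (cosh (b r))"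
  proof (rule recessive_solutions_proportional[of \<alpha> l th R "prodG th" "prodG' th" "\<lambda>b. gegJ (cosh b)" "\<lambda>b. gegJ' (cosh b) * sinh b" C D
        "rGamma (l + \<alpha> + 1) * laplaceI (- \<i> * of_real th)" "rGamma (l + \<alpha> + 1)", folded mu_def b_def])
    show "((\<lambda>r. exp (mu * (of_real r + \<i> * of_real th)) * gegJ (cosh (of_real r + \<i> * of_real th))) \<longlongrightarrow> rGamma (l + \<alpha> + 1)) at_top"
      by (rule gegJ_cosh_limit) (use th in auto)
    show "((\<lambda>r. exp (mu * (of_real r + \<i> * of_real th)) * prodG th (of_real r + \<i> * of_real th)) \<longlongrightarrow> rGamma (l + \<alpha> + 1) * laplaceI (- \<i> * of_real th)) at_top"
      using A(4) by (simp only: b_def)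
    show "cmod (gegJ (cosh (of_real r + \<i> * of_real th))) \<le> D * exp (- Re mu * r)" if "R < r" for r
      using D(1)[OF mem[OF pos(1)[OF that]]] pos[OF that] by (simp add: b_def)
    show "cmod (gegJ' (cosh (of_real r + \<i> * of_real th)) * sinh (of_real r + \<i> * of_real th) + mu * gegJ (cosh (of_real r + \<i> * of_real th))) \<le> D * exp (- (Re mu + 2) * r)"
      if "R < r" for r
      using D(2)[OF mem[OF pos(1)[OF that]]] pos[OF that] by (simp add: b_def)
    show "cmod (prodG th (of_real r + \<i> * of_real th)) \<le> C * exp (- Re mu * r)" if "R < r" for r
      using A(2)[OF that] by (simp add: b_def)
    show "cmod (prodG' th (of_real r + \<i> * of_real th) + mu * prodG th (of_real r + \<i> * of_real th)) \<le> C * exp (- (Re mu + 2) * r)" if "R < r" for r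
      using A(3)[OF that] by (simp add: b_def)
    note dG = has_derivative_prodG[OF memw[OF pos(1)], unfolded b_def] has_derivative_prodG'[OF memw[OF pos(1)], unfolded b_def]
    note dJ = gegJ_cosh_derivatives[OF mem[OF pos(1)], unfolded b_def]
    show "(prodG th has_field_derivative prodG' th (of_real r + \<i> * of_real th)) (at (of_real r + \<i> * of_real th))" if "R < r" for r
      by (rule dG(1)[OF that])
    show "(prodG' th has_field_derivative l * mu * prodG th (of_real r + \<i> * of_real th) -
        2 * \<alpha> * cosh (of_real r + \<i> * of_real th) / sinh (of_real r + \<i> * of_real th) * prodG' th (of_real r + \<i> * of_real th))
        (at (of_real r + \<i> * of_real th))" if "R < r" for r
      by (rule dG(2)[OF that])
    show "((\<lambda>b. gegJ (cosh b)) has_field_derivative gegJ' (cosh (of_real r + \<i> * of_real th)) * sinh (of_real r + \<i> * of_real th)) (at (of_real r + \<i> * of_real th))" if "R < r" for r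
      by (rule dJ(1)[OF that])
    show "((\<lambda>b. gegJ' (cosh b) * sinh b) has_field_derivative l * mu * gegJ (cosh (of_real r + \<i> * of_real th)) -
        2 * \<alpha> * cosh (of_real r + \<i> * of_real th) / sinh (of_real r + \<i> * of_real th) * (gegJ' (cosh (of_real r + \<i> * of_real th)) * sinh (of_real r + \<i> * of_real th)))
        (at (of_real r + \<i> * of_real th))" if "R < r" for r
      by (rule dJ(2)[OF that])
  qed (use Re_alpha Re_l th A(1) g0 in \<open>auto simp: b_def\<close>)
  have all: "prodG th (b r) = laplaceI (- \<i> * of_real th) * gegJ (cosh (b r))" if "r > 0" for r
  proof (rule analytic_continuation_ray[where f = "prodG th" and g = "\<lambda>b. laplaceI (- \<i> * of_real th) * gegJ (cosh b)" and R = R' and th = th and S = "wedge th"])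
    show "prodG th holomorphic_on wedge th"
      using has_derivative_prodG open_wedge by (auto simp: holomorphic_on_open)
    show "(\<lambda>b. laplaceI (- \<i> * of_real th) * gegJ (cosh b)) holomorphic_on wedge th"
      using gegJ_cosh_derivatives(1) wedge_subset open_wedge
      by (intro holomorphic_intros) (auto simp: holomorphic_on_open)
    show "complex_of_real r + \<i> * of_real th \<in> wedge th" if "R' < r" for r
      using memw[of r] that R'(1) A(1) by (simp add: b_def)
    show "prodG th (complex_of_real r + \<i> * of_real th) = laplaceI (- \<i> * of_real th) * gegJ (cosh (complex_of_real r + \<i> * of_real th))" if "R' < r" for r
      using R'(2)[OF that] g0 by (simp add: b_def)
  qed (use open_wedge convex_connected[OF convex_wedge] memw[OF that] in auto)
  have s: "0 < s" "s < 1" using P(2,3)[of 1 1] by auto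
  obtain g where g: "integrable (lborel_gt 1) g"
    "\<And>w t. t > 1 \<Longrightarrow> Re w > 1 \<Longrightarrow> s * (t - 1) \<le> Re w - 1 \<Longrightarrow> s * t \<le> Re w \<Longrightarrow> norm w \<le> (2 * exp 1) * t \<Longrightarrow>
       norm (gegJ w * gweight \<alpha> t) \<le> g t"
    using gegJ_dominated[OF s(1)] by metis
  \<comment> \<open>One majorant for 0 <= r < 1: it yields convergence of the limiting integral at r
    = 0 and dominates on the way there.\<close>
  have bd: "norm (gegJ (prod_arg th (b r) t) * gweight \<alpha> t) \<le> g t" if r: "0 \<le> r" "r < 1" and t: "t > 1" for r t
  proof (rule g(2)[OF t])
    note Q = P[OF r(1) less_imp_le[OF t], folded b_def]
    have "0 < s * (t - 1)" using s t by simp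
    then show "1 < Re (prod_arg th (b r) t)" using Q(4) by (simp only: b_def)
    show "s * (t - 1) \<le> Re (prod_arg th (b r) t) - 1" "s * t \<le> Re (prod_arg th (b r) t)" using Q(4,5) by (simp_all only: b_def)
    have "exp r * t \<le> exp 1 * t" using r t by (intro mult_right_mono) auto
    then show "norm (prod_arg th (b r) t) \<le> 2 * exp 1 * t" using Q(7) by (simp add: b_def)
  qed
  have Re0: "Re (prod_arg th (b 0) t) > 1" if "t > 1" for t
  proof -
    have "0 < s * (t - 1)" using s that by simp
    then show ?thesis using P(4)[OF order_refl less_imp_le[OF that]] by (simp only: b_def)
  qed
  have m0: "(\<lambda>t. gegJ (prod_arg th (b 0) t) * gweight \<alpha> t) \<in> borel_measurable (lborel_gt 1)"
    by (intro measurable_lborel_gt_continuous continuous_on_mult continuous_on_gweight continuous_on_gegJ_prod_arg Re0)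
  have "integrable (lborel_gt 1) (\<lambda>t. gegJ (prod_arg th (b 0) t) * gweight \<alpha> t)"
    by (rule Bochner_Integration.integrable_bound[OF g(1) m0], rule AE_I2)
       (use bd[of 0] in \<open>auto intro: order_trans[OF _ abs_ge_self]\<close>)
  then show "integrable (lborel_gt 1) (\<lambda>t. gegJ (of_real ((cos th)\<^sup>2 + t * (sin th)\<^sup>2)) * gweight \<alpha> t)"
    unfolding w0 w_def .
  have L: "((\<lambda>r. \<integral>t. gegJ (prod_arg th (b r) t) * gweight \<alpha> t \<partial>lborel_gt 1) \<longlongrightarrow>
      (\<integral>t. gegJ (prod_arg th (b 0) t) * gweight \<alpha> t \<partial>lborel_gt 1)) (at 0 within {0<..<1})"
  proof (rule dominated_convergence_within[OF _ m0 g(1)])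
    show "(\<lambda>t. gegJ (prod_arg th (b r) t) * gweight \<alpha> t) \<in> borel_measurable (lborel_gt 1)" if "r \<in> {0<..<1}" for r
      by (rule borel_measurable_integrable, rule integrable_prodG, rule memw) (use that in simp)
    show "norm (gegJ (prod_arg th (b r) t) * gweight \<alpha> t) \<le> g t" if "r \<in> {0<..<1}" "t \<in> space (lborel_gt 1)" for r t
      by (rule bd) (use that in auto)
    show "((\<lambda>r. gegJ (prod_arg th (b r) t) * gweight \<alpha> t) \<longlongrightarrow> gegJ (prod_arg th (b 0) t) * gweight \<alpha> t) (at 0 within {0<..<1})"
      if "t \<in> space (lborel_gt 1)" for t
    proof (intro tendsto_mult tendsto_const)
      have "prod_arg th (b 0) t \<in> cut_plane_D" using Re0[of t] that by (simp add: mem_cut_plane_D)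
      note iso = DERIV_isCont[OF has_derivative_gegJ[OF this]]
      have "((\<lambda>r. prod_arg th (b r) t) \<longlongrightarrow> prod_arg th (b 0) t) (at 0 within {0<..<1})"
        unfolding prod_arg_def b_def by (intro tendsto_intros)
      then show "((\<lambda>r. gegJ (prod_arg th (b r) t)) \<longlongrightarrow> gegJ (prod_arg th (b 0) t)) (at 0 within {0<..<1})"
        by (rule isCont_tendsto_compose[OF iso])
    qed
  qed
  have dom: "b 0 \<in> laplace_domain" using th pi_gt_zero by (simp add: mem_laplace_domain b_def)
  have "((\<lambda>r. b r) \<longlongrightarrow> b 0) (at 0 within {0<..<1})" unfolding b_def by (intro tendsto_intros)
  then have "((\<lambda>r. laplaceI (b r)) \<longlongrightarrow> laplaceI (b 0)) (at 0 within {0<..<1})"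
    by (rule isCont_tendsto_compose[OF DERIV_isCont[OF has_derivative_laplaceI[OF dom]]])
  then have R: "((\<lambda>r. laplaceI (- \<i> * of_real th) * (kJ * laplaceI (b r))) \<longlongrightarrow> laplaceI (- \<i> * of_real th) * (kJ * laplaceI (b 0))) (at 0 within {0<..<1})"
    by (intro tendsto_intros)
  have eq: "laplaceI (- \<i> * of_real th) * (kJ * laplaceI (b r)) = (\<integral>t. gegJ (prod_arg th (b r) t) * gweight \<alpha> t \<partial>lborel_gt 1)" if "r > 0" for r
    using all[OF that] gegJ_eq_laplaceI[OF mem[OF that]] by (simp add: prodG_def)
  have "((\<lambda>r. \<integral>t. gegJ (prod_arg th (b r) t) * gweight \<alpha> t \<partial>lborel_gt 1) \<longlongrightarrow> laplaceI (- \<i> * of_real th) * (kJ * laplaceI (b 0))) (at 0 within {0<..<1})"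
    by (rule Lim_transform_eventually[OF R]) (unfold eventually_at_filter, intro always_eventually allI impI eq, simp)
  moreover have "at (0::real) within {0<..<1} \<noteq> bot"
    by (simp add: trivial_limit_within islimpt_greaterThanLessThan1)
  ultimately have "(\<integral>t. gegJ (prod_arg th (b 0) t) * gweight \<alpha> t \<partial>lborel_gt 1) = laplaceI (- \<i> * of_real th) * (kJ * laplaceI (b 0))"
    using L tendsto_unique by blast
  then show "(\<integral>t. gegJ (of_real ((cos th)\<^sup>2 + t * (sin th)\<^sup>2)) * gweight \<alpha> t \<partial>lborel_gt 1) =
      kJ * laplaceI (\<i> * of_real th) * laplaceI (- \<i> * of_real th)"
    unfolding w0 w_def by (simp add: b_def mult_ac)
qed

end

subsection \<open>Boundary values on the cut\<close>

lemma islimpt_of_open: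
  fixes z :: complex
  assumes "open U" "z \<in> U"
  shows "z islimpt U"
  using assms interior_limit_point interior_open by metis

lemma gegenbauer_D_eq:
  assumes z: "z \<in> cut_plane_D"
  shows "gegenbauer_D l \<alpha> z = exp (\<i> * pi * \<alpha>) * Gamma (l + 2 * \<alpha>) / (Gamma \<alpha> * (2 * z) powr (l + 2 * \<alpha>))
           * reg_hypergeo (l / 2 + \<alpha>) (l / 2 + \<alpha> + 1 / 2) (l + \<alpha> + 1) (1 / z\<^sup>2)"
  unfolding gegenbauer_D_def
proof (rule analytic_extension_eqI[where \<xi> = 2])
  show "open cut_plane_D" "connected cut_plane_D" by (rule open_cut_planes connected_cut_planes)+
  have "open ({z. norm z > 1} \<inter> cut_plane_D)"
    by (intro open_Int open_cut_planes open_Collect_less continuous_intros)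
  moreover have "{z \<in> cut_plane_D. norm z > 1} = {z. norm z > 1} \<inter> cut_plane_D" by auto
  ultimately show "2 islimpt {z \<in> cut_plane_D. norm z > 1}"
    by (intro islimpt_of_open) (auto simp: mem_cut_plane_D)
  show "(\<lambda>z. exp (\<i> * pi * \<alpha>) * Gamma (l + 2 * \<alpha>) / (Gamma \<alpha> * (2 * z) powr (l + 2 * \<alpha>))
           * reg_hypergeo (l / 2 + \<alpha>) (l / 2 + \<alpha> + 1 / 2) (l + \<alpha> + 1) (1 / z\<^sup>2)) holomorphic_on cut_plane_D"
  proof -
    have F: "(\<lambda>z. reg_hypergeo (l / 2 + \<alpha>) (l / 2 + \<alpha> + 1 / 2) (l + \<alpha> + 1) (1 / z\<^sup>2)) holomorphic_on cut_plane_D"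
    proof (rule holomorphic_on_compose_gen[of "\<lambda>z. 1 / z\<^sup>2" _ _ cut_plane_F, unfolded o_def])
      show "(\<lambda>z. 1 / z\<^sup>2) holomorphic_on cut_plane_D"
        by (intro holomorphic_intros) (auto simp: mem_cut_plane_D)
    qed (use holomorphic_reg_hypergeo inverse_square_in_cut_plane_F in auto)
    have P: "(\<lambda>z. (2 * z) powr (- (l + 2 * \<alpha>))) holomorphic_on cut_plane_D"
      by (intro holomorphic_intros) (auto simp: mem_cut_plane_D complex_nonpos_Reals_iff)
    have "(\<lambda>z. (exp (\<i> * pi * \<alpha>) * Gamma (l + 2 * \<alpha>) / Gamma \<alpha>) * (2 * z) powr (- (l + 2 * \<alpha>))
           * reg_hypergeo (l / 2 + \<alpha>) (l / 2 + \<alpha> + 1 / 2) (l + \<alpha> + 1) (1 / z\<^sup>2)) holomorphic_on cut_plane_D"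
      by (intro holomorphic_on_mult holomorphic_on_const F P)
    moreover have "E / (G * P) = E / G * inverse P" for E G P :: complex by (simp add: divide_inverse)
    ultimately show ?thesis by (simp only: powr_minus)
  qed
qed (use z in \<open>auto simp: mem_cut_plane_D\<close>)

text \<open>The first-kind function is regular at 1 and has only the cut to the left of -1. The
  larger domain is needed because its Wronskian is followed along real b > 0, where cosh b > 1, down
  to b = 0.\<close>

definition cut_plane_C :: "complex set" where
  "cut_plane_C = {z. (1 - z) / 2 \<in> cut_plane_F}"

lemma mem_cut_plane_C: "z \<in> cut_plane_C \<longleftrightarrow> \<not> (Im z = 0 \<and> Re z \<le> -1)"
  by (auto simp: cut_plane_C_def mem_cut_plane_F)

lemma cut_plane_trig_subset_C: "cut_plane_trig \<subseteq> cut_plane_C"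
  by (auto simp: mem_cut_plane_trig mem_cut_plane_C)

lemma of_real_segment_islimpt:
  assumes "a < c" "c < b"
  shows "complex_of_real c islimpt complex_of_real ` {a<..<b}"
  unfolding islimpt_approachable
proof (intro allI impI)
  fix e :: real assume e: "e > 0"
  define h where "h = min ((b - c) / 2) (e / 2)"
  have h_le: "h \<le> (b - c) / 2" "h \<le> e / 2" unfolding h_def by (rule min.cobounded1 min.cobounded2)+
  have h: "h > 0" using e assms by (simp add: h_def)
  have h2: "c + h < b" using assms(2) h_le(1) by (simp add: field_simps)
  have h3: "h < e" using e h_le(2) by simp
  have "dist (complex_of_real (c + h)) (of_real c) = h" using h by (simp add: dist_norm)
  then show "\<exists>x'\<in>complex_of_real ` {a<..<b}. x' \<noteq> of_real c \<and> dist x' (of_real c) < e"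
    using h h2 h3 assms by (intro bexI[of _ "complex_of_real (c + h)"] imageI) simp_all
qed

lemma analytic_extension_trig_eqI:
  assumes "g holomorphic_on cut_plane_trig" "\<And>x. \<bar>x\<bar> < 1 \<Longrightarrow> g (of_real x) = f x" "z \<in> cut_plane_trig"
  shows "analytic_extension (\<lambda>z. f (Re z)) (complex_of_real ` {-1<..<1}) cut_plane_trig z = g z"
proof (rule analytic_extension_eqI[where \<xi> = 0])
  show "complex_of_real ` {-1<..<1} \<subseteq> cut_plane_trig" by (auto simp: mem_cut_plane_trig)
  show "g z = f (Re z)" if "z \<in> complex_of_real ` {-1<..<1}" for z
    using that assms(2) by (auto simp: abs_less_iff)
qed (use assms open_cut_planes connected_cut_planes of_real_segment_islimpt[of "-1" 0 1] in \<open>auto simp: mem_cut_plane_trig\<close>)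

lemma gegenbauer_C_trig_eq:
  assumes z: "z \<in> cut_plane_trig"
  shows "gegenbauer_C_trig l \<alpha> z =
     of_real (sqrt pi) * Gamma (2 * \<alpha> + l) / (2 powr (2 * \<alpha> - 1) * Gamma \<alpha> * Gamma (l + 1))
       * reg_hypergeo (- l) (2 * \<alpha> + l) (\<alpha> + 1 / 2) ((1 - z) / 2)"
  unfolding gegenbauer_C_trig_def
proof (rule analytic_extension_trig_eqI[OF _ _ z])
  have "(\<lambda>z. reg_hypergeo (- l) (2 * \<alpha> + l) (\<alpha> + 1 / 2) ((1 - z) / 2)) holomorphic_on cut_plane_trig"
  proof (rule holomorphic_on_compose_gen[of "\<lambda>z. (1 - z) / 2" _ _ cut_plane_F, unfolded o_def])
    show "(\<lambda>z. (1 - z) / 2) ` cut_plane_trig \<subseteq> cut_plane_F"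
      using cut_plane_trig_subset_C by (auto simp: cut_plane_C_def)
  qed (auto intro!: holomorphic_intros holomorphic_reg_hypergeo)
  then show "(\<lambda>z. of_real (sqrt pi) * Gamma (2 * \<alpha> + l) / (2 powr (2 * \<alpha> - 1) * Gamma \<alpha> * Gamma (l + 1))
       * reg_hypergeo (- l) (2 * \<alpha> + l) (\<alpha> + 1 / 2) ((1 - z) / 2)) holomorphic_on cut_plane_trig"
    by (intro holomorphic_on_mult holomorphic_on_const)
qed (simp add: gegenbauer_C_trig_real_def)

lemma cosh_i_Arccos: "cosh (\<i> * Arccos z) = z" "cosh (- (\<i> * Arccos z)) = z"
proof -
  have "cosh (\<i> * w) = cos w" for w :: complex by (simp add: cosh_field_def cos_exp_eq)
  then show "cosh (\<i> * Arccos z) = z" "cosh (- (\<i> * Arccos z)) = z" by simp_all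
qed

lemma isCont_Arccos_cut_plane_trig: "z \<in> cut_plane_trig \<Longrightarrow> isCont Arccos z"
  by (rule isCont_Arccos) (auto simp: mem_cut_plane_trig)

text \<open>A connectedness argument fixes the sign: Re (Arccos z) has a connected image on the cut
  plane, takes the value pi/2 at 0 and never vanishes, because a zero would make z real and at least
  1. The value pi is excluded by the other cut.\<close>

lemma Arccos_strip:
  assumes z: "z \<in> cut_plane_trig"
  shows "0 < Re (Arccos z)" "Re (Arccos z) < pi"
proof -
  have e: "Re z = cosh (- Im (Arccos z)) * cos (Re (Arccos z))" "Im z = sinh (- Im (Arccos z)) * sin (Re (Arccos z))" for z
    using Re_cosh[of "\<i> * Arccos z"] Im_cosh[of "\<i> * Arccos z"] by (simp_all add: cosh_i_Arccos)
  have n0: "Re (Arccos z) \<noteq> 0" if "z \<in> cut_plane_trig" for z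
  proof
    assume "Re (Arccos z) = 0"
    then show False using e[of z] that cosh_real_ge_1[of "- Im (Arccos z)"] by (simp add: mem_cut_plane_trig)
  qed
  have "Re (Arccos z) \<noteq> pi"
  proof
    assume "Re (Arccos z) = pi"
    then show False using e[of z] z cosh_real_ge_1[of "- Im (Arccos z)"] by (simp add: mem_cut_plane_trig)
  qed
  then show "Re (Arccos z) < pi" using Re_Arccos_bounds[of z] by linarith
  let ?S = "(\<lambda>z. Re (Arccos z)) ` cut_plane_trig"
  have "continuous_on cut_plane_trig (\<lambda>z. Re (Arccos z))"
    by (intro continuous_at_imp_continuous_on ballI isCont_Re isCont_Arccos_cut_plane_trig)
  then have conn: "connected ?S"
    by (rule connected_continuous_image[OF _ connected_cut_planes(3)])
  have "0 \<in> cut_plane_trig" by (simp add: mem_cut_plane_trig)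
  from imageI[OF this, of "\<lambda>z. Re (Arccos z)"] have "pi / 2 \<in> ?S" by simp
  moreover have "Re (Arccos z) \<in> ?S" using z by (rule imageI)
  ultimately have "Re (Arccos z) \<le> 0 \<Longrightarrow> 0 \<in> ?S"
    using connectedD_interval[OF conn, of "Re (Arccos z)" "pi / 2" 0] by simp
  moreover have "0 \<notin> ?S" using n0 by force
  ultimately show "0 < Re (Arccos z)" by linarith
qed

lemma i_Arccos_laplace_domain:
  assumes "z \<in> cut_plane_trig"
  shows "\<i> * Arccos z \<in> laplace_domain" "- (\<i> * Arccos z) \<in> laplace_domain"
  using Arccos_strip[OF assms] by (auto simp: mem_laplace_domain)

text \<open>Im z is sinh (- Im (Arccos z)) times a positive sine, so the side of the real axis on
  which z lies decides which of \<plusminus> i Arccos z has positive real part.\<close>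

lemma i_Arccos_half_strip:
  assumes "z \<notin> \<real>"
  shows "Im z > 0 \<Longrightarrow> \<i> * Arccos z \<in> half_strip" "Im z < 0 \<Longrightarrow> - (\<i> * Arccos z) \<in> half_strip"
proof -
  have z: "z \<in> cut_plane_trig" using assms by (auto simp: mem_cut_plane_trig complex_is_Real_iff)
  note A = Arccos_strip[OF z]
  have s: "sin (Re (Arccos z)) > 0" using A by (intro sin_gt_zero) auto
  have e: "Im z = sinh (- Im (Arccos z)) * sin (Re (Arccos z))"
    using Im_cosh[of "\<i> * Arccos z"] by (simp add: cosh_i_Arccos)
  show "Im z > 0 \<Longrightarrow> \<i> * Arccos z \<in> half_strip" "Im z < 0 \<Longrightarrow> - (\<i> * Arccos z) \<in> half_strip"
    using A s e by (auto simp: mem_half_strip zero_less_mult_iff mult_less_0_iff)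
qed

lemma holomorphic_Arccos_cut_plane_trig: "Arccos holomorphic_on cut_plane_trig"
  by (rule holomorphic_on_Arccos) (auto simp: mem_cut_plane_trig)

context gegenbauer_params
begin

definition dJ :: complex where "dJ = exp (\<i> * pi * \<alpha>) * Gamma mu / Gamma \<alpha>"

lemma gegenbauer_D_eq_gegJ:
  assumes "z \<in> cut_plane_D"
  shows "gegenbauer_D l \<alpha> z = dJ * gegJ z"
proof -
  have "E / (G * P) * F = E / G * (inverse P * F)" for E G P F :: complex by (simp add: divide_inverse)
  moreover have "l / 2 + \<alpha> = mu / 2" by (simp add: mu_def field_simps)
  ultimately show ?thesis
    unfolding gegenbauer_D_eq[OF assms] gegJ_def hypF_def dJ_def mu_def [symmetric] powr_minus by (simp only:)
qed

text \<open>Above the cut z is cosh b with b = i Arccos z in the half strip, below it with b = - i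
  Arccos z. Laplace's integral is continuous across Re b = 0 at these points, so the boundary values
  are simply its values there.\<close>

lemma gegenbauer_D_boundary:
  assumes x: "\<bar>x\<bar> < 1"
  shows "Lim (at_right 0) (\<lambda>\<epsilon>. gegenbauer_D l \<alpha> (Complex x \<epsilon>)) = dJ * kJ * laplaceI (\<i> * Arccos (of_real x))"
    and "Lim (at_right 0) (\<lambda>\<epsilon>. gegenbauer_D l \<alpha> (Complex x (- \<epsilon>))) = dJ * kJ * laplaceI (- (\<i> * Arccos (of_real x)))"
proof -
  have xt: "complex_of_real x \<in> cut_plane_trig" using x by (auto simp: mem_cut_plane_trig abs_less_iff)
  note dom = i_Arccos_laplace_domain[OF xt]
  note cont = DERIV_isCont[OF has_derivative_laplaceI[OF dom(1)]] DERIV_isCont[OF has_derivative_laplaceI[OF dom(2)]]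
  have t: "((\<lambda>\<epsilon>. Complex x \<epsilon>) \<longlongrightarrow> of_real x) (at_right 0)" "((\<lambda>\<epsilon>. Complex x (- \<epsilon>)) \<longlongrightarrow> of_real x) (at_right 0)"
    unfolding complex_of_real_def
    by (intro tendsto_Complex tendsto_const tendsto_ident_at) (intro tendsto_Complex tendsto_const tendsto_eq_intros, auto)
  note tA = isCont_tendsto_compose[OF isCont_Arccos_cut_plane_trig[OF xt] t(1)] isCont_tendsto_compose[OF isCont_Arccos_cut_plane_trig[OF xt] t(2)]
  have T: "((\<lambda>\<epsilon>. \<i> * Arccos (Complex x \<epsilon>)) \<longlongrightarrow> \<i> * Arccos (of_real x)) (at_right 0)"
    "((\<lambda>\<epsilon>. - (\<i> * Arccos (Complex x (- \<epsilon>)))) \<longlongrightarrow> - (\<i> * Arccos (of_real x))) (at_right 0)"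
    by (intro tendsto_intros tA)+
  have L: "((\<lambda>\<epsilon>. dJ * kJ * laplaceI (\<i> * Arccos (Complex x \<epsilon>))) \<longlongrightarrow> dJ * kJ * laplaceI (\<i> * Arccos (of_real x))) (at_right 0)"
    "((\<lambda>\<epsilon>. dJ * kJ * laplaceI (- (\<i> * Arccos (Complex x (- \<epsilon>))))) \<longlongrightarrow> dJ * kJ * laplaceI (- (\<i> * Arccos (of_real x)))) (at_right 0)"
    by (intro tendsto_mult tendsto_const isCont_tendsto_compose[OF cont(1) T(1)])
       (intro tendsto_mult tendsto_const isCont_tendsto_compose[OF cont(2) T(2)])
  have e1: "dJ * kJ * laplaceI (\<i> * Arccos (Complex x \<epsilon>)) = gegenbauer_D l \<alpha> (Complex x \<epsilon>)" if "\<epsilon> > 0" for \<epsilon>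
  proof -
    have D: "Complex x \<epsilon> \<in> cut_plane_D" using that by (simp add: mem_cut_plane_D)
    have h: "\<i> * Arccos (Complex x \<epsilon>) \<in> half_strip" using that by (intro i_Arccos_half_strip) (auto simp: complex_is_Real_iff)
    show ?thesis using gegJ_eq_laplaceI[OF h] gegenbauer_D_eq_gegJ[OF D] by (simp add: cosh_i_Arccos)
  qed
  have e2: "dJ * kJ * laplaceI (- (\<i> * Arccos (Complex x (- \<epsilon>)))) = gegenbauer_D l \<alpha> (Complex x (- \<epsilon>))" if "\<epsilon> > 0" for \<epsilon>
  proof -
    have D: "Complex x (- \<epsilon>) \<in> cut_plane_D" using that by (simp add: mem_cut_plane_D)
    have h: "- (\<i> * Arccos (Complex x (- \<epsilon>))) \<in> half_strip" using that by (intro i_Arccos_half_strip) (auto simp: complex_is_Real_iff)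
    show ?thesis using gegJ_eq_laplaceI[OF h] gegenbauer_D_eq_gegJ[OF D] by (simp add: cosh_i_Arccos)
  qed
  show "Lim (at_right 0) (\<lambda>\<epsilon>. gegenbauer_D l \<alpha> (Complex x \<epsilon>)) = dJ * kJ * laplaceI (\<i> * Arccos (of_real x))"
    by (intro tendsto_Lim Lim_transform_eventually[OF L(1)] eventually_at_rightI[of 0 1]) (auto simp: e1)
  show "Lim (at_right 0) (\<lambda>\<epsilon>. gegenbauer_D l \<alpha> (Complex x (- \<epsilon>))) = dJ * kJ * laplaceI (- (\<i> * Arccos (of_real x)))"
    by (intro tendsto_Lim Lim_transform_eventually[OF L(2)] eventually_at_rightI[of 0 1]) (auto simp: e2)
qed

lemma holomorphic_laplaceI_Arccos:
  "(\<lambda>z. laplaceI (\<i> * Arccos z)) holomorphic_on cut_plane_trig"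
  "(\<lambda>z. laplaceI (- (\<i> * Arccos z))) holomorphic_on cut_plane_trig"
proof -
  have I: "laplaceI holomorphic_on laplace_domain"
    using has_derivative_laplaceI open_laplace_domain by (auto simp: holomorphic_on_open)
  show "(\<lambda>z. laplaceI (\<i> * Arccos z)) holomorphic_on cut_plane_trig"
    by (rule holomorphic_on_compose_gen[of "\<lambda>z. \<i> * Arccos z" _ _ laplace_domain, unfolded o_def])
       (use I i_Arccos_laplace_domain in \<open>auto intro!: holomorphic_intros holomorphic_Arccos_cut_plane_trig\<close>)
  show "(\<lambda>z. laplaceI (- (\<i> * Arccos z))) holomorphic_on cut_plane_trig"
    by (rule holomorphic_on_compose_gen[of "\<lambda>z. - (\<i> * Arccos z)" _ _ laplace_domain, unfolded o_def])
       (use I i_Arccos_laplace_domain in \<open>auto intro!: holomorphic_intros holomorphic_Arccos_cut_plane_trig\<close>)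
qed

lemma gegenbauer_D_trig_eq:
  assumes z: "z \<in> cut_plane_trig"
  shows "gegenbauer_D_trig l \<alpha> z =
     exp (- (\<i> * pi / 2)) * (dJ * kJ * laplaceI (\<i> * Arccos z))
     + exp (- 2 * \<i> * pi * (\<alpha> - 1 / 4)) * (dJ * kJ * laplaceI (- (\<i> * Arccos z)))"
  unfolding gegenbauer_D_trig_def
proof (rule analytic_extension_trig_eqI[OF _ _ z])
  show "(\<lambda>z. exp (- (\<i> * pi / 2)) * (dJ * kJ * laplaceI (\<i> * Arccos z))
     + exp (- 2 * \<i> * pi * (\<alpha> - 1 / 4)) * (dJ * kJ * laplaceI (- (\<i> * Arccos z)))) holomorphic_on cut_plane_trig"
    by (intro holomorphic_on_add holomorphic_on_mult holomorphic_on_const holomorphic_laplaceI_Arccos)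
qed (simp add: gegenbauer_D_trig_real_def gegenbauer_D_boundary)

end

subsection \<open>Connection formula\<close>

lemma connected_laplace_domain: "connected laplace_domain"
proof -
  have "starlike laplace_domain"
    unfolding starlike_def
  proof (intro bexI[of _ 1] ballI subsetI)
    fix z w assume z: "z \<in> laplace_domain" and "w \<in> closed_segment 1 z"
    then obtain u where u: "0 \<le> u" "u \<le> 1" "w = of_real (1 - u) * 1 + of_real u * z"
      by (auto simp: in_segment scaleR_conv_of_real)
    have "\<bar>u * Im z\<bar> < pi"
    proof -
      have "\<bar>u * Im z\<bar> \<le> 1 * \<bar>Im z\<bar>" unfolding abs_mult using u by (intro mult_right_mono) auto
      then show ?thesis using z by (simp add: mem_laplace_domain)
    qed
    moreover have "1 - u + u * Re z > 0" if "Im z = 0"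
    proof (cases "u = 1")
      case False
      have "u * Re z \<ge> 0" using z that u by (simp add: mem_laplace_domain)
      then show ?thesis using False u by simp
    qed (use z that in \<open>simp add: mem_laplace_domain\<close>)
    moreover have "1 - u + u * Re z > 0" if "u = 0" using that by simp
    ultimately show "w \<in> laplace_domain" using u(3) by (auto simp: mem_laplace_domain)
  qed (simp add: mem_laplace_domain)
  then show ?thesis by (rule starlike_imp_connected)
qed

lemma constant_if_zero_derivative:
  fixes V :: "complex \<Rightarrow> complex"
  assumes "open S" "connected S" "\<And>z. z \<in> S \<Longrightarrow> (V has_field_derivative 0) (at z)"
    "a \<in> S" "b \<in> S"
  shows "V a = V b"
proof -
  have "V constant_on S"
    using assms by (intro has_field_derivative_0_imp_constant_on) auto
  then show ?thesis using assms(4,5) by (auto simp: constant_on_def)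
qed

text \<open>Abel's identity: the Wronskian satisfies W' = - 2 \<alpha> coth b W, and the factor
  sinh^(2 \<alpha>) compensates this.\<close>

lemma DERIV_wronskian_sinh:
  fixes f f' g g' :: "complex \<Rightarrow> complex"
  assumes "sinh b \<notin> \<real>\<^sub>\<le>\<^sub>0"
    "(f has_field_derivative f' b) (at b)" "(f' has_field_derivative (q * f b - 2 * \<alpha> * cosh b / sinh b * f' b)) (at b)"
    "(g has_field_derivative g' b) (at b)" "(g' has_field_derivative (q * g b - 2 * \<alpha> * cosh b / sinh b * g' b)) (at b)"
  shows "((\<lambda>b. (f b * g' b - f' b * g b) * sinh b powr (2 * \<alpha>)) has_field_derivative 0) (at b)"
proof -
  have nz: "sinh b \<noteq> 0" using assms(1) by auto
  have dW: "((\<lambda>b. f b * g' b - f' b * g b) has_field_derivative (- 2 * \<alpha> * cosh b / sinh b * (f b * g' b - f' b * g b))) (at b)"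
    by (rule derivative_eq_intros assms(2-) refl)+ (simp add: field_simps nz)
  have dS: "((\<lambda>z. sinh z powr (2 * \<alpha>)) has_field_derivative (2 * \<alpha> * sinh b powr (2 * \<alpha> - 1) * cosh b)) (at b)"
    by (rule derivative_eq_intros refl assms(1))+ simp
  have "sinh b powr (2 * \<alpha> - 1) = sinh b powr (2 * \<alpha>) / sinh b"
    using nz by (simp add: powr_diff)
  then have "- 2 * \<alpha> * cosh b / sinh b * (f b * g' b - f' b * g b) * sinh b powr (2 * \<alpha>) +
      2 * \<alpha> * sinh b powr (2 * \<alpha> - 1) * cosh b * (f b * g' b - f' b * g b) = 0"
    by simp
  from DERIV_cong[OF DERIV_mult[OF dW dS] this] show ?thesis .
qed

context gegenbauer_params
begin

section \<open>The first-kind function and the Wronskians\<close>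

definition regC :: "complex \<Rightarrow> complex" where
  "regC z = reg_hypergeo (- l) mu (\<alpha> + 1 / 2) ((1 - z) / 2)"

definition regC' :: "complex \<Rightarrow> complex" where
  "regC' z = deriv (reg_hypergeo (- l) mu (\<alpha> + 1 / 2)) ((1 - z) / 2) * (- 1 / 2)"

text \<open>The second derivative is described through (z^2 - 1) D and not as a quotient, since z =
  1 belongs to the domain and continuity of \<open>regC'\<close> there is used.\<close>

lemma regC_derivatives:
  assumes z: "z \<in> cut_plane_C"
  shows "(regC has_field_derivative regC' z) (at z)"
    and "\<exists>D. (regC' has_field_derivative D) (at z) \<and> (z\<^sup>2 - 1) * D = l * mu * regC z - (2 * \<alpha> + 1) * z * regC' z"
proof -
  let ?F = "reg_hypergeo (- l) mu (\<alpha> + 1 / 2)" and ?x = "(1 - z) / 2"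
  have x: "?x \<in> cut_plane_F" using z by (simp add: cut_plane_C_def)
  have d: "((\<lambda>z. (1 - z) / 2) has_field_derivative (- 1 / 2)) (at z)"
    by (auto intro!: derivative_eq_intros)
  have dF: "(?F has_field_derivative deriv ?F ?x) (at ?x)" "(deriv ?F has_field_derivative deriv (deriv ?F) ?x) (at ?x)"
    using x holomorphic_reg_hypergeo open_cut_planes(1) by (auto intro!: holomorphic_derivI holomorphic_deriv)
  show "(regC has_field_derivative regC' z) (at z)"
    unfolding regC_def [abs_def] regC'_def by (rule DERIV_chain2[OF dF(1) d])
  have "(regC' has_field_derivative (deriv (deriv ?F) ?x * (- 1 / 2)) * (- 1 / 2)) (at z)"
    unfolding regC'_def [abs_def] by (rule DERIV_cmult_right[OF DERIV_chain2[OF dF(2) d]])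
  moreover have "(z\<^sup>2 - 1) * ((deriv (deriv ?F) ?x * (- 1 / 2)) * (- 1 / 2)) = l * mu * regC z - (2 * \<alpha> + 1) * z * regC' z"
  proof -
    define F0 F1 F2 where "F0 = ?F ?x" and "F1 = deriv ?F ?x" and "F2 = deriv (deriv ?F) ?x"
    have ode: "?x * (1 - ?x) * F2 + ((\<alpha> + 1 / 2) - (- l + mu + 1) * ?x) * F1 - (- l) * mu * F0 = 0"
      unfolding F0_def F1_def F2_def by (rule hypergeometric_ODE[OF x])
    have e: "?x * (1 - ?x) = - (z\<^sup>2 - 1) / 4" by (simp add: field_simps power2_eq_square)
    have "(z\<^sup>2 - 1) * ((F2 * (- 1 / 2)) * (- 1 / 2)) = (l * mu * F0 - (2 * \<alpha> + 1) * z * (F1 * (- 1 / 2)))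
        - (?x * (1 - ?x) * F2 + ((\<alpha> + 1 / 2) - (- l + mu + 1) * ?x) * F1 - (- l) * mu * F0)"
      unfolding e mu_def by (simp add: field_simps)
    then show ?thesis unfolding ode by (simp add: regC_def regC'_def F0_def F1_def F2_def)
  qed
  ultimately show "\<exists>D. (regC' has_field_derivative D) (at z) \<and> (z\<^sup>2 - 1) * D = l * mu * regC z - (2 * \<alpha> + 1) * z * regC' z"
    by blast
qed

lemma cosh_in_cut_plane_C:
  assumes "\<bar>Im b\<bar> < pi"
  shows "cosh b \<in> cut_plane_C"
proof (rule ccontr)
  assume "cosh b \<notin> cut_plane_C"
  then have e: "sinh (Re b) * sin (Im b) = 0" "cosh (Re b) * cos (Im b) \<le> -1"
    by (auto simp: mem_cut_plane_C Re_cosh Im_cosh)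
  show False
  proof (cases "Im b = 0")
    case True
    then show False using e cosh_real_pos[of "Re b"] by simp
  next
    case False
    then have "sin (Im b) \<noteq> 0" using assms sin_nonzero_strip by simp
    then have "cos (Im b) \<le> -1" using e by auto
    then have "cos (Im b) = -1" using cos_ge_minus_one[of "Im b"] by linarith
    then have "(sin (Im b))\<^sup>2 = 0" using sin_squared_eq[of "Im b"] by simp
    then show False using \<open>sin (Im b) \<noteq> 0\<close> by simp
  qed
qed

lemma regC_cosh_derivatives:
  assumes b: "b \<in> laplace_domain"
  shows "((\<lambda>b. regC (cosh b)) has_field_derivative regC' (cosh b) * sinh b) (at b)"
    and "((\<lambda>b. regC' (cosh b) * sinh b) has_field_derivative
          (l * mu * regC (cosh b) - 2 * \<alpha> * cosh b / sinh b * (regC' (cosh b) * sinh b))) (at b)"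
proof -
  have z: "cosh b \<in> cut_plane_C" using b by (intro cosh_in_cut_plane_C) (auto simp: mem_laplace_domain)
  have s: "sinh b \<noteq> 0" by (rule sinh_nonzero[OF b])
  have dc: "(cosh has_field_derivative sinh b) (at b)" by (auto intro!: derivative_eq_intros)
  show "((\<lambda>b. regC (cosh b)) has_field_derivative regC' (cosh b) * sinh b) (at b)"
    by (rule DERIV_chain2[OF regC_derivatives(1)[OF z] dc])
  have ds: "(sinh has_field_derivative cosh b) (at b)" by (auto intro!: derivative_eq_intros)
  obtain D where D: "(regC' has_field_derivative D) (at (cosh b))"
    "((cosh b)\<^sup>2 - 1) * D = l * mu * regC (cosh b) - (2 * \<alpha> + 1) * cosh b * regC' (cosh b)"
    using regC_derivatives(2)[OF z] by blast
  have e: "(cosh b)\<^sup>2 - 1 = (sinh b)\<^sup>2" using hyperbolic_pythagoras[of b] by (simp add: algebra_simps)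
  have D': "D * sinh b * sinh b = l * mu * regC (cosh b) - (2 * \<alpha> + 1) * cosh b * regC' (cosh b)"
    using D(2) unfolding e by (simp add: power2_eq_square mult_ac)
  show "((\<lambda>b. regC' (cosh b) * sinh b) has_field_derivative
          (l * mu * regC (cosh b) - 2 * \<alpha> * cosh b / sinh b * (regC' (cosh b) * sinh b))) (at b)"
    by (rule DERIV_cong[OF DERIV_mult[OF DERIV_chain2[OF D(1) dc] ds]], unfold D')
       (use s in \<open>simp add: algebra_simps\<close>)
qed

text \<open>The substitution \<open>t = 1 + \<sigma> / sinh r\<close> exhibits the singular factor of the derivative at \<open>r = 0\<close>.\<close>
lemma laplaceI'_rescaled:
  assumes r: "r > 0"
  shows "laplaceI' (of_real r) * of_real (sinh r) powr (2 * \<alpha>) =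
    (\<integral>\<sigma>. - mu * (of_real (exp r + \<sigma>) powr (- mu - 1) * of_real ((sinh r)\<^sup>2 + sinh r * cosh r + cosh r * \<sigma>) *
        of_real (\<sigma> * (\<sigma> + 2 * sinh r)) powr (\<alpha> - 1)) \<partial>lborel_gt 0)"
proof -
  define s c where "s = sinh r" and "c = cosh r"
  have s: "s > 0" using r by (simp add: s_def)
  let ?f = "\<lambda>t. - mu * base (of_real r) t powr (- mu - 1) * (sinh (of_real r) + of_real t * cosh (of_real r)) * gweight \<alpha> t"
  have "laplaceI' (of_real r) = (1 / s) *\<^sub>R (\<integral>\<sigma>. ?f (1 + 1 / s * \<sigma>) \<partial>lborel_gt 0)"
    unfolding laplaceI'_def using integral_lborel_gt_affine(2)[of "1 / s" 1 0 ?f] s by simp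
  then have "laplaceI' (of_real r) * of_real s powr (2 * \<alpha>) =
      (of_real (1 / s) * of_real s powr (2 * \<alpha>)) * (\<integral>\<sigma>. ?f (1 + 1 / s * \<sigma>) \<partial>lborel_gt 0)"
    by (simp add: scaleR_conv_of_real)
  also have "\<dots> = (\<integral>\<sigma>. (of_real (1 / s) * of_real s powr (2 * \<alpha>)) * ?f (1 + 1 / s * \<sigma>) \<partial>lborel_gt 0)"
    by (rule Bochner_Integration.integral_mult_right_zero [symmetric])
  also have "\<dots> = (\<integral>\<sigma>. - mu * (of_real (exp r + \<sigma>) powr (- mu - 1) * of_real (s\<^sup>2 + s * c + c * \<sigma>) *
        of_real (\<sigma> * (\<sigma> + 2 * s)) powr (\<alpha> - 1)) \<partial>lborel_gt 0)"
  proof (intro Bochner_Integration.integral_cong refl)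
    fix \<sigma> assume "\<sigma> \<in> space (lborel_gt 0)"
    then have \<sigma>: "\<sigma> > 0" by simp
    have sc: "sinh (of_real r) = complex_of_real s" "cosh (of_real r) = complex_of_real c"
      by (simp_all add: s_def c_def sinh_cosh_of_real)
    have b: "base (of_real r) (1 + 1 / s * \<sigma>) = of_real (exp r + \<sigma>)"
    proof -
      have "base (of_real r) (1 + 1 / s * \<sigma>) = of_real (c + (1 + 1 / s * \<sigma>) * s)" unfolding sc by simp
      also have "c + (1 + 1 / s * \<sigma>) * s = (s + c) + \<sigma>" using s by (simp add: field_simps)
      also have "s + c = exp r" unfolding s_def c_def by (rule sinh_plus_cosh)
      finally show ?thesis .
    qed
    have q: "sinh (of_real r) + of_real (1 + 1 / s * \<sigma>) * cosh (of_real r) = complex_of_real ((s\<^sup>2 + s * c + c * \<sigma>) / s)"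
    proof -
      have "sinh (of_real r) + of_real (1 + 1 / s * \<sigma>) * cosh (of_real r) = complex_of_real (s + (1 + 1 / s * \<sigma>) * c)"
        unfolding sc by simp
      also have "s + (1 + 1 / s * \<sigma>) * c = (s\<^sup>2 + s * c + c * \<sigma>) / s" using s by (simp add: field_simps power2_eq_square)
      finally show ?thesis .
    qed
    have g: "gweight \<alpha> (1 + 1 / s * \<sigma>) = of_real (\<sigma> * (\<sigma> + 2 * s)) powr (\<alpha> - 1) * of_real s powr (2 - 2 * \<alpha>)"
    proof -
      have pos: "0 < \<sigma> * (\<sigma> + 2 * s)" "0 < 1 / s" "0 < 1 / s * (1 / s)" using s \<sigma> by simp_all
      have "(1 + 1 / s * \<sigma>)\<^sup>2 - 1 = (\<sigma> * (\<sigma> + 2 * s)) * (1 / s * (1 / s))" using s by (simp add: field_simps power2_eq_square)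
      then have "gweight \<alpha> (1 + 1 / s * \<sigma>) = (complex_of_real (\<sigma> * (\<sigma> + 2 * s)) * (of_real (1 / s) * of_real (1 / s))) powr (\<alpha> - 1)"
        by (simp only: gweight_def of_real_mult)
      also have "\<dots> = of_real (\<sigma> * (\<sigma> + 2 * s)) powr (\<alpha> - 1) * (of_real (1 / s) powr (\<alpha> - 1) * of_real (1 / s) powr (\<alpha> - 1))"
        by (simp only: of_real_mult [symmetric] powr_of_real_mult[OF pos(1,3)] powr_of_real_mult[OF pos(2,2)])
      also have "complex_of_real (1 / s) powr (\<alpha> - 1) * of_real (1 / s) powr (\<alpha> - 1) = of_real s powr (2 - 2 * \<alpha>)"
      proof -
        have "complex_of_real (1 / s) powr (\<alpha> - 1) = of_real s powr (1 - \<alpha>)"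
        proof -
          have "Ln (complex_of_real (1 / s)) = - Ln (of_real s)"
            using s by (simp only: Ln_of_real zero_less_divide_1_iff) (simp add: ln_div)
          then show ?thesis using s by (simp add: powr_def algebra_simps)
        qed
        then have "complex_of_real (1 / s) powr (\<alpha> - 1) * of_real (1 / s) powr (\<alpha> - 1) = of_real s powr ((1 - \<alpha>) + (1 - \<alpha>))"
          by (simp only: powr_add)
        then show ?thesis by (simp add: algebra_simps)
      qed
      finally show ?thesis .
    qed
    have p: "complex_of_real s powr (2 * \<alpha>) * of_real s powr (2 - 2 * \<alpha>) = of_real s * of_real s"
    proof -
      have "complex_of_real s powr (2 * \<alpha>) * of_real s powr (2 - 2 * \<alpha>) = of_real s powr (2 * \<alpha> + (2 - 2 * \<alpha>))"
        by (simp only: powr_add)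
      also have "2 * \<alpha> + (2 - 2 * \<alpha>) = of_nat 2" by simp
      also have "complex_of_real s powr of_nat 2 = of_real s * of_real s"
        using s by (subst powr_nat') (simp_all add: power2_eq_square)
      finally show ?thesis .
    qed
    have "(of_real (1 / s) * of_real s powr (2 * \<alpha>)) * ?f (1 + 1 / s * \<sigma>) =
        - mu * (of_real (exp r + \<sigma>) powr (- mu - 1) * (of_real (1 / s) * of_real ((s\<^sup>2 + s * c + c * \<sigma>) / s) *
        (of_real s powr (2 * \<alpha>) * of_real s powr (2 - 2 * \<alpha>))) * of_real (\<sigma> * (\<sigma> + 2 * s)) powr (\<alpha> - 1))"
      unfolding b q g by (simp only: mult_ac)
    also have "of_real (1 / s) * of_real ((s\<^sup>2 + s * c + c * \<sigma>) / s) * (of_real s powr (2 * \<alpha>) * of_real s powr (2 - 2 * \<alpha>)) =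
        complex_of_real (s\<^sup>2 + s * c + c * \<sigma>)"
    proof -
      have "1 / s * ((s\<^sup>2 + s * c + c * \<sigma>) / s) * (s * s) = s\<^sup>2 + s * c + c * \<sigma>" using s by (simp add: field_simps)
      then show ?thesis unfolding p by (simp only: of_real_mult [symmetric])
    qed
    finally show "(of_real (1 / s) * of_real s powr (2 * \<alpha>)) * ?f (1 + 1 / s * \<sigma>) =
        - mu * (of_real (exp r + \<sigma>) powr (- mu - 1) * of_real (s\<^sup>2 + s * c + c * \<sigma>) * of_real (\<sigma> * (\<sigma> + 2 * s)) powr (\<alpha> - 1))" .
  qed
  finally show ?thesis unfolding s_def c_def .
qed

text \<open>In the rescaled form the integrand has the limit - \<mu> \<sigma>^(2 \<alpha> - 1) (1 +
  \<sigma>)^(-(2 \<alpha> + l + 1)) as r tends to 0, again a Beta integrand; the power sinh^(2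
  \<alpha>) is exactly what makes this limit finite.\<close>

lemma laplaceI'_at_0:
  "((\<lambda>r. laplaceI' (of_real r) * of_real (sinh r) powr (2 * \<alpha>)) \<longlongrightarrow> - mu * Beta (2 * \<alpha>) (l + 1)) (at 0 within {0<..<1})"
proof -
  define \<rho> m where "\<rho> = Re \<alpha>" and "m = Re mu"
  have m: "m > 2 * \<rho> - 1" "\<rho> > 0" "m > -1" using Re_mu Re_alpha by (auto simp: m_def \<rho>_def)
  define f where "f = (\<lambda>r \<sigma>. - mu * (complex_of_real (exp r + \<sigma>) powr (- mu - 1) * of_real ((sinh r)\<^sup>2 + sinh r * cosh r + cosh r * \<sigma>) *
        of_real (\<sigma> * (\<sigma> + 2 * sinh r)) powr (\<alpha> - 1)))"
  define g where "g = (\<lambda>\<sigma>. - mu * (complex_of_real \<sigma> powr (2 * \<alpha> - 1) * of_real (1 + \<sigma>) powr (- (2 * \<alpha> + (l + 1)))))"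
  \<comment> \<open>For r < 1 both sinh r and cosh r are at most 2. The polynomial factor is at most
    4 (\<sigma> + 2 sinh r); absorbed into the weight it gives (\<sigma> + 2 sinh r)^\<rho>, which
    is increasing because \<rho> > 0 and at most (4 (1 + \<sigma>))^\<rho>.\<close>
  define w where "w = (\<lambda>\<sigma>. (norm mu * 4 * 4 powr \<rho>) * (\<sigma> powr (\<rho> - 1) * (1 + \<sigma>) powr (- (\<rho> + (m + 1 - 2 * \<rho>)))))"
  have "((\<lambda>r. \<integral>\<sigma>. f r \<sigma> \<partial>lborel_gt 0) \<longlongrightarrow> (\<integral>\<sigma>. g \<sigma> \<partial>lborel_gt 0)) (at 0 within {0<..<1})"
  proof (rule dominated_convergence_within)
    show "f r \<in> borel_measurable (lborel_gt 0)" if "r \<in> {0<..<1}" for r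
    proof -
      have p: "exp r > 0" "sinh r > 0" using that by auto
      have "complex_of_real (exp r + \<sigma>) \<notin> \<real>\<^sub>\<le>\<^sub>0" "complex_of_real (\<sigma> * (\<sigma> + 2 * sinh r)) \<notin> \<real>\<^sub>\<le>\<^sub>0" if "\<sigma> > 0" for \<sigma>
      proof -
        have "exp r + \<sigma> > 0" "\<sigma> * (\<sigma> + 2 * sinh r) > 0" using p that by (auto intro!: mult_pos_pos add_pos_pos)
        then show "complex_of_real (exp r + \<sigma>) \<notin> \<real>\<^sub>\<le>\<^sub>0" "complex_of_real (\<sigma> * (\<sigma> + 2 * sinh r)) \<notin> \<real>\<^sub>\<le>\<^sub>0"
          by (auto simp only: complex_nonpos_Reals_iff Re_complex_of_real)
      qed
      then have "continuous_on {0<..} (\<lambda>\<sigma>. complex_of_real (exp r + \<sigma>) powr (- mu - 1))"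
          "continuous_on {0<..} (\<lambda>\<sigma>. complex_of_real (\<sigma> * (\<sigma> + 2 * sinh r)) powr (\<alpha> - 1))"
        by (intro continuous_at_imp_continuous_on ballI isCont_powr_complex continuous_intros; simp only: greaterThan_iff not_False_eq_True)+
      then show ?thesis
        unfolding f_def by (intro measurable_lborel_gt_continuous continuous_on_mult continuous_on_const) (auto intro!: continuous_intros)
    qed
    note B = integrable_Beta_second_kind[of "2 * \<alpha>" "l + 1"]
    have B': "integrable (lborel_gt 0) g"
      unfolding g_def by (intro Bochner_Integration.integrable_mult_right B) (use Re_alpha Re_l in auto)
    then show "g \<in> borel_measurable (lborel_gt 0)" by (rule borel_measurable_integrable)
    show "integrable (lborel_gt 0) w"
      unfolding w_def by (intro Bochner_Integration.integrable_mult_right Beta_second_kind_real(1)) (use m in auto)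
    show "norm (f r \<sigma>) \<le> w \<sigma>" if r: "r \<in> {0<..<1}" and "\<sigma> \<in> space (lborel_gt 0)" for r \<sigma>
    proof -
      have \<sigma>: "\<sigma> > 0" using that by simp
      define s c where "s = sinh r" and "c = cosh r"
      have s0: "s > 0" using r by (simp add: s_def)
      have c1: "c \<ge> 1" unfolding c_def by (rule cosh_real_ge_1)
      have e1: "exp r \<ge> 1" using r by simp
      have "exp (1::real) \<le> 3" by (rule exp_le)
      moreover have "exp r \<le> exp 1" "exp (- r) \<le> 1" using r by simp_all
      ultimately have "exp r + exp (- r) \<le> 4" by linarith
      then have c2: "c \<le> 2" by (simp add: c_def cosh_field_def)
      have sc: "s \<le> c" unfolding s_def c_def by (simp add: sinh_field_def cosh_field_def)
      have ss: "s\<^sup>2 \<le> s * c" unfolding power2_eq_square using sc s0 by (intro mult_left_mono) auto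
      have pos: "\<sigma> * (\<sigma> + 2 * s) > 0" using \<sigma> s0 by simp
      have n1: "norm (complex_of_real (exp r + \<sigma>) powr (- mu - 1)) = (exp r + \<sigma>) powr (- m - 1)"
        using \<sigma> e1 add_pos_pos[OF exp_gt_zero \<sigma>, of r] by (subst norm_of_real_powr) (simp_all add: m_def)
      have n2: "norm (complex_of_real (\<sigma> * (\<sigma> + 2 * s)) powr (\<alpha> - 1)) = \<sigma> powr (\<rho> - 1) * (\<sigma> + 2 * s) powr (\<rho> - 1)"
        using pos \<sigma> s0 by (subst norm_of_real_powr) (simp_all add: \<rho>_def powr_mult)
      have p0: "0 \<le> s\<^sup>2 + s * c + c * \<sigma>" using s0 c1 \<sigma> by (intro add_nonneg_nonneg mult_nonneg_nonneg) auto
      have n3: "norm (complex_of_real (s\<^sup>2 + s * c + c * \<sigma>)) = s\<^sup>2 + s * c + c * \<sigma>"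
        unfolding norm_of_real using p0 by (rule abs_of_nonneg)
      have b3: "s\<^sup>2 + s * c + c * \<sigma> \<le> 4 * (\<sigma> + 2 * s)"
      proof -
        have "s\<^sup>2 + s * c + c * \<sigma> \<le> 2 * (s * c) + c * \<sigma>" using ss by linarith
        also have "\<dots> = c * (2 * s + \<sigma>)" by (simp add: algebra_simps)
        also have "\<dots> \<le> 4 * (2 * s + \<sigma>)" using c2 s0 \<sigma> by (intro mult_right_mono) auto
        finally show ?thesis by (simp add: algebra_simps)
      qed
      have b1: "(exp r + \<sigma>) powr (- m - 1) \<le> (1 + \<sigma>) powr (- m - 1)"
        using m e1 \<sigma> by (intro powr_mono2') auto
      have "norm (f r \<sigma>) = norm mu * ((exp r + \<sigma>) powr (- m - 1) * (s\<^sup>2 + s * c + c * \<sigma>) * (\<sigma> powr (\<rho> - 1) * (\<sigma> + 2 * s) powr (\<rho> - 1)))"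
        unfolding f_def s_def [symmetric] c_def [symmetric] norm_mult norm_minus_cancel n1 n2 n3 ..
      also have "\<dots> \<le> norm mu * ((1 + \<sigma>) powr (- m - 1) * (4 * (\<sigma> + 2 * s)) * (\<sigma> powr (\<rho> - 1) * (\<sigma> + 2 * s) powr (\<rho> - 1)))"
        using p0 by (intro mult_left_mono mult_right_mono mult_mono b1 b3) auto
      also have "\<dots> = norm mu * 4 * (\<sigma> powr (\<rho> - 1) * (1 + \<sigma>) powr (- m - 1)) * ((\<sigma> + 2 * s) powr (\<rho> - 1) * (\<sigma> + 2 * s))"
        by (simp only: mult_ac)
      also have "(\<sigma> + 2 * s) powr (\<rho> - 1) * (\<sigma> + 2 * s) = (\<sigma> + 2 * s) powr \<rho>"
        using \<sigma> s0 by (simp add: powr_diff)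
      also have "norm mu * 4 * (\<sigma> powr (\<rho> - 1) * (1 + \<sigma>) powr (- m - 1)) * (\<sigma> + 2 * s) powr \<rho> \<le>
          norm mu * 4 * (\<sigma> powr (\<rho> - 1) * (1 + \<sigma>) powr (- m - 1)) * (4 * (1 + \<sigma>)) powr \<rho>"
        using sc c2 \<sigma> s0 m by (intro mult_left_mono powr_mono2) auto
      also have "(4 * (1 + \<sigma>)) powr \<rho> = 4 powr \<rho> * (1 + \<sigma>) powr \<rho>" by (rule powr_mult)
      also have "norm mu * 4 * (\<sigma> powr (\<rho> - 1) * (1 + \<sigma>) powr (- m - 1)) * (4 powr \<rho> * (1 + \<sigma>) powr \<rho>) =
          (norm mu * 4 * 4 powr \<rho>) * (\<sigma> powr (\<rho> - 1) * ((1 + \<sigma>) powr (- m - 1) * (1 + \<sigma>) powr \<rho>))"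
        by (simp only: mult_ac)
      also have "(1 + \<sigma>) powr (- m - 1) * (1 + \<sigma>) powr \<rho> = (1 + \<sigma>) powr (- (\<rho> + (m + 1 - 2 * \<rho>)))"
      proof -
        have "(- m - 1) + \<rho> = - (\<rho> + (m + 1 - 2 * \<rho>))" by simp
        then show ?thesis by (simp only: powr_add [symmetric])
      qed
      finally show ?thesis by (simp only: w_def)
    qed
    show "((\<lambda>r. f r \<sigma>) \<longlongrightarrow> g \<sigma>) (at 0 within {0<..<1})" if "\<sigma> \<in> space (lborel_gt 0)" for \<sigma>
    proof -
      have \<sigma>: "\<sigma> > 0" using that by simp
      have t1: "((\<lambda>r. exp r + \<sigma>) \<longlongrightarrow> exp 0 + \<sigma>) (at 0 within {0<..<1})" by (intro tendsto_intros)
      have t2: "((\<lambda>r. (sinh r)\<^sup>2 + sinh r * cosh r + cosh r * \<sigma>) \<longlongrightarrow> (sinh 0)\<^sup>2 + sinh 0 * cosh 0 + cosh 0 * \<sigma>) (at 0 within {0<..<1})"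
        by (intro tendsto_intros)
      have t3: "((\<lambda>r. \<sigma> * (\<sigma> + 2 * sinh r)) \<longlongrightarrow> \<sigma> * (\<sigma> + 2 * sinh 0)) (at 0 within {0<..<1})" by (intro tendsto_intros)
      have "((\<lambda>r. f r \<sigma>) \<longlongrightarrow> - mu * (complex_of_real (exp 0 + \<sigma>) powr (- mu - 1) * of_real ((sinh 0)\<^sup>2 + sinh 0 * cosh 0 + cosh 0 * \<sigma>) *
        of_real (\<sigma> * (\<sigma> + 2 * sinh 0)) powr (\<alpha> - 1))) (at 0 within {0<..<1})"
        unfolding f_def using \<sigma>
        by (intro tendsto_mult tendsto_const tendsto_powr_complex tendsto_of_real t1 t2 t3) (auto simp: complex_nonpos_Reals_iff mult_le_0_iff)
      also have "- mu * (complex_of_real (exp 0 + \<sigma>) powr (- mu - 1) * of_real ((sinh 0)\<^sup>2 + sinh 0 * cosh 0 + cosh 0 * \<sigma>) *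
        of_real (\<sigma> * (\<sigma> + 2 * sinh 0)) powr (\<alpha> - 1)) = g \<sigma>"
      proof -
        have "complex_of_real (\<sigma> * \<sigma>) powr (\<alpha> - 1) = of_real \<sigma> powr (\<alpha> - 1) * of_real \<sigma> powr (\<alpha> - 1)"
          using \<sigma> by (intro powr_of_real_mult)
        also have "of_real \<sigma> * \<dots> = of_real \<sigma> powr (1 + (\<alpha> - 1) + (\<alpha> - 1))" using \<sigma> by (simp only: powr_add) simp
        also have "1 + (\<alpha> - 1) + (\<alpha> - 1) = 2 * \<alpha> - 1" by simp
        finally have 1: "complex_of_real \<sigma> * of_real (\<sigma> * \<sigma>) powr (\<alpha> - 1) = of_real \<sigma> powr (2 * \<alpha> - 1)" .
        have 2: "- mu - 1 = - (2 * \<alpha> + (l + 1))" by (simp add: mu_def)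
        show ?thesis unfolding g_def 1 [symmetric] 2 by (simp add: mult_ac)
      qed
      finally show ?thesis .
    qed
  qed
  moreover have "(\<integral>\<sigma>. g \<sigma> \<partial>lborel_gt 0) = - mu * Beta (2 * \<alpha>) (l + 1)"
    unfolding g_def Bochner_Integration.integral_mult_right_zero
    by (subst Beta_second_kind) (use Re_alpha Re_l in auto)
  moreover have "(\<integral>\<sigma>. f r \<sigma> \<partial>lborel_gt 0) = laplaceI' (of_real r) * of_real (sinh r) powr (2 * \<alpha>)" if "r > 0" for r
    unfolding f_def by (rule laplaceI'_rescaled[OF that, symmetric])
  ultimately have "((\<lambda>r. \<integral>\<sigma>. f r \<sigma> \<partial>lborel_gt 0) \<longlongrightarrow> - mu * Beta (2 * \<alpha>) (l + 1)) (at 0 within {0<..<1})"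
    "\<And>r. r > 0 \<Longrightarrow> (\<integral>\<sigma>. f r \<sigma> \<partial>lborel_gt 0) = laplaceI' (of_real r) * of_real (sinh r) powr (2 * \<alpha>)" by simp_all
  then show ?thesis
    by (elim Lim_transform_eventually) (auto simp: eventually_at_filter intro!: always_eventually)
qed

end

lemma powr_i: "\<i> powr a = exp (\<i> * pi / 2 * a)" "(- \<i>) powr a = exp (- (\<i> * pi / 2 * a))"
  by (simp_all add: powr_def mult_ac)

lemma Gamma_duplication_powr:
  fixes z :: complex
  assumes "z \<notin> \<int>\<^sub>\<le>\<^sub>0" "z + 1 / 2 \<notin> \<int>\<^sub>\<le>\<^sub>0"
  shows "Gamma z * Gamma (z + 1 / 2) = 2 powr (1 - 2 * z) * of_real (sqrt pi) * Gamma (2 * z)"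
proof -
  have "Ln 2 = complex_of_real (ln 2)" using Ln_of_real[of 2] by simp
  then have "(2::complex) powr (1 - 2 * z) = exp ((1 - 2 * z) * of_real (ln 2))" by (simp add: powr_def)
  then show ?thesis using Gamma_legendre_duplication[OF assms] by simp
qed

lemma powr_times_of_real:
  fixes c :: complex
  assumes "t > 0"
  shows "(c * of_real t) powr s = c powr s * of_real t powr s"
proof (cases "c = 0")
  case False
  then have "Ln (of_real t * c) = of_real (ln t) + Ln c" unfolding Ln_times_of_real[OF assms False] using assms by (simp add: Ln_of_real)
  then show ?thesis using assms False by (simp only: powr_def Ln_of_real mult.commute[of c] ring_distribs exp_add) (simp add: Ln_of_real)
qed simp

lemma sinh_cosh_i_times_of_real:
  "sinh (\<i> * complex_of_real x) = \<i> * of_real (sin x)" "cosh (\<i> * complex_of_real x) = of_real (cos x)"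
  by (simp_all add: sinh_field_def cosh_field_def exp_Euler exp_minus_Euler sin_of_real cos_of_real)

lemma powr_i_times_real:
  assumes "s > 0"
  shows "(\<i> * complex_of_real s) powr (2 * a) = exp (\<i> * pi * a) * of_real s powr (2 * a)"
    and "(- (\<i> * complex_of_real s)) powr (2 * a) = exp (- (\<i> * pi * a)) * of_real s powr (2 * a)"
proof -
  have "(\<i> * complex_of_real s) powr (2 * a) = \<i> powr (2 * a) * of_real s powr (2 * a)"
    "((- \<i>) * complex_of_real s) powr (2 * a) = (- \<i>) powr (2 * a) * of_real s powr (2 * a)"
    using assms by (rule powr_times_of_real)+
  then show "(\<i> * complex_of_real s) powr (2 * a) = exp (\<i> * pi * a) * of_real s powr (2 * a)"
    "(- (\<i> * complex_of_real s)) powr (2 * a) = exp (- (\<i> * pi * a)) * of_real s powr (2 * a)"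
    by (simp_all add: powr_i mult.assoc)
qed

context gegenbauer_params
begin

text \<open>The bound in the right half plane gives growth at most sinh^(-e) with e < 2 Re \<alpha>
  near 0, so the weight sinh^(2 \<alpha> + 1) forces the limit 0.\<close>

lemma laplaceI_at_0:
  "((\<lambda>r. laplaceI (of_real r) * of_real (sinh r) powr (2 * \<alpha>) * of_real (sinh r)) \<longlongrightarrow> 0) (at 0 within {0<..<1})"
proof -
  obtain e M where e: "0 \<le> e" "e < 2 * Re \<alpha>" "M \<ge> 0"
    "\<And>w. Re w > 1 \<Longrightarrow> norm (gegJ w) \<le> M * norm w powr (e - Re mu) * norm (w\<^sup>2 - 1) powr (- e / 2)"
    using gegJ_bound_right_half_plane by blast
  have np: "\<alpha> \<notin> \<int>\<^sub>\<le>\<^sub>0" "l + 1 \<notin> \<int>\<^sub>\<le>\<^sub>0"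
    using Re_alpha Re_l by (auto intro!: Re_pos_imp_not_nonpos_Int)
  have k: "kJ \<noteq> 0" using np by (simp add: kJ_def Gamma_eq_zero_iff)
  define p where "p = 2 * Re \<alpha> + 1 - e"
  have p: "p > 0" using e by (simp add: p_def)
  have bd: "norm (laplaceI (of_real r) * of_real (sinh r) powr (2 * \<alpha>) * of_real (sinh r)) \<le>
      M / norm kJ * cosh r powr (e - Re mu) * sinh r powr p" if r: "r > 0" for r
  proof -
    have c: "cosh r > 1" using r cosh_real_strict_mono[of 0 r] by simp
    have s: "sinh r > 0" using r by simp
    have "(complex_of_real (cosh r))\<^sup>2 - 1 = of_real ((sinh r)\<^sup>2)" by (simp add: sinh_square_eq)
    then have n: "norm ((complex_of_real (cosh r))\<^sup>2 - 1) powr (- e / 2) = sinh r powr (- e)"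
      using s by (simp add: norm_power powr_powr flip: powr_numeral)
    have "norm (gegJ (of_real (cosh r))) \<le> M * norm (complex_of_real (cosh r)) powr (e - Re mu) * sinh r powr (- e)"
      using e(4)[of "of_real (cosh r)"] c unfolding n by simp
    moreover have "gegJ (of_real (cosh r)) = kJ * laplaceI (of_real r)"
    proof -
      have "cosh (complex_of_real r) = of_real (cosh r)" by (rule sinh_cosh_of_real)
      then show ?thesis using gegJ_eq_laplaceI[of "of_real r"] r by (simp add: mem_half_strip)
    qed
    ultimately have "norm (laplaceI (of_real r)) \<le> M / norm kJ * cosh r powr (e - Re mu) * sinh r powr (- e)"
      using k c by (simp add: norm_mult field_simps)
    moreover have "sinh r powr (- e) * (sinh r powr (2 * Re \<alpha>) * sinh r) = sinh r powr p"
      using s unfolding p_def by (simp add: powr_add powr_diff powr_minus field_simps)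
    moreover have "norm (laplaceI (of_real r) * of_real (sinh r) powr (2 * \<alpha>) * of_real (sinh r)) =
        norm (laplaceI (of_real r)) * (sinh r powr (2 * Re \<alpha>) * sinh r)"
      using s by (simp add: norm_mult norm_of_real_powr)
    moreover have "norm (laplaceI (of_real r)) * (sinh r powr (2 * Re \<alpha>) * sinh r) \<le>
        M / norm kJ * cosh r powr (e - Re mu) * sinh r powr (- e) * (sinh r powr (2 * Re \<alpha>) * sinh r)"
      using s by (intro mult_right_mono calculation(1)) auto
    ultimately show ?thesis by (simp only: mult.assoc)
  qed
  have "((\<lambda>r. M / norm kJ * cosh r powr (e - Re mu) * sinh r powr p) \<longlongrightarrow> M / norm kJ * cosh 0 powr (e - Re mu) * 0) (at 0 within {0<..<1})"
  proof (intro tendsto_mult tendsto_const tendsto_powr tendsto_intros)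
    have "((\<lambda>r::real. sinh r) \<longlongrightarrow> sinh 0) (at 0 within {0<..<1})" by (intro tendsto_intros)
    then have "((\<lambda>r::real. sinh r) \<longlongrightarrow> 0) (at 0 within {0<..<1})" by simp
    then have "((\<lambda>r. sinh r powr p) \<longlongrightarrow> 0 powr p) (at 0 within {0<..<1})"
      by (intro tendsto_powr2 tendsto_const) (use p in \<open>auto simp: eventually_at_filter intro!: always_eventually\<close>)
    then show "((\<lambda>r. sinh r powr p) \<longlongrightarrow> 0) (at 0 within {0<..<1})" by simp
  qed simp
  then have lim: "((\<lambda>r. M / norm kJ * cosh r powr (e - Re mu) * sinh r powr p) \<longlongrightarrow> 0) (at 0 within {0<..<1})" by simp
  show ?thesis
    by (rule Lim_null_comparison[OF _ lim]) (auto simp: eventually_at_filter simp del: norm_mult intro!: always_eventually bd [unfolded times_divide_eq_left])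
qed

text \<open>The limit at b = 0: the value 1 / \<Gamma>(\<alpha> + 1/2) of \<open>regC\<close> at 1
  times the limit of the weighted derivative of Laplace's integral.\<close>

definition wronskC :: complex where "wronskC = - mu * Beta (2 * \<alpha>) (l + 1) * rGamma (\<alpha> + 1 / 2)"

text \<open>The weighted Wronskian is constant on the connected \<open>laplace_domain\<close>, so it
  can be evaluated as b tends to 0 along the positive reals. There the term with the derivative of
  \<open>regC\<close> drops out by \<open>laplaceI_at_0\<close>.\<close>

lemma wronskian_regC:
  assumes b: "b \<in> laplace_domain"
  shows "(regC (cosh b) * laplaceI' b - regC' (cosh b) * sinh b * laplaceI b) * sinh b powr (2 * \<alpha>) = wronskC"
proof -
  define V where "V = (\<lambda>b. (regC (cosh b) * laplaceI' b - regC' (cosh b) * sinh b * laplaceI b) * sinh b powr (2 * \<alpha>))"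
  have V0: "(V has_field_derivative 0) (at b)" if "b \<in> laplace_domain" for b
    unfolding V_def
    by (rule DERIV_wronskian_sinh[OF sinh_not_nonpos regC_cosh_derivatives has_derivative_laplaceI has_derivative_laplaceI'])
       (rule that)+
  have V1: "V b = V (of_real r)" if "r > 0" for r
    by (rule constant_if_zero_derivative[OF open_laplace_domain connected_laplace_domain V0 b])
       (use that in \<open>auto simp: mem_laplace_domain\<close>)
  have one: "1 \<in> cut_plane_C" by (simp add: mem_cut_plane_C)
  have lim: "((\<lambda>r. f (cosh (complex_of_real r))) \<longlongrightarrow> f 1) (at 0 within {0<..<1})" if "isCont f 1" for f :: "complex \<Rightarrow> complex"
  proof (rule isCont_tendsto_compose[OF that])
    have "((\<lambda>r. cosh (complex_of_real r)) \<longlongrightarrow> cosh (of_real 0)) (at 0 within {0<..<1})" by (intro tendsto_intros)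
    then show "((\<lambda>r. cosh (complex_of_real r)) \<longlongrightarrow> 1) (at 0 within {0<..<1})" by simp
  qed
  have c1: "isCont regC 1" using regC_derivatives(1)[OF one] by (rule DERIV_isCont)
  have c2: "isCont regC' 1" using regC_derivatives(2)[OF one] by (auto intro: DERIV_isCont)
  have "((\<lambda>r. regC (cosh (of_real r)) * (laplaceI' (of_real r) * of_real (sinh r) powr (2 * \<alpha>)) -
      regC' (cosh (of_real r)) * (laplaceI (of_real r) * of_real (sinh r) powr (2 * \<alpha>) * of_real (sinh r)))
      \<longlongrightarrow> regC 1 * (- mu * Beta (2 * \<alpha>) (l + 1)) - regC' 1 * 0) (at 0 within {0<..<1})"
    by (intro tendsto_diff tendsto_mult lim c1 c2 laplaceI_at_0 laplaceI'_at_0)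
  moreover have "regC (cosh (of_real r)) * (laplaceI' (of_real r) * of_real (sinh r) powr (2 * \<alpha>)) -
      regC' (cosh (of_real r)) * (laplaceI (of_real r) * of_real (sinh r) powr (2 * \<alpha>) * of_real (sinh r)) = V (of_real r)" for r :: real
    unfolding V_def sinh_cosh_of_real(1) by (simp only: algebra_simps)
  moreover have "regC 1 = rGamma (\<alpha> + 1 / 2)" by (simp add: regC_def reg_hypergeo_0)
  ultimately have "((\<lambda>r. V (of_real r)) \<longlongrightarrow> wronskC) (at 0 within {0<..<1})"
    by (simp add: wronskC_def mult_ac)
  then have "((\<lambda>r::real. V b) \<longlongrightarrow> wronskC) (at 0 within {0<..<1})"
    by (rule Lim_transform_eventually) (auto simp: eventually_at_filter V1 intro!: always_eventually)
  moreover have "at (0::real) within {0<..<1} \<noteq> bot"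
    by (auto simp: trivial_limit_within islimpt_greaterThanLessThan1)
  ultimately have "V b = wronskC" using tendsto_unique tendsto_const by blast
  then show ?thesis by (simp add: V_def)
qed

text \<open>At these points cosh b = 0 and sinh b = \<plusminus> i, so the base is \<plusminus> i t
  and the integrals reduce to the Beta values of \<open>integral_gweight_powr\<close>.\<close>

lemma laplaceI_at_i_pi_half:
  shows "laplaceI (\<i> * pi / 2) = \<i> powr (- mu) * (Beta \<alpha> ((l + 1) / 2) / 2)"
    and "laplaceI (- (\<i> * pi / 2)) = (- \<i>) powr (- mu) * (Beta \<alpha> ((l + 1) / 2) / 2)"
    and "laplaceI' (\<i> * pi / 2) = - mu * \<i> powr (- mu) * (Beta \<alpha> (l / 2 + 1) / 2)"
    and "laplaceI' (- (\<i> * pi / 2)) = - mu * (- \<i>) powr (- mu) * (Beta \<alpha> (l / 2 + 1) / 2)"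
proof -
  have sc: "sinh (\<i> * pi / 2) = \<i>" "cosh (\<i> * pi / 2) = (0::complex)"
    using sinh_cosh_i_times_of_real[of "pi / 2"] by simp_all
  have pw: "(c * complex_of_real t) powr s = c powr s * of_real t powr s" if "t > 1" for c s t
    using that by (intro powr_times_of_real) auto
  then have pwI: "(complex_of_real t * c) powr s = c powr s * of_real t powr s" if "t > 1" for c s t
    using that by (simp only: mult.commute[of "of_real t" c])
  have i1: "(\<integral>t. of_real t powr (- mu) * gweight \<alpha> t \<partial>lborel_gt 1) = Beta \<alpha> ((l + 1) / 2) / 2"
    using integral_gweight_powr[of \<alpha> mu] Re_alpha Re_mu by (simp add: mu_def field_simps)
  have i2: "(\<integral>t. of_real t powr (- mu - 1) * gweight \<alpha> t \<partial>lborel_gt 1) = Beta \<alpha> (l / 2 + 1) / 2"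
    proof -
    have "- (mu + 1) = - mu - 1" "(mu + 1 + 1) / 2 - \<alpha> = l / 2 + 1" by (simp_all add: mu_def field_simps)
    then show ?thesis using integral_gweight_powr[of \<alpha> "mu + 1"] Re_alpha Re_mu by simp
  qed
  have I: "laplaceI b = c powr (- mu) * (Beta \<alpha> ((l + 1) / 2) / 2)"
    "laplaceI' b = - mu * c powr (- mu - 1) * c * (Beta \<alpha> (l / 2 + 1) / 2)" if "sinh b = c" "cosh b = 0" for b c
  proof -
    have "laplaceI b = (\<integral>t. c powr (- mu) * (of_real t powr (- mu) * gweight \<alpha> t) \<partial>lborel_gt 1)"
      unfolding laplaceI_def that by (intro Bochner_Integration.integral_cong refl) (simp add: pwI)
    then show "laplaceI b = c powr (- mu) * (Beta \<alpha> ((l + 1) / 2) / 2)" by (simp add: i1)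
    have "laplaceI' b = (\<integral>t. - mu * c powr (- mu - 1) * c * (of_real t powr (- mu - 1) * gweight \<alpha> t) \<partial>lborel_gt 1)"
      unfolding laplaceI'_def that by (intro Bochner_Integration.integral_cong refl) (simp add: pwI)
    then show "laplaceI' b = - mu * c powr (- mu - 1) * c * (Beta \<alpha> (l / 2 + 1) / 2)"
      by (simp add: i2)
  qed
  have c: "c powr (- mu - 1) * c = c powr (- mu)" if "c \<noteq> 0" for c
    using that by (simp add: powr_diff)
  show "laplaceI (\<i> * pi / 2) = \<i> powr (- mu) * (Beta \<alpha> ((l + 1) / 2) / 2)"
    "laplaceI (- (\<i> * pi / 2)) = (- \<i>) powr (- mu) * (Beta \<alpha> ((l + 1) / 2) / 2)"
    by (rule I(1); simp add: sc)+
  have "laplaceI' b = - mu * c powr (- mu) * (Beta \<alpha> (l / 2 + 1) / 2)" if "sinh b = c" "cosh b = 0" "c \<noteq> 0" for b c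
    using I(2)[OF that(1,2)] c[OF that(3)] by (simp only: mult.assoc)
  then show "laplaceI' (\<i> * pi / 2) = - mu * \<i> powr (- mu) * (Beta \<alpha> (l / 2 + 1) / 2)"
    "laplaceI' (- (\<i> * pi / 2)) = - mu * (- \<i>) powr (- mu) * (Beta \<alpha> (l / 2 + 1) / 2)"
    by (simp_all add: sc)
qed

definition wronskI :: complex where "wronskI = mu / 2 * Beta \<alpha> ((l + 1) / 2) * Beta \<alpha> (l / 2 + 1)"

text \<open>Because coth is odd, I (b) and I (-b) solve the same equation, and both exist on the
  strip 0 < Im b < pi; their weighted Wronskian is read off at i pi / 2. The plus sign comes from
  differentiating I (-b), and the phase e^(i pi \<alpha>) of sinh^(2 \<alpha>) cancels on passing to
  sin \<theta>.\<close>

lemma wronskian_laplaceI: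
  assumes th: "0 < th" "th < pi"
  defines "b \<equiv> \<i> * of_real th"
  shows "(laplaceI b * laplaceI' (- b) + laplaceI' b * laplaceI (- b)) * of_real (sin th) powr (2 * \<alpha>) = - wronskI"
proof -
  define S where "S = {b. Im b > 0} \<inter> {b. Im b < pi}"
  have S: "open S" "connected S"
    unfolding S_def by (intro open_Int open_halfspace_Im_gt open_halfspace_Im_lt
      convex_connected convex_Int convex_halfspace_Im_gt convex_halfspace_Im_lt)+
  define V where "V = (\<lambda>b. (laplaceI b * (- laplaceI' (- b)) - laplaceI' b * laplaceI (- b)) * sinh b powr (2 * \<alpha>))"
  have V0: "(V has_field_derivative 0) (at b)" if "b \<in> S" for b
  proof -
    have b: "b \<in> laplace_domain" "- b \<in> laplace_domain" using that by (auto simp: S_def mem_laplace_domain)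
    have dm: "(uminus has_field_derivative - 1) (at b)" by (auto intro!: derivative_eq_intros)
    have 1: "((\<lambda>b. laplaceI (- b)) has_field_derivative - laplaceI' (- b)) (at b)"
      using DERIV_chain2[OF has_derivative_laplaceI[OF b(2)] dm] by simp
    have 2: "((\<lambda>b. - laplaceI' (- b)) has_field_derivative (l * mu * laplaceI (- b) - 2 * \<alpha> * cosh b / sinh b * (- laplaceI' (- b)))) (at b)"
      by (rule DERIV_cong[OF DERIV_minus[OF DERIV_chain2[OF has_derivative_laplaceI'[OF b(2)] dm]]]) simp
    show ?thesis
      unfolding V_def
      by (rule DERIV_wronskian_sinh[OF sinh_not_nonpos[OF b(1)] has_derivative_laplaceI[OF b(1)] has_derivative_laplaceI'[OF b(1)] 1 2])
  qed
  have "V b = V (\<i> * pi / 2)"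
    by (rule constant_if_zero_derivative[OF S V0]) (use th in \<open>auto simp: S_def b_def\<close>)
  moreover have "V (\<i> * pi / 2) = wronskI * exp (\<i> * pi * \<alpha>)"
  proof -
    have sc: "sinh (\<i> * pi / 2) = \<i>"
      using sinh_cosh_i_times_of_real(1)[of "pi / 2"] by simp
    have i: "\<i> powr (- mu) * (- \<i>) powr (- mu) = 1" by (simp add: powr_i flip: exp_add)
    have e1: "\<i> powr (2 * \<alpha>) = exp (\<i> * pi * \<alpha>)" by (simp add: powr_i mult_ac)
    define A B where "A = Beta \<alpha> ((l + 1) / 2)" and "B = Beta \<alpha> (l / 2 + 1)"
    have "V (\<i> * pi / 2) = (\<i> powr (- mu) * (- \<i>) powr (- mu)) * (mu / 2 * A * B) * \<i> powr (2 * \<alpha>)"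
      unfolding V_def sc laplaceI_at_i_pi_half A_def [symmetric] B_def [symmetric] by (simp add: field_simps)
    then show ?thesis
      unfolding i e1 by (simp add: wronskI_def A_def B_def)
  qed
  moreover have "sinh b powr (2 * \<alpha>) = exp (\<i> * pi * \<alpha>) * of_real (sin th) powr (2 * \<alpha>)"
  proof -
    have "sinh b = \<i> * complex_of_real (sin th)"
      unfolding b_def by (rule sinh_cosh_i_times_of_real)
    then show ?thesis using powr_i_times_real(1)[OF sin_gt_zero[OF th]] by (simp only:)
  qed
  ultimately have "(laplaceI b * (- laplaceI' (- b)) - laplaceI' b * laplaceI (- b)) * (exp (\<i> * pi * \<alpha>) * of_real (sin th) powr (2 * \<alpha>)) =
      wronskI * exp (\<i> * pi * \<alpha>)"
    by (simp only: V_def)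
  then have "exp (\<i> * pi * \<alpha>) * (- ((laplaceI b * laplaceI' (- b) + laplaceI' b * laplaceI (- b)) * of_real (sin th) powr (2 * \<alpha>)))
      = exp (\<i> * pi * \<alpha>) * wronskI"
    by (simp add: algebra_simps)
  then have "- ((laplaceI b * laplaceI' (- b) + laplaceI' b * laplaceI (- b)) * of_real (sin th) powr (2 * \<alpha>)) = wronskI"
    by (simp only: mult_left_cancel[OF exp_not_eq_zero])
  then show ?thesis by (simp only: minus_equation_iff)
qed

text \<open>Legendre's duplication formula merges the Gamma values at half arguments, leaving the
  power 2^(\<mu> - l - 1) = 2^(2 \<alpha> - 1). The quotient of the two Wronskians is then just -1 /
  (sqrt pi \<Gamma>(\<alpha>)), which matches the normalisation of C.\<close>

lemma wronskian_values:
  assumes mu: "mu \<notin> \<int>\<^sub>\<le>\<^sub>0"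
  shows "wronskI = 2 powr (2 * \<alpha> - 1) * (Gamma \<alpha>)\<^sup>2 * Gamma (l + 1) / Gamma mu" "wronskI \<noteq> 0"
    and "wronskC = - wronskI / (of_real (sqrt pi) * Gamma \<alpha>)"
proof -
  have np: "\<alpha> \<notin> \<int>\<^sub>\<le>\<^sub>0" "2 * \<alpha> \<notin> \<int>\<^sub>\<le>\<^sub>0" "l + 1 \<notin> \<int>\<^sub>\<le>\<^sub>0" "\<alpha> + 1 / 2 \<notin> \<int>\<^sub>\<le>\<^sub>0" "(l + 1) / 2 \<notin> \<int>\<^sub>\<le>\<^sub>0" "l / 2 + 1 \<notin> \<int>\<^sub>\<le>\<^sub>0"
    "(mu + 1) / 2 \<notin> \<int>\<^sub>\<le>\<^sub>0" "mu / 2 + 1 \<notin> \<int>\<^sub>\<le>\<^sub>0" "mu + 1 \<notin> \<int>\<^sub>\<le>\<^sub>0"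
    using Re_alpha Re_l Re_mu by (auto intro!: Re_pos_imp_not_nonpos_Int)
  have mu0: "mu \<noteq> 0" using mu by auto
  have g: "Gamma z \<noteq> 0" if "z \<notin> \<int>\<^sub>\<le>\<^sub>0" for z :: complex using that by (simp add: Gamma_eq_zero_iff)
  have d1: "Gamma ((l + 1) / 2) * Gamma (l / 2 + 1) = 2 powr (- l) * of_real (sqrt pi) * Gamma (l + 1)"
  proof -
    have "(l + 1) / 2 + 1 / 2 = l / 2 + 1" by (simp add: field_simps)
    moreover have "1 - 2 * ((l + 1) / 2) = - l" "2 * ((l + 1) / 2) = l + 1" by (simp_all add: field_simps)
    ultimately show ?thesis
      using Gamma_duplication_powr[of "(l + 1) / 2"] np(5,6) by metis
  qed
  have d2: "Gamma ((mu + 1) / 2) * Gamma (mu / 2 + 1) = 2 powr (- mu) * of_real (sqrt pi) * Gamma (mu + 1)"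
  proof -
    have "(mu + 1) / 2 + 1 / 2 = mu / 2 + 1" by (simp add: field_simps)
    moreover have "1 - 2 * ((mu + 1) / 2) = - mu" "2 * ((mu + 1) / 2) = mu + 1" by (simp_all add: field_simps)
    ultimately show ?thesis
      using Gamma_duplication_powr[of "(mu + 1) / 2"] np(7,8) by metis
  qed
  have d3: "Gamma \<alpha> * Gamma (\<alpha> + 1 / 2) = 2 powr (1 - 2 * \<alpha>) * of_real (sqrt pi) * Gamma (2 * \<alpha>)"
    by (rule Gamma_duplication_powr[OF np(1,4)])
  have g1: "Gamma (mu + 1) = mu * Gamma mu" by (rule Gamma_plus1[OF mu])
  have s1: "\<alpha> + (l + 1) / 2 = (mu + 1) / 2" "\<alpha> + (l / 2 + 1) = mu / 2 + 1" "2 * \<alpha> + (l + 1) = mu + 1"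
    by (simp_all add: mu_def field_simps)
  have sp: "complex_of_real (sqrt pi) \<noteq> 0" by simp
  have "wronskI = mu / 2 * ((Gamma \<alpha>)\<^sup>2 * (Gamma ((l + 1) / 2) * Gamma (l / 2 + 1)) / (Gamma ((mu + 1) / 2) * Gamma (mu / 2 + 1)))"
    unfolding wronskI_def Beta_def s1 by (simp add: power2_eq_square mult_ac)
  also have "\<dots> = mu / 2 * ((Gamma \<alpha>)\<^sup>2 * (2 powr (- l) * Gamma (l + 1)) / (2 powr (- mu) * (mu * Gamma mu)))"
    unfolding d1 d2 g1 using sp by (simp add: field_simps)
  also have "\<dots> = (2 powr (- l) / 2 powr (- mu) / 2) * (Gamma \<alpha>)\<^sup>2 * Gamma (l + 1) / Gamma mu"
    using mu0 by (simp add: field_simps)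
  also have "2 powr (- l) / 2 powr (- mu) / 2 = (2 :: complex) powr (2 * \<alpha> - 1)"
  proof -
    have "(2::complex) powr (2 * \<alpha> - 1) = 2 powr (- l - (- mu) - 1)" by (simp add: mu_def)
    then show ?thesis by (simp only: powr_diff) simp
  qed
  finally show W: "wronskI = 2 powr (2 * \<alpha> - 1) * (Gamma \<alpha>)\<^sup>2 * Gamma (l + 1) / Gamma mu" .
  then show "wronskI \<noteq> 0" using np g mu by simp
  have G: "Gamma \<alpha> \<noteq> 0" "Gamma (\<alpha> + 1 / 2) \<noteq> 0" "Gamma mu \<noteq> 0" using g np mu by auto
  have "wronskC = - (mu * (Gamma (2 * \<alpha>) * Gamma (l + 1) / (mu * Gamma mu)) / Gamma (\<alpha> + 1 / 2))"
    unfolding wronskC_def Beta_def s1 g1 rGamma_inverse_Gamma by (simp add: field_simps)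
  also have "\<dots> = - (Gamma (2 * \<alpha>) * Gamma (l + 1) / Gamma mu / Gamma (\<alpha> + 1 / 2))" using mu0 by simp
  also have "Gamma (2 * \<alpha>) = 2 powr (2 * \<alpha> - 1) * (Gamma \<alpha> * Gamma (\<alpha> + 1 / 2)) / of_real (sqrt pi)"
  proof -
    have "(2::complex) powr (2 * \<alpha> - 1) * 2 powr (1 - 2 * \<alpha>) = 2 powr ((2 * \<alpha> - 1) + (1 - 2 * \<alpha>))" by (rule powr_add [symmetric])
    then have "(2::complex) powr (2 * \<alpha> - 1) * (2 powr (1 - 2 * \<alpha>) * z) = z" for z by (simp flip: mult.assoc)
    then show ?thesis unfolding d3 using sp by (simp add: mult.assoc)
  qed
  also have "- (2 powr (2 * \<alpha> - 1) * (Gamma \<alpha> * Gamma (\<alpha> + 1 / 2)) / of_real (sqrt pi) * Gamma (l + 1) / Gamma mu / Gamma (\<alpha> + 1 / 2)) =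
      - wronskI / (of_real (sqrt pi) * Gamma \<alpha>)"
    unfolding W using G sp by (simp add: field_simps power2_eq_square)
  finally show "wronskC = - wronskI / (of_real (sqrt pi) * Gamma \<alpha>)" .
qed

text \<open>
  Eliminating the derivative of \<open>regC\<close> between its Wronskians with the two solutions \<open>laplaceI (\<plusminus> b)\<close>.
\<close>
lemma regC_connection:
  assumes mu: "mu \<notin> \<int>\<^sub>\<le>\<^sub>0" and th: "0 < th" "th < pi"
  defines "b \<equiv> \<i> * of_real th"
  shows "of_real (sqrt pi) * Gamma \<alpha> * regC (of_real (cos th)) = exp (\<i> * pi * \<alpha>) * laplaceI b + exp (- (\<i> * pi * \<alpha>)) * laplaceI (- b)"
proof -
  have b: "b \<in> laplace_domain" "- b \<in> laplace_domain" using th by (auto simp: b_def mem_laplace_domain)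
  define E s where "E = exp (\<i> * pi * \<alpha>)" and "s = complex_of_real (sin th) powr (2 * \<alpha>)"
  have sth: "sin th > 0" using th by (rule sin_gt_zero)
  have E: "exp (- (\<i> * pi * \<alpha>)) = inverse E" "E \<noteq> 0" by (simp_all add: E_def exp_minus)
  have sb: "sinh b = \<i> * complex_of_real (sin th)"
    unfolding b_def by (rule sinh_cosh_i_times_of_real)
  have cb: "cosh b = complex_of_real (cos th)"
    unfolding b_def by (rule sinh_cosh_i_times_of_real)
  have "sinh b powr (2 * \<alpha>) = E * s" "sinh (- b) powr (2 * \<alpha>) = inverse E * s"
    using powr_i_times_real[OF sth, of \<alpha>] by (simp_all add: sb E_def s_def exp_minus)
  note pw = this
  define Y Y' Jp Jm Jp' Jm'
    where "Y = regC (cosh b)" and "Y' = regC' (cosh b) * sinh b"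
    and "Jp = laplaceI b" and "Jm = laplaceI (- b)" and "Jp' = laplaceI' b" and "Jm' = laplaceI' (- b)"
  have 1: "(Y * Jp' - Y' * Jp) * (E * s) = wronskC"
    using wronskian_regC[OF b(1)] unfolding pw by (simp add: Y_def Y'_def Jp_def Jp'_def)
  have 2: "(Y * Jm' + Y' * Jm) * (inverse E * s) = wronskC"
    using wronskian_regC[OF b(2)] unfolding pw by (simp add: Y_def Y'_def Jm_def Jm'_def)
  have 3: "(Jp * Jm' + Jp' * Jm) * s = - wronskI"
    using wronskian_laplaceI[OF th] by (simp add: b_def s_def Jp_def Jp'_def Jm_def Jm'_def)
  have w1: "(Y * Jp' - Y' * Jp) * s = wronskC * inverse E" using 1 E(2) by (simp add: field_simps)
  have w2: "(Y * Jm' + Y' * Jm) * s = wronskC * E" using 2 E(2) by (simp add: field_simps)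
  have "Y * ((Jp * Jm' + Jp' * Jm) * s) = ((Y * Jp' - Y' * Jp) * s) * Jm + ((Y * Jm' + Y' * Jm) * s) * Jp"
    by (simp add: algebra_simps)
  then have "Y * (- wronskI) = wronskC * (E * Jp + inverse E * Jm)"
    unfolding w1 w2 3 by (simp add: algebra_simps)
  moreover have "of_real (sqrt pi) * Gamma \<alpha> * wronskC = - wronskI"
    using wronskian_values(3)[OF mu] Re_alpha by (simp add: Gamma_eq_zero_iff Re_pos_imp_not_nonpos_Int)
  ultimately have "(- wronskI) * (of_real (sqrt pi) * Gamma \<alpha> * Y) = (- wronskI) * (E * Jp + inverse E * Jm)"
    by (metis mult.assoc mult.commute)
  then have "of_real (sqrt pi) * Gamma \<alpha> * Y = E * Jp + inverse E * Jm"
    using wronskian_values(2)[OF mu] by simp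
  then show ?thesis unfolding E(1) Y_def Jp_def Jm_def cb E_def .
qed

text \<open>With P and Q the values I (\<plusminus> i\<theta>) multiplied by exp (\<plusminus> i pi
  \<alpha>), the connection formula gives C = \<delta> (P + Q), while the boundary values give D = -
  i \<delta> (P - Q). So the sum of squares is 4 \<delta>^2 P Q, and the phases cancel in P
  Q.\<close>

lemma gegenbauer_sum_squares:
  assumes mu: "mu \<notin> \<int>\<^sub>\<le>\<^sub>0" and th: "0 < th" "th < pi"
  shows "(gegenbauer_C_trig l \<alpha> (of_real (cos th)))\<^sup>2 + (gegenbauer_D_trig l \<alpha> (of_real (cos th)))\<^sup>2 =
    4 * (Gamma mu / (2 powr (2 * \<alpha> - 1) * (Gamma \<alpha>)\<^sup>2 * Gamma (l + 1)))\<^sup>2 * (laplaceI (\<i> * th) * laplaceI (- (\<i> * th)))"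
proof -
  define x where "x = cos th"
  have x: "\<bar>x\<bar> < 1"
    using cos_monotone_0_pi[of 0 th] cos_monotone_0_pi[of th pi] th by (simp add: x_def abs_less_iff)
  have z: "complex_of_real x \<in> cut_plane_trig" using x by (auto simp: mem_cut_plane_trig)
  have arc: "Arccos (complex_of_real x) = of_real th"
    unfolding x_def cos_of_real [symmetric] using th by (intro Arccos_cos) auto
  define \<delta> P Q where "\<delta> = Gamma mu / (2 powr (2 * \<alpha> - 1) * (Gamma \<alpha>)\<^sup>2 * Gamma (l + 1))"
    and "P = exp (\<i> * pi * \<alpha>) * laplaceI (\<i> * th)" and "Q = exp (- (\<i> * pi * \<alpha>)) * laplaceI (- (\<i> * th))"
  have G: "Gamma \<alpha> \<noteq> 0" using Re_alpha by (simp add: Gamma_eq_zero_iff Re_pos_imp_not_nonpos_Int)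
  have "gegenbauer_C_trig l \<alpha> (of_real x) = \<delta> * (of_real (sqrt pi) * Gamma \<alpha> * regC (of_real x))"
    unfolding gegenbauer_C_trig_eq[OF z] \<delta>_def regC_def mu_def using G by (simp add: power2_eq_square add_ac mult_ac)
  also have "of_real (sqrt pi) * Gamma \<alpha> * regC (of_real x) = P + Q"
    unfolding x_def P_def Q_def by (rule regC_connection[OF mu th])
  finally have C: "gegenbauer_C_trig l \<alpha> (of_real x) = \<delta> * (P + Q)" .
  have dk: "dJ * kJ = exp (\<i> * pi * \<alpha>) * \<delta>" by (simp add: dJ_def kJ_def \<delta>_def power2_eq_square)
  have e1: "exp (- (\<i> * pi / 2)) = - \<i>"
    using powr_i(2)[of 1] by simp
  \<comment> \<open>The 1/4 in the definition of D contributes the factor i, and the factor exp (i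
    pi \<alpha>) of D itself leaves exp (- i pi \<alpha>), the phase contained in Q.\<close>
  have e2: "exp (- 2 * \<i> * pi * (\<alpha> - 1 / 4)) * exp (\<i> * pi * \<alpha>) = \<i> * exp (- (\<i> * pi * \<alpha>))"
  proof -
    have "exp (- 2 * \<i> * pi * (\<alpha> - 1 / 4)) * exp (\<i> * pi * \<alpha>) = exp (- (- (\<i> * pi / 2))) * exp (- (\<i> * pi * \<alpha>))"
      unfolding exp_add [symmetric] by (rule arg_cong[of _ _ exp]) (simp add: field_simps)
    also have "exp (- (- (\<i> * pi / 2))) = \<i>" using e1 by (simp only: exp_minus[of "- (\<i> * pi / 2)"]) simp
    finally show ?thesis .
  qed
  have "gegenbauer_D_trig l \<alpha> (of_real x) = - \<i> * (exp (\<i> * pi * \<alpha>) * \<delta> * laplaceI (\<i> * th)) +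
      (exp (- 2 * \<i> * pi * (\<alpha> - 1 / 4)) * exp (\<i> * pi * \<alpha>)) * (\<delta> * laplaceI (- (\<i> * th)))"
    unfolding gegenbauer_D_trig_eq[OF z] arc e1 dk by (simp only: mult.assoc)
  then have D: "gegenbauer_D_trig l \<alpha> (of_real x) = - \<i> * \<delta> * (P - Q)"
    unfolding e2 P_def Q_def by (simp add: algebra_simps)
  have "(\<delta> * (P + Q))\<^sup>2 + (- \<i> * \<delta> * (P - Q))\<^sup>2 = 4 * \<delta>\<^sup>2 * (P * Q)"
    by (simp add: power_mult_distrib) (simp add: power2_eq_square algebra_simps)
  also have "P * Q = laplaceI (\<i> * th) * laplaceI (- (\<i> * th))"
  proof -
    have "exp (\<i> * pi * \<alpha>) * exp (- (\<i> * pi * \<alpha>)) = 1" by (simp flip: exp_add)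
    then show ?thesis unfolding P_def Q_def by (metis mult.assoc mult.left_commute mult.left_neutral)
  qed
  finally show ?thesis unfolding C D x_def [symmetric] \<delta>_def .
qed

end

subsection \<open>Analytic continuation in the argument\<close>

lemma square_not_of_real_ge_1:
  assumes x: "x \<in> cut_plane_trig" and u: "u \<ge> 1"
  shows "x\<^sup>2 \<noteq> of_real u"
proof
  assume e: "x\<^sup>2 = of_real u"
  then have re: "(Re x)\<^sup>2 - (Im x)\<^sup>2 = u" and im: "Re x * Im x = 0"
    by (auto simp: complex_eq_iff power2_eq_square)
  have "Im x = 0"
  proof (rule ccontr)
    assume "Im x \<noteq> 0"
    then have "Re x = 0" using im by simp
    then show False using re u zero_le_power2[of "Im x"] by simp
  qed
  moreover have "1 \<le> \<bar>Re x\<bar>"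
    using re u \<open>Im x = 0\<close> abs_le_square_iff[of 1 "Re x"] by simp
  ultimately show False using x by (auto simp: mem_cut_plane_trig)
qed

lemma nicholson_factors_not_nonpos:
  assumes x: "x \<in> cut_plane_trig"
  shows "1 - x\<^sup>2 \<notin> \<real>\<^sub>\<le>\<^sub>0" and "w \<ge> 1 \<Longrightarrow> 1 - 2 * x\<^sup>2 + of_real w \<notin> \<real>\<^sub>\<le>\<^sub>0"
proof -
  show "1 - x\<^sup>2 \<notin> \<real>\<^sub>\<le>\<^sub>0"
  proof
    assume "1 - x\<^sup>2 \<in> \<real>\<^sub>\<le>\<^sub>0"
    then obtain r where "1 - x\<^sup>2 = of_real r" "r \<le> 0" by (auto elim: nonpos_Reals_cases)
    then have "x\<^sup>2 = of_real (1 - r)" by (simp add: algebra_simps)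
    then show False using square_not_of_real_ge_1[OF x, of "1 - r"] \<open>r \<le> 0\<close> by simp
  qed
  show "1 - 2 * x\<^sup>2 + of_real w \<notin> \<real>\<^sub>\<le>\<^sub>0" if w: "w \<ge> 1"
  proof
    assume "1 - 2 * x\<^sup>2 + of_real w \<in> \<real>\<^sub>\<le>\<^sub>0"
    then obtain r where "1 - 2 * x\<^sup>2 + of_real w = of_real r" "r \<le> 0" by (auto elim: nonpos_Reals_cases)
    then have "x\<^sup>2 = of_real ((1 + w - r) / 2)" by (simp add: field_simps)
    then show False using square_not_of_real_ge_1[OF x, of "(1 + w - r) / 2"] w \<open>r \<le> 0\<close> by simp
  qed
qed

text \<open>Divided by w the factor is 1 + s (1 - 2 x^2) with s = 1 / w, and including s = 0 makes
  the parameter set compact. A zero would mean x^2 = (1 + 1/s) / 2 >= 1, which the cut plane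
  excludes.\<close>

lemma nicholson_factor_bounds:
  fixes K :: "complex set"
  assumes K: "compact K" "K \<subseteq> cut_plane_trig"
  obtains c d where "c > 0"
    "\<And>x w. x \<in> K \<Longrightarrow> w \<ge> 1 \<Longrightarrow> c * w \<le> norm (1 - 2 * x\<^sup>2 + of_real w) \<and> norm (1 - 2 * x\<^sup>2 + of_real w) \<le> d * w"
proof (cases "K = {}")
  case False
  let ?f = "\<lambda>p. norm (1 + of_real (snd p) * (1 - 2 * (fst p)\<^sup>2))"
  have co: "compact (K \<times> {0..1::real})" using K(1) by (intro compact_Times) auto
  have cf: "continuous_on (K \<times> {0..1::real}) ?f" by (intro continuous_intros)
  have ne: "K \<times> {0..1::real} \<noteq> {}" using False by auto
  obtain p where p: "p \<in> K \<times> {0..1}" "\<forall>q\<in>K \<times> {0..1}. ?f p \<le> ?f q"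
    using continuous_attains_inf[OF co ne cf] by blast
  obtain r where r: "r \<in> K \<times> {0..1}" "\<forall>q\<in>K \<times> {0..1}. ?f q \<le> ?f r"
    using continuous_attains_sup[OF co ne cf] by blast
  have scale: "norm (1 - 2 * x\<^sup>2 + of_real w) = w * ?f (x, 1 / w)" if "w \<ge> 1" for x :: complex and w
  proof -
    have "1 - 2 * x\<^sup>2 + of_real w = of_real w * (1 + of_real (1 / w) * (1 - 2 * x\<^sup>2))"
      using that by (simp add: field_simps)
    then have "norm (1 - 2 * x\<^sup>2 + of_real w) = \<bar>w\<bar> * norm (1 + of_real (1 / w) * (1 - 2 * x\<^sup>2))"
      by (simp only: norm_mult norm_of_real)
    then show ?thesis using that by simp
  qed
  obtain x s where xs: "p = (x, s)" "x \<in> K" "0 \<le> s" "s \<le> 1" using p(1) by auto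
  have "1 + of_real s * (1 - 2 * x\<^sup>2) \<noteq> 0"
  proof
    assume e: "1 + of_real s * (1 - 2 * x\<^sup>2) = 0"
    then have s: "s \<noteq> 0" by auto
    have "x\<^sup>2 = of_real ((1 + 1 / s) / 2)" using e s by (simp add: field_simps)
    then show False using square_not_of_real_ge_1[of x "(1 + 1 / s) / 2"] K(2) xs s by (auto simp: field_simps)
  qed
  then have "?f p > 0" by (simp add: xs(1))
  moreover have "?f p * w \<le> norm (1 - 2 * x\<^sup>2 + of_real w) \<and> norm (1 - 2 * x\<^sup>2 + of_real w) \<le> ?f r * w"
    if "x \<in> K" "w \<ge> 1" for x w
  proof -
    have "(x, 1 / w) \<in> K \<times> {0..1}" using that by auto
    then have "?f p \<le> ?f (x, 1 / w)" "?f (x, 1 / w) \<le> ?f r" using p(2) r(2) by blast+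
    then have "w * ?f p \<le> w * ?f (x, 1 / w)" "w * ?f (x, 1 / w) \<le> w * ?f r" using that by (intro mult_left_mono; simp)+
    then show ?thesis unfolding scale[OF that(2)] by (simp only: mult.commute[of w])
  qed
  ultimately show ?thesis by (rule that)
qed (use that[of 1] in auto)

context gegenbauer_params
begin

text \<open>On compact sets of x the third factor is comparable with w^(Re \<alpha> - 1), and
  together with the bound on D this gives a shifted Beta integrand as majorant.\<close>

lemma holomorphic_nicholson_integral:
  "(\<lambda>x. \<integral>w. nicholson_integrand l \<alpha> x w \<partial>lborel_gt 1) holomorphic_on cut_plane_trig"
  and integrable_nicholson: "x \<in> cut_plane_trig \<Longrightarrow> integrable (lborel_gt 1) (nicholson_integrand l \<alpha> x)"
proof -
  define m \<rho> where "m = Re mu" and "\<rho> = Re \<alpha>"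
  have m: "m > 2 * \<rho> - 1" "\<rho> > 0" using Re_mu Re_alpha by (auto simp: m_def \<rho>_def)
  obtain e M where e: "0 \<le> e" "e < 2 * \<rho>" "M \<ge> 0"
    "\<And>w. Re w > 1 \<Longrightarrow> norm (gegJ w) \<le> M * norm w powr (e - m) * norm (w\<^sup>2 - 1) powr (- e / 2)"
    using gegJ_bound_right_half_plane unfolding m_def \<rho>_def by blast
  \<comment> \<open>The exponent p - 1 at w = 1 collects Re \<alpha> - 1 from the integrand and -e/2
    from D. The exponent q equals Re l + 1, the margin of convergence at infinity.\<close>
  define p where "p = \<rho> - e / 2"
  define q where "q = m + 1 - 2 * \<rho>"
  have pq: "p > 0" "q > 0" using e m by (auto simp: p_def q_def)
  have D: "complex_of_real w \<in> cut_plane_D" if "w > 1" for w using that by (simp add: mem_cut_plane_D)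
  have cD: "continuous_on {1<..} (\<lambda>w. gegenbauer_D l \<alpha> (complex_of_real w))"
  proof (rule continuous_on_eq)
    show "continuous_on {1<..} (\<lambda>w. dJ * gegJ (complex_of_real w))"
    proof (intro continuous_on_mult continuous_on_const continuous_at_imp_continuous_on ballI)
      fix w :: real assume "w \<in> {1<..}"
      then show "isCont (\<lambda>w. gegJ (complex_of_real w)) w"
        by (intro isCont_o2[OF _ DERIV_isCont[OF has_derivative_gegJ]] continuous_intros D) simp
    qed
  qed (simp add: gegenbauer_D_eq_gegJ D)
  have meas: "nicholson_integrand l \<alpha> x \<in> borel_measurable (lborel_gt 1)" if x: "x \<in> cut_plane_trig" for x
  proof -
    have "continuous_on {1<..} (\<lambda>w. complex_of_real (w - 1) powr (\<alpha> - 1))"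
      "continuous_on {1<..} (\<lambda>w. (1 - 2 * x\<^sup>2 + complex_of_real w) powr (\<alpha> - 1))"
      using nicholson_factors_not_nonpos(2)[OF x]
      by (auto intro!: continuous_at_imp_continuous_on isCont_powr_complex continuous_intros
            simp: complex_nonpos_Reals_iff[of "complex_of_real _ - 1"])
    then show ?thesis
      unfolding nicholson_integrand_def [abs_def] by (intro measurable_lborel_gt_continuous continuous_on_mult cD)
  qed
  define g where "g = (\<lambda>w::real. (w - 1) powr (p - 1) * w powr (- (p + q)))"
  have g: "integrable (lborel_gt 1) g"
    using integral_lborel_gt_affine(1)[of 1 1 0 g] Beta_second_kind_real(1)[OF pq] by (simp add: g_def)
  have bd: "\<exists>C. \<forall>x\<in>K. \<forall>w\<in>{1<..}. norm (nicholson_integrand l \<alpha> x w) \<le> C * g w"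
    if K: "compact K" "K \<subseteq> cut_plane_trig" for K
  proof -
    obtain c d where cd: "c > 0"
      "\<And>x w. x \<in> K \<Longrightarrow> w \<ge> 1 \<Longrightarrow> c * w \<le> norm (1 - 2 * x\<^sup>2 + of_real w) \<and> norm (1 - 2 * x\<^sup>2 + of_real w) \<le> d * w"
      using nicholson_factor_bounds[OF K] by blast
    define N where "N = exp (pi * \<bar>Im (\<alpha> - 1)\<bar>)"
    define A where "A = c powr (\<rho> - 1) + d powr (\<rho> - 1)"
    have "norm (nicholson_integrand l \<alpha> x w) \<le> (norm dJ * M * (N * A)) * g w" if x: "x \<in> K" and w: "w > 1" for x w
    proof -
      have w0: "complex_of_real w \<in> cut_plane_D" by (rule D[OF w])
      have w1: "w\<^sup>2 - 1 > 0" using w by (rule square_minus_1_pos)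
      have nz: "1 - 2 * x\<^sup>2 + of_real w \<noteq> 0" using cd(2)[OF x, of w] w mult_pos_pos[OF cd(1), of w] by auto
      have n1: "norm (gegenbauer_D l \<alpha> (of_real w)) \<le> norm dJ * (M * w powr (e - m) * ((w - 1) powr (- e / 2) * w powr (- e / 2)))"
      proof -
        have "(complex_of_real w)\<^sup>2 - 1 = of_real (w\<^sup>2 - 1)" by simp
        then have "norm ((complex_of_real w)\<^sup>2 - 1) = w\<^sup>2 - 1" using w1 by (simp only: norm_of_real abs_of_pos)
        also have "(w\<^sup>2 - 1) powr (- e / 2) = (w - 1) powr (- e / 2) * (w + 1) powr (- e / 2)"
          using powr_mult[of "w - 1" "w + 1" "- e / 2"] by (simp only: power2_eq_square square_diff_one_factored mult.commute)
        finally have "norm ((complex_of_real w)\<^sup>2 - 1) powr (- e / 2) = (w - 1) powr (- e / 2) * (w + 1) powr (- e / 2)" .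
        also have "\<dots> \<le> (w - 1) powr (- e / 2) * w powr (- e / 2)"
          using w e by (intro mult_left_mono powr_mono2') auto
        finally have "M * w powr (e - m) * norm ((complex_of_real w)\<^sup>2 - 1) powr (- e / 2) \<le>
            M * w powr (e - m) * ((w - 1) powr (- e / 2) * w powr (- e / 2))"
          using e by (intro mult_left_mono) auto
        then have "norm (gegJ (of_real w)) \<le> M * w powr (e - m) * ((w - 1) powr (- e / 2) * w powr (- e / 2))"
          using e(4)[of "of_real w"] w by simp
        then show ?thesis
          unfolding gegenbauer_D_eq_gegJ[OF w0] norm_mult by (rule mult_left_mono) simp
      qed
      have n2: "norm (complex_of_real (w - 1) powr (\<alpha> - 1)) = (w - 1) powr (\<rho> - 1)"
        using w by (subst norm_of_real_powr) (simp_all add: \<rho>_def)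
      have n3: "norm ((1 - 2 * x\<^sup>2 + of_real w) powr (\<alpha> - 1)) \<le> N * (A * w powr (\<rho> - 1))"
      proof -
        have "norm ((1 - 2 * x\<^sup>2 + of_real w) powr (\<alpha> - 1)) \<le> N * norm (1 - 2 * x\<^sup>2 + of_real w) powr (\<rho> - 1)"
          using norm_powr_le[OF nz, of "\<alpha> - 1"] by (simp add: N_def \<rho>_def)
        also have "\<dots> \<le> N * (A * w powr (\<rho> - 1))"
          unfolding A_def using cd(1) cd(2)[OF x, of w] w
          by (intro mult_left_mono powr_between) (auto simp: N_def)
        finally show ?thesis .
      qed
      have "norm (nicholson_integrand l \<alpha> x w) \<le>
          norm dJ * (M * w powr (e - m) * ((w - 1) powr (- e / 2) * w powr (- e / 2))) * (w - 1) powr (\<rho> - 1) * (N * (A * w powr (\<rho> - 1)))"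
        unfolding nicholson_integrand_def norm_mult n2
        using e by (intro mult_mono n1 n3 mult_right_mono) auto
      also have "\<dots> = (norm dJ * M * (N * A)) * (((w - 1) powr (- e / 2) * (w - 1) powr (\<rho> - 1)) *
          (w powr (e - m) * w powr (- e / 2) * w powr (\<rho> - 1)))" by (simp only: mult_ac)
      also have "(w - 1) powr (- e / 2) * (w - 1) powr (\<rho> - 1) = (w - 1) powr (p - 1)"
      proof -
        have "(- e / 2) + (\<rho> - 1) = p - 1" by (simp add: p_def)
        then show ?thesis by (simp only: powr_add [symmetric])
      qed
      also have "w powr (e - m) * w powr (- e / 2) * w powr (\<rho> - 1) = w powr (- (p + q))"
      proof -
        have "(e - m) + (- e / 2) + (\<rho> - 1) = - (p + q)" by (simp add: p_def q_def)
        then show ?thesis by (simp only: powr_add [symmetric])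
      qed
      finally show ?thesis by (simp only: g_def)
    qed
    then show ?thesis by blast
  qed
  show "integrable (lborel_gt 1) (nicholson_integrand l \<alpha> x)" if x: "x \<in> cut_plane_trig"
  proof -
    obtain C where C: "\<forall>w\<in>{1<..}. norm (nicholson_integrand l \<alpha> x w) \<le> C * g w"
      using bd[of "{x}"] x by auto
    show ?thesis
    proof (rule Bochner_Integration.integrable_bound)
      show "integrable (lborel_gt 1) (\<lambda>w. C * g w)" by (intro Bochner_Integration.integrable_mult_right g)
      show "AE w in lborel_gt 1. norm (nicholson_integrand l \<alpha> x w) \<le> norm (C * g w)"
      proof (rule AE_I2)
        fix w assume "w \<in> space (lborel_gt 1)"
        then have "norm (nicholson_integrand l \<alpha> x w) \<le> C * g w" using C by simp
        also have "\<dots> \<le> norm (C * g w)" by simp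
        finally show "norm (nicholson_integrand l \<alpha> x w) \<le> norm (C * g w)" .
      qed
    qed (rule meas[OF x])
  qed
  show "(\<lambda>x. \<integral>w. nicholson_integrand l \<alpha> x w \<partial>lborel_gt 1) holomorphic_on cut_plane_trig"
  proof (rule param_integral_holomorphic[OF open_cut_planes(3)])
    fix w assume "w \<in> space (lborel_gt 1)"
    then have "w \<ge> 1" by simp
    then show "(\<lambda>x. nicholson_integrand l \<alpha> x w) holomorphic_on cut_plane_trig"
      unfolding nicholson_integrand_def using nicholson_factors_not_nonpos(2)
      by (intro holomorphic_intros) auto
  next
    fix x assume "x \<in> cut_plane_trig"
    then obtain r where r: "r > 0" "cball x r \<subseteq> cut_plane_trig"
      using open_contains_cball open_cut_planes(3) by metis
    obtain C where C: "\<forall>x\<in>cball x r. \<forall>w\<in>{1<..}. norm (nicholson_integrand l \<alpha> x w) \<le> C * g w"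
      using bd[OF compact_cball r(2)] by blast
    have "integrable (lborel_gt 1) (\<lambda>w. C * g w)" by (intro Bochner_Integration.integrable_mult_right g)
    moreover have "ball x r \<subseteq> cut_plane_trig" using r(2) ball_subset_cball by (rule subset_trans[rotated])
    ultimately show "\<exists>U g. open U \<and> x \<in> U \<and> U \<subseteq> cut_plane_trig \<and> integrable (lborel_gt 1) g \<and>
               (\<forall>y\<in>U. \<forall>t\<in>space (lborel_gt 1). norm (nicholson_integrand l \<alpha> y t) \<le> g t)"
      using r(1) C by (intro exI[of _ "ball x r"] exI[of _ "\<lambda>w. C * g w"]) auto
  qed (rule meas)
qed

text \<open>With s = sin^2 \<theta>, the two factors of the integrand are the powers of s (t - 1)
  and s (t + 1); together with the Jacobian s they give s^(2 \<alpha> - 1), which cancels against (1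
  - x^2)^(2 \<alpha> - 1). What is left is the integral of the product formula.\<close>

lemma nicholson_real:
  assumes mu: "mu \<notin> \<int>\<^sub>\<le>\<^sub>0" and th: "0 < th" "th < pi / 2"
  defines "x \<equiv> complex_of_real (cos th)"
  shows "(gegenbauer_C_trig l \<alpha> x)\<^sup>2 + (gegenbauer_D_trig l \<alpha> x)\<^sup>2 =
    exp (- (\<i> * pi * \<alpha>)) * Gamma mu / (2 powr (2 * \<alpha> - 3) * (Gamma \<alpha>)\<^sup>2 * Gamma (l + 1) * (1 - x\<^sup>2) powr (2 * \<alpha> - 1))
      * (\<integral>w. nicholson_integrand l \<alpha> x w \<partial>lborel_gt 1)"
proof -
  define d s where "d = (cos th)\<^sup>2" and "s = (sin th)\<^sup>2"
  have sth: "sin th > 0" using th by (intro sin_gt_zero) auto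
  have s: "s > 0" "d = 1 - s" using sth by (simp_all add: s_def d_def cos_squared_eq)
  have x2: "x\<^sup>2 = of_real d" by (simp add: x_def d_def)
  have xs: "1 - x\<^sup>2 = of_real s" using s(2) by (simp add: x2)
  define Q where "Q = laplaceI (\<i> * th) * laplaceI (- (\<i> * th))"
  have "(\<integral>w. nicholson_integrand l \<alpha> x w \<partial>lborel_gt 1) = s *\<^sub>R (\<integral>t. nicholson_integrand l \<alpha> x (d + s * t) \<partial>lborel_gt 1)"
    using integral_lborel_gt_affine(2)[OF s(1), of d 1 "nicholson_integrand l \<alpha> x"] s(2) by simp
  also have "(\<integral>t. nicholson_integrand l \<alpha> x (d + s * t) \<partial>lborel_gt 1) =
      (\<integral>t. dJ * of_real s powr (2 * \<alpha> - 2) * (gegJ (of_real (d + t * s)) * gweight \<alpha> t) \<partial>lborel_gt 1)"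
  proof (intro Bochner_Integration.integral_cong refl)
    fix t assume "t \<in> space (lborel_gt 1)"
    then have t: "t > 1" by simp
    have t1: "t - 1 > 0" and t2: "t + 1 > 0" using t by simp_all
    have dt: "d + s * t > 1" using mult_strict_left_mono[OF t s(1)] s(2) by simp
    have f: "d + s * t - 1 = s * (t - 1)" "1 - 2 * x\<^sup>2 + of_real (d + s * t) = of_real (s * (t + 1))"
      unfolding x2 s(2) by (simp_all add: algebra_simps)
    have "of_real (d + s * t - 1) powr (\<alpha> - 1) * (1 - 2 * x\<^sup>2 + of_real (d + s * t)) powr (\<alpha> - 1) =
        (of_real s powr (\<alpha> - 1) * of_real s powr (\<alpha> - 1)) * (of_real (t - 1) powr (\<alpha> - 1) * of_real (t + 1) powr (\<alpha> - 1))"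
      unfolding f powr_of_real_mult[OF s(1) t1] powr_of_real_mult[OF s(1) t2] by (simp only: mult_ac)
    also have "of_real s powr (\<alpha> - 1) * of_real s powr (\<alpha> - 1) = complex_of_real s powr (2 * \<alpha> - 2)"
      unfolding powr_add [symmetric] by simp
    also have "complex_of_real (t - 1) powr (\<alpha> - 1) * of_real (t + 1) powr (\<alpha> - 1) = gweight \<alpha> t"
    proof -
      have "t\<^sup>2 - 1 = (t - 1) * (t + 1)" by (simp add: power2_eq_square algebra_simps)
      then show ?thesis unfolding gweight_def by (simp only: powr_of_real_mult[OF t1 t2])
    qed
    finally have "of_real (d + s * t - 1) powr (\<alpha> - 1) * (1 - 2 * x\<^sup>2 + of_real (d + s * t)) powr (\<alpha> - 1) =
      of_real s powr (2 * \<alpha> - 2) * gweight \<alpha> t" .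
    moreover have "gegenbauer_D l \<alpha> (of_real (d + s * t)) = dJ * gegJ (of_real (d + t * s))"
      using gegenbauer_D_eq_gegJ[of "of_real (d + s * t)"] dt by (simp add: mem_cut_plane_D mult.commute)
    ultimately show "nicholson_integrand l \<alpha> x (d + s * t) = dJ * of_real s powr (2 * \<alpha> - 2) * (gegJ (of_real (d + t * s)) * gweight \<alpha> t)"
      unfolding nicholson_integrand_def by (simp only: mult_ac)
  qed
  also have "\<dots> = dJ * of_real s powr (2 * \<alpha> - 2) * (kJ * Q)"
    using laplaceI_product_formula(2)[OF th] by (simp add: d_def s_def Q_def mult.assoc)
  finally have I: "(\<integral>w. nicholson_integrand l \<alpha> x w \<partial>lborel_gt 1) = of_real s powr (2 * \<alpha> - 1) * (dJ * kJ * Q)"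
  proof -
    assume a: "(\<integral>w. nicholson_integrand l \<alpha> x w \<partial>lborel_gt 1) = s *\<^sub>R (dJ * of_real s powr (2 * \<alpha> - 2) * (kJ * Q))"
    have "complex_of_real s powr (2 * \<alpha> - 1) = of_real s powr (1 + (2 * \<alpha> - 2))" by simp
    also have "\<dots> = of_real s * of_real s powr (2 * \<alpha> - 2)" using s(1) by (simp only: powr_add) simp
    finally show ?thesis using a by (simp add: scaleR_conv_of_real mult_ac)
  qed
  define \<delta> where "\<delta> = Gamma mu / (2 powr (2 * \<alpha> - 1) * (Gamma \<alpha>)\<^sup>2 * Gamma (l + 1))"
  have dk: "dJ * kJ = exp (\<i> * pi * \<alpha>) * \<delta>" by (simp add: dJ_def kJ_def \<delta>_def power2_eq_square)
  have sp: "complex_of_real s powr (2 * \<alpha> - 1) \<noteq> 0" using s(1) by simp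
  \<comment> \<open>The factor 4 in the sum of squares accounts for the difference between 2^(2
    \<alpha> - 1) in the normalisation of C and D and 2^(2 \<alpha> - 3) in the result.\<close>
  have two: "(2::complex) powr (2 * \<alpha> - 1) = 4 * 2 powr (2 * \<alpha> - 3)"
  proof -
    have "(2::complex) powr (2 * \<alpha> - 1) = 2 powr (2 + (2 * \<alpha> - 3))" by simp
    also have "\<dots> = 2 powr 2 * 2 powr (2 * \<alpha> - 3)" by (rule powr_add)
    also have "(2::complex) powr 2 = 4" using powr_nat'[of "2::complex" 2] by simp
    finally show ?thesis .
  qed
  have pre: "Gamma mu / (2 powr (2 * \<alpha> - 3) * (Gamma \<alpha>)\<^sup>2 * Gamma (l + 1)) = 4 * \<delta>"
    unfolding \<delta>_def two by simp
  have ee: "exp (- (\<i> * pi * \<alpha>)) * exp (\<i> * pi * \<alpha>) = 1" by (simp flip: exp_add)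
  have "exp (- (\<i> * pi * \<alpha>)) * Gamma mu / (2 powr (2 * \<alpha> - 3) * (Gamma \<alpha>)\<^sup>2 * Gamma (l + 1) * of_real s powr (2 * \<alpha> - 1))
      * (of_real s powr (2 * \<alpha> - 1) * (exp (\<i> * pi * \<alpha>) * \<delta> * Q)) =
      (exp (- (\<i> * pi * \<alpha>)) * exp (\<i> * pi * \<alpha>)) * (Gamma mu / (2 powr (2 * \<alpha> - 3) * (Gamma \<alpha>)\<^sup>2 * Gamma (l + 1))) * \<delta> * Q"
    using sp by (simp add: mult_ac)
  also have "\<dots> = 4 * \<delta>\<^sup>2 * Q" unfolding ee pre by (simp add: power2_eq_square)
  also have "\<dots> = (gegenbauer_C_trig l \<alpha> x)\<^sup>2 + (gegenbauer_D_trig l \<alpha> x)\<^sup>2"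
    using gegenbauer_sum_squares[OF mu, of th] th by (simp add: x_def \<delta>_def Q_def)
  finally show ?thesis unfolding I xs dk by simp
qed

text \<open>Both sides are holomorphic on the connected cut plane and agree for 0 < x < 1. Since the
  integrand is Lebesgue integrable here, its Lebesgue integral is the Henstock-Kurzweil integral of
  the statement.\<close>

lemma nicholson_generic:
  assumes mu: "mu \<notin> \<int>\<^sub>\<le>\<^sub>0" and x: "x \<in> cut_plane_trig"
  shows "(gegenbauer_C_trig l \<alpha> x)\<^sup>2 + (gegenbauer_D_trig l \<alpha> x)\<^sup>2 =
    exp (- (\<i> * pi * \<alpha>)) * Gamma mu / (2 powr (2 * \<alpha> - 3) * (Gamma \<alpha>)\<^sup>2 * Gamma (l + 1) * (1 - x\<^sup>2) powr (2 * \<alpha> - 1))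
      * integral {1<..} (nicholson_integrand l \<alpha> x)"
proof -
  define R where "R = (\<lambda>x. exp (- (\<i> * pi * \<alpha>)) * Gamma mu /
      (2 powr (2 * \<alpha> - 3) * (Gamma \<alpha>)\<^sup>2 * Gamma (l + 1) * (1 - x\<^sup>2) powr (2 * \<alpha> - 1))
      * (\<integral>w. nicholson_integrand l \<alpha> x w \<partial>lborel_gt 1))"
  define L where "L = (\<lambda>x. (gegenbauer_C_trig l \<alpha> x)\<^sup>2 + (gegenbauer_D_trig l \<alpha> x)\<^sup>2)"
  have np: "\<alpha> \<notin> \<int>\<^sub>\<le>\<^sub>0" "l + 1 \<notin> \<int>\<^sub>\<le>\<^sub>0"
    using Re_alpha Re_l by (auto intro!: Re_pos_imp_not_nonpos_Int)
  have hR: "R holomorphic_on cut_plane_trig"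
    unfolding R_def
  proof (intro holomorphic_on_mult holomorphic_on_divide holomorphic_on_const holomorphic_nicholson_integral)
    show "(\<lambda>x. (1 - x\<^sup>2) powr (2 * \<alpha> - 1)) holomorphic_on cut_plane_trig"
      using nicholson_factors_not_nonpos(1) by (intro holomorphic_intros) auto
    have "(1 - x\<^sup>2) powr (2 * \<alpha> - 1) \<noteq> 0" if "x \<in> cut_plane_trig" for x
      using nicholson_factors_not_nonpos(1)[OF that] by auto
    then show "2 powr (2 * \<alpha> - 3) * (Gamma \<alpha>)\<^sup>2 * Gamma (l + 1) * (1 - x\<^sup>2) powr (2 * \<alpha> - 1) \<noteq> 0" if "x \<in> cut_plane_trig" for x
      using np that by (simp add: Gamma_eq_zero_iff)
  qed
  have hC: "gegenbauer_C_trig l \<alpha> holomorphic_on cut_plane_trig"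
  proof (rule holomorphic_transform)
    have "regC holomorphic_on cut_plane_trig"
      using regC_derivatives(1) cut_plane_trig_subset_C open_cut_planes(3) by (fastforce simp: holomorphic_on_open)
    then show "(\<lambda>z. of_real (sqrt pi) * Gamma mu / (2 powr (2 * \<alpha> - 1) * Gamma \<alpha> * Gamma (l + 1)) * regC z) holomorphic_on cut_plane_trig"
      by (intro holomorphic_on_mult holomorphic_on_const)
  qed (simp add: gegenbauer_C_trig_eq regC_def mu_def add.commute)
  have hD: "gegenbauer_D_trig l \<alpha> holomorphic_on cut_plane_trig"
    by (rule holomorphic_transform[OF _ gegenbauer_D_trig_eq [symmetric]])
       (intro holomorphic_on_add holomorphic_on_mult holomorphic_on_const holomorphic_laplaceI_Arccos)
  have "L x - R x = 0"
  proof (rule analytic_continuation[where U = "complex_of_real ` {0<..<1}" and \<xi> = "1 / 2" and S = cut_plane_trig and f = "\<lambda>x. L x - R x"])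
    show "(\<lambda>x. L x - R x) holomorphic_on cut_plane_trig"
      unfolding L_def by (intro holomorphic_intros hR hC hD)
    show "L z - R z = 0" if zU: "z \<in> complex_of_real ` {0<..<1}" for z
    proof -
      obtain u where u: "z = of_real u" "0 < u" "u < 1" using zU by auto
      have "0 < arccos u" "arccos u < pi / 2"
        using arccos_less_arccos[of u 1] arccos_less_arccos[of 0 u] u by simp_all
      then show ?thesis
        using nicholson_real[OF mu, of "arccos u"] u by (simp add: L_def R_def)
    qed
  qed (use open_cut_planes(3) connected_cut_planes(3) of_real_segment_islimpt[of 0 "1 / 2" 1] x in \<open>auto simp: mem_cut_plane_trig\<close>)
  moreover have "(\<integral>w. nicholson_integrand l \<alpha> x w \<partial>lborel_gt 1) = integral {1<..} (nicholson_integrand l \<alpha> x)"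
    using set_borel_integral_eq_integral(2)[of "{1<..}" "nicholson_integrand l \<alpha> x"] integrable_nicholson[OF x]
    by (simp add: integrable_lborel_gt integral_lborel_gt)
  ultimately show ?thesis by (simp add: L_def R_def)
qed

end

subsection \<open>The hypergeometric series at 1\<close>

lemma tendsto_suminf_dominated:
  fixes a :: "nat \<Rightarrow> 'b \<Rightarrow> 'a :: {real_normed_algebra, banach}"
  assumes "\<And>k. ((\<lambda>n. a k n) \<longlongrightarrow> b k) F" and bd: "eventually (\<lambda>n. \<forall>k. norm (a k n) \<le> M k) F"
    and "summable M" "F \<noteq> bot"
  shows "((\<lambda>n. \<Sum>k. a k n) \<longlongrightarrow> (\<Sum>k. b k)) F"
proof -
  have "eventually (\<lambda>x. True \<and> (\<forall>k. norm (a k (snd x)) \<le> M k)) (at_top \<times>\<^sub>F F)"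
    using eventually_prodI[OF always_eventually[of "\<lambda>_. True"] bd] by simp
  then have "eventually (\<lambda>(k, n). norm (a k n) \<le> M k) (at_top \<times>\<^sub>F F)"
    by (rule eventually_mono) auto
  from tannerys_theorem[OF assms(1) this assms(3,4)] show ?thesis by simp
qed

text \<open>Raabe's test concerns |z n|, but the expansion at hand is that of z n. The identity (|z|
  - 1) (|z| + 1) = 2 Re (z - 1) + |z - 1|^2 transfers it, the quadratic term being of lower
  order.\<close>

lemma norm_minus_1_asymptotics:
  fixes z :: "nat \<Rightarrow> complex"
  assumes lim: "(\<lambda>n. of_nat n * (z n - 1)) \<longlonglongrightarrow> s"
  shows "(\<lambda>n. of_nat n * (norm (z n) - 1)) \<longlonglongrightarrow> Re s"
proof -
  have "(\<lambda>n. of_nat n * (z n - 1) * (1 / of_nat n)) \<longlonglongrightarrow> s * 0"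
    by (intro tendsto_mult lim lim_1_over_n)
  moreover have "eventually (\<lambda>n. of_nat n * (z n - 1) * (1 / of_nat n) = z n - 1) sequentially"
    using eventually_gt_at_top[of "0::nat"] by eventually_elim simp
  ultimately have "(\<lambda>n. z n - 1) \<longlonglongrightarrow> s * 0"
    by (rule Lim_transform_eventually)
  then have z0: "(\<lambda>n. z n - 1) \<longlonglongrightarrow> 0" by simp
  then have z1: "z \<longlonglongrightarrow> 1" by (simp add: LIM_zero_iff)
  have "(\<lambda>n. (2 * Re (of_nat n * (z n - 1)) + norm (of_nat n * (z n - 1)) * norm (z n - 1)) / (norm (z n) + 1))
      \<longlonglongrightarrow> (2 * Re s + norm s * norm (0 :: complex)) / (norm (1 :: complex) + 1)"
    by (intro tendsto_intros lim z0 z1) simp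
  moreover have "(2 * Re (of_nat n * (z n - 1)) + norm (of_nat n * (z n - 1)) * norm (z n - 1)) / (norm (z n) + 1) =
      of_nat n * (norm (z n) - 1)" for n
  proof -
    have p: "norm (z n) + 1 \<noteq> 0" using norm_ge_zero[of "z n"] by linarith
    have "(norm (z n) - 1) * (norm (z n) + 1) = 2 * Re (z n - 1) + (norm (z n - 1))\<^sup>2"
    proof -
      have "(norm (z n) - 1) * (norm (z n) + 1) = (norm (z n))\<^sup>2 - 1" by (simp add: power2_eq_square algebra_simps)
      also have "\<dots> = 2 * Re (z n - 1) + (norm (z n - 1))\<^sup>2"
        unfolding cmod_power2 by (simp add: power2_eq_square algebra_simps)
      finally show ?thesis .
    qed
    then have "of_nat n * (norm (z n) - 1) * (norm (z n) + 1) = of_nat n * (2 * Re (z n - 1) + (norm (z n - 1))\<^sup>2)"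
      by (simp only: mult.assoc)
    moreover have "2 * Re (of_nat n * (z n - 1)) + norm (of_nat n * (z n - 1)) * norm (z n - 1) =
        of_nat n * (2 * Re (z n - 1) + (norm (z n - 1))\<^sup>2)"
    proof -
      have "norm (of_nat n * (z n - 1)) = of_nat n * norm (z n - 1)" "Re (of_nat n * (z n - 1)) = of_nat n * Re (z n - 1)"
        unfolding norm_mult by simp_all
      then show ?thesis by (simp only: power2_eq_square distrib_left mult_ac)
    qed
    ultimately show ?thesis by (simp only: nonzero_divide_eq_eq[OF p])
  qed
  ultimately show ?thesis by simp
qed

lemma eventually_plus_of_nat_not_nonpos_Int: "eventually (\<lambda>n. (c :: complex) + of_nat n \<notin> \<int>\<^sub>\<le>\<^sub>0) sequentially"
proof -
  obtain N :: nat where N: "- Re c < real N" using reals_Archimedean2 by blast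
  show ?thesis
    using eventually_ge_at_top[of N]
    by eventually_elim (use N in \<open>intro Re_pos_imp_not_nonpos_Int, simp\<close>)
qed

text \<open>The quotient of consecutive coefficients is 1 + (c + 1 - a - b) / n up to lower order,
  so Raabe's constant is Re (c - a - b) + 1 > 1. Excluding nonpositive integers a and b keeps the
  coefficients nonzero from some index on.\<close>

lemma summable_hyp_fps_at_1:
  assumes ab: "a \<notin> \<int>\<^sub>\<le>\<^sub>0" "b \<notin> \<int>\<^sub>\<le>\<^sub>0" and s: "Re (c - a - b) > 0"
  shows "summable (\<lambda>n. norm (fps_nth (hyp_fps a b c) n))"
proof (rule raabes_test_convergence)
  define h where "h = fps_nth (hyp_fps a b c)"
  have nz: "(a + of_nat n) \<noteq> 0" "(b + of_nat n) \<noteq> 0" for n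
    using ab by (metis add.commute add_eq_0_iff minus_of_nat_in_nonpos_Ints)+
  have pn: "pochhammer a n \<noteq> 0" "pochhammer b n \<noteq> 0" for n
    using ab pochhammer_eq_0_imp_nonpos_Int by blast+
  have ev: "eventually (\<lambda>n. h n \<noteq> 0) sequentially"
    using eventually_plus_of_nat_not_nonpos_Int[of c]
    by eventually_elim (simp add: h_def pn rGamma_eq_zero_iff)
  then show "eventually (\<lambda>n. norm (fps_nth (hyp_fps a b c) n) > 0) sequentially"
    by eventually_elim (simp add: h_def)
  define z where "z n = (of_nat (Suc n) * (c + of_nat n)) / ((a + of_nat n) * (b + of_nat n))" for n
  have "(\<lambda>n. ((c + 1 - a - b) + (c - a * b) / of_nat n) / ((1 + a / of_nat n) * (1 + b / of_nat n))) \<longlonglongrightarrow>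
      ((c + 1 - a - b) + 0) / ((1 + 0) * (1 + 0))"
    by (intro tendsto_intros) simp
  moreover have "eventually (\<lambda>n. ((c + 1 - a - b) + (c - a * b) / of_nat n) / ((1 + a / of_nat n) * (1 + b / of_nat n)) =
      of_nat n * (z n - 1)) sequentially"
    using eventually_gt_at_top[of "0::nat"]
  proof eventually_elim
    fix n :: nat assume n: "0 < n"
    define N where "N = (of_nat n :: complex)"
    have N: "N \<noteq> 0" using n by (simp add: N_def)
    have nz': "a + N \<noteq> 0" "b + N \<noteq> 0" using nz by (simp_all add: N_def)
    have "z n - 1 = ((1 + N) * (c + N) - (a + N) * (b + N)) / ((a + N) * (b + N))"
      unfolding z_def N_def [symmetric] of_nat_Suc diff_divide_distrib using nz' by simp
    also have "(1 + N) * (c + N) - (a + N) * (b + N) = (c + 1 - a - b) * N + (c - a * b)" by (simp add: algebra_simps)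
    finally have "z n - 1 = ((c + 1 - a - b) * N + (c - a * b)) / ((a + N) * (b + N))" .
    moreover have gen: "(Y / N) / ((p / N) * (q / N)) = N * (Y / (p * q))" if "p \<noteq> 0" "q \<noteq> 0" for Y p q
      using N that by (simp add: field_simps)
    moreover have "1 + a / N = (a + N) / N" "1 + b / N = (b + N) / N"
      "(c + 1 - a - b) + (c - a * b) / N = ((c + 1 - a - b) * N + (c - a * b)) / N" using N by (simp_all add: field_simps)
    ultimately show "((c + 1 - a - b) + (c - a * b) / of_nat n) / ((1 + a / of_nat n) * (1 + b / of_nat n)) = of_nat n * (z n - 1)"
      unfolding N_def [symmetric] by (simp only: gen[OF nz'])
  qed
  ultimately have "(\<lambda>n. of_nat n * (z n - 1)) \<longlonglongrightarrow> ((c + 1 - a - b) + 0) / ((1 + 0) * (1 + 0))"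
    by (rule Lim_transform_eventually)
  then have "(\<lambda>n. of_nat n * (z n - 1)) \<longlonglongrightarrow> c + 1 - a - b" by simp
  then have lim: "(\<lambda>n. of_nat n * (norm (z n) - 1)) \<longlonglongrightarrow> Re (c + 1 - a - b)"
    by (rule norm_minus_1_asymptotics)
  have "eventually (\<lambda>n. of_nat n * (norm (z n) - 1) = of_nat n * (norm (h n) / norm (h (Suc n)) - 1)) sequentially"
    using eventually_sequentially_Suc[THEN iffD2, OF ev]
  proof eventually_elim
    fix n assume 0: "h (Suc n) \<noteq> 0"
    have nz0: "(a + of_nat n) * (b + of_nat n) \<noteq> 0" using nz[of n] by simp
    have "of_nat (Suc n) * (c + of_nat n) * h (Suc n) = h n * ((a + of_nat n) * (b + of_nat n))"
      using hyp_fps_rec[of n c a b] unfolding h_def by (simp only: mult.commute)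
    then have "z n = h n / h (Suc n)" unfolding z_def by (simp only: frac_eq_eq[OF nz0 0])
    then show "of_nat n * (norm (z n) - 1) = of_nat n * (norm (h n) / norm (h (Suc n)) - 1)"
      by (simp add: norm_divide)
  qed
  from Lim_transform_eventually[OF lim this]
  have "(\<lambda>n. ereal (of_nat n * (norm (h n) / norm (h (Suc n)) - 1))) \<longlonglongrightarrow> ereal (Re (c + 1 - a - b))" by simp
  then have "liminf (\<lambda>n. ereal (of_nat n * (norm (h n) / norm (h (Suc n)) - 1))) = ereal (Re (c + 1 - a - b))"
    by (intro lim_imp_Liminf) auto
  then show "1 < liminf (\<lambda>n. ereal (of_nat n * (norm (fps_nth (hyp_fps a b c) n) / norm (fps_nth (hyp_fps a b c) (Suc n)) - 1)))"
    unfolding h_def using s by (simp del: hyp_fps_nth add: one_ereal_def)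
qed

definition hyp_at_1 :: "complex \<Rightarrow> complex \<Rightarrow> complex \<Rightarrow> complex" where
  "hyp_at_1 a b c = (\<Sum>n. fps_nth (hyp_fps a b c) n)"

text \<open>With h and k the coefficients for c and c + 1, the combination of their terms telescopes
  as v n - v (n + 1), where v n = n h n.\<close>

lemma hyp_at_1_contiguous:
  assumes ab: "a \<notin> \<int>\<^sub>\<le>\<^sub>0" "b \<notin> \<int>\<^sub>\<le>\<^sub>0" and s: "Re (c - a - b) > 0"
  shows "(c - a) * (c - b) * hyp_at_1 a b (c + 1) = (c - a - b) * hyp_at_1 a b c"
proof -
  define h k where "h = fps_nth (hyp_fps a b c)" and "k = fps_nth (hyp_fps a b (c + 1))"
  define v where "v n = of_nat n * h n" for n
  have sh: "summable (\<lambda>n. norm (h n))" "summable (\<lambda>n. norm (k n))"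
    unfolding h_def k_def by (rule summable_hyp_fps_at_1; use ab s in simp)+
  have sm: "summable h" "summable k" using sh by (auto intro: summable_norm_cancel)
  have term_eq: "(c - a - b) * h n - (c - a) * (c - b) * k n = v n - v (Suc n)" for n
  proof -
    have "h n = (c + of_nat n) * k n"
      using rGamma_plus1[of "c + of_nat n"] by (simp add: h_def k_def add_ac mult_ac)
    moreover have "v (Suc n) = (a + of_nat n) * (b + of_nat n) * k n"
    proof -
      have f: "(fact (Suc n) :: complex) = of_nat (Suc n) * fact n" by (rule fact_Suc)
      show ?thesis
        unfolding v_def h_def k_def hyp_fps_nth pochhammer_Suc f
        by (simp del: of_nat_Suc fact_Suc add: field_simps) (simp add: add_ac)
    qed
    ultimately show ?thesis by (simp add: v_def algebra_simps)
  qed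
  define S where "S = (c - a - b) * (\<Sum>n. h n) - (c - a) * (c - b) * (\<Sum>n. k n)"
  have "(\<lambda>n. (c - a - b) * h n - (c - a) * (c - b) * k n) sums S"
    unfolding S_def using sm by (intro sums_diff sums_mult summable_sums)
  then have "(\<lambda>N. \<Sum>n<N. v n - v (Suc n)) \<longlonglongrightarrow> S" unfolding term_eq by (simp add: sums_def)
  moreover have "(\<Sum>n<N. v n - v (Suc n)) = - v N" for N
    using sum_lessThan_telescope'[of v N] by (simp add: v_def)
  ultimately have "(\<lambda>N. - v N) \<longlonglongrightarrow> S" by (simp only:)
  from tendsto_minus[OF this] have lim: "v \<longlonglongrightarrow> - S" by simp
  \<comment> \<open>The sequence n h n has the limit -S. If S were nonzero, |h n| would be at least
    a multiple of 1 / n, against absolute convergence.\<close>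
  have "S = 0"
  proof (rule ccontr)
    assume "S \<noteq> 0"
    then have S: "norm S > 0" by simp
    have "(\<lambda>n. norm (v n)) \<longlonglongrightarrow> norm S" using tendsto_norm[OF lim] by simp
    then have ev: "eventually (\<lambda>n. norm S / 2 < norm (v n)) sequentially"
      using S by (intro order_tendstoD(1)) auto
    have "summable (\<lambda>n. inverse (of_nat n) :: real)"
    proof (rule summable_comparison_test_ev)
      show "summable (\<lambda>n. 2 / norm S * norm (h n))" by (intro summable_mult sh)
      show "eventually (\<lambda>n. norm (inverse (of_nat n) :: real) \<le> 2 / norm S * norm (h n)) sequentially"
        using ev eventually_gt_at_top[of 0]
      proof eventually_elim
        fix n :: nat assume "norm S / 2 < norm (v n)" "0 < n"
        then have "norm S / 2 < real n * norm (h n)" "real n > 0" by (simp_all add: v_def norm_mult)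
        moreover have "s / 2 < r * y \<Longrightarrow> r > 0 \<Longrightarrow> s > 0 \<Longrightarrow> inverse r \<le> 2 / s * y" for s r y :: real
          by (simp add: field_simps)
        ultimately show "norm (inverse (of_nat n) :: real) \<le> 2 / norm S * norm (h n)" using S by simp
      qed
    qed
    then show False using not_summable_harmonic by blast
  qed
  then have "(c - a - b) * hyp_at_1 a b c - (c - a) * (c - b) * hyp_at_1 a b (c + 1) = 0"
    unfolding S_def hyp_at_1_def h_def k_def .
  then show ?thesis by (simp only: right_minus_eq)
qed

lemma norm_pochhammer_bounds:
  fixes z :: complex
  shows "norm z \<le> r \<Longrightarrow> norm (pochhammer z n) \<le> pochhammer r n"
    and "0 \<le> r \<Longrightarrow> r \<le> Re z \<Longrightarrow> pochhammer r n \<le> norm (pochhammer z n)"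
proof -
  show "norm (pochhammer z n) \<le> pochhammer r n" if "norm z \<le> r"
    unfolding pochhammer_prod prod_norm [symmetric]
  proof (rule prod_mono, intro conjI)
    fix i show "norm (z + of_nat i) \<le> r + of_nat i" using norm_triangle_ineq[of z "of_nat i"] that by simp
  qed simp
  show "pochhammer r n \<le> norm (pochhammer z n)" if "0 \<le> r" "r \<le> Re z"
    unfolding pochhammer_prod prod_norm [symmetric]
  proof (rule prod_mono, intro conjI)
    fix i show "r + of_nat i \<le> norm (z + of_nat i)" using complex_Re_le_cmod[of "z + of_nat i"] that by simp
  qed (use that in simp)
qed

text \<open>
  This is Gauss' summation theorem up to the value: by the contiguous relation a zero at \<open>c\<close> would propagate
  to all \<open>c + k\<close>, while \<open>Gamma (c + k) * hyp_at_1 a b (c + k)\<close> tends to 1.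
\<close>
lemma hyp_at_1_nonzero:
  assumes ab: "a \<notin> \<int>\<^sub>\<le>\<^sub>0" "b \<notin> \<int>\<^sub>\<le>\<^sub>0" and s: "Re (c - a - b) > 0" and cab: "c - a \<notin> \<int>\<^sub>\<le>\<^sub>0" "c - b \<notin> \<int>\<^sub>\<le>\<^sub>0"
  shows "hyp_at_1 a b c \<noteq> 0"
proof
  assume z: "hyp_at_1 a b c = 0"
  have nz: "(c - a + of_nat n) \<noteq> 0" "(c - b + of_nat n) \<noteq> 0" for n
    using cab by (metis add.commute add_eq_0_iff minus_of_nat_in_nonpos_Ints)+
  have zk: "hyp_at_1 a b (c + of_nat k) = 0" for k
  proof (induction k)
    case (Suc k)
    have "(c + of_nat k - a) * (c + of_nat k - b) * hyp_at_1 a b (c + of_nat k + 1) = 0"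
      using hyp_at_1_contiguous[OF ab, of "c + of_nat k"] s Suc.IH by simp
    moreover have "c + of_nat k - a \<noteq> 0" "c + of_nat k - b \<noteq> 0"
      using nz[of k] by (simp_all add: algebra_simps)
    ultimately show ?case by (simp add: add_ac)
  qed (use z in simp)
  define A B where "A = norm a + 1" and "B = norm b + 1"
  \<comment> \<open>The surplus C - A - B = 1 makes the majorant summable: up to the constant 1 /
    \<Gamma>(C) its terms are the coefficients of \<open>hyp_fps A B C\<close>. For large k the real
    part of c + k exceeds C.\<close>
  define C where "C = A + B + 1"
  have AB: "A > 0" "B > 0" "C > 0" 
  proof -
    show "A > 0" "B > 0" unfolding A_def B_def by (intro add_nonneg_pos norm_ge_zero zero_less_one)+
    then show "C > 0" by (simp add: C_def)
  qed
  define M where "M n = pochhammer A n * pochhammer B n / (pochhammer C n * fact n)" for n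
  have sM: "summable M"
  proof -
    have g: "rGamma (complex_of_real C) \<noteq> 0"
      using AB by (simp add: rGamma_eq_zero_iff Re_pos_imp_not_nonpos_Int)
    have "summable (\<lambda>n. norm (fps_nth (hyp_fps A B C) n) / norm (rGamma (complex_of_real C)))"
      using AB by (intro summable_divide summable_hyp_fps_at_1) (auto simp: C_def intro!: Re_pos_imp_not_nonpos_Int)
    moreover have "norm (fps_nth (hyp_fps A B C) n) / norm (rGamma (complex_of_real C)) = M n" for n
    proof -
      have p: "pochhammer C n > 0" "pochhammer A n > 0" "pochhammer B n > 0" using AB by (auto intro: pochhammer_pos)
      have "norm (rGamma (complex_of_real C)) = pochhammer C n * norm (rGamma (of_real C + of_nat n :: complex))"
        using pochhammer_rGamma[of "complex_of_real C" n] p by (simp add: norm_mult pochhammer_of_real)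
      moreover have "rGamma (of_real C + of_nat n :: complex) \<noteq> 0"
        using pochhammer_rGamma[of "complex_of_real C" n] g by auto
      ultimately show ?thesis
        using p by (simp add: M_def norm_mult norm_divide pochhammer_of_real field_simps)
    qed
    ultimately show ?thesis by (simp only:)
  qed
  define t where "t n k = pochhammer a n * pochhammer b n / (pochhammer (c + of_nat k) n * fact n)" for n k
  have "((\<lambda>k. \<Sum>n. t n k) \<longlongrightarrow> (\<Sum>n. if n = 0 then 1 else 0)) sequentially"
  proof (rule tendsto_suminf_dominated[OF _ _ sM])
    obtain N :: nat where N: "C - Re c < real N" using reals_Archimedean2 by blast
    show "eventually (\<lambda>k. \<forall>n. norm (t n k) \<le> M n) sequentially"
      using eventually_ge_at_top[of N]
    proof (eventually_elim, intro allI)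
      fix k n :: nat assume "N \<le> k"
      then have "C \<le> Re (c + of_nat k)" using N by simp
      then show "norm (t n k) \<le> M n"
        unfolding t_def M_def norm_mult norm_divide norm_fact using AB
        by (intro frac_le mult_mono mult_nonneg_nonneg norm_pochhammer_bounds pochhammer_nonneg mult_pos_pos pochhammer_pos)
           (auto simp: A_def B_def)
    qed
    show "(\<lambda>k. t n k) \<longlonglongrightarrow> (if n = 0 then 1 else 0)" for n
    proof (cases n)
      case (Suc m)
      have "filterlim (\<lambda>k. pochhammer (c + of_nat k) n * fact n) at_infinity sequentially"
        unfolding filterlim_at_infinity_conv_norm_at_top
      proof (rule filterlim_at_top_mono)
        show "filterlim (\<lambda>k. Re c + real k) at_top sequentially"
          by (intro filterlim_tendsto_add_at_top[OF tendsto_const] filterlim_real_sequentially)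
        obtain N :: nat where N: "1 - Re c < real N" using reals_Archimedean2 by blast
        show "eventually (\<lambda>k. Re c + real k \<le> norm (pochhammer (c + of_nat k) n * fact n)) sequentially"
          using eventually_ge_at_top[of N]
        proof eventually_elim
          fix k :: nat assume "N \<le> k"
          then have 1: "1 \<le> Re (c + of_nat k)" using N by simp
          have "1 \<le> pochhammer (1 + 1 :: real) m" unfolding pochhammer_prod by (rule prod_ge_1) simp
          then have "1 * (1::real) \<le> pochhammer (1 + 1) m * fact n" by (intro mult_mono fact_ge_1) auto
          also have "\<dots> \<le> norm (pochhammer (c + of_nat k + 1) m) * fact n"
            using 1 by (intro mult_right_mono norm_pochhammer_bounds) auto
          finally have "1 \<le> norm (pochhammer (c + of_nat k + 1) m) * fact n" by simp
          then have "(Re c + real k) * 1 \<le> norm (c + of_nat k) * (norm (pochhammer (c + of_nat k + 1) m) * fact n)"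
            using 1 complex_Re_le_cmod[of "c + of_nat k"] by (intro mult_mono) auto
          then show "Re c + real k \<le> norm (pochhammer (c + of_nat k) n * fact n)"
            unfolding Suc pochhammer_rec by (simp add: norm_mult norm_fact Suc del: fact_Suc)
        qed
      qed
      then have "(\<lambda>k. pochhammer a n * pochhammer b n / (pochhammer (c + of_nat k) n * fact n)) \<longlonglongrightarrow> 0"
        by (rule tendsto_divide_0[OF tendsto_const])
      then show ?thesis unfolding t_def Suc by simp
    qed (simp add: t_def)
  qed simp
  then have "(\<lambda>k. \<Sum>n. t n k) \<longlonglongrightarrow> 1" using sums_unique[OF sums_single[of 0 "\<lambda>_. 1 :: complex"]] by simp
  moreover have "eventually (\<lambda>k. (\<Sum>n. t n k) = 0) sequentially"
    using eventually_plus_of_nat_not_nonpos_Int[of c]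
  proof eventually_elim
    fix k assume k: "c + of_nat k \<notin> \<int>\<^sub>\<le>\<^sub>0"
    have "t n k = Gamma (c + of_nat k) * fps_nth (hyp_fps a b (c + of_nat k)) n" for n
    proof -
      have "pochhammer (c + of_nat k) n \<noteq> 0" using k pochhammer_eq_0_imp_nonpos_Int by blast
      moreover have "rGamma (c + of_nat k) * Gamma (c + of_nat k) = 1"
        using k by (simp add: rGamma_inverse_Gamma Gamma_eq_zero_iff)
      ultimately show ?thesis
        using pochhammer_rGamma[of "c + of_nat k" n] by (simp add: t_def field_simps)
    qed
    then have "(\<Sum>n. t n k) = Gamma (c + of_nat k) * hyp_at_1 a b (c + of_nat k)"
      using summable_hyp_fps_at_1[OF ab, of "c + of_nat k"] s
      by (simp add: hyp_at_1_def suminf_mult summable_norm_cancel del: hyp_fps_nth)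
    then show "(\<Sum>n. t n k) = 0" by (simp add: zk)
  qed
  ultimately have "(\<lambda>k::nat. 0::complex) \<longlonglongrightarrow> 1" by (rule Lim_transform_eventually)
  then show False using LIMSEQ_unique[OF tendsto_const] by fastforce
qed

text \<open>Abel's limit in the absolutely convergent case: on (0, 1) the moduli of the coefficients
  dominate the terms of the series.\<close>

lemma reg_hypergeo_at_left_1:
  assumes ab: "a \<notin> \<int>\<^sub>\<le>\<^sub>0" "b \<notin> \<int>\<^sub>\<le>\<^sub>0" and s: "Re (c - a - b) > 0"
  shows "((\<lambda>x. reg_hypergeo a b c (of_real x)) \<longlongrightarrow> hyp_at_1 a b c) (at_left 1)"
proof -
  let ?h = "fps_nth (hyp_fps a b c)"
  have ev: "eventually (\<lambda>x::real. 0 < x \<and> x < 1) (at_left 1)"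
    using eventually_at_left_real[of 0 1] by (rule eventually_mono) auto
  have "((\<lambda>x::real. \<Sum>n. ?h n * of_real x ^ n) \<longlongrightarrow> (\<Sum>n. ?h n)) (at_left 1)"
  proof (rule tendsto_suminf_dominated[OF _ _ summable_hyp_fps_at_1[OF assms]])
    show "((\<lambda>x. ?h n * of_real x ^ n) \<longlongrightarrow> ?h n) (at_left 1)" for n
    proof -
      have "((\<lambda>x::real. ?h n * of_real x ^ n) \<longlongrightarrow> ?h n * of_real 1 ^ n) (at_left 1)" by (intro tendsto_intros)
      then show ?thesis by simp
    qed
    show "eventually (\<lambda>x::real. \<forall>n. norm (?h n * of_real x ^ n) \<le> norm (?h n)) (at_left 1)"
      using ev
    proof (eventually_elim, intro allI)
      fix x :: real and n assume "0 < x \<and> x < 1"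
      then show "norm (?h n * of_real x ^ n) \<le> norm (?h n)"
        unfolding norm_mult norm_power by (intro mult_right_le_one_le power_le_one) auto
    qed
  qed simp
  moreover have "eventually (\<lambda>x::real. (\<Sum>n. ?h n * of_real x ^ n) = reg_hypergeo a b c (of_real x)) (at_left 1)"
    using ev by eventually_elim (simp add: reg_hypergeo_eq_series eval_fps_def)
  ultimately show ?thesis unfolding hyp_at_1_def by (rule Lim_transform_eventually)
qed

subsection \<open>Necessary conditions for convergence\<close>

lemma has_integral_powr_window:
  fixes \<beta> :: complex
  assumes "\<beta> \<noteq> 0" "p > 0" "\<rho> > 1"
  shows "((\<lambda>w. of_real (w - c) powr (\<beta> - 1)) has_integral of_real p powr \<beta> * ((of_real \<rho> powr \<beta> - 1) / \<beta>)) {c + p..c + \<rho> * p}"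
proof -
  have le: "p \<le> \<rho> * p" using assms by simp
  have "((\<lambda>w. of_real (w - c) powr (\<beta> - 1)) has_integral
      of_real (c + \<rho> * p - c) powr \<beta> / \<beta> - of_real (c + p - c) powr \<beta> / \<beta>) {c + p..c + \<rho> * p}"
  proof (rule fundamental_theorem_of_calculus)
    fix w assume "w \<in> {c + p..c + \<rho> * p}"
    then have w: "complex_of_real (w - c) \<notin> \<real>\<^sub>\<le>\<^sub>0" using assms(2) by (simp add: complex_nonpos_Reals_iff del: of_real_diff)
    have 1: "((\<lambda>z. z powr \<beta> / \<beta>) has_field_derivative of_real (w - c) powr (\<beta> - 1)) (at (of_real (w - c)))"
      using w assms(1) by (auto intro!: derivative_eq_intros)
    have 2: "((\<lambda>w. complex_of_real (w - c)) has_vector_derivative 1) (at w within {c + p..c + \<rho> * p})"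
      by (auto intro!: derivative_eq_intros simp: has_vector_derivative_def scaleR_conv_of_real)
    from field_vector_diff_chain_within[OF 2 DERIV_subset[OF 1]]
    show "((\<lambda>w. of_real (w - c) powr \<beta> / \<beta>) has_vector_derivative of_real (w - c) powr (\<beta> - 1)) (at w within {c + p..c + \<rho> * p})"
      by (simp add: o_def del: of_real_diff)
  qed (use le in simp)
  also have "complex_of_real (c + \<rho> * p - c) powr \<beta> / \<beta> - of_real (c + p - c) powr \<beta> / \<beta> = of_real p powr \<beta> * ((of_real \<rho> powr \<beta> - 1) / \<beta>)"
    using assms by (simp add: powr_times_of_real field_simps)
  finally show ?thesis .
qed

text \<open>
  If \<open>Re \<beta> \<le> 0\<close> then \<open>\<integral> (w - c) powr (\<beta> - 1)\<close> over \<open>[c + p, c + \<rho> p]\<close> does not tend to 0 as \<open>p \<rightarrow> 0\<close>, not even for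
  oscillating powers: the ratio \<open>\<rho>\<close> is chosen with \<open>\<rho> powr \<beta> \<noteq> 1\<close>. Similarly for \<open>Re \<beta> \<ge> 0\<close> and \<open>p \<rightarrow> \<infinity>\<close>.
\<close>
lemma powr_window_lower_bound:
  fixes \<beta> h0 :: complex
  assumes "\<beta> \<noteq> 0" "h0 \<noteq> 0"
  obtains \<rho> \<delta> \<eta> :: real where "\<rho> > 1" "\<delta> > 0" "\<eta> > 0"
    "\<forall>f h c p. p > 0 \<longrightarrow> f integrable_on {c + p..c + \<rho> * p} \<longrightarrow>
      (\<forall>w\<in>{c + p..c + \<rho> * p}. f w = h w * of_real (w - c) powr (\<beta> - 1) \<and> norm (h w - h0) \<le> \<eta>) \<longrightarrow>
      \<delta> * p powr Re \<beta> \<le> norm (integral {c + p..c + \<rho> * p} f)"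
proof -
  \<comment> \<open>With this ratio \<rho>^\<beta> = exp (\<beta> / |\<beta>|), the exponential of a
    number of modulus 1. It is not 1, because the periods of exp have modulus 0 or at least 2
    pi.\<close>
  define \<rho> where "\<rho> = exp (1 / norm \<beta>)"
  have \<rho>: "\<rho> > 1" using assms by (simp add: \<rho>_def)
  have rb: "of_real \<rho> powr \<beta> = exp (\<beta> / norm \<beta>)"
    using \<rho> by (simp add: powr_def Ln_of_real \<rho>_def)
  define E where "E = of_real \<rho> powr \<beta> - 1"
  have "E \<noteq> 0"
  proof
    assume "E = 0"
    then have "exp (\<beta> / norm \<beta>) = 1" unfolding E_def rb by simp
    then obtain n :: int where n: "Re (\<beta> / norm \<beta>) = 0" "Im (\<beta> / norm \<beta>) = of_int (2 * n) * pi"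
      unfolding exp_eq_1 by blast
    have 1: "norm (\<beta> / norm \<beta>) = 1" using assms by (simp add: norm_divide)
    then have "\<bar>of_int (2 * n) * pi\<bar> = 1" using n cmod_eq_Im[of "\<beta> / norm \<beta>"] by simp
    moreover have "\<bar>of_int (2 * n) * pi\<bar> = of_int (2 * \<bar>n\<bar>) * pi" by (simp add: abs_mult)
    moreover have "of_int (2 * \<bar>n\<bar>) * pi = 0 \<or> of_int (2 * \<bar>n\<bar>) * pi \<ge> 2 * pi"
      by (cases "n = 0") (auto intro!: mult_right_mono)
    ultimately show False using pi_gt3 by linarith
  qed
  define K y where "K = norm h0 * norm E / norm \<beta>" and "y = Re \<beta> - 1"
  define M where "M = (1 powr y + \<rho> powr y) * (\<rho> - 1)"
  have K: "K > 0" using assms \<open>E \<noteq> 0\<close> by (simp add: K_def)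
  have "\<rho> powr y > 0" using \<rho> by simp
  then have M: "M > 0" using \<rho> by (simp add: M_def add_pos_pos)
  \<comment> \<open>K p^(Re \<beta>) is the size of the main term and \<eta> M p^(Re \<beta>) bounds
    the error caused by h; this \<eta> lets the error consume at most half of the main term.\<close>
  define \<eta> where "\<eta> = K / (2 * M)"
  have \<eta>: "\<eta> > 0" using K M by (simp add: \<eta>_def)
  show ?thesis
  proof (rule that[OF \<rho> _ \<eta>, of "K / 2"], goal_cases)
    case 2
    show ?case
    proof (intro allI impI)
    fix f h :: "real \<Rightarrow> complex" and c p :: real
    assume p: "p > 0" and f: "f integrable_on {c + p..c + \<rho> * p}"
      and "\<forall>w\<in>{c + p..c + \<rho> * p}. f w = h w * of_real (w - c) powr (\<beta> - 1) \<and> norm (h w - h0) \<le> \<eta>"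
    then have fw: "f w = h w * of_real (w - c) powr (\<beta> - 1) \<and> norm (h w - h0) \<le> \<eta>" if "w \<in> {c + p..c + \<rho> * p}" for w
      using that by blast
    define I where "I = of_real p powr \<beta> * (E / \<beta>)"
    have I: "((\<lambda>w. of_real (w - c) powr (\<beta> - 1)) has_integral I) {c + p..c + \<rho> * p}"
      unfolding I_def E_def by (rule has_integral_powr_window[OF assms(1) p \<rho>])
    have I': "((\<lambda>w. f w - h0 * of_real (w - c) powr (\<beta> - 1)) has_integral (integral {c + p..c + \<rho> * p} f - h0 * I)) {c + p..c + \<rho> * p}"
      by (intro has_integral_diff has_integral_mult_right I integrable_integral f)
    have "norm (integral {c + p..c + \<rho> * p} f - h0 * I) \<le> (\<eta> * ((1 powr y + \<rho> powr y) * p powr y)) * measure lborel {c + p..c + \<rho> * p}"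
    proof (rule has_integral_bound_real[OF _ finite.emptyI I'])
      fix w assume "w \<in> {c + p..c + \<rho> * p} - {}"
      then have w: "w \<in> {c + p..c + \<rho> * p}" by simp
      have wc: "w - c > 0" "1 * p \<le> w - c" "w - c \<le> \<rho> * p" using w p by auto
      have "f w - h0 * of_real (w - c) powr (\<beta> - 1) = (h w - h0) * of_real (w - c) powr (\<beta> - 1)"
        using fw[OF w] by (simp only: left_diff_distrib)
      then have "norm (f w - h0 * of_real (w - c) powr (\<beta> - 1)) = norm (h w - h0) * (w - c) powr y"
        using wc(1) by (simp only: norm_mult norm_of_real_powr) (simp add: y_def)
      also have "\<dots> \<le> \<eta> * ((1 powr y + \<rho> powr y) * p powr y)"
        using fw[OF w] \<eta> p wc by (intro mult_mono powr_between) auto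
      finally show "norm (f w - h0 * of_real (w - c) powr (\<beta> - 1)) \<le> \<eta> * ((1 powr y + \<rho> powr y) * p powr y)" .
    qed (use \<eta> in auto)
    also have "measure lborel {c + p..c + \<rho> * p} = (\<rho> - 1) * p"
      using p \<rho> by (simp add: content_real algebra_simps)
    also have "(\<eta> * ((1 powr y + \<rho> powr y) * p powr y)) * ((\<rho> - 1) * p) = \<eta> * M * (p powr y * p)"
      by (simp only: M_def mult_ac)
    also have "p powr y * p = p powr Re \<beta>" using p by (simp add: y_def powr_diff)
    also have "\<eta> * M = K / 2" using M by (simp add: \<eta>_def)
    finally have 1: "norm (integral {c + p..c + \<rho> * p} f - h0 * I) \<le> K / 2 * p powr Re \<beta>" .
    have 2: "norm (h0 * I) = K * p powr Re \<beta>"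
      using p by (simp add: I_def K_def norm_mult norm_divide norm_of_real_powr)
    have "norm (h0 * I) \<le> norm (integral {c + p..c + \<rho> * p} f) + norm (integral {c + p..c + \<rho> * p} f - h0 * I)"
      by norm
    then show "K / 2 * p powr Re \<beta> \<le> norm (integral {c + p..c + \<rho> * p} f)" using 1 2 by linarith
    qed
  qed (use K in simp)
qed

lemma integral_windows_tendsto_0:
  fixes f :: "real \<Rightarrow> complex"
  assumes f: "f integrable_on {a<..}" and \<rho>: "\<rho> > 1"
  shows "((\<lambda>p. integral {a + p..a + \<rho> * p} f) \<longlongrightarrow> 0) (at_right 0)"
    and "((\<lambda>p. integral {p..\<rho> * p} f) \<longlongrightarrow> 0) at_top"
    and "a < u \<Longrightarrow> f integrable_on {u..v}"
proof -
  define F where "F = (\<lambda>x. if x \<in> {a<..} then f x else 0)"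
  have FI: "F integrable_on {u..v}" for u v
    using integrable_altD(1)[OF f, of u v] by (simp add: F_def cbox_interval)
  have cong: "integral {u..v} F = integral {u..v} f" if "a < u" for u v
    using that by (intro integral_cong) (auto simp: F_def)
  show fI: "f integrable_on {u..v}" if "a < u" for u v
    using FI[of u v] by (rule integrable_eq) (use that in \<open>auto simp: F_def\<close>)
  have diff: "integral {u..v} F = integral {c..v} F - integral {c..u} F" if "c \<le> u" "u \<le> v" for c u v
    using Henstock_Kurzweil_Integration.integral_combine[OF that FI] by (simp add: algebra_simps)
  show "((\<lambda>p. integral {a + p..a + \<rho> * p} f) \<longlongrightarrow> 0) (at_right 0)"
  proof -
    define \<Phi> where "\<Phi> x = integral {a..x} F" for x
    have "continuous_on {a..a + 1} \<Phi>" unfolding \<Phi>_def by (rule indefinite_integral_continuous_1[OF FI])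
    then have lim: "(\<Phi> \<longlongrightarrow> \<Phi> a) (at a within {a..a + 1})" by (auto simp: continuous_on_def)
    have *: "((\<lambda>p. \<Phi> (a + k * p)) \<longlongrightarrow> \<Phi> a) (at_right 0)" if k: "k > 0" for k
    proof (rule filterlim_compose[OF lim])
      have "((\<lambda>p. a + k * p) \<longlongrightarrow> a + k * 0) (at_right 0)" by (intro tendsto_intros)
      moreover have "eventually (\<lambda>p. a + k * p \<in> {a..a + 1} \<and> a + k * p \<noteq> a) (at_right 0)"
        using eventually_at_right_real[of 0 "1 / k"] k
        by (auto elim!: eventually_mono simp: field_simps)
      ultimately show "filterlim (\<lambda>p. a + k * p) (at a within {a..a + 1}) (at_right 0)"
        by (simp add: filterlim_at)
    qed
    have "((\<lambda>p. \<Phi> (a + \<rho> * p) - \<Phi> (a + 1 * p)) \<longlongrightarrow> \<Phi> a - \<Phi> a) (at_right 0)"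
      using \<rho> by (intro tendsto_diff *) auto
    moreover have "eventually (\<lambda>p. \<Phi> (a + \<rho> * p) - \<Phi> (a + 1 * p) = integral {a + p..a + \<rho> * p} f) (at_right 0)"
      using eventually_at_right_less[of 0]
    proof eventually_elim
      fix p :: real assume p: "0 < p"
      have "p \<le> \<rho> * p" using p \<rho> by simp
      then show "\<Phi> (a + \<rho> * p) - \<Phi> (a + 1 * p) = integral {a + p..a + \<rho> * p} f"
        using diff[of a "a + p" "a + \<rho> * p"] cong[of "a + p"] p by (simp add: \<Phi>_def)
    qed
    ultimately have "((\<lambda>p. integral {a + p..a + \<rho> * p} f) \<longlongrightarrow> \<Phi> a - \<Phi> a) (at_right 0)"
      by (rule Lim_transform_eventually)
    then show ?thesis by simp
  qed
  show "((\<lambda>p. integral {p..\<rho> * p} f) \<longlongrightarrow> 0) at_top"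
  proof (rule tendstoI)
    fix e :: real assume "e > 0"
    from integrable_altD(2)[OF f this] obtain B where B: "B > 0"
      "\<And>u v u' v'. ball 0 B \<subseteq> {u..v} \<Longrightarrow> ball 0 B \<subseteq> {u'..v'} \<Longrightarrow> norm (integral {u..v} F - integral {u'..v'} F) < e"
      unfolding F_def cbox_interval by blast
    show "eventually (\<lambda>p. dist (integral {p..\<rho> * p} f) 0 < e) at_top"
      using eventually_gt_at_top[of "max B (max a 0)"]
    proof eventually_elim
      fix p assume "p > max B (max a 0)"
      then have p: "p > B" "p > a" "p > 0" by auto
      have pp: "p \<le> \<rho> * p" using p \<rho> by simp
      have "B < \<rho> * p" using p pp by linarith
      then have "ball 0 B \<subseteq> {- B..\<rho> * p}" "ball 0 B \<subseteq> {- B..p}" using p(1) by (auto simp: dist_real_def abs_less_iff)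
      from B(2)[OF this] have "norm (integral {- B..\<rho> * p} F - integral {- B..p} F) < e" .
      then show "dist (integral {p..\<rho> * p} f) 0 < e"
        using diff[of "- B" p "\<rho> * p"] cong[OF p(2)] p B(1) pp by simp
    qed
  qed
qed

lemma power_singularity_integrable_imp:
  fixes f h :: "real \<Rightarrow> complex"
  assumes f: "f integrable_on {a<..}" and "\<beta> \<noteq> 0" "h0 \<noteq> 0"
    and fw: "\<And>w. w > a \<Longrightarrow> f w = h w * of_real (w - a) powr (\<beta> - 1)" and h: "(h \<longlongrightarrow> h0) (at_right a)"
  shows "Re \<beta> > 0"
proof (rule ccontr)
  assume neg: "\<not> Re \<beta> > 0"
  obtain \<rho> \<delta> \<eta> :: real where win: "\<forall>f h c p. p > 0 \<longrightarrow> f integrable_on {c + p..c + \<rho> * p} \<longrightarrow>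
      (\<forall>w\<in>{c + p..c + \<rho> * p}. f w = h w * of_real (w - c) powr (\<beta> - 1) \<and> norm (h w - h0) \<le> \<eta>) \<longrightarrow>
      \<delta> * p powr Re \<beta> \<le> norm (integral {c + p..c + \<rho> * p} f)"
    and r: "\<rho> > 1" "\<delta> > 0" "\<eta> > 0"
    by (rule powr_window_lower_bound[OF assms(2,3)]) (rule that)
  from tendstoD[OF h r(3)] obtain b where b: "b > a" "\<And>w. a < w \<Longrightarrow> w < b \<Longrightarrow> dist (h w) h0 < \<eta>"
    unfolding eventually_at_right_field by blast
  from tendstoD[OF integral_windows_tendsto_0(1)[OF f r(1)] r(2)]
  have "eventually (\<lambda>p. norm (integral {a + p..a + \<rho> * p} f) < \<delta>) (at_right 0)" by simp
  moreover have "eventually (\<lambda>p. p \<in> {0<..<min 1 ((b - a) / \<rho>)}) (at_right 0)"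
    using b(1) r(1) by (intro eventually_at_right_real) auto
  ultimately have "eventually (\<lambda>p::real. False) (at_right 0)"
  proof eventually_elim
    fix p assume I: "norm (integral {a + p..a + \<rho> * p} f) < \<delta>" and "p \<in> {0<..<min 1 ((b - a) / \<rho>)}"
    then have p: "0 < p" "p < 1" "\<rho> * p < b - a" using r(1) by (auto simp: field_simps)
    have "\<delta> * p powr Re \<beta> \<le> norm (integral {a + p..a + \<rho> * p} f)"
    proof (rule win[rule_format, OF p(1) integral_windows_tendsto_0(3)[OF f r(1)]])
      fix w assume "w \<in> {a + p..a + \<rho> * p}"
      then have "a < w" "w < b" using p by auto
      then show "f w = h w * of_real (w - a) powr (\<beta> - 1) \<and> norm (h w - h0) \<le> \<eta>"
        using fw b(2)[of w] by (simp add: dist_norm less_imp_le)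
    qed (use p in simp)
    moreover have "1 \<le> p powr Re \<beta>"
      using p neg powr_mono'[of "Re \<beta>" 0 p] by simp
    then have "\<delta> * 1 \<le> \<delta> * p powr Re \<beta>" using r(2) by (intro mult_left_mono) auto
    ultimately show False using I by linarith
  qed
  then show False by simp
qed

lemma power_growth_integrable_imp:
  fixes f h :: "real \<Rightarrow> complex"
  assumes f: "f integrable_on {a<..}" and "\<beta> \<noteq> 0" "h0 \<noteq> 0"
    and fw: "\<And>w. w > max a 0 \<Longrightarrow> f w = h w * of_real w powr (\<beta> - 1)" and h: "(h \<longlongrightarrow> h0) at_top"
  shows "Re \<beta> < 0"
proof (rule ccontr)
  assume neg: "\<not> Re \<beta> < 0"
  obtain \<rho> \<delta> \<eta> :: real where win: "\<forall>f h c p. p > 0 \<longrightarrow> f integrable_on {c + p..c + \<rho> * p} \<longrightarrow>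
      (\<forall>w\<in>{c + p..c + \<rho> * p}. f w = h w * of_real (w - c) powr (\<beta> - 1) \<and> norm (h w - h0) \<le> \<eta>) \<longrightarrow>
      \<delta> * p powr Re \<beta> \<le> norm (integral {c + p..c + \<rho> * p} f)"
    and r: "\<rho> > 1" "\<delta> > 0" "\<eta> > 0"
    by (rule powr_window_lower_bound[OF assms(2,3)]) (rule that)
  from tendstoD[OF h r(3)] obtain b where b: "\<And>w. w \<ge> b \<Longrightarrow> dist (h w) h0 < \<eta>"
    unfolding eventually_at_top_linorder by blast
  from tendstoD[OF integral_windows_tendsto_0(2)[OF f r(1)] r(2)]
  have "eventually (\<lambda>p. norm (integral {p..\<rho> * p} f) < \<delta>) at_top" by simp
  then have "eventually (\<lambda>p::real. False) at_top"
    using eventually_gt_at_top[of "max b (max a 1)"]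
  proof eventually_elim
    fix p assume I: "norm (integral {p..\<rho> * p} f) < \<delta>" and "p > max b (max a 1)"
    then have p: "p > b" "p > a" "p > 1" by auto
    have "\<delta> * p powr Re \<beta> \<le> norm (integral {0 + p..0 + \<rho> * p} f)"
    proof (rule win[rule_format, OF _ integral_windows_tendsto_0(3)[OF f r(1)]])
      fix w assume "w \<in> {0 + p..0 + \<rho> * p}"
      then have w: "w > max a 0" "w \<ge> b" using p by auto
      show "f w = h w * of_real (w - 0) powr (\<beta> - 1) \<and> norm (h w - h0) \<le> \<eta>"
        using fw[OF w(1)] b[OF w(2)] by (simp add: dist_norm less_imp_le)
    qed (use p in auto)
    moreover have "1 \<le> p powr Re \<beta>" using p neg by (intro ge_one_powr_ge_zero) auto
    then have "\<delta> * 1 \<le> \<delta> * p powr Re \<beta>" using r(2) by (intro mult_left_mono) auto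
    ultimately show False using I by simp
  qed
  then show False by simp
qed

section \<open>Endpoint behaviour of the Nicholson integrand\<close>

lemma gegenbauer_D_real:
  assumes "w > 1"
  shows "gegenbauer_D l \<alpha> (of_real w) = exp (\<i> * pi * \<alpha>) * Gamma (l + 2 * \<alpha>) / Gamma \<alpha> * 2 powr (- (l + 2 * \<alpha>)) *
    (of_real w powr (- (l + 2 * \<alpha>)) * reg_hypergeo (l / 2 + \<alpha>) (l / 2 + \<alpha> + 1 / 2) (l + \<alpha> + 1) (of_real (1 / w\<^sup>2)))"
proof -
  have z: "complex_of_real w \<in> cut_plane_D" using assms by (simp add: mem_cut_plane_D)
  have "inverse ((2 * complex_of_real w) powr (l + 2 * \<alpha>)) = 2 powr (- (l + 2 * \<alpha>)) * of_real w powr (- (l + 2 * \<alpha>))"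
    using powr_times_of_real[of w 2 "- (l + 2 * \<alpha>)"] assms by (simp only: powr_minus [symmetric])
  moreover have "1 / (complex_of_real w)\<^sup>2 = of_real (1 / w\<^sup>2)" by simp
  moreover have "E / (G * P) * F = E / G * (inverse P * F)" for E G P F :: complex by (simp add: divide_inverse)
  ultimately show ?thesis unfolding gegenbauer_D_eq[OF z] by (simp only: mult.assoc)
qed

text \<open>If Re \<alpha> <= 0, then Re (c - p - q) = 1/2 - Re \<alpha> > 0, so the hypergeometric
  factor has a finite limit at 1, nonzero by Gauss' theorem. The integrand is then a nonzero
  multiple of (w - 1)^(\<alpha> - 1) near 1, and integrability of that forces Re \<alpha> >
  0.\<close>

lemma nicholson_integrable_imp_Re_alpha:
  assumes x: "x \<in> cut_plane_trig" and a: "\<alpha> \<notin> \<int>\<^sub>\<le>\<^sub>0" and m: "l + 2 * \<alpha> \<notin> \<int>\<^sub>\<le>\<^sub>0" and l: "l + 1 \<notin> \<int>\<^sub>\<le>\<^sub>0"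
    and I: "nicholson_integrand l \<alpha> x integrable_on {1<..}"
  shows "Re \<alpha> > 0"
proof (rule ccontr)
  assume neg: "\<not> Re \<alpha> > 0"
  define A where "A = exp (\<i> * pi * \<alpha>) * Gamma (l + 2 * \<alpha>) / Gamma \<alpha> * 2 powr (- (l + 2 * \<alpha>))"
  have A: "A \<noteq> 0" using a m by (simp add: A_def Gamma_eq_zero_iff)
  define p q c where "p = l / 2 + \<alpha>" and "q = l / 2 + \<alpha> + 1 / 2" and "c = l + \<alpha> + 1"
  have np: "2 * z - of_nat k \<in> \<int>\<^sub>\<le>\<^sub>0" if z: "z \<in> \<int>\<^sub>\<le>\<^sub>0" for z :: complex and k
  proof -
    obtain n where "z = of_int n" "n \<le> 0" using z by (auto elim: nonpos_Ints_cases)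
    then have "2 * z - of_nat k = of_int (2 * n - int k)" "2 * n - int k \<le> 0" by simp_all
    then show ?thesis by (simp only: nonpos_Ints_of_int)
  qed
  \<comment> \<open>Doubling p, q, c - p and c - q gives l + 2 \<alpha> or l + 1 up to the shift by
    1, so a nonpositive integer among them would contradict the hypotheses on these two.\<close>
  have e: "2 * p - of_nat 0 = l + 2 * \<alpha>" "2 * q - of_nat 1 = l + 2 * \<alpha>" "2 * (c - p) - of_nat 1 = l + 1" "2 * (c - q) - of_nat 0 = l + 1"
    by (simp_all add: p_def q_def c_def algebra_simps)
  have nn: "p \<notin> \<int>\<^sub>\<le>\<^sub>0" "q \<notin> \<int>\<^sub>\<le>\<^sub>0" "c - p \<notin> \<int>\<^sub>\<le>\<^sub>0" "c - q \<notin> \<int>\<^sub>\<le>\<^sub>0"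
    using np[of p 0] np[of q 1] np[of "c - p" 1] np[of "c - q" 0] m l unfolding e by blast+
  have s: "Re (c - p - q) > 0" using neg by (simp add: p_def q_def c_def)
  define h where "h w = A * (of_real w powr (- (l + 2 * \<alpha>)) * reg_hypergeo p q c (of_real (1 / w\<^sup>2))) *
      (1 - 2 * x\<^sup>2 + of_real w) powr (\<alpha> - 1)" for w :: real
  define h0 where "h0 = A * (of_real 1 powr (- (l + 2 * \<alpha>)) * hyp_at_1 p q c) * (1 - 2 * x\<^sup>2 + of_real 1) powr (\<alpha> - 1)"
  have nx: "1 - 2 * x\<^sup>2 + of_real 1 \<notin> \<real>\<^sub>\<le>\<^sub>0" by (rule nicholson_factors_not_nonpos(2)[OF x]) simp
  have "1 - 2 * x\<^sup>2 + of_real 1 \<noteq> 0" using nx by (metis nonpos_Reals_zero_I)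
  then have h0: "h0 \<noteq> 0" unfolding h0_def using A hyp_at_1_nonzero[OF nn(1,2) s nn(3,4)] by simp
  have g: "((\<lambda>w::real. reg_hypergeo p q c (of_real (1 / w\<^sup>2))) \<longlongrightarrow> hyp_at_1 p q c) (at_right 1)"
  proof (rule filterlim_compose[OF reg_hypergeo_at_left_1[OF nn(1,2) s]])
    have "((\<lambda>w::real. 1 / w\<^sup>2) \<longlongrightarrow> 1 / 1\<^sup>2) (at_right 1)" by (intro tendsto_intros) simp
    moreover have "eventually (\<lambda>w::real. 1 / w\<^sup>2 \<in> {..<1} \<and> 1 / w\<^sup>2 \<noteq> 1) (at_right 1)"
      using eventually_at_right_less[of 1]
    proof eventually_elim
      fix w :: real assume w: "1 < w"
      then have "1 < w\<^sup>2" by (simp add: one_less_power)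
      then have "1 / w\<^sup>2 < 1" using w by simp
      then show "1 / w\<^sup>2 \<in> {..<1} \<and> 1 / w\<^sup>2 \<noteq> 1" by (metis lessThan_iff less_irrefl)
    qed
    ultimately show "filterlim (\<lambda>w::real. 1 / w\<^sup>2) (at_left 1) (at_right 1)"
      by (simp add: filterlim_at)
  qed
  have id: "((\<lambda>w::real. of_real w) \<longlongrightarrow> complex_of_real 1) (at_right 1)" by (intro tendsto_intros)
  have "(h \<longlongrightarrow> h0) (at_right 1)"
    unfolding h_def h0_def
    by (intro tendsto_mult tendsto_const g tendsto_powr_complex tendsto_add id nx) (simp add: complex_nonpos_Reals_iff)
  moreover have "nicholson_integrand l \<alpha> x w = h w * of_real (w - 1) powr (\<alpha> - 1)" if "w > 1" for w
    unfolding nicholson_integrand_def h_def gegenbauer_D_real[OF that] A_def p_def q_def c_def by (simp only: mult_ac)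
  moreover have "\<alpha> \<noteq> 0" using a by auto
  ultimately have "Re \<alpha> > 0" using power_singularity_integrable_imp[OF I _ h0, of \<alpha> h] by blast
  then show False using neg by simp
qed

text \<open>At infinity the integrand behaves like a constant times w^(-\<mu> + 2 (\<alpha> - 1)) =
  w^(-(l + 1) - 1). The constant contains 1 / \<Gamma>(l + \<alpha> + 1), so the condition on l +
  \<alpha> + 1 is what keeps it nonzero.\<close>

lemma nicholson_integrable_imp_Re_l:
  assumes a: "\<alpha> \<notin> \<int>\<^sub>\<le>\<^sub>0" and m: "l + 2 * \<alpha> \<notin> \<int>\<^sub>\<le>\<^sub>0" and l: "l + 1 \<notin> \<int>\<^sub>\<le>\<^sub>0" and la: "l + \<alpha> + 1 \<notin> \<int>\<^sub>\<le>\<^sub>0"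
    and I: "nicholson_integrand l \<alpha> x integrable_on {1<..}"
  shows "Re l > -1"
proof -
  define A where "A = exp (\<i> * pi * \<alpha>) * Gamma (l + 2 * \<alpha>) / Gamma \<alpha> * 2 powr (- (l + 2 * \<alpha>))"
  have A: "A \<noteq> 0" using a m by (simp add: A_def Gamma_eq_zero_iff)
  define F where "F = reg_hypergeo (l / 2 + \<alpha>) (l / 2 + \<alpha> + 1 / 2) (l + \<alpha> + 1)"
  define h where "h w = A * F (of_real (1 / w\<^sup>2)) * of_real (1 - 1 / w) powr (\<alpha> - 1) * (1 + (1 - 2 * x\<^sup>2) * of_real (1 / w)) powr (\<alpha> - 1)" for w :: real
  define h0 where "h0 = A * F (of_real 0) * of_real (1 - 0) powr (\<alpha> - 1) * (1 + (1 - 2 * x\<^sup>2) * of_real 0) powr (\<alpha> - 1)"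
  have h0: "h0 \<noteq> 0" using A la by (simp add: h0_def F_def reg_hypergeo_0 rGamma_eq_zero_iff)
  have t1: "((\<lambda>w::real. 1 / w) \<longlongrightarrow> 0) at_top" "((\<lambda>w::real. 1 / w\<^sup>2) \<longlongrightarrow> 0) at_top" by real_asymp+
  have "0 \<in> cut_plane_F" by (simp add: mem_cut_plane_F)
  then have cF: "isCont F (of_real 0)"
    unfolding F_def using holomorphic_on_imp_continuous_on[OF holomorphic_reg_hypergeo] open_cut_planes(1)
    by (simp add: continuous_on_eq_continuous_at)
  have "(h \<longlongrightarrow> h0) at_top"
    unfolding h_def h0_def
    by (intro tendsto_mult tendsto_const isCont_tendsto_compose[OF cF] tendsto_powr_complex tendsto_add tendsto_of_real tendsto_diff t1) auto
  moreover have "nicholson_integrand l \<alpha> x w = h w * of_real w powr (- (l + 1) - 1)" if "w > max 1 0" for w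
  proof -
    have w: "w > 1" using that by simp
    have 1: "of_real (w - 1) powr (\<alpha> - 1) = of_real (1 - 1 / w) powr (\<alpha> - 1) * of_real w powr (\<alpha> - 1)"
    proof -
      have "w - 1 = (1 - 1 / w) * w" using w by (simp add: field_simps)
      then have "complex_of_real (w - 1) = of_real (1 - 1 / w) * of_real w" by (simp only: of_real_mult)
      then show ?thesis using w by (simp only:) (rule powr_times_of_real, simp)
    qed
    have 2: "(1 - 2 * x\<^sup>2 + of_real w) powr (\<alpha> - 1) = (1 + (1 - 2 * x\<^sup>2) * of_real (1 / w)) powr (\<alpha> - 1) * of_real w powr (\<alpha> - 1)"
    proof -
      have "1 - 2 * x\<^sup>2 + of_real w = (1 + (1 - 2 * x\<^sup>2) * of_real (1 / w)) * of_real w"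
        using w by (simp add: field_simps)
      then show ?thesis using w by (simp only:) (rule powr_times_of_real, simp)
    qed
    have 3: "complex_of_real w powr (- (l + 2 * \<alpha>)) * of_real w powr (\<alpha> - 1) * of_real w powr (\<alpha> - 1) = of_real w powr (- (l + 1) - 1)"
    proof -
      have "- (l + 2 * \<alpha>) + (\<alpha> - 1) + (\<alpha> - 1) = - (l + 1) - 1" by simp
      then show ?thesis by (simp only: powr_add [symmetric])
    qed
    show ?thesis
      unfolding nicholson_integrand_def h_def gegenbauer_D_real[OF w] 1 2 3 [symmetric] A_def F_def by (simp only: mult_ac)
  qed
  moreover have "- (l + 1) \<noteq> 0" using l by (metis minus_zero minus_minus zero_in_nonpos_Ints)
  ultimately have "Re (- (l + 1)) < 0" using power_growth_integrable_imp[OF I _ h0, of "- (l + 1)" h] by blast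
  then show ?thesis by simp
qed

subsection \<open>The exceptional parameters\<close>

lemma analytic_extension_cong:
  assumes "\<And>z. z \<in> U \<Longrightarrow> f z = g z"
  shows "analytic_extension f U S = analytic_extension g U S"
  using assms by (simp add: analytic_extension_def cong: ball_cong)

lemma reg_hypergeo_commute: "reg_hypergeo a b c = reg_hypergeo b a c"
  unfolding reg_hypergeo_def reg_hypergeo_series_def by (simp only: mult.commute[of "pochhammer a _"])

text \<open>For \<open>c = 1 - N\<close> the first \<open>N\<close> terms of the regularized series vanish.\<close>
lemma reg_hypergeo_shift:
  assumes z: "norm z < 1"
  shows "reg_hypergeo a b (1 - of_nat N) z =
    pochhammer a N * pochhammer b N * z ^ N * reg_hypergeo (a + of_nat N) (b + of_nat N) (of_nat N + 1) z"
proof -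
  let ?f = "\<lambda>n. fps_nth (hyp_fps a b (1 - of_nat N)) n * z ^ n"
  let ?g = "\<lambda>n. fps_nth (hyp_fps (a + of_nat N) (b + of_nat N) (of_nat N + 1)) n * z ^ n"
  have rG: "rGamma (1 + of_nat n :: complex) = inverse (fact n)" for n
    by (simp only: rGamma_inverse_Gamma Gamma_fact)
  have 0: "?f n = 0" if "n < N" for n
  proof -
    have "(1 - of_nat N + of_nat n :: complex) = - of_nat (N - n - 1)" using that by (simp add: of_nat_diff)
    then have "rGamma (1 - of_nat N + of_nat n :: complex) = 0" by (simp only: rGamma_eq_zero_iff minus_of_nat_in_nonpos_Ints)
    then show ?thesis by simp
  qed
  have 1: "?f (n + N) = pochhammer a N * pochhammer b N * z ^ N * ?g n" for n
  proof -
    have "rGamma (1 - of_nat N + of_nat (n + N) :: complex) = inverse (fact n)"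
      using rG[of n] by simp
    moreover have "rGamma (of_nat N + 1 + of_nat n :: complex) = inverse (fact (n + N))"
      using rG[of "n + N"] by (simp add: add_ac del: fact_Suc)
    moreover have "pochhammer a (n + N) = pochhammer a N * pochhammer (a + of_nat N) n"
      "pochhammer b (n + N) = pochhammer b N * pochhammer (b + of_nat N) n"
      using pochhammer_product'[of _ N n] by (simp_all add: add.commute)
    ultimately show ?thesis by (simp add: power_add field_simps)
  qed
  have "(\<Sum>n. ?f n) = (\<Sum>n. ?f (n + N)) + (\<Sum>n<N. ?f n)"
    by (rule suminf_split_initial_segment[OF summable_hyp_fps[OF z]])
  also have "(\<Sum>n<N. ?f n) = 0" using 0 by (intro sum.neutral) auto
  also have "(\<Sum>n. ?f (n + N)) = pochhammer a N * pochhammer b N * z ^ N * (\<Sum>n. ?g n)"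
    unfolding 1 by (rule suminf_mult[OF summable_hyp_fps[OF z]])
  finally show ?thesis using z by (simp add: reg_hypergeo_eq_series eval_fps_def)
qed

text \<open>When l + \<alpha> = -N, the number l + 2 N is - l - 2 \<alpha>. The N vanishing
  coefficients produce a factor z^(-2N), which is the quotient of the two power prefactors up to
  4^N; that constant is supplied by the duplication formula for \<open>pochhammer\<close>.\<close>

lemma gegenbauer_exceptional:
  assumes la: "l + \<alpha> = - of_nat N" and m: "l + 2 * \<alpha> \<notin> \<int>\<^sub>\<le>\<^sub>0"
  shows "gegenbauer_D (l + 2 * of_nat N) \<alpha> = gegenbauer_D l \<alpha>"
  unfolding gegenbauer_D_def
proof (rule analytic_extension_cong)
  fix z :: complex assume "z \<in> {z \<in> cut_plane_D. norm z > 1}"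
  then have z: "norm z > 1" by simp
  then have z0: "z \<noteq> 0" by auto
  define mu where "mu = l + 2 * \<alpha>"
  have e: "l + 2 * of_nat N + 2 * \<alpha> = mu + 2 * of_nat N" "(l + 2 * of_nat N) / 2 + \<alpha> = l / 2 + \<alpha> + of_nat N"
    "l / 2 + \<alpha> + of_nat N + 1 / 2 = l / 2 + \<alpha> + 1 / 2 + of_nat N"
    "l + 2 * of_nat N + \<alpha> + 1 = of_nat N + 1" "l + \<alpha> + 1 = 1 - of_nat N"
    using la by (simp_all add: mu_def field_simps)
  have "1 < (norm z)\<^sup>2" using z by (simp add: one_less_power)
  then have n1: "norm (1 / z\<^sup>2) < 1" using z0 by (simp add: norm_divide norm_power)
  define F where "F = reg_hypergeo (l / 2 + \<alpha> + of_nat N) (l / 2 + \<alpha> + 1 / 2 + of_nat N) (of_nat N + 1) (1 / z\<^sup>2)"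
  define Q where "Q = pochhammer (l / 2 + \<alpha>) N * pochhammer (l / 2 + \<alpha> + 1 / 2) N"
  have F: "reg_hypergeo (l / 2 + \<alpha>) (l / 2 + \<alpha> + 1 / 2) (1 - of_nat N) (1 / z\<^sup>2) = Q * (1 / z\<^sup>2) ^ N * F"
    unfolding Q_def F_def by (rule reg_hypergeo_shift[OF n1])
  have G: "Gamma (mu + 2 * of_nat N) = Gamma mu * (of_nat (2 ^ (2 * N)) * Q)"
  proof -
    have "pochhammer mu (2 * N) = of_nat (2 ^ (2 * N)) * Q"
      using pochhammer_double[of "l / 2 + \<alpha>" N] by (simp add: Q_def mu_def distrib_left mult.assoc)
    moreover have "Gamma mu \<noteq> 0" using m by (simp add: mu_def Gamma_eq_zero_iff)
    ultimately show ?thesis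
      using pochhammer_Gamma[of mu "2 * N"] m by (simp add: mu_def field_simps)
  qed
  have P: "(2 * z) powr (mu + 2 * of_nat N) = (2 * z) powr mu * (of_nat (2 ^ (2 * N)) * (z\<^sup>2) ^ N)"
  proof -
    have "(2 * z) powr (2 * of_nat N) = (2 * z) ^ (2 * N)"
      using z0 powr_nat'[of "2 * z" "2 * N"] by simp
    also have "\<dots> = of_nat (2 ^ (2 * N)) * (z\<^sup>2) ^ N" by (simp add: power_mult_distrib power_mult)
    finally show ?thesis by (simp only: powr_add)
  qed
  have "(2::complex) ^ (2 * N) \<noteq> 0" "(z\<^sup>2) ^ N \<noteq> 0" using z0 by simp_all
  then show "exp (\<i> * pi * \<alpha>) * Gamma (l + 2 * of_nat N + 2 * \<alpha>) / (Gamma \<alpha> * (2 * z) powr (l + 2 * of_nat N + 2 * \<alpha>))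
      * reg_hypergeo ((l + 2 * of_nat N) / 2 + \<alpha>) ((l + 2 * of_nat N) / 2 + \<alpha> + 1 / 2) (l + 2 * of_nat N + \<alpha> + 1) (1 / z\<^sup>2) =
      exp (\<i> * pi * \<alpha>) * Gamma (l + 2 * \<alpha>) / (Gamma \<alpha> * (2 * z) powr (l + 2 * \<alpha>))
      * reg_hypergeo (l / 2 + \<alpha>) (l / 2 + \<alpha> + 1 / 2) (l + \<alpha> + 1) (1 / z\<^sup>2)"
    unfolding e F F_def [symmetric] G P mu_def [symmetric] by (simp add: power_divide mult_ac)
qed

text \<open>Put k = l + 2 N = - l - 2 \<alpha>. By reflection \<Gamma>(-l) \<Gamma>(l + 1) and
  \<Gamma>(-k) \<Gamma>(k + 1) are pi divided by sines whose arguments differ by 2 pi N, hence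
  equal; dividing gives the claim.\<close>

lemma Gamma_ratio_exceptional:
  fixes l \<alpha> :: complex
  assumes la: "l + \<alpha> = - of_nat N" and l: "l + 1 \<notin> \<int>\<^sub>\<le>\<^sub>0" "l + 2 * of_nat N + 1 \<notin> \<int>\<^sub>\<le>\<^sub>0"
  shows "Gamma (l + 2 * of_nat N + 2 * \<alpha>) / Gamma (l + 2 * of_nat N + 1) = Gamma (l + 2 * \<alpha>) / Gamma (l + 1)"
proof -
  have \<alpha>: "\<alpha> = - l - of_nat N" using la by (simp add: algebra_simps eq_neg_iff_add_eq_0)
  have e: "l + 2 * of_nat N + 2 * \<alpha> = - l" "l + 2 * \<alpha> = - (l + 2 * of_nat N)" by (simp_all add: \<alpha> algebra_simps)
  have "Gamma (- l) * Gamma (l + 1) = of_real pi / sin (of_real pi * (- l))"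
    using Gamma_reflection_complex[of "- l"] by (simp add: add.commute)
  moreover have "Gamma (- (l + 2 * of_nat N)) * Gamma (l + 2 * of_nat N + 1) = of_real pi / sin (of_real pi * (- (l + 2 * of_nat N)))"
    using Gamma_reflection_complex[of "- (l + 2 * of_nat N)"] unfolding diff_minus_eq_add add.commute[of 1] .
  moreover have "sin (of_real pi * (- (l + 2 * of_nat N))) = sin (of_real pi * (- l))"
  proof -
    have "of_real pi * (- (l + 2 * of_nat N)) = of_real pi * (- l) - of_nat N * (2 * of_real pi)" by (simp add: algebra_simps)
    moreover have "sin (w - of_nat N * (2 * of_real pi)) = sin w" for w :: complex
    proof -
      have "sin w = sin ((w - of_nat N * (2 * of_real pi)) + of_nat N * (2 * of_real pi))" by simp
      also have "\<dots> = sin (w - of_nat N * (2 * of_real pi))"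
        by (rule sin.plus_of_nat)
      finally show ?thesis by simp
    qed
    ultimately show ?thesis by simp
  qed
  moreover have "Gamma (l + 1) \<noteq> 0" "Gamma (l + 2 * of_nat N + 1) \<noteq> 0" using l by (simp_all add: Gamma_eq_zero_iff)
  ultimately show ?thesis unfolding e by (simp add: frac_eq_eq)
qed

theorem theorem59:
  fixes l \<alpha> x :: complex
  assumes "x \<in> cut_plane_trig"
    and "\<alpha> \<notin> \<int>\<^sub>\<le>\<^sub>0" and "l + 2 * \<alpha> \<notin> \<int>\<^sub>\<le>\<^sub>0" and "l + 1 \<notin> \<int>\<^sub>\<le>\<^sub>0"
    and "nicholson_integrand l \<alpha> x integrable_on {1<..}"
  shows "(gegenbauer_C_trig l \<alpha> x)\<^sup>2 + (gegenbauer_D_trig l \<alpha> x)\<^sup>2 =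
    exp (- (\<i> * pi * \<alpha>)) * Gamma (l + 2 * \<alpha>)
      / (2 powr (2 * \<alpha> - 3) * (Gamma \<alpha>)\<^sup>2 * Gamma (l + 1) * (1 - x\<^sup>2) powr (2 * \<alpha> - 1))
      * integral {1<..} (nicholson_integrand l \<alpha> x)"
proof -
  have Re_alpha: "Re \<alpha> > 0" by (rule nicholson_integrable_imp_Re_alpha[OF assms])
  have generic: "(gegenbauer_C_trig k \<alpha> x)\<^sup>2 + (gegenbauer_D_trig k \<alpha> x)\<^sup>2 =
    exp (- (\<i> * pi * \<alpha>)) * Gamma (k + 2 * \<alpha>)
      / (2 powr (2 * \<alpha> - 3) * (Gamma \<alpha>)\<^sup>2 * Gamma (k + 1) * (1 - x\<^sup>2) powr (2 * \<alpha> - 1))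
      * integral {1<..} (nicholson_integrand k \<alpha> x)"
    if k: "k + 2 * \<alpha> \<notin> \<int>\<^sub>\<le>\<^sub>0" "k + 1 \<notin> \<int>\<^sub>\<le>\<^sub>0" "k + \<alpha> + 1 \<notin> \<int>\<^sub>\<le>\<^sub>0" "nicholson_integrand k \<alpha> x integrable_on {1<..}" for k
  proof -
    have "Re k > -1" by (rule nicholson_integrable_imp_Re_l[OF assms(2) k])
    then interpret gegenbauer_params k \<alpha> using Re_alpha by unfold_locales
    have "mu \<notin> \<int>\<^sub>\<le>\<^sub>0" using k(1) by (simp only: mu_def not_False_eq_True)
    from nicholson_generic[OF this assms(1)] show ?thesis by (simp only: mu_def)
  qed
  show ?thesis
  \<comment> \<open>If l + \<alpha> + 1 is a nonpositive integer, the leading coefficient of D at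
    infinity vanishes and D decays faster, so the decay argument gives no lower bound on Re l. The
    parameter is then replaced.\<close>
  proof (cases "l + \<alpha> + 1 \<in> \<int>\<^sub>\<le>\<^sub>0")
    case False
    then show ?thesis using assms by (intro generic)
  next
    case True
    then obtain n :: nat where n: "l + \<alpha> + 1 = - of_nat n" by (rule nonpos_Ints_cases')
    define N where "N = Suc n"
    have la: "l + \<alpha> = - of_nat N"
    proof -
      have "l + \<alpha> = (l + \<alpha> + 1) - 1" by simp
      then show ?thesis unfolding n by (simp add: N_def)
    qed
    \<comment> \<open>Equal to - l - 2 \<alpha>. Since k + \<alpha> + 1 = N + 1 is positive, the
      generic case applies to k.\<close>
    define k where "k = l + 2 * of_nat N"
    have shift: "z - of_nat j \<in> \<int>\<^sub>\<le>\<^sub>0" if z: "z \<in> \<int>\<^sub>\<le>\<^sub>0" for z :: complex and j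
    proof -
      obtain i where "z = of_int i" "i \<le> 0" using z by (auto elim: nonpos_Ints_cases)
      then have "z - of_nat j = of_int (i - int j)" "i - int j \<le> 0" by simp_all
      then show ?thesis by (simp only: nonpos_Ints_of_int)
    qed
    have al: "\<alpha> = k + 2 * \<alpha> - of_nat N" "l + 1 = k + 1 - of_nat (2 * N)" "k + \<alpha> + 1 = of_nat N + 1"
      using la by (simp_all add: k_def algebra_simps eq_neg_iff_add_eq_0)
    have k: "k + 2 * \<alpha> \<notin> \<int>\<^sub>\<le>\<^sub>0" "k + 1 \<notin> \<int>\<^sub>\<le>\<^sub>0" "k + \<alpha> + 1 \<notin> \<int>\<^sub>\<le>\<^sub>0"
    proof -
      show "k + 2 * \<alpha> \<notin> \<int>\<^sub>\<le>\<^sub>0" using shift[of "k + 2 * \<alpha>" N] assms(2) al(1) by metis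
      show "k + 1 \<notin> \<int>\<^sub>\<le>\<^sub>0" using shift[of "k + 1" "2 * N"] assms(4) al(2) by metis
      show "k + \<alpha> + 1 \<notin> \<int>\<^sub>\<le>\<^sub>0" unfolding al(3) by (rule Re_pos_imp_not_nonpos_Int) simp
    qed
    have D: "gegenbauer_D k \<alpha> = gegenbauer_D l \<alpha>"
      unfolding k_def by (rule gegenbauer_exceptional[OF la assms(3)])
    then have D': "gegenbauer_D_trig k \<alpha> = gegenbauer_D_trig l \<alpha>" "nicholson_integrand k \<alpha> x = nicholson_integrand l \<alpha> x"
      by (simp_all add: gegenbauer_D_trig_def gegenbauer_D_trig_real_def nicholson_integrand_def fun_eq_iff)
    have ratio: "Gamma (k + 2 * \<alpha>) / Gamma (k + 1) = Gamma (l + 2 * \<alpha>) / Gamma (l + 1)"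
      unfolding k_def by (rule Gamma_ratio_exceptional[OF la assms(4)]) (use k in \<open>simp add: k_def\<close>)
    have C: "gegenbauer_C_trig k \<alpha> x = gegenbauer_C_trig l \<alpha> x"
    proof -
      have "reg_hypergeo (- k) (2 * \<alpha> + k) (\<alpha> + 1 / 2) = reg_hypergeo (- l) (2 * \<alpha> + l) (\<alpha> + 1 / 2)"
      proof -
        \<comment> \<open>Passing from l to k exchanges the first two parameters of the
          hypergeometric function in C, in which it is symmetric; the prefactor depends on the
          parameter only through the Gamma ratio.\<close>
        have "\<alpha> = - of_nat N - l" using la by (metis add_diff_cancel_left')
        then have "- k = 2 * \<alpha> + l" "2 * \<alpha> + k = - l" by (simp_all add: k_def)
        then show ?thesis by (simp only: reg_hypergeo_commute[of "2 * \<alpha> + l" "- l"])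
      qed
      moreover have "s * G / (t * A * H) * F = s / (t * A) * (G / H) * F" for s G t A H F :: complex by simp
      ultimately show ?thesis
        unfolding gegenbauer_C_trig_eq[OF assms(1)] add.commute[of "2 * \<alpha>"] by (simp only: ratio)
    qed
    have "e * G / (t * A * H * X) * J = e / (t * A * X) * (G / H) * J" for e G t A H X J :: complex by simp
    then show ?thesis
      using generic[OF k] assms(5) by (simp only: C D' ratio)
  qed
qed

end
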